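(* Let $g\geq 1$ and let the code type be one of $2^E_{II}$, $q^E_1$, $q^E$ (with the field $\mathbb{F}=\mathbb{F}_q$ as described in the context; $q=2$ for type $2^E_{II}$). Let $N$ be a positive integer divisible by the order of the group $Z$ attached to the type. Let $f\in\mathbb{C}[y_v: v\in\mathbb{F}_q^g]$ be a homogeneous polynomial of degree $N$ which is a cusp form of genus $g$ for the Clifford-Weil group $\mathcal{C}_g$ of that type. Then \[ \left( D(E_{2g})(\underline{x},\underline{y}),f(\underline{y})\right)_g = c\,N!\, \bar{f}(\underline{x}), \] where the inner product is taken in the variables $\underline{y}$, $\bar f(\underline{x})$ is the polynomial obtained from $f$ (with the variables $y_v$ renamed $x_v$) by complex conjugating its coefficients, and the constant $c$ (independent of $f$) is \[ c=\begin{cases} 2^{g^2+2g-Ng/2}\prod_{i=1}^g\frac{2^i-1}{2^{g+i}+1} , & \mbox{for type } 2^E_{II},\\ q^{g^2+2g-Ng/2}\prod_{i=1}^g\frac{q^i-1}{q^{g+i}+1} , & \mbox{for type } q^E_{1},\\ q^{g^2-Ng/2}\prod_{i=1}^g\frac{q^i-1}{q^{g+i}+1} , & \mbox{for type } q^E. \end{cases} \]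
   Context: Types. For type $2^E_{II}$: $\mathbb{F}=\mathbb{F}_2$, $\beta:\mathbb{F}_2\times\mathbb{F}_2\to\mathbb{Q}/\mathbb{Z}$, $\beta(x,y)=\frac12 xy$, and the set of quadratic forms is $\Phi=\{\phi,2\phi,3\phi,0\}$ with $\phi(x)=\frac14 x^2$ (values in $\mathbb{Q}/\mathbb{Z}$, $x\in\{0,1\}$); here $Z=\mathbb{Z}/8\mathbb{Z}$. For types $q^E$ and $q^E_1$: $q=p^f$ is an odd prime power, $\mathbb{F}=\mathbb{F}_q$, $\mathrm{Tr}:\mathbb{F}_q\to\mathbb{F}_p$ is the trace, $\beta(x,y)=\frac1p\mathrm{Tr}(xy)\in\frac1p\mathbb{Z}/\mathbb{Z}$; for $q^E$, $\Phi=\{x\mapsto \frac1p\mathrm{Tr}(ax^2): a\in\mathbb{F}_q\}$ and $Z=\mathbb{Z}/\gcd(q+1,4)\mathbb{Z}$; for $q^E_1$, $\Phi=\{x\mapsto\frac1p\mathrm{Tr}(ax^2+bx): a,b\in\mathbb{F}_q\}$ and $Z=\mathbb{F}_p\times\mathbb{Z}/\gcd(q+1,4)\mathbb{Z}$. Clifford-Weil group. For $n\geq1$ let $\beta^{(n)}(x,y)=\sum_{i=1}^n\beta(x_i,y_i)$ on $\mathbb{F}^n$ (column vectors). Let $\Phi^{(n)}$ be the set of maps $\mathbb{F}^n\to\mathbb{Q}/\mathbb{Z}$ of the form $(v_1,\dots,v_n)\mapsto\sum_i\phi_i(v_i)+\sum_{i<j}\beta(v_i,m_{ij}v_j)$ with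 $\phi_i\in\Phi$, $m_{ij}\in\mathbb{F}$. The Clifford-Weil group $\mathcal{C}_n$ is the subgroup of $\mathrm{GL}_{|\mathbb{F}|^n}(\mathbb{C})$ generated by the following linear substitutions of the variables $x_v$, $v\in\mathbb{F}^n$: $m_u: x_v\mapsto x_{uv}$ for $u\in\mathrm{GL}_n(\mathbb{F})$; $d_\phi: x_v\mapsto \exp(2\pi i\phi(v))x_v$ for $\phi\in\Phi^{(n)}$; and $h_{\iota,u_\iota,v_\iota}: x_v\mapsto |\iota\mathbb{F}^n|^{-1/2}\sum_{w\in\iota\mathbb{F}^n}\exp(2\pi i\beta^{(n)}(w,v_\iota v))\,x_{(1-\iota)v+w}$, where $\iota\in M_n(\mathbb{F})$ is a symmetric idempotent, i.e. $\iota=u_\iota v_\iota$ with $u_\iota\in\iota M_n(\mathbb{F})\iota^T$, $v_\iota\in\iota^TM_n(\mathbb{F})\iota$, $v_\iota u_\iota=\iota^T$. For $\sigma\in\mathcal{C}_n$ and a polynomial $p$, $p^\sigma$ denotes the polynomial obtained by applying the substitution $\sigma$ to the variables. $\mathcal{P}_n$ denotes the subgroup of $\mathcal{C}_n$ generated by all $m_u$ and $d_\phi$. Eisenstein series. In variables $X_v$, $v\in\mathbb{F}^{2g}$: for types $2^E_{II}$ and $q^E_1$, $E_{2g}=\frac{1}{|\mathcal{P}_{2g}\backslash\mathcal{C}_{2g}|}\sum_{\sigma\in\mathcal{P}_{2g}\backslash\mathcal{C}_{2g}}\big(\sum_{v\in\mathbb{F}^{2g}}X_v^N\big)^\sigma$;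 for type $q^E$, $E_{2g}=\frac{1}{|\mathcal{P}_{2g}\backslash\mathcal{C}_{2g}|}\sum_{\sigma\in\mathcal{P}_{2g}\backslash\mathcal{C}_{2g}}\big(X_{(0,\dots,0)}^N\big)^\sigma$ (the summands depend only on the coset). Doubling map. $D:\mathbb{C}[X_v: v\in\mathbb{F}^{2g}]\to\mathbb{C}[x_{v_1}:v_1\in\mathbb{F}^g]\otimes\mathbb{C}[y_{v_2}:v_2\in\mathbb{F}^g]$ is the ring homomorphism with $D(X_{(v_1,v_2)})=x_{v_1}y_{v_2}$. Inner product. On homogeneous polynomials of degree $N$ in $\mathbb{C}[y_v:v\in\mathbb{F}^g]$, $(\cdot,\cdot)_g$ is the hermitian form (linear in the first, conjugate-linear in the second argument) with $(\prod_v y_v^{n_v},\prod_v y_v^{m_v})_g=\prod_v n_v!$ if $n_v=m_v$ for all $v$ and $0$ otherwise. For $P=\sum_m a_m(\underline{x})\,m(\underline{y})$ (sum over monomials $m$ in $\underline{y}$ of degree $N$, $a_m$ polynomials in $\underline{x}$), $(P,f)_g:=\sum_m a_m(\underline{x})(m,f)_g$. Cusp forms. $\Phi_{g,1}:\mathbb{C}[y_v:v\in\mathbb{F}^g]\to\mathbb{C}[y_v:v\in\mathbb{F}^{g-1}]$ is the ring homomorphism sending $y_{(v_1,\dots,v_g)}$ to $y_{(v_1,\dots,v_{g-1})}$ if $v_g=0$ and to $0$ otherwise (for $g=1$ the target is $\mathbb{C}[y_\circ]$). A cusp form of genus $g$ for $\mathcal{C}_g$ is a nonzero homogeneous polynomial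 $f$ invariant under $\mathcal{C}_g$ with $\Phi_{g,1}(f)=0$. *)

theory Defs
  imports
    "Jordan_Normal_Form.Matrix"
    "HOL-Algebra.Generated_Groups"
    "HOL-Algebra.Elementary_Groups"
    "HOL-Library.Poly_Mapping"
    "HOL-Library.Cardinality"
    Complex_Main
begin

section \<open>Polynomials in variables indexed by an arbitrary type\<close>

text \<open>The inner finitely supported function is the exponent vector of a monomial.\<close>

type_synonym ('v, 'a) mpoly = "('v \<Rightarrow>\<^sub>0 nat) \<Rightarrow>\<^sub>0 'a"

definition pconst :: "'a::zero \<Rightarrow> ('v, 'a) mpoly" where
  "pconst c = Poly_Mapping.single 0 c"

definition pvar :: "'v \<Rightarrow> ('v, 'a::zero_neq_one) mpoly" where
  "pvar v = Poly_Mapping.single (Poly_Mapping.single v 1) 1"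

text \<open>If \<open>h\<close> is a ring homomorphism on the coefficients, \<open>peval h s\<close> is the ring homomorphism
  extending \<open>h\<close> that maps the variable with index \<open>v\<close> to \<open>s v\<close>.\<close>

definition peval :: "('a::zero \<Rightarrow> 'r::comm_ring_1) \<Rightarrow> ('v \<Rightarrow> 'r) \<Rightarrow> ('v, 'a) mpoly \<Rightarrow> 'r" where
  "peval h s p = (\<Sum>m\<in>Poly_Mapping.keys p. h (Poly_Mapping.lookup p m) *
     (\<Prod>v\<in>Poly_Mapping.keys m. s v ^ Poly_Mapping.lookup m v))"

definition polys_in :: "'v set \<Rightarrow> ('v, 'a::zero) mpoly set" where
  "polys_in V = {p. \<forall>m\<in>Poly_Mapping.keys p. Poly_Mapping.keys m \<subseteq> V}"

definition homogeneous :: "nat \<Rightarrow> ('v, 'a::zero) mpoly \<Rightarrow> bool" where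
  "homogeneous N p \<longleftrightarrow>
     (\<forall>m\<in>Poly_Mapping.keys p. (\<Sum>v\<in>Poly_Mapping.keys m. Poly_Mapping.lookup m v) = N)"

definition conj_poly :: "('v, complex) mpoly \<Rightarrow> ('v, complex) mpoly" where
  "conj_poly p = Poly_Mapping.map cnj p"


section \<open>Code types\<close>

text \<open>\<open>Type_2II\<close>, \<open>Type_qE\<close> and \<open>Type_qE1\<close> stand for $2^E_{II}$, $q^E$ and $q^E_1$. The field
  $\mathbb{F}_q$ is a finite field type \<open>'f\<close>, with $q$ = \<open>CARD('f)\<close> and $p$ = \<open>CHAR('f)\<close>.\<close>

datatype code_type = Type_2II | Type_qE | Type_qE1

definition admissible_field :: "code_type \<Rightarrow> 'f::{finite,field} itself \<Rightarrow> bool" where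
  "admissible_field T F = (case T of
       Type_2II \<Rightarrow> CARD('f) = 2
     | Type_qE \<Rightarrow> odd CARD('f)
     | Type_qE1 \<Rightarrow> odd CARD('f))"

definition order_Z :: "code_type \<Rightarrow> 'f::{finite,field} itself \<Rightarrow> nat" where
  "order_Z T F = (case T of
       Type_2II \<Rightarrow> Coset.order (integer_mod_group 8)
     | Type_qE \<Rightarrow> Coset.order (integer_mod_group (gcd (CARD('f) + 1) 4))
     | Type_qE1 \<Rightarrow>
         Coset.order (integer_mod_group CHAR('f) \<times>\<times> integer_mod_group (gcd (CARD('f) + 1) 4)))"

definition field_degree :: "'f::{finite,field} itself \<Rightarrow> nat" where
  "field_degree F = (THE f. CARD('f) = CHAR('f) ^ f)"

text \<open>The trace takes values in the prime field, regarded as a subfield of \<open>'f\<close>.\<close>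

definition field_tr :: "'f::{finite,field} \<Rightarrow> 'f" where
  "field_tr x = (\<Sum>i<field_degree TYPE('f). x ^ (CHAR('f) ^ i))"

text \<open>The representative in $\{0,\dots,p-1\}$ of an element of the prime field.\<close>

definition prime_field_rep :: "'f::{finite,field} \<Rightarrow> nat" where
  "prime_field_rep x = (LEAST k. of_nat k = x)"

text \<open>Elements of $\mathbb{Q}/\mathbb{Z}$ are given by rational representatives. They only enter
  through the following character, which is trivial on the integers.\<close>

definition e_QZ :: "rat \<Rightarrow> complex" where
  "e_QZ r = exp (2 * complex_of_real pi * \<i> * of_rat r)"

definition frac_tr :: "'f::{finite,field} \<Rightarrow> rat" where
  "frac_tr x = of_nat (prime_field_rep (field_tr x)) / of_nat CHAR('f)"

definition beta :: "code_type \<Rightarrow> 'f::{finite,field} \<Rightarrow> 'f \<Rightarrow> rat" where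
  "beta T x y = (case T of
       Type_2II \<Rightarrow> of_nat (prime_field_rep (x * y)) / 2
     | Type_qE \<Rightarrow> frac_tr (x * y)
     | Type_qE1 \<Rightarrow> frac_tr (x * y))"

definition quarter_square :: "'f::{finite,field} \<Rightarrow> rat" where
  "quarter_square x = (of_nat (prime_field_rep x))\<^sup>2 / 4"

definition Phi :: "code_type \<Rightarrow> ('f::{finite,field} \<Rightarrow> rat) set" where
  "Phi T = (case T of
       Type_2II \<Rightarrow> {quarter_square, \<lambda>x. 2 * quarter_square x, \<lambda>x. 3 * quarter_square x, \<lambda>x. 0}
     | Type_qE \<Rightarrow> {\<lambda>x. frac_tr (a * x\<^sup>2) | a. True}
     | Type_qE1 \<Rightarrow> {\<lambda>x. frac_tr (a * x\<^sup>2 + b * x) | a b. True})"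

definition beta_n :: "code_type \<Rightarrow> nat \<Rightarrow> 'f::{finite,field} vec \<Rightarrow> 'f vec \<Rightarrow> rat" where
  "beta_n T n x y = (\<Sum>i<n. beta T (x $ i) (y $ i))"

definition Phi_n :: "code_type \<Rightarrow> nat \<Rightarrow> ('f::{finite,field} vec \<Rightarrow> rat) set" where
  "Phi_n T n = {\<lambda>v. (\<Sum>i<n. \<phi> i (v $ i)) + (\<Sum>j<n. \<Sum>i<j. beta T (v $ i) (m i j * v $ j))
     | (\<phi> :: nat \<Rightarrow> 'f \<Rightarrow> rat) (m :: nat \<Rightarrow> nat \<Rightarrow> 'f). \<forall>i<n. \<phi> i \<in> Phi T}"


section \<open>Clifford-Weil groups\<close>

text \<open>A linear substitution $x_v \mapsto \sum_w A_{v,w} x_w$ is given by the matrix $A$, whose rows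
  and columns are indexed by $\mathbb{F}^n$ and which is extended by zero. With the matrix product
  as multiplication, $p^{AB} = (p^A)^B$.\<close>

type_synonym 'f subst = "'f vec \<Rightarrow> 'f vec \<Rightarrow> complex"

definition subst_monoid :: "nat \<Rightarrow> 'f::{finite,field} subst monoid" where
  "subst_monoid n = \<lparr>
     carrier = {A. \<forall>v w. \<not> (v \<in> carrier_vec n \<and> w \<in> carrier_vec n) \<longrightarrow> A v w = 0},
     monoid.mult = (\<lambda>A B v w. \<Sum>u\<in>carrier_vec n. A v u * B u w),
     one = (\<lambda>v w. if v \<in> carrier_vec n \<and> w = v then 1 else 0)\<rparr>"

definition subst_GL :: "nat \<Rightarrow> 'f::{finite,field} subst monoid" where
  "subst_GL n = units_of (subst_monoid n)"

definition apply_subst ::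
    "nat \<Rightarrow> 'f::{finite,field} subst \<Rightarrow> ('f vec, complex) mpoly \<Rightarrow> ('f vec, complex) mpoly" where
  "apply_subst n A p = peval pconst (\<lambda>v. \<Sum>w\<in>carrier_vec n. pconst (A v w) * pvar w) p"

definition m_sub :: "nat \<Rightarrow> 'f::{finite,field} mat \<Rightarrow> 'f subst" where
  "m_sub n u = (\<lambda>v z. if v \<in> carrier_vec n \<and> z = u *\<^sub>v v then 1 else 0)"

definition d_sub :: "nat \<Rightarrow> ('f::{finite,field} vec \<Rightarrow> rat) \<Rightarrow> 'f subst" where
  "d_sub n \<phi> = (\<lambda>v z. if v \<in> carrier_vec n \<and> z = v then e_QZ (\<phi> v) else 0)"

definition mat_image :: "nat \<Rightarrow> 'f::{finite,field} mat \<Rightarrow> 'f vec set" where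
  "mat_image n A = (\<lambda>v. A *\<^sub>v v) ` carrier_vec n"

definition h_sub ::
    "code_type \<Rightarrow> nat \<Rightarrow> 'f::{finite,field} mat \<Rightarrow> 'f mat \<Rightarrow> 'f subst" where
  "h_sub T n \<iota> v\<^sub>\<iota> = (\<lambda>v z. if v \<in> carrier_vec n
     then (\<Sum>w\<in>mat_image n \<iota>. if z = (1\<^sub>m n - \<iota>) *\<^sub>v v + w
             then e_QZ (beta_n T n w (v\<^sub>\<iota> *\<^sub>v v)) else 0)
          / complex_of_real (sqrt (real (card (mat_image n \<iota>))))
     else 0)"

definition symmetric_idempotent ::
    "nat \<Rightarrow> 'f::{finite,field} mat \<Rightarrow> 'f mat \<Rightarrow> 'f mat \<Rightarrow> bool" where
  "symmetric_idempotent n \<iota> u\<^sub>\<iota> v\<^sub>\<iota> \<longleftrightarrow>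
     \<iota> \<in> carrier_mat n n \<and> \<iota> * \<iota> = \<iota> \<and>
     u\<^sub>\<iota> \<in> {\<iota> * M * transpose_mat \<iota> | M. M \<in> carrier_mat n n} \<and>
     v\<^sub>\<iota> \<in> {transpose_mat \<iota> * M * \<iota> | M. M \<in> carrier_mat n n} \<and>
     \<iota> = u\<^sub>\<iota> * v\<^sub>\<iota> \<and> v\<^sub>\<iota> * u\<^sub>\<iota> = transpose_mat \<iota>"

definition parabolic_gens :: "code_type \<Rightarrow> nat \<Rightarrow> 'f::{finite,field} subst set" where
  "parabolic_gens T n =
     {m_sub n u | u. u \<in> carrier_mat n n \<and> invertible_mat u} \<union>
     {d_sub n \<phi> | \<phi>. \<phi> \<in> Phi_n T n}"

definition clifford_weil_gens :: "code_type \<Rightarrow> nat \<Rightarrow> 'f::{finite,field} subst set" where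
  "clifford_weil_gens T n = parabolic_gens T n \<union>
     {h_sub T n \<iota> v\<^sub>\<iota> | \<iota> u\<^sub>\<iota> v\<^sub>\<iota>. symmetric_idempotent n \<iota> u\<^sub>\<iota> v\<^sub>\<iota>}"

definition clifford_weil :: "code_type \<Rightarrow> nat \<Rightarrow> 'f::{finite,field} subst monoid" where
  "clifford_weil T n =
     (subst_GL n)\<lparr>carrier := generate (subst_GL n) (clifford_weil_gens T n)\<rparr>"

definition parabolic :: "code_type \<Rightarrow> nat \<Rightarrow> 'f::{finite,field} subst set" where
  "parabolic T n = generate (subst_GL n) (parabolic_gens T n)"


section \<open>Eisenstein series, doubling map and cusp forms\<close>

definition eisenstein_seed ::
    "code_type \<Rightarrow> nat \<Rightarrow> nat \<Rightarrow> ('f::{finite,field} vec, complex) mpoly" where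
  "eisenstein_seed T n N = (case T of
       Type_2II \<Rightarrow> \<Sum>v\<in>carrier_vec n. pvar v ^ N
     | Type_qE \<Rightarrow> pvar (0\<^sub>v n) ^ N
     | Type_qE1 \<Rightarrow> \<Sum>v\<in>carrier_vec n. pvar v ^ N)"

text \<open>The sum over $\mathcal{P}_n\backslash\mathcal{C}_n$ uses an arbitrary representative of each
  coset $\mathcal{P}_n\sigma$; for the relevant \<open>N\<close> the seed is invariant under $\mathcal{P}_n$.\<close>

definition eisenstein ::
    "code_type \<Rightarrow> nat \<Rightarrow> nat \<Rightarrow> ('f::{finite,field} vec, complex) mpoly" where
  "eisenstein T n N =
     (let cosets = rcosets\<^bsub>(clifford_weil T n :: 'f subst monoid)\<^esub> (parabolic T n) in
      pconst (1 / of_nat (card cosets)) *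
      (\<Sum>S\<in>cosets. apply_subst n (SOME \<sigma>. \<sigma> \<in> S) (eisenstein_seed T n N)))"

text \<open>$\mathbb{C}[\underline{x}]\otimes\mathbb{C}[\underline{y}]$ is rendered as
  $\mathbb{C}[\underline{x}][\underline{y}]$.\<close>

definition doubling ::
    "nat \<Rightarrow> ('f::{finite,field} vec, complex) mpoly \<Rightarrow> ('f vec, ('f vec, complex) mpoly) mpoly"
  where
  "doubling g p = peval (\<lambda>c. pconst (pconst c))
     (\<lambda>v. pconst (pvar (vec_first v g)) * pvar (vec_last v g)) p"

definition monom_inner :: "('v \<Rightarrow>\<^sub>0 nat) \<Rightarrow> ('v \<Rightarrow>\<^sub>0 nat) \<Rightarrow> complex" where
  "monom_inner m m' =
     (if m = m' then \<Prod>v\<in>Poly_Mapping.keys m. fact (Poly_Mapping.lookup m v) else 0)"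

definition poly_inner :: "('v, complex) mpoly \<Rightarrow> ('v, complex) mpoly \<Rightarrow> complex" where
  "poly_inner p f = (\<Sum>m\<in>Poly_Mapping.keys p. \<Sum>m'\<in>Poly_Mapping.keys f.
     Poly_Mapping.lookup p m * cnj (Poly_Mapping.lookup f m') * monom_inner m m')"

definition inner_y ::
    "('v, ('v, complex) mpoly) mpoly \<Rightarrow> ('v, complex) mpoly \<Rightarrow> ('v, complex) mpoly" where
  "inner_y P f = (\<Sum>m\<in>Poly_Mapping.keys P.
     Poly_Mapping.lookup P m * pconst (poly_inner (Poly_Mapping.single m 1) f))"

definition Phi_op ::
    "nat \<Rightarrow> ('f::{finite,field} vec, complex) mpoly \<Rightarrow> ('f vec, complex) mpoly" where
  "Phi_op g p =
     peval pconst (\<lambda>v. if v $ (g - 1) = 0 then pvar (vec_first v (g - 1)) else 0) p"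

definition cusp_form :: "code_type \<Rightarrow> nat \<Rightarrow> ('f::{finite,field} vec, complex) mpoly \<Rightarrow> bool" where
  "cusp_form T g f \<longleftrightarrow>
     f \<in> polys_in (carrier_vec g) \<and> f \<noteq> 0 \<and> (\<exists>N. homogeneous N f) \<and>
     (\<forall>\<sigma>\<in>carrier (clifford_weil T g). apply_subst g \<sigma> f = f) \<and>
     Phi_op g f = 0"

definition doubling_const :: "code_type \<Rightarrow> nat \<Rightarrow> nat \<Rightarrow> nat \<Rightarrow> real" where
  "doubling_const T q g N = (case T of
       Type_2II \<Rightarrow> 2 powr (real g ^ 2 + 2 * real g - real N * real g / 2) *
         (\<Prod>i=1..g. (2 ^ i - 1) / (2 ^ (g + i) + 1))
     | Type_qE1 \<Rightarrow> real q powr (real g ^ 2 + 2 * real g - real N * real g / 2) *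
         (\<Prod>i=1..g. (real q ^ i - 1) / (real q ^ (g + i) + 1))
     | Type_qE \<Rightarrow> real q powr (real g ^ 2 - real N * real g / 2) *
         (\<Prod>i=1..g. (real q ^ i - 1) / (real q ^ (g + i) + 1)))"

end

theory Submission
  imports
    Defs
    "HOL-Number_Theory.Cong"
    "HOL-Computational_Algebra.Polynomial"
    "HOL-Library.Function_Algebras"
    "Jordan_Normal_Form.Determinant"
begin

text \<open>
  Call a function on $\mathbb{F}^n$ a state if it is a quadratic character supported on an affine
  (for type $q^E$: linear) subspace, of norm 1, up to an $N$-th root of unity. The Clifford-Weil group permutes
  the states transitively, and the seed of the Eisenstein series is a sum of $N$-th powers of linear
  forms with state coefficients. Hence $E_{2g}$ is, up to a scalar, the sum of the $N$-th powers of
  the linear forms belonging to all states on $\mathbb{F}^{2g}$, and pairing the double of the power belonging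
  to $s$ with $f$ substitutes the rows of $s$, a matrix with indices in $\mathbb{F}^g$, into the
  conjugate of $f$. For a cusp form this vanishes unless $s$ is, up to the action of
  $\mathcal{C}_g$, a multiple of a monomial matrix in $\mathcal{P}_g$, in which case invariance
  gives back $\bar f$. The constant comes from counting these states and all states.
\<close>

text \<open>Neither the order of \<open>C n\<close> nor the index of \<open>parabolic\<close> is
  computed: coset averages become averages over \<open>C n\<close>, then over states, and the states
  are counted by a recursion on the dimension. Divisibility of \<open>N\<close> by the order of Z
  acts only through N-th powers: it makes Gauss sums, and in the affine types also the values of
  quadratic characters, N-th roots of unity up to positive factors, so that powers forget the phase.

  The delicate point is the vanishing. Write a state on F^(2g) as a matrix s(a, b) with b the index
  of y. Acting by \<open>C g\<close> on b alone turns the vector s(0, -), if it is nonzero, into a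
  multiple of a point mass at 0. The support is then a subspace meeting a = 0 only in 0. Either it
  projects onto all b, and is the graph of an isomorphism, or all its b lie in a hyperplane, and the
  Siegel operator kills the substitution.

  In the constant, GL_g gives the factors q^i - 1, the quotient of the numbers of states on F^(2g)
  and F^g gives q^(g+i) + 1, the q^(2g) seed vectors of the affine types give the extra 2g, and the
  norm q^(-g/2) of the entries gives -Ng/2.\<close>

abbreviation monom_eval :: "('v \<Rightarrow> 'r::comm_ring_1) \<Rightarrow> ('v \<Rightarrow>\<^sub>0 nat) \<Rightarrow> 'r" where
  "monom_eval s m \<equiv> (\<Prod>v\<in>Poly_Mapping.keys m. s v ^ Poly_Mapping.lookup m v)"

lemma monom_eval_superset:
  assumes "finite A" "Poly_Mapping.keys m \<subseteq> A"
  shows "monom_eval s m = (\<Prod>v\<in>A. s v ^ Poly_Mapping.lookup m v)"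
  by (rule prod.mono_neutral_left) (use assms in \<open>auto simp: in_keys_iff\<close>)

lemma monom_eval_add: "monom_eval s (m + m') = monom_eval s m * monom_eval s m'"
proof -
  let ?A = "Poly_Mapping.keys m \<union> Poly_Mapping.keys m'"
  have "monom_eval s (m + m') = (\<Prod>v\<in>?A. s v ^ Poly_Mapping.lookup (m + m') v)"
    by (rule monom_eval_superset) (use keys_add[of m m'] in auto)
  also have "\<dots> = (\<Prod>v\<in>?A. s v ^ Poly_Mapping.lookup m v) * (\<Prod>v\<in>?A. s v ^ Poly_Mapping.lookup m' v)"
    by (simp add: lookup_add power_add prod.distrib)
  also have "\<dots> = monom_eval s m * monom_eval s m'"
    by (subst (1 2) monom_eval_superset[of ?A]) auto
  finally show ?thesis .
qed

lemma peval_superset: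
  assumes "h 0 = 0" "finite A" "Poly_Mapping.keys p \<subseteq> A"
  shows "peval h s p = (\<Sum>m\<in>A. h (Poly_Mapping.lookup p m) * monom_eval s m)"
  unfolding peval_def
  by (rule sum.mono_neutral_left) (use assms in \<open>auto simp: in_keys_iff\<close>)

lemma poly_mapping_sum_single:
  "p = (\<Sum>m\<in>Poly_Mapping.keys p. Poly_Mapping.single m (Poly_Mapping.lookup p m))"
proof (rule poly_mapping_eqI)
  fix k
  have "(\<Sum>m\<in>Poly_Mapping.keys p. Poly_Mapping.lookup (Poly_Mapping.single m (Poly_Mapping.lookup p m)) k)
      = (\<Sum>m\<in>Poly_Mapping.keys p. if m = k then Poly_Mapping.lookup p k else 0)"
    by (intro sum.cong) (auto simp: lookup_single when_def)
  then show "Poly_Mapping.lookup p k =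
    Poly_Mapping.lookup (\<Sum>m\<in>Poly_Mapping.keys p. Poly_Mapping.single m (Poly_Mapping.lookup p m)) k"
    by (auto simp: lookup_sum in_keys_iff)
qed

section \<open>Evaluation of polynomials as a ring homomorphism\<close>

context comm_ring_hom
begin

lemma peval_add: "peval hom s (p + q) = peval hom s p + peval hom s q"
proof -
  let ?A = "Poly_Mapping.keys p \<union> Poly_Mapping.keys q"
  have "peval hom s (p + q) = (\<Sum>m\<in>?A. hom (Poly_Mapping.lookup (p + q) m) * monom_eval s m)"
    by (rule peval_superset) (use keys_add[of p q] in auto)
  also have "\<dots> = (\<Sum>m\<in>?A. hom (Poly_Mapping.lookup p m) * monom_eval s m) +
      (\<Sum>m\<in>?A. hom (Poly_Mapping.lookup q m) * monom_eval s m)"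
    by (simp add: lookup_add hom_add algebra_simps sum.distrib)
  also have "\<dots> = peval hom s p + peval hom s q"
    by (subst (1 2) peval_superset[of _ ?A]) auto
  finally show ?thesis .
qed

lemma peval_zero: "peval hom s 0 = 0"
  by (simp add: peval_def)

lemma peval_sum: "peval hom s (\<Sum>x\<in>A. F x) = (\<Sum>x\<in>A. peval hom s (F x))"
  by (induction A rule: infinite_finite_induct) (auto simp: peval_add peval_zero)

lemma peval_single: "peval hom s (Poly_Mapping.single m c) = hom c * monom_eval s m"
  by (subst peval_superset[of _ "{m}"]) (auto simp: lookup_single when_def)

lemma peval_mult: "peval hom s (p * q) = peval hom s p * peval hom s q"
proof -
  have "p * q = (\<Sum>m\<in>Poly_Mapping.keys p. \<Sum>m'\<in>Poly_Mapping.keys q.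
      Poly_Mapping.single (m + m') (Poly_Mapping.lookup p m * Poly_Mapping.lookup q m'))"
    by (subst poly_mapping_sum_single[of p], subst poly_mapping_sum_single[of q])
      (simp add: sum_product mult_single)
  then have "peval hom s (p * q) = (\<Sum>m\<in>Poly_Mapping.keys p. \<Sum>m'\<in>Poly_Mapping.keys q.
      hom (Poly_Mapping.lookup p m * Poly_Mapping.lookup q m') * monom_eval s (m + m'))"
    by (simp add: peval_sum peval_single)
  also have "\<dots> = peval hom s p * peval hom s q"
    unfolding monom_eval_add by (simp add: peval_def sum_product hom_mult ac_simps)
  finally show ?thesis .
qed

lemma peval_hom: "comm_ring_hom (peval hom s)"
proof
  show "peval hom s 1 = 1"
    using peval_single[of s 0 1] by simp
qed (simp_all add: peval_add peval_mult peval_zero)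

text \<open>A homomorphism applied after an evaluation merges into the coefficient map and into the
  substituted values. Compositions of substitutions, complex conjugation, the cusp operator and
  translations of the variables are all rewritten with this rule.\<close>

lemma hom_peval: "hom (peval h s p) = peval (\<lambda>c. hom (h c)) (\<lambda>v. hom (s v)) p"
  by (simp add: peval_def hom_sum hom_mult hom_prod hom_power)

end

lemma pconst_hom: "comm_ring_hom (pconst :: 'a::comm_ring_1 \<Rightarrow> ('v, 'a) mpoly)"
  by unfold_locales (auto simp: pconst_def single_add mult_single)

interpretation pconst: comm_ring_hom "pconst :: 'a::comm_ring_1 \<Rightarrow> ('v, 'a) mpoly"
  by (rule pconst_hom)

lemma (in comm_ring_hom) peval_pconst: "peval hom s (pconst c) = hom c"
  by (simp add: pconst_def peval_single)

lemma (in comm_ring_hom) peval_pvar: "peval hom s (pvar v) = s v"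
  by (simp add: pvar_def peval_single)

lemma peval_cong:
  assumes "p \<in> polys_in V" "\<And>v. v \<in> V \<Longrightarrow> s v = s' v"
  shows "peval h s p = peval h s' p"
  unfolding peval_def
proof (intro sum.cong refl arg_cong2[of _ _ _ _ "(*)"] prod.cong)
  fix m v assume "m \<in> Poly_Mapping.keys p" "v \<in> Poly_Mapping.keys m"
  then show "s v ^ Poly_Mapping.lookup m v = s' v ^ Poly_Mapping.lookup m v"
    using assms unfolding polys_in_def by force
qed

lemma peval_pvar_id:
  fixes p :: "('v, 'a::comm_ring_1) mpoly"
  shows "peval pconst pvar p = p"
proof -
  have 1: "monom_eval pvar m = (Poly_Mapping.single m 1 :: ('v, 'a) mpoly)" for m :: "'v \<Rightarrow>\<^sub>0 nat"
  proof -
    have pw: "(pvar v :: ('v, 'a) mpoly) ^ k = Poly_Mapping.single (Poly_Mapping.single v k) 1" for v k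
      by (induction k) (auto simp: pvar_def mult_single single_add[symmetric])
    have "finite A \<Longrightarrow> (\<Prod>v\<in>A. Poly_Mapping.single (Poly_Mapping.single v (Poly_Mapping.lookup m v)) 1)
        = (Poly_Mapping.single (\<Sum>v\<in>A. Poly_Mapping.single v (Poly_Mapping.lookup m v)) 1 :: ('v, 'a) mpoly)" for A
      by (induction A rule: finite_induct) (auto simp: mult_single)
    then show ?thesis
      using poly_mapping_sum_single[of m] by (simp add: pw)
  qed
  show ?thesis
    unfolding peval_def 1 by (subst (3) poly_mapping_sum_single[of p]) (simp add: pconst_def mult_single)
qed

section \<open>Composition of linear substitutions\<close>

lemma apply_subst_hom: "comm_ring_hom (apply_subst n A)"
  unfolding apply_subst_def[abs_def] by (rule pconst.peval_hom)

lemma apply_subst_pconst [simp]: "apply_subst n A (pconst c) = pconst c"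
  by (simp add: apply_subst_def pconst.peval_pconst)

lemma apply_subst_pvar [simp]:
  "apply_subst n A (pvar v) = (\<Sum>w\<in>carrier_vec n. pconst (A v w) * pvar w)"
  by (simp add: apply_subst_def pconst.peval_pvar)

lemma finite_carrier_vec [simp]: "finite (carrier_vec n :: 'f::finite vec set)"
proof -
  have "carrier_vec n \<subseteq> vec_of_list ` {xs :: 'f list. set xs \<subseteq> UNIV \<and> length xs = n}"
  proof
    fix v :: "'f vec" assume "v \<in> carrier_vec n"
    then show "v \<in> vec_of_list ` {xs :: 'f list. set xs \<subseteq> UNIV \<and> length xs = n}"
      by (intro image_eqI[of _ _ "list_of_vec v"]) (auto simp: vec_list)
  qed
  then show ?thesis
    by (rule finite_subset) (intro finite_imageI finite_lists_length_eq, simp)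
qed

text \<open>Row \<open>v\<close> of a substitution lists the image of the variable \<open>v\<close>,
  so applying \<open>A\<close> and afterwards \<open>B\<close> multiplies the matrices in that same
  order: substitutions act from the right.\<close>

lemma apply_subst_apply_subst:
  fixes A B :: "'f::{finite,field} subst"
  shows "apply_subst n B (apply_subst n A p) = apply_subst n (A \<otimes>\<^bsub>subst_monoid n\<^esub> B) p"
proof -
  interpret B: comm_ring_hom "apply_subst n B" by (rule apply_subst_hom)
  have "apply_subst n B (apply_subst n A p) = peval pconst
      (\<lambda>v. \<Sum>w\<in>carrier_vec n. pconst (A v w) * (\<Sum>u\<in>carrier_vec n. pconst (B w u) * pvar u)) p"
    unfolding apply_subst_def[of n A] by (simp add: B.hom_peval B.hom_sum B.hom_mult)
  also have "(\<lambda>v. \<Sum>w\<in>carrier_vec n. pconst (A v w) * (\<Sum>u\<in>carrier_vec n. pconst (B w u) * pvar u))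
    = (\<lambda>v. \<Sum>u\<in>carrier_vec n. pconst ((A \<otimes>\<^bsub>subst_monoid n\<^esub> B) v u) * (pvar u :: ('f vec, complex) mpoly))"
    (is "?l = ?r")
  proof
    fix v
    have "?l v = (\<Sum>w\<in>carrier_vec n. \<Sum>u\<in>carrier_vec n. pconst (A v w) * (pconst (B w u) * pvar u))"
      by (simp add: sum_distrib_left)
    also have "\<dots> = ?r v"
      by (subst sum.swap) (simp add: subst_monoid_def pconst.hom_sum pconst.hom_mult sum_distrib_right mult.assoc)
    finally show "?l v = ?r v" .
  qed
  finally show ?thesis by (simp add: apply_subst_def)
qed

section \<open>Pairing with powers of linear forms\<close>

lemma lookup_pconst_mult: "Poly_Mapping.lookup (pconst c * P) m = c * Poly_Mapping.lookup P m"
  unfolding pconst_def mult_map_scale_conv_mult[symmetric]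
  by (simp add: Poly_Mapping.map.rep_eq when_def)

lemma poly_inner_single:
  "poly_inner (Poly_Mapping.single m 1) f =
     cnj (Poly_Mapping.lookup f m) * (\<Prod>v\<in>Poly_Mapping.keys m. fact (Poly_Mapping.lookup m v))"
proof -
  let ?c = "\<Prod>v\<in>Poly_Mapping.keys m. fact (Poly_Mapping.lookup m v) :: complex"
  have "poly_inner (Poly_Mapping.single m 1) f =
      (\<Sum>m'\<in>Poly_Mapping.keys f. cnj (Poly_Mapping.lookup f m') * monom_inner m m')"
    by (simp add: poly_inner_def)
  also have "\<dots> = (\<Sum>m'\<in>Poly_Mapping.keys f. if m' = m then cnj (Poly_Mapping.lookup f m) * ?c else 0)"
    by (intro sum.cong) (auto simp: monom_inner_def)
  finally show ?thesis by (simp add: in_keys_iff)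
qed

lemma inner_y_superset:
  assumes "finite A" "Poly_Mapping.keys P \<subseteq> A"
  shows "inner_y P f = (\<Sum>m\<in>A. Poly_Mapping.lookup P m * pconst (poly_inner (Poly_Mapping.single m 1) f))"
  unfolding inner_y_def by (rule sum.mono_neutral_left) (use assms in \<open>auto simp: in_keys_iff\<close>)

lemma inner_y_add: "inner_y (P + Q) f = inner_y P f + inner_y Q f"
proof -
  let ?A = "Poly_Mapping.keys P \<union> Poly_Mapping.keys Q"
  have "inner_y (P + Q) f = (\<Sum>m\<in>?A. Poly_Mapping.lookup (P + Q) m *
      pconst (poly_inner (Poly_Mapping.single m 1) f))"
    by (rule inner_y_superset) (use keys_add[of P Q] in auto)
  then show ?thesis
    by (simp add: inner_y_superset[of ?A P] inner_y_superset[of ?A Q] lookup_add algebra_simps sum.distrib)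
qed

lemma inner_y_sum: "inner_y (\<Sum>x\<in>A. F x) f = (\<Sum>x\<in>A. inner_y (F x) f)"
  by (induction A rule: infinite_finite_induct) (auto simp: inner_y_add, auto simp: inner_y_def)

lemma inner_y_pconst_mult: "inner_y (pconst c * P) f = c * inner_y P f"
proof -
  have "Poly_Mapping.keys (pconst c * P) \<subseteq> Poly_Mapping.keys P"
    by (auto simp: in_keys_iff lookup_pconst_mult)
  from inner_y_superset[OF finite_keys this] show ?thesis
    by (simp add: inner_y_def lookup_pconst_mult sum_distrib_left mult.assoc)
qed

text \<open>Multiplication by a variable shifts exponents by one. Subtraction of exponents is
  truncated, so without the test on the exponent of \<open>v\<close> a wrong coefficient would be
  read off.\<close>

lemma lookup_single_mult:
  fixes Q :: "('v \<Rightarrow>\<^sub>0 nat) \<Rightarrow>\<^sub>0 'a::comm_ring_1"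
  shows "Poly_Mapping.lookup (Poly_Mapping.single (Poly_Mapping.single v 1) c * Q) m =
    (if Poly_Mapping.lookup m v > 0 then c * Poly_Mapping.lookup Q (m - Poly_Mapping.single v 1) else 0)"
proof -
  have "Poly_Mapping.single (Poly_Mapping.single v 1) c * Q = (\<Sum>m'\<in>Poly_Mapping.keys Q.
      Poly_Mapping.single (Poly_Mapping.single v 1 + m') (c * Poly_Mapping.lookup Q m'))"
    by (subst (1) poly_mapping_sum_single[of Q]) (simp add: sum_distrib_left mult_single)
  then have 1: "Poly_Mapping.lookup (Poly_Mapping.single (Poly_Mapping.single v 1) c * Q) m =
      (\<Sum>m'\<in>Poly_Mapping.keys Q. if Poly_Mapping.single v 1 + m' = m then c * Poly_Mapping.lookup Q m' else 0)"
    by (auto simp: lookup_sum lookup_single when_def intro!: sum.cong)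
  show ?thesis
  proof (cases "Poly_Mapping.lookup m v > 0")
    case True
    have "Poly_Mapping.single v 1 + m' = m \<longleftrightarrow> m' = m - Poly_Mapping.single v 1" for m'
    proof
      assume *: "m' = m - Poly_Mapping.single v 1"
      show "Poly_Mapping.single v 1 + m' = m"
        by (rule poly_mapping_eqI) (use True in \<open>auto simp: * lookup_add lookup_minus lookup_single when_def\<close>)
    qed auto
    then show ?thesis using True
      unfolding 1 by (auto simp: in_keys_iff)
  next
    case False
    have "Poly_Mapping.single v 1 + m' \<noteq> m" for m'
    proof
      assume "Poly_Mapping.single v 1 + m' = m"
      then have "Poly_Mapping.lookup m v = 1 + Poly_Mapping.lookup m' v"
        by (auto simp: lookup_add)
      with False show False by simp
    qed
    then show ?thesis using False unfolding 1 by simp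
  qed
qed

lemma lookup_linear_form_power:
  fixes a :: "'v \<Rightarrow> 'r::comm_ring_1"
  assumes X: "finite X"
  defines "L \<equiv> (\<Sum>v\<in>X. pconst (a v) * pvar v)"
  shows "(\<Prod>v\<in>X. of_nat (fact (Poly_Mapping.lookup m v))) * Poly_Mapping.lookup (L ^ N) m =
    (if Poly_Mapping.keys m \<subseteq> X \<and> (\<Sum>v\<in>X. Poly_Mapping.lookup m v) = N
     then of_nat (fact N) * (\<Prod>v\<in>X. a v ^ Poly_Mapping.lookup m v) else 0)"
proof (induction N arbitrary: m)
  case 0
  have "m = 0" if "Poly_Mapping.keys m \<subseteq> X" "\<forall>v\<in>X. Poly_Mapping.lookup m v = 0"
    by (rule poly_mapping_eqI) (use that in \<open>auto simp: in_keys_iff\<close>)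
  then show ?case
    using X by (auto simp: lookup_one when_def)
next
  case (Suc N)
  let ?l = "Poly_Mapping.lookup"
  let ?s = "\<lambda>v. Poly_Mapping.single v (1::nat)"
  let ?C = "Poly_Mapping.keys m \<subseteq> X \<and> (\<Sum>v\<in>X. ?l m v) = Suc N"
  have term_eq: "(\<Prod>u\<in>X. of_nat (fact (?l m u))) * (if ?l m v > 0 then a v * ?l (L ^ N) (m - ?s v) else 0) =
      (if ?C then of_nat (?l m v) * of_nat (fact N) * (\<Prod>v\<in>X. a v ^ ?l m v) else 0)" if v: "v \<in> X" for v
  proof (cases "?l m v > 0")
    case True
    let ?m = "m - ?s v"
    have lm: "?l ?m u = (if u = v then ?l m v - 1 else ?l m u)" for u
      by (simp add: lookup_minus lookup_single when_def)
    note lm = lm lm[unfolded One_nat_def]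
    have f: "(\<Prod>u\<in>X. of_nat (fact (?l m u))) = (of_nat (?l m v) :: 'r) * (\<Prod>u\<in>X. of_nat (fact (?l ?m u)))"
      using True by (simp add: prod.remove[OF X v] lm fact_reduce[of "?l m v", where ?'a = nat] mult.assoc
          del: One_nat_def)
    have g: "(\<Prod>u\<in>X. a u ^ ?l m u) = a v * (\<Prod>u\<in>X. a u ^ ?l ?m u)"
      using X v True by (simp add: prod.remove[OF X v] lm power_eq_if[of "a v" "?l m v"] mult.assoc
          del: One_nat_def)
    have k: "Poly_Mapping.keys ?m \<subseteq> X \<longleftrightarrow> Poly_Mapping.keys m \<subseteq> X"
      using v by (auto simp: in_keys_iff lm subset_iff split: if_splits)
    have "(\<Sum>u\<in>X. ?l m u) = Suc (\<Sum>u\<in>X. ?l ?m u)"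
      using X v True by (simp add: sum.remove[OF X v] lm)
    then have c: "Poly_Mapping.keys ?m \<subseteq> X \<and> (\<Sum>u\<in>X. ?l ?m u) = N \<longleftrightarrow> ?C"
      using k by simp
    have "(\<Prod>u\<in>X. of_nat (fact (?l m u))) * (a v * ?l (L ^ N) ?m) =
        of_nat (?l m v) * a v * ((\<Prod>u\<in>X. of_nat (fact (?l ?m u))) * ?l (L ^ N) ?m)"
      by (simp add: f ac_simps)
    then show ?thesis
      using True by (simp only: Suc.IH c g) (simp add: ac_simps)
  qed auto
  have "?l (L ^ Suc N) m = (\<Sum>v\<in>X. if ?l m v > 0 then a v * ?l (L ^ N) (m - ?s v) else 0)"
    by (simp add: L_def sum_distrib_right lookup_sum pconst_def pvar_def mult_single lookup_single_mult
        del: One_nat_def cong: sum.cong if_cong)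
  then have "(\<Prod>u\<in>X. of_nat (fact (?l m u))) * ?l (L ^ Suc N) m =
      (\<Sum>v\<in>X. if ?C then of_nat (?l m v) * of_nat (fact N) * (\<Prod>v\<in>X. a v ^ ?l m v) else 0)"
    using term_eq by (simp only: sum_distrib_left cong: sum.cong)
  also have "\<dots> = (if ?C then of_nat (\<Sum>v\<in>X. ?l m v) * of_nat (fact N) * (\<Prod>v\<in>X. a v ^ ?l m v) else 0)"
    unfolding of_nat_sum sum_distrib_right by (cases ?C) (simp_all only: if_True if_False sum.neutral_const simp_thms)
  finally show ?case by (auto simp: distrib_right)
qed

text \<open>Powers of linear forms are the reproducing kernels of this inner product: its factorials
  cancel the denominators of the multinomial coefficients, which leaves evaluation of the conjugated
  polynomial at the coefficients \<open>a\<close>. These are themselves polynomials, in the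
  variables x.\<close>

lemma inner_y_linear_form_power:
  fixes f :: "('v, complex) mpoly"
  assumes "finite X" "f \<in> polys_in X" "homogeneous N f"
  shows "inner_y ((\<Sum>v\<in>X. pconst (a v) * pvar v) ^ N) f =
    pconst (fact N) * peval pconst a (conj_poly f)"
proof -
  let ?P = "(\<Sum>v\<in>X. pconst (a v) * pvar v) ^ N" and ?l = "Poly_Mapping.lookup"
  have k: "Poly_Mapping.keys (conj_poly f) = Poly_Mapping.keys f"
    by (auto simp: conj_poly_def in_keys_iff Poly_Mapping.map.rep_eq when_def)
  have "inner_y ?P f = (\<Sum>m\<in>Poly_Mapping.keys ?P \<union> Poly_Mapping.keys f.
     ?l ?P m * pconst (poly_inner (Poly_Mapping.single m 1) f))"
    by (rule inner_y_superset) auto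
  also have "\<dots> = (\<Sum>m\<in>Poly_Mapping.keys f. ?l ?P m * pconst (poly_inner (Poly_Mapping.single m 1) f))"
    by (rule sum.mono_neutral_right) (auto simp: poly_inner_single in_keys_iff)
  also have "\<dots> = (\<Sum>m\<in>Poly_Mapping.keys f. pconst (fact N) * (pconst (?l (conj_poly f) m) * monom_eval a m))"
  proof (rule sum.cong[OF refl])
    fix m assume m: "m \<in> Poly_Mapping.keys f"
    then have mX: "Poly_Mapping.keys m \<subseteq> X" using assms by (auto simp: polys_in_def)
    have e: "monom_eval a m = (\<Prod>v\<in>X. a v ^ ?l m v)"
      using assms mX by (rule_tac monom_eval_superset)
    have "(\<Sum>v\<in>Poly_Mapping.keys m. ?l m v) = N" using assms m by (auto simp: homogeneous_def)
    moreover have "(\<Sum>v\<in>X. ?l m v) = (\<Sum>v\<in>Poly_Mapping.keys m. ?l m v)"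
      by (rule sum.mono_neutral_right) (use assms mX in \<open>auto simp: in_keys_iff\<close>)
    ultimately have "(\<Prod>v\<in>X. of_nat (fact (?l m v))) * ?l ?P m = of_nat (fact N) * monom_eval a m"
      using mX lookup_linear_form_power[OF assms(1), of m a N] by (simp add: e)
    moreover have "(\<Prod>v\<in>X. of_nat (fact (?l m v))) =
        (\<Prod>v\<in>Poly_Mapping.keys m. (of_nat (fact (?l m v)) :: ('v, complex) mpoly))"
      by (rule prod.mono_neutral_right) (use assms mX in \<open>auto simp: in_keys_iff\<close>)
    moreover have pf: "pconst (fact k) = (of_nat (fact k) :: ('v, complex) mpoly)" for k :: nat
      by (metis pconst.hom_of_nat of_nat_fact)
    then have "(\<Prod>v\<in>Poly_Mapping.keys m. (of_nat (fact (?l m v)) :: ('v, complex) mpoly)) =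
        pconst (\<Prod>v\<in>Poly_Mapping.keys m. fact (?l m v))"
      by (simp add: pconst.hom_prod)
    moreover note pf[of N]
    ultimately have "pconst (\<Prod>v\<in>Poly_Mapping.keys m. fact (?l m v)) * ?l ?P m =
        pconst (fact N) * monom_eval a m"
      by simp
    then have "pconst (cnj (?l f m)) * (pconst (\<Prod>v\<in>Poly_Mapping.keys m. fact (?l m v)) * ?l ?P m) =
        pconst (cnj (?l f m)) * (pconst (fact N) * monom_eval a m)"
      by simp
    then show "?l ?P m * pconst (poly_inner (Poly_Mapping.single m 1) f) =
        pconst (fact N) * (pconst (?l (conj_poly f) m) * monom_eval a m)"
      using m by (simp add: poly_inner_single pconst.hom_mult conj_poly_def Poly_Mapping.map.rep_eq
          when_def in_keys_iff ac_simps)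
  qed
  also have "\<dots> = pconst (fact N) * peval pconst a (conj_poly f)"
    by (simp add: peval_def k sum_distrib_left)
  finally show ?thesis .
qed

section \<open>Finite fields and the trace character\<close>

lemma finite_field_CHAR_prime: "prime CHAR('f::{finite,field})"
  by (rule prime_CHAR_semidom) (simp add: finite_imp_CHAR_pos)

text \<open>Multiplication by a nonzero x permutes the nonzero elements, so their product absorbs
  the factor x^(q-1), which must therefore be 1.\<close>

lemma finite_field_power_card: "(x :: 'f::{finite,field}) ^ CARD('f) = x"
proof (cases "x = 0")
  case False
  have "(\<Prod>y\<in>UNIV-{0}. x * y) = (\<Prod>y\<in>UNIV-{0}. y)"
    by (rule prod.reindex_bij_witness[of _ "\<lambda>y. y / x" "\<lambda>y. x * y"]) (use False in auto)
  then have "x ^ (CARD('f) - 1) * \<Prod>(UNIV-{0}) = 1 * \<Prod>(UNIV-{0})"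
    by (simp add: prod.distrib)
  then have "x ^ (CARD('f) - 1) = 1"
    by (subst (asm) mult_right_cancel) auto
  then show ?thesis
    using power_Suc[of x "CARD('f) - 1"] by simp
qed (simp add: power_0_left)

text \<open>An additive subgroup A that misses x is enlarged to the union of the cosets k x + A for
  k < p. These are disjoint, because a difference k - l is invertible modulo p and a coincidence
  would put x into A. Each enlargement multiplies the size by p, starting from {0}.\<close>

lemma finite_field_card_eq_CHAR_power: "\<exists>k. CARD('f::{finite,field}) = CHAR('f) ^ k"
proof -
  let ?p = "CHAR('f)"
  have p: "prime ?p" by (rule finite_field_CHAR_prime)
  define sub where "sub A \<longleftrightarrow> (0::'f) \<in> A \<and> (\<forall>x\<in>A. \<forall>y\<in>A. x - y \<in> A)" for A
  have add: "x + y \<in> A" if "sub A" "x \<in> A" "y \<in> A" for A x y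
    using that unfolding sub_def by (metis diff_0 diff_minus_eq_add)
  have nat: "of_nat k * x \<in> A" if "sub A" "x \<in> A" for A x k
    by (induction k) (use that add in \<open>auto simp: sub_def algebra_simps\<close>)
  have step: "\<exists>B. sub B \<and> A \<subset> B \<and> card B = ?p * card A" if A: "sub A" and x: "x \<notin> A" for A x
  proof -
    define F where "F = (\<lambda>(k::nat, a). of_nat k * x + a)"
    define B where "B = F ` ({..<?p} \<times> A)"
    have inj: "inj_on F ({..<?p} \<times> A)"
    proof -
      have *: "k \<le> l" if e: "of_nat k * x + a = of_nat l * x + b" and "a \<in> A" "b \<in> A" "k < ?p" "l < ?p" for k l a b
      proof (rule ccontr)
        assume kl: "\<not> k \<le> l"
        let ?d = "k - l"
        have d: "of_nat ?d * x = b - a"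
          using e kl by (simp add: of_nat_diff algebra_simps)
        have "coprime ?d ?p"
          using p kl \<open>k < ?p\<close> by (metis coprime_commute diff_less_mono2 dvd_imp_le leD less_imp_diff_less
              linorder_not_le prime_imp_coprime zero_less_diff)
        then obtain u where "[?d * u = 1] (mod ?p)"
          using cong_solve_coprime_nat by force
        then have "(of_nat (?d * u) :: 'f) = of_nat 1"
          by (simp only: of_nat_eq_iff_cong_CHAR)
        then have "x = of_nat u * (of_nat ?d * x)"
          by (simp add: mult.assoc[symmetric] mult.commute)
        moreover have "b - a \<in> A" using A that by (auto simp: sub_def)
        ultimately have "x \<in> A" using nat[OF A] d by metis
        with x show False by simp
      qed
      have "F z = F z' \<Longrightarrow> z = z'" if zz: "z \<in> {..<?p} \<times> A" "z' \<in> {..<?p} \<times> A" for z z'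
        using *[of "fst z" "snd z" "fst z'" "snd z'"] *[of "fst z'" "snd z'" "fst z" "snd z"] zz
        by (auto simp: F_def split: prod.splits)
      then show ?thesis by (auto simp: inj_on_def)
    qed
    have "sub B"
      unfolding sub_def
    proof (intro conjI ballI)
      show "0 \<in> B" unfolding B_def F_def
        by (rule image_eqI[of _ _ "(0,0)"]) (use A p in \<open>auto simp: sub_def prime_gt_0_nat\<close>)
      fix y z assume "y \<in> B" "z \<in> B"
      then obtain k a l b where y: "y = of_nat k * x + a" "k < ?p" "a \<in> A"
        and z: "z = of_nat l * x + b" "l < ?p" "b \<in> A"
        by (auto simp: B_def F_def)
      \<comment> \<open>Here \<open>?p - l\<close> stands for -l, and the reduction keeps the
        multiplier below \<open>?p\<close>.\<close>
      let ?m = "(k + (?p - l)) mod ?p"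
      have "(of_nat ?m :: 'f) = of_nat (k + (?p - l))"
        by (simp only: of_nat_eq_iff_cong_CHAR) simp
      also have "\<dots> = of_nat k - of_nat l" using z by (simp add: of_nat_diff)
      finally have "y - z = of_nat ?m * x + (a - b)"
        by (simp only: y(1) z(1)) (simp add: algebra_simps)
      moreover have "a - b \<in> A" using A y z by (auto simp: sub_def)
      ultimately show "y - z \<in> B"
        unfolding B_def F_def using p by (intro image_eqI[of _ _ "(?m, a - b)"]) (auto simp: prime_gt_0_nat)
    qed
    moreover have "A \<subseteq> B"
    proof
      fix a assume "a \<in> A"
      then show "a \<in> B" unfolding B_def F_def
        by (intro image_eqI[of _ _ "(0,a)"]) (use p in \<open>auto simp: prime_gt_0_nat\<close>)
    qed
    moreover have "x \<in> B" unfolding B_def F_def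
      by (rule image_eqI[of _ _ "(1,0)"]) (use A prime_gt_1_nat[OF p] in \<open>auto simp: sub_def\<close>)
    moreover have "card B = ?p * card A"
      by (simp add: B_def card_image[OF inj])
    ultimately show ?thesis using x by blast
  qed
  have "\<exists>k. CARD('f) = card A * ?p ^ k" if "sub A" for A
    using that
  proof (induction "CARD('f) - card A" arbitrary: A rule: less_induct)
    case less
    show ?case
    proof (cases "A = UNIV")
      case False
      then obtain x where "x \<notin> A" by auto
      from step[OF less.prems this] obtain B where B: "sub B" "A \<subset> B" "card B = ?p * card A"
        by (elim exE conjE)
      have "card A < card B" "card B \<le> CARD('f)"
        by (rule psubset_card_mono[OF _ B(2)], simp) (rule card_mono, simp_all)
      then have "CARD('f) - card B < CARD('f) - card A" by linarith
      from less.hyps[OF this B(1)] obtain k where "CARD('f) = card B * ?p ^ k" by blast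
      then have "CARD('f) = card A * ?p ^ Suc k" using B by simp
      then show ?thesis by blast
    qed (auto intro: exI[of _ 0])
  qed
  from this[of "{0}"] show ?thesis by (simp add: sub_def)
qed

lemma card_eq_CHAR_field_degree: "CARD('f::{finite,field}) = CHAR('f) ^ field_degree TYPE('f)"
proof -
  obtain k where k: "CARD('f) = CHAR('f) ^ k" using finite_field_card_eq_CHAR_power by blast
  have "field_degree TYPE('f) = k" unfolding field_degree_def
  proof (rule the_equality)
    show "CARD('f) = CHAR('f) ^ k" by (rule k)
  next
    fix l assume "CARD('f) = CHAR('f) ^ l"
    with k have "CHAR('f) ^ l = CHAR('f) ^ k" by simp
    then show "l = k"
      by (subst (asm) power_inject_exp) (rule prime_gt_1_nat[OF finite_field_CHAR_prime])
  qed
  with k show ?thesis by simp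
qed

lemma field_degree_pos: "field_degree TYPE('f::{finite,field}) > 0"
proof (rule ccontr)
  assume "\<not> ?thesis"
  then have "CARD('f) = 1" using card_eq_CHAR_field_degree[where ?'f = 'f] by simp
  then obtain a where "(UNIV :: 'f set) = {a}" by (auto simp: card_1_singleton_iff)
  then have "(0::'f) = 1" by (metis UNIV_I singletonD)
  then show False by simp
qed

lemma field_tr_add: "field_tr (x + y) = field_tr x + (field_tr y :: 'f::{finite,field})"
  unfolding field_tr_def
  by (simp add: freshmans_dream'[OF finite_field_CHAR_prime refl] sum.distrib)

text \<open>Because x^q = x, the Frobenius map permutes the summands cyclically, so the trace is a
  root of X^p - X. That polynomial has at most p roots, and the p multiples of 1 already supply
  them.\<close>

lemma field_tr_in_prime_field: "\<exists>k. field_tr (x :: 'f::{finite,field}) = of_nat k"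
proof -
  let ?p = "CHAR('f)" and ?d = "field_degree TYPE('f)"
  have p: "prime ?p" by (rule finite_field_CHAR_prime)
  have "field_tr x ^ ?p = (\<Sum>i<?d. (x ^ ?p ^ i) ^ ?p)"
    unfolding field_tr_def by (rule freshmans_dream_sum[OF p refl])
  also have "\<dots> = (\<Sum>i<?d. x ^ ?p ^ Suc i)"
    by (simp add: power_mult[symmetric] mult.commute)
  also have "\<dots> = (\<Sum>i\<in>{1..?d}. x ^ ?p ^ i)"
    by (rule sum.reindex_bij_witness[of _ "\<lambda>i. i - 1" Suc]) auto
  also have "\<dots> = (\<Sum>i<?d. x ^ ?p ^ i)"
  proof -
    have "{1..?d} = insert ?d {1..<?d}" "{..<?d} = insert 0 {1..<?d}" using field_degree_pos[where ?'f = 'f] by auto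
    moreover have "x ^ ?p ^ ?d = x" using finite_field_power_card[of x] card_eq_CHAR_field_degree[where ?'f = 'f] by simp
    ultimately show ?thesis by simp
  qed
  finally have tr: "field_tr x ^ ?p = field_tr x" by (simp add: field_tr_def)
  let ?P = "monom 1 ?p - monom 1 1 :: 'f poly"
  have p1: "?p > 1" using p by (rule prime_gt_1_nat)
  have cf: "coeff ?P ?p = 1" using p1 by simp
  have P0: "?P \<noteq> 0" using cf by (metis coeff_0 zero_neq_one)
  have "degree ?P \<le> ?p" using p1 by (intro degree_diff_le) (auto intro: order.trans[OF degree_monom_le])
  then have c: "card {z. poly ?P z = 0} \<le> ?p" using card_poly_roots_bound[OF P0] by linarith
  have sub: "of_nat ` {..<?p} \<subseteq> {z. poly ?P z = 0}"
  proof -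
    have "(of_nat k :: 'f) ^ ?p = of_nat k" for k
    proof (induction k)
      case (Suc k)
      then show ?case using freshmans_dream[OF p refl, of "of_nat k" "1::'f"] by (simp add: add.commute)
    qed (use p1 in auto)
    then show ?thesis by (auto simp: poly_monom)
  qed
  have inj: "inj_on (of_nat :: nat \<Rightarrow> 'f) {..<?p}"
    by (auto simp: inj_on_def of_nat_eq_iff_cong_CHAR cong_def)
  have "of_nat ` {..<?p} = {z. poly ?P z = 0}"
    using sub c by (intro card_seteq poly_roots_finite[OF P0]) (auto simp: card_image[OF inj])
  moreover have "field_tr x \<in> {z. poly ?P z = 0}" using tr by (simp add: poly_monom)
  ultimately show ?thesis by auto
qed

text \<open>The trace is a polynomial function of degree at most p^(d-1) < q with leading
  coefficient 1, hence it cannot vanish on all q elements.\<close>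

lemma field_tr_nontrivial: "\<exists>x. field_tr (x :: 'f::{finite,field}) \<noteq> 0"
proof (rule ccontr)
  assume *: "\<not> ?thesis"
  let ?p = "CHAR('f)" and ?d = "field_degree TYPE('f)"
  have p1: "?p > 1" using finite_field_CHAR_prime by (rule prime_gt_1_nat)
  define P where "P = (\<Sum>i<?d. monom (1::'f) (?p ^ i))"
  have "coeff P (?p ^ (?d - 1)) = (\<Sum>i<?d. if i = ?d - 1 then 1 else 0)"
    unfolding P_def coeff_sum using p1 by (intro sum.cong) auto
  also have "\<dots> = 1" using field_degree_pos[where ?'f = 'f] by simp
  finally have P0: "P \<noteq> 0" by auto
  have "degree P \<le> ?p ^ (?d - 1)" unfolding P_def
    by (rule degree_sum_le) (use p1 in \<open>auto intro!: order.trans[OF degree_monom_le] power_increasing\<close>)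
  moreover have "{x. poly P x = 0} = UNIV"
    using * by (auto simp: P_def poly_sum poly_monom field_tr_def)
  ultimately have "CARD('f) \<le> ?p ^ (?d - 1)" using card_poly_roots_bound[OF P0] by simp
  moreover have "?p ^ (?d - 1) < ?p ^ ?d"
    using p1 field_degree_pos[where ?'f = 'f] by (intro power_strict_increasing) auto
  ultimately show False using card_eq_CHAR_field_degree[where ?'f = 'f] by simp
qed

lemma e_QZ_cis: "e_QZ r = cis (2 * pi * of_rat r)"
proof -
  have "of_rat r = (of_real (of_rat r) :: complex)"
    by (cases r) (simp add: of_rat_rat)
  then show ?thesis by (simp add: e_QZ_def cis_conv_exp mult_ac)
qed

lemma e_QZ_add: "e_QZ (r + s) = e_QZ r * e_QZ s"
  by (simp add: e_QZ_def of_rat_add exp_add[symmetric] algebra_simps)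

lemma e_QZ_0 [simp]: "e_QZ 0 = 1"
  by (simp add: e_QZ_def)

lemma e_QZ_sum: "e_QZ (\<Sum>x\<in>A. r x) = (\<Prod>x\<in>A. e_QZ (r x))"
  by (induction A rule: infinite_finite_induct) (auto simp: e_QZ_add)

lemma e_QZ_of_nat_mult: "e_QZ (of_nat k * r) = e_QZ r ^ k"
  by (induction k) (auto simp: e_QZ_add algebra_simps)

lemma e_QZ_1 [simp]: "e_QZ 1 = 1"
  by (simp add: e_QZ_cis)

lemma e_QZ_half: "e_QZ (1/2) = -1"
  by (simp add: e_QZ_cis of_rat_divide)

lemma e_QZ_quarter: "e_QZ (1/4) = \<i>"
  by (simp add: e_QZ_cis of_rat_divide)

lemma norm_e_QZ [simp]: "norm (e_QZ r) = 1"
  by (simp add: e_QZ_cis)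

lemma prime_field_rep_of_nat: "[prime_field_rep (of_nat k :: 'f::{finite,field}) = k] (mod CHAR('f))"
proof -
  have "of_nat (prime_field_rep (of_nat k :: 'f)) = (of_nat k :: 'f)"
    unfolding prime_field_rep_def by (rule LeastI[of _ k]) simp
  then show ?thesis by (simp add: of_nat_eq_iff_cong_CHAR)
qed

text \<open>\<open>prime_field_rep\<close> respects sums only modulo p. This rule makes the choice
  of representatives irrelevant, since integral parts disappear under \<open>e_QZ\<close>.\<close>

lemma e_QZ_frac_cong:
  assumes "[k = l] (mod p)" "p > 0"
  shows "e_QZ (of_nat k / of_nat p) = e_QZ (of_nat l / of_nat p)"
proof -
  have "e_QZ (of_nat k / of_nat p) = e_QZ (of_nat (k mod p) / of_nat p)" for k
  proof -
    have "(of_nat k :: rat) = of_nat (k div p) * of_nat p + of_nat (k mod p)"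
      by (metis div_mult_mod_eq of_nat_add of_nat_mult)
    then have "of_nat k / of_nat p = (of_nat (k div p) * 1 + of_nat (k mod p) / of_nat p :: rat)"
      using assms(2) by (simp add: add_divide_distrib)
    then show ?thesis by (simp only: e_QZ_add e_QZ_of_nat_mult) simp
  qed
  then show ?thesis using assms by (metis cong_def)
qed

lemma e_QZ_frac_tr: "field_tr x = of_nat k \<Longrightarrow> e_QZ (frac_tr (x :: 'f::{finite,field})) = e_QZ (of_nat k / of_nat CHAR('f))"
  unfolding frac_tr_def
  by (rule e_QZ_frac_cong) (auto intro: prime_field_rep_of_nat simp: prime_gt_0_nat[OF finite_field_CHAR_prime])

lemma e_QZ_frac_tr_add: "e_QZ (frac_tr (x + y)) = e_QZ (frac_tr x) * e_QZ (frac_tr (y :: 'f::{finite,field}))"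
proof -
  obtain k l where kl: "field_tr x = of_nat k" "field_tr y = of_nat l" using field_tr_in_prime_field by metis
  then have "field_tr (x + y) = of_nat (k + l)" by (simp add: field_tr_add)
  from e_QZ_frac_tr[OF this] e_QZ_frac_tr[OF kl(1)] e_QZ_frac_tr[OF kl(2)]
  show ?thesis by (simp add: add_divide_distrib e_QZ_add)
qed

text \<open>The cosine equals 1 only at integral multiples of 2 pi, and k/p lies strictly between 0
  and 1.\<close>

lemma e_QZ_unit_frac_neq_1:
  assumes "0 < k" "k < p"
  shows "e_QZ (of_nat k / of_nat p) \<noteq> 1"
proof
  let ?x = "of_nat k / of_nat p :: real"
  assume "e_QZ (of_nat k / of_nat p) = 1"
  then have "cos (2 * pi * ?x) = 1"
    by (simp add: e_QZ_cis of_rat_divide complex_eq_iff)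
  then obtain n :: int where "2 * pi * ?x = of_int n * 2 * pi"
    unfolding cos_one_2pi_int by blast
  then have "(2 * pi) * ?x = (2 * pi) * of_int n" by simp
  then have "?x = of_int n" by (subst (asm) mult_left_cancel) auto
  moreover have "0 < ?x" "?x < 1" using assms by auto
  ultimately have "0 < real_of_int n" "real_of_int n < 1" by simp_all
  then show False by simp
qed

lemma e_QZ_frac_tr_nontrivial: "\<exists>x. e_QZ (frac_tr (x :: 'f::{finite,field})) \<noteq> 1"
proof -
  obtain x :: 'f where x: "field_tr x \<noteq> 0" using field_tr_nontrivial by blast
  obtain k where k: "field_tr x = of_nat k" using field_tr_in_prime_field by blast
  let ?k = "k mod CHAR('f)"
  have pos: "CHAR('f) > 0" using finite_field_CHAR_prime by (rule prime_gt_0_nat)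
  have k': "field_tr x = of_nat ?k" unfolding k by (simp only: of_nat_eq_iff_cong_CHAR) simp
  then have "?k > 0" using x by (metis gr0I of_nat_0)
  moreover have "?k < CHAR('f)" using pos by simp
  ultimately show ?thesis using e_QZ_frac_tr[OF k'] e_QZ_unit_frac_neq_1 by metis
qed

section \<open>Quadratic characters of a finite field\<close>

text \<open>The common frame for all types: \<chi> is the exponential of y = 1 inserted into the
  form beta, and the exponential of beta at (x, y) is \<chi>(x y).\<close>

locale quad_char =
  fixes \<chi> :: "'f::{finite,field} \<Rightarrow> complex" and ev :: bool and N :: nat
  assumes \<chi>_add: "\<chi> (x + y) = \<chi> x * \<chi> y"
    and \<chi>_nontrivial: "\<exists>x. \<chi> x \<noteq> 1"
    and norm_\<chi> [simp]: "norm (\<chi> x) = 1"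
    and N_pos: "N > 0"
begin

text \<open>The flag \<open>ev\<close> restricts to even functions, which distinguishes $q^E$ from $q^E_1$.\<close>

definition quad1 :: "'f \<Rightarrow> ('f \<Rightarrow> complex) \<Rightarrow> bool" where
  "quad1 a \<theta> \<longleftrightarrow> \<theta> 0 = 1 \<and> (\<forall>x y. \<theta> (x + y) = \<theta> x * \<theta> y * \<chi> (a * x * y)) \<and> (ev \<longrightarrow> (\<forall>x. \<theta> (- x) = \<theta> x))"

text \<open>The exponentials of the forms in \<open>Phi\<close>, characterised by their functional
  equation so that characteristic two and odd characteristic can be treated alike;
  \<open>Q1_eq_Phi\<close> identifies the two.\<close>

definition Q1 :: "('f \<Rightarrow> complex) set" where
  "Q1 = {\<theta>. \<exists>a. quad1 a \<theta>}"

lemma quad1I: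
  "\<theta> 0 = 1 \<Longrightarrow> (\<And>x y. \<theta> (x + y) = \<theta> x * \<theta> y * \<chi> (a * x * y)) \<Longrightarrow> (\<And>x. ev \<Longrightarrow> \<theta> (- x) = \<theta> x) \<Longrightarrow> quad1 a \<theta>"
  unfolding quad1_def by blast

lemma quad1D:
  assumes "quad1 a \<theta>"
  shows "\<theta> 0 = 1" "\<theta> (x + y) = \<theta> x * \<theta> y * \<chi> (a * x * y)" "ev \<Longrightarrow> \<theta> (- x) = \<theta> x"
  using assms unfolding quad1_def by blast+

lemma \<chi>_nonzero [simp]: "\<chi> x \<noteq> 0"
  using norm_\<chi>[of x] by (metis norm_zero zero_neq_one)

lemma \<chi>_0 [simp]: "\<chi> 0 = 1"
  using \<chi>_add[of 0 0] by simp

lemma \<chi>_cnj: "\<chi> x * cnj (\<chi> x) = 1"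
  by (simp add: complex_norm_square[symmetric])

lemma \<chi>_minus: "\<chi> (- x) = cnj (\<chi> x)"
proof -
  have "\<chi> x * \<chi> (- x) = \<chi> x * cnj (\<chi> x)" using \<chi>_add[of x "- x"] by (simp add: \<chi>_cnj)
  then show ?thesis by simp
qed

lemma \<chi>_diff: "\<chi> (x - y) = \<chi> x * cnj (\<chi> y)"
  using \<chi>_add[of x "- y"] by (simp add: \<chi>_minus)

lemma \<chi>_eq_1_imp_0:
  assumes "\<And>t. \<chi> (t * x) = 1"
  shows "x = 0"
proof (rule ccontr)
  assume x: "x \<noteq> 0"
  obtain y where "\<chi> y \<noteq> 1" using \<chi>_nontrivial by blast
  with assms[of "y / x"] x show False by simp
qed

lemma \<chi>_sum: "(\<Sum>t\<in>UNIV. \<chi> (t * x)) = (if x = 0 then of_nat CARD('f) else 0)"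
proof (cases "x = 0")
  case False
  then obtain s where s: "\<chi> (s * x) \<noteq> 1" using \<chi>_eq_1_imp_0 by blast
  have "(\<Sum>t\<in>UNIV. \<chi> (t * x)) = (\<Sum>t\<in>UNIV. \<chi> ((s + t) * x))"
    by (rule sum.reindex_bij_witness[of _ "\<lambda>t. s + t" "\<lambda>t. t - s"]) auto
  also have "\<dots> = \<chi> (s * x) * (\<Sum>t\<in>UNIV. \<chi> (t * x))"
    by (simp add: distrib_right \<chi>_add sum_distrib_left)
  finally show ?thesis using s False by (metis mult_cancel_right1 mult.commute)
qed simp

text \<open>If \<theta> differed from every \<chi>(b x), a shift by a point of difference would make
  each of its Fourier coefficients zero. Summing the coefficients over b isolates q \<theta>(0) = q,
  a contradiction.\<close>

lemma additive_char:
  assumes "\<theta> 0 = (1::complex)" "\<And>x y. \<theta> (x + y) = \<theta> x * \<theta> y"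
  shows "\<exists>b. \<forall>x. \<theta> x = \<chi> (b * x)"
proof (rule ccontr)
  assume no: "\<not> ?thesis"
  have S0: "(\<Sum>x\<in>UNIV. \<theta> x * \<chi> (- b * x)) = 0" (is "?S = 0") for b
  proof -
    obtain y where y: "\<theta> y \<noteq> \<chi> (b * y)" using no by blast
    have "?S = (\<Sum>x\<in>UNIV. \<theta> (y + x) * \<chi> (- b * (y + x)))"
      by (rule sum.reindex_bij_witness[of _ "\<lambda>t. y + t" "\<lambda>t. t - y"]) auto
    also have "\<dots> = \<theta> y * \<chi> (- b * y) * ?S"
      by (simp only: distrib_left \<chi>_add assms(2) sum_distrib_left mult_ac)
    finally have "?S = 0 \<or> \<theta> y * cnj (\<chi> (b * y)) = 1" by (simp add: \<chi>_minus)
    moreover have "\<theta> y * cnj (\<chi> (b * y)) \<noteq> 1"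
      using y \<chi>_cnj[of "b * y"] by (metis mult_right_cancel mult_zero_right zero_neq_one)
    ultimately show ?thesis by blast
  qed
  have "0 = (\<Sum>b\<in>UNIV. \<Sum>x\<in>UNIV. \<theta> x * \<chi> (- b * x))" unfolding S0 by simp
  also have "\<dots> = (\<Sum>x\<in>UNIV. \<theta> x * (\<Sum>b\<in>UNIV. \<chi> (b * (- x))))"
    by (subst sum.swap) (simp add: sum_distrib_left)
  also have "\<dots> = (\<Sum>x\<in>(UNIV::'f set). if x = 0 then of_nat CARD('f) else 0)"
    unfolding \<chi>_sum by (rule sum.cong[OF refl]) (auto simp: assms(1))
  also have "\<dots> = of_nat CARD('f)" by simp
  finally show False by simp
qed

lemma quad1_linear: "(ev \<Longrightarrow> b = 0) \<Longrightarrow> quad1 0 (\<lambda>x. \<chi> (b * x))"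
  by (rule quad1I) (simp_all add: \<chi>_add distrib_left)

text \<open>The polar form vanishes, so \<theta> is an additive character \<chi>(b x). If it is even
  as well, comparing the values at t/2 and -t/2 shows \<chi>(t b) = 1 for all t, whence b =
  0.\<close>

lemma quad1_0:
  assumes "quad1 0 \<theta>" and two: "ev \<Longrightarrow> (2::'f) \<noteq> 0"
  shows "\<exists>b. (ev \<longrightarrow> b = 0) \<and> (\<forall>x. \<theta> x = \<chi> (b * x))"
proof -
  have 1: "\<theta> 0 = 1" and 2: "\<theta> (x + y) = \<theta> x * \<theta> y * \<chi> (0 * x * y)" for x y
    using assms(1) unfolding quad1_def by blast+
  obtain b where b: "\<forall>x. \<theta> x = \<chi> (b * x)"
    using additive_char[of \<theta>] 1 2 by (metis \<chi>_0 mult_1_right mult_zero_left)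
  have "b = 0" if ev
  proof (rule \<chi>_eq_1_imp_0)
    fix t
    have e: "\<chi> (b * (t/2)) = \<chi> (- (b * (t/2)))"
      using quad1D(3)[OF assms(1) that, of "t/2"] b by (metis mult_minus_right)
    have "\<chi> (b * (t/2) + b * (t/2)) = \<chi> (- (b * (t/2)) + b * (t/2))"
      using arg_cong[OF e, of "\<lambda>z. z * \<chi> (b * (t/2))"] by (simp only: \<chi>_add[symmetric])
    moreover have "b * (t/2) + b * (t/2) = t * b"
    proof -
      have "b * (t/2) + b * (t/2) = (b * t / 2) * 2" by (simp only: mult_2_right times_divide_eq_right)
      then show ?thesis using two[OF that] by (simp add: mult.commute)
    qed
    ultimately show "\<chi> (t * b) = 1" by (simp only: add.left_inverse \<chi>_0)
  qed
  with b show ?thesis by blast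
qed

lemma quad1_mult: "quad1 a \<theta> \<Longrightarrow> quad1 b \<psi> \<Longrightarrow> quad1 (a + b) (\<lambda>x. \<theta> x * \<psi> x)"
  by (rule quad1I) (simp_all add: quad1D(1) quad1D(2)[of a \<theta>] quad1D(2)[of b \<psi>] quad1D(3) \<chi>_add distrib_right)

lemma quad1_nonzero: "quad1 a \<theta> \<Longrightarrow> \<theta> x \<noteq> 0"
  by (metis quad1D(1,2) add.right_inverse mult_zero_left zero_neq_one)

end

text \<open>The arithmetic input that depends on the type. \<open>gauss\<close> says that the
  Fourier transform of a nondegenerate quadratic character is again one, up to a factor that is a
  positive multiple of an N-th root of unity. Values of characters need to be N-th roots of unity
  only in the affine types, since for even characters the points that matter later are at 0.\<close>

locale code_char = quad_char \<chi> ev N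
  for \<chi> :: "'f::{finite,field} \<Rightarrow> complex" and ev N +
  assumes two: "ev \<Longrightarrow> (2::'f) \<noteq> 0"
    and gauss: "quad1 a \<theta> \<Longrightarrow> a \<noteq> 0 \<Longrightarrow>
      \<exists>c \<theta>'. \<theta>' \<in> Q1 \<and> c \<noteq> 0 \<and> c ^ N = of_real (norm c ^ N) \<and> (\<forall>x. (\<Sum>t\<in>UNIV. \<theta> t * \<chi> (t * x)) = c * \<theta>' x)"
    and root_of_unity: "\<not> ev \<Longrightarrow> quad1 a \<theta> \<Longrightarrow> \<theta> x ^ N = 1"

subsection \<open>Odd characteristic\<close>

context quad_char
begin

lemma quad1_square: "(ev \<Longrightarrow> b = 0) \<Longrightarrow> quad1 (2 * a) (\<lambda>x. \<chi> (a * x\<^sup>2 + b * x))"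
proof (rule quad1I)
  fix x y
  have "a * (x + y)\<^sup>2 + b * (x + y) = (a * x\<^sup>2 + b * x) + (a * y\<^sup>2 + b * y) + 2 * a * x * y"
    by (simp add: power2_eq_square algebra_simps)
  then show "\<chi> (a * (x + y)\<^sup>2 + b * (x + y)) = \<chi> (a * x\<^sup>2 + b * x) * \<chi> (a * y\<^sup>2 + b * y) * \<chi> (2 * a * x * y)"
    by (simp only: \<chi>_add)
qed simp_all

text \<open>With 2 invertible, the character \<chi>(a/2 x^2) has the same polar form as \<theta>,
  and the quotient of the two is additive.\<close>

lemma quad1_odd:
  assumes two: "(2::'f) \<noteq> 0" and q: "quad1 a \<theta>"
  shows "\<exists>b. (ev \<longrightarrow> b = 0) \<and> (\<forall>x. \<theta> x = \<chi> (a / 2 * x\<^sup>2 + b * x))"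
proof -
  have "quad1 (a + 2 * (- a / 2)) (\<lambda>x. \<theta> x * \<chi> (- a / 2 * x\<^sup>2 + 0 * x))"
    by (rule quad1_mult[OF q]) (rule quad1_square, simp)
  then have "quad1 0 (\<lambda>x. \<theta> x * \<chi> (- (a / 2 * x\<^sup>2)))" using two by simp
  from quad1_0[OF this] two obtain b where b: "ev \<longrightarrow> b = 0" "\<And>x. \<theta> x * \<chi> (- (a / 2 * x\<^sup>2)) = \<chi> (b * x)"
    by blast
  have "\<theta> x = \<chi> (a / 2 * x\<^sup>2 + b * x)" for x
  proof -
    have "\<chi> (a / 2 * x\<^sup>2 + b * x) = \<theta> x * (\<chi> (a / 2 * x\<^sup>2) * cnj (\<chi> (a / 2 * x\<^sup>2)))"
      by (simp add: \<chi>_add b(2)[symmetric] \<chi>_minus mult_ac)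
    then show ?thesis by (simp add: \<chi>_cnj)
  qed
  with b show ?thesis by blast
qed

lemma Q1_odd:
  assumes "(2::'f) \<noteq> 0"
  shows "Q1 = (\<lambda>(a, b) x. \<chi> (a * x\<^sup>2 + b * x)) ` (UNIV \<times> (if ev then {0} else UNIV))" (is "_ = ?F ` ?S")
proof (intro equalityI subsetI)
  fix \<theta> assume "\<theta> \<in> Q1"
  then obtain a where "quad1 a \<theta>" by (auto simp: Q1_def)
  from quad1_odd[OF assms this] obtain b where b: "ev \<longrightarrow> b = 0" "\<forall>x. \<theta> x = \<chi> (a / 2 * x\<^sup>2 + b * x)" by blast
  then have "\<theta> = ?F (a / 2, b)" by auto
  then show "\<theta> \<in> ?F ` ?S" by (rule image_eqI) (use b in auto)
next
  fix \<theta> assume "\<theta> \<in> ?F ` ?S"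
  then obtain a b where "\<theta> = (\<lambda>x. \<chi> (a * x\<^sup>2 + b * x))" "ev \<Longrightarrow> b = 0" by (auto split: if_splits)
  then show "\<theta> \<in> Q1" unfolding Q1_def using quad1_square by blast
qed

lemma card_Q1_odd:
  assumes two: "(2::'f) \<noteq> 0"
  shows "card Q1 = (if ev then CARD('f) else CARD('f) ^ 2)"
proof -
  have "inj (\<lambda>(a, b) x. \<chi> (a * x\<^sup>2 + b * x))"
  proof (rule injI, clarify)
    fix a b a' b'
    assume e: "(\<lambda>x. \<chi> (a * x\<^sup>2 + b * x)) = (\<lambda>x. \<chi> (a' * x\<^sup>2 + b' * x))"
    have 1: "\<chi> ((a - a') * x\<^sup>2 + (b - b') * x) = 1" for x
    proof -
      have "\<chi> ((a * x\<^sup>2 + b * x) - (a' * x\<^sup>2 + b' * x)) = 1"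
        unfolding \<chi>_diff using fun_cong[OF e, of x] by (simp add: \<chi>_cnj)
      then show ?thesis by (simp add: algebra_simps)
    qed
    have "\<chi> (t * (2 * (a - a'))) = 1" for t
    proof -
      \<comment> \<open>The second difference removes the linear terms and leaves 2 (a - a')
        t.\<close>
      have "(a - a') * (t + 1)\<^sup>2 + (b - b') * (t + 1) =
          ((a - a') * t\<^sup>2 + (b - b') * t) + ((a - a') * 1\<^sup>2 + (b - b') * 1) + t * (2 * (a - a'))"
        by (simp add: power2_eq_square algebra_simps)
      then show ?thesis using 1[of "t + 1"] 1[of t] 1[of 1] by (simp only: \<chi>_add mult_1)
    qed
    then have "2 * (a - a') = 0" by (rule \<chi>_eq_1_imp_0)
    then have a: "a = a'" using two by simp
    moreover have "b - b' = 0"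
      by (rule \<chi>_eq_1_imp_0) (use 1 a in \<open>simp add: mult.commute\<close>)
    ultimately show "a = a' \<and> b = b'" by simp
  qed
  then have "card Q1 = card (UNIV \<times> (if ev then {0} else UNIV) :: ('f \<times> 'f) set)"
    unfolding Q1_odd[OF two] by (intro card_image) (auto intro: inj_on_subset)
  then show ?thesis by (simp add: power2_eq_square)
qed

lemma gauss_sum_cnj: "cnj (\<Sum>t\<in>UNIV. \<chi> (a * t\<^sup>2)) = (\<Sum>t\<in>UNIV. \<chi> (- (a * t\<^sup>2)))"
  by (simp add: \<chi>_minus)

text \<open>Substituting i t for t changes the sign of the quadratic form, so the Gauss sum is real
  and its square is positive or zero.\<close>

lemma gauss_sum_square_minus_one:
  assumes i: "i\<^sup>2 = (-1::'f)"
  shows "cnj (\<Sum>t\<in>UNIV. \<chi> (a * t\<^sup>2)) = (\<Sum>t\<in>UNIV. \<chi> (a * t\<^sup>2))"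
  unfolding gauss_sum_cnj
proof (rule sum.reindex_bij_witness[of _ "\<lambda>t. i * t" "\<lambda>t. - i * t"])
  fix t
  have "i * (i * t) = - t" using i by (simp add: mult.assoc[symmetric] power2_eq_square)
  then show "- i * (i * t) = t" "i * (- i * t) = t" by simp_all
  show "\<chi> (a * (- i * t)\<^sup>2) = \<chi> (- (a * t\<^sup>2))" by (simp add: power_mult_distrib i)
qed auto

text \<open>Now the nonzero squares S and their negatives partition the nonzero elements. Hence the
  Gauss sum plus its conjugate is twice the full sum of a nontrivial character, which is 0, and the
  Gauss sum is purely imaginary.\<close>

lemma gauss_sum_nonsquare_minus_one:
  assumes no: "\<And>i. i\<^sup>2 \<noteq> (-1::'f)" and two: "(2::'f) \<noteq> 0" and a: "a \<noteq> 0"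
  shows "cnj (\<Sum>t\<in>UNIV. \<chi> (a * t\<^sup>2)) = - (\<Sum>t\<in>UNIV. \<chi> (a * t\<^sup>2))"
proof -
  define S where "S = (\<lambda>t::'f. t\<^sup>2) ` (UNIV - {0})"
  have fib: "card {t \<in> UNIV - {0}. t\<^sup>2 = x} = 2" if "x \<in> S" for x
  proof -
    from that obtain s where "x = s\<^sup>2" "s \<in> UNIV - {0}" unfolding S_def by (rule imageE)
    then have s: "s \<noteq> 0" "x = s\<^sup>2" by simp_all
    have "{t \<in> UNIV - {0}. t\<^sup>2 = x} = {s, - s}"
      unfolding s(2) power2_eq_iff using s(1) by auto
    moreover have "s \<noteq> - s" using s two by (metis add.right_inverse mult_2 no_zero_divisors)
    ultimately show ?thesis by simp
  qed
  have sumS: "(\<Sum>t\<in>UNIV - {0}. F (t\<^sup>2)) = (\<Sum>x\<in>S. of_nat 2 * F x)" for F :: "'f \<Rightarrow> complex"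
  proof -
    have "(\<Sum>t\<in>UNIV - {0}. F (t\<^sup>2)) = (\<Sum>x\<in>S. \<Sum>t\<in>{t \<in> UNIV - {0}. t\<^sup>2 = x}. F (t\<^sup>2))"
      unfolding S_def by (rule sum.image_gen) simp
    also have "\<dots> = (\<Sum>x\<in>S. of_nat 2 * F x)"
    proof (rule sum.cong[OF refl])
      fix x assume "x \<in> S"
      have "(\<Sum>t\<in>{t \<in> UNIV - {0}. t\<^sup>2 = x}. F (t\<^sup>2)) = (\<Sum>t\<in>{t \<in> UNIV - {0}. t\<^sup>2 = x}. F x)"
        by (rule sum.cong) auto
      then show "(\<Sum>t\<in>{t \<in> UNIV - {0}. t\<^sup>2 = x}. F (t\<^sup>2)) = of_nat 2 * F x"
        by (simp only: sum_constant fib[OF \<open>x \<in> S\<close>])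
    qed
    finally show ?thesis .
  qed
  have disj: "S \<inter> uminus ` S = {}"
  proof -
    have "s\<^sup>2 \<noteq> - (t\<^sup>2)" if "t \<noteq> 0" for s t :: 'f
    proof
      assume "s\<^sup>2 = - (t\<^sup>2)"
      then have "(s / t)\<^sup>2 = -1" using that by (simp add: power_divide)
      with no show False by blast
    qed
    then show ?thesis by (auto simp: S_def)
  qed
  have "of_nat (card (UNIV - {0::'f})) = (of_nat (2 * card S) :: complex)"
    using sumS[of "\<lambda>_. 1"] by simp
  then have cS: "card (UNIV - {0::'f}) = 2 * card S" by (simp only: of_nat_eq_iff)
  have un: "S \<union> uminus ` S = UNIV - {0}"
  proof (rule card_subset_eq)
    show "S \<union> uminus ` S \<subseteq> UNIV - {0}" by (auto simp: S_def)
    have "card (S \<union> uminus ` S) = card S + card (uminus ` S)" using disj by (intro card_Un_disjoint) auto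
    also have "card (uminus ` S) = card S" by (rule card_image) (auto simp: inj_on_def)
    finally show "card (S \<union> uminus ` S) = card (UNIV - {0::'f})" using cS by simp
  qed simp
  have r: "(\<Sum>t\<in>UNIV. F t) = F 0 + (\<Sum>t\<in>UNIV - {0}. F t)" for F :: "'f \<Rightarrow> complex"
    by (rule sum.remove) auto
  have "(\<Sum>t\<in>UNIV. \<chi> (a * t\<^sup>2)) + (\<Sum>t\<in>UNIV. \<chi> (- (a * t\<^sup>2))) =
      2 + ((\<Sum>x\<in>S. of_nat 2 * \<chi> (a * x)) + (\<Sum>x\<in>S. of_nat 2 * \<chi> (- (a * x))))"
    unfolding sumS[symmetric] by (subst (1 2) r) simp
  also have "(\<Sum>x\<in>S. of_nat 2 * \<chi> (- (a * x))) = (\<Sum>x\<in>uminus ` S. of_nat 2 * \<chi> (a * x))"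
    by (subst sum.reindex) (auto simp: inj_on_def)
  also have "(\<Sum>x\<in>S. of_nat 2 * \<chi> (a * x)) + (\<Sum>x\<in>uminus ` S. of_nat 2 * \<chi> (a * x)) =
      (\<Sum>x\<in>UNIV - {0}. of_nat 2 * \<chi> (a * x))"
    using disj un by (subst sum.union_disjoint[symmetric]) auto
  also have "2 + \<dots> = (\<Sum>x\<in>UNIV. of_nat 2 * \<chi> (a * x))"
    using r[of "\<lambda>x. of_nat 2 * \<chi> (a * x)"] by simp
  also have "\<dots> = 0" using \<chi>_sum[of a] a by (simp add: sum_distrib_left[symmetric] mult.commute)
  finally show ?thesis unfolding gauss_sum_cnj by (simp add: add_eq_0_iff)
qed

text \<open>The squared absolute value is q: after the substitution t = u + s the sum over s
  vanishes unless u = 0.\<close>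

lemma gauss_sum_nonzero:
  assumes two: "(2::'f) \<noteq> 0" and a: "a \<noteq> 0"
  shows "(\<Sum>t\<in>UNIV. \<chi> (a * t\<^sup>2)) \<noteq> 0"
proof -
  let ?G = "\<Sum>t\<in>UNIV. \<chi> (a * t\<^sup>2)"
  have "?G * cnj ?G = (\<Sum>s\<in>UNIV. \<Sum>t\<in>UNIV. \<chi> (a * t\<^sup>2 - a * s\<^sup>2))"
    by (simp add: sum_product \<chi>_diff) (rule sum.swap)
  also have "\<dots> = (\<Sum>s\<in>UNIV. \<Sum>u\<in>UNIV. \<chi> (a * u\<^sup>2) * \<chi> (s * (2 * a * u)))"
  proof (rule sum.cong[OF refl], rule sum.reindex_bij_witness[of _ "\<lambda>u. u + s" "\<lambda>t. t - s" for s])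
    fix s t
    show "\<chi> (a * (t - s)\<^sup>2) * \<chi> (s * (2 * a * (t - s))) = \<chi> (a * t\<^sup>2 - a * s\<^sup>2)"
      unfolding \<chi>_add[symmetric] by (rule arg_cong[of _ _ \<chi>]) (simp add: power2_eq_square algebra_simps)
  qed auto
  also have "\<dots> = (\<Sum>u\<in>UNIV. \<chi> (a * u\<^sup>2) * (\<Sum>s\<in>UNIV. \<chi> (s * (2 * a * u))))"
    by (subst sum.swap) (simp add: sum_distrib_left)
  also have "\<dots> = (\<Sum>u\<in>(UNIV::'f set). if u = 0 then of_nat CARD('f) else 0)"
    unfolding \<chi>_sum by (rule sum.cong[OF refl]) (use two a in auto)
  also have "\<dots> = of_nat CARD('f)" by simp
  finally show ?thesis by auto
qed

text \<open>Completing the square expresses the sum as the pure Gauss sum G times \<chi>(-(b + x)^2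
  / (4k)). G^2 is real, positive if -1 is a square and negative otherwise, so the N-th power of G is
  positive for N even or divisible by 4, respectively. The term with b^2 is killed by the N-th
  power, or absent in the even type.\<close>

lemma gauss_odd:
  assumes two: "(2::'f) \<noteq> 0"
    and N: "even N" "(\<And>i. i\<^sup>2 \<noteq> (-1::'f)) \<Longrightarrow> 4 dvd N"
    and \<chi>N: "\<not> ev \<Longrightarrow> (\<And>x. \<chi> x ^ N = 1)"
    and q: "quad1 a \<theta>" "a \<noteq> 0"
  shows "\<exists>c \<theta>'. \<theta>' \<in> Q1 \<and> c \<noteq> 0 \<and> c ^ N = of_real (norm c ^ N) \<and> (\<forall>x. (\<Sum>t\<in>UNIV. \<theta> t * \<chi> (t * x)) = c * \<theta>' x)"
proof -
  obtain b where b: "ev \<longrightarrow> b = 0" "\<And>x. \<theta> x = \<chi> (a / 2 * x\<^sup>2 + b * x)" using quad1_odd[OF two q(1)] by blast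
  define k where "k = a / 2"
  have k: "k \<noteq> 0" using q(2) two by (simp add: k_def)
  let ?G = "\<Sum>t\<in>UNIV. \<chi> (k * t\<^sup>2)"
  have G: "?G ^ N = of_real (norm ?G ^ N)"
  proof (cases "\<exists>i. i\<^sup>2 = (-1::'f)")
    case True
    then have "cnj ?G = ?G" using gauss_sum_square_minus_one by blast
    then have "?G\<^sup>2 = of_real ((norm ?G)\<^sup>2)" by (simp only: complex_norm_square power2_eq_square[of ?G])
    moreover obtain m where "N = 2 * m" using N(1) by blast
    ultimately show ?thesis by (simp only: power_mult of_real_power)
  next
    case False
    then have "cnj ?G = - ?G" using gauss_sum_nonsquare_minus_one two k by blast
    then have "?G\<^sup>2 = - of_real ((norm ?G)\<^sup>2)"
      by (simp only: complex_norm_square power2_eq_square[of ?G] mult_minus_right minus_minus)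
    then have "(?G\<^sup>2)\<^sup>2 = (of_real ((norm ?G)\<^sup>2))\<^sup>2" by simp
    moreover obtain m where "N = 2 * 2 * m" using N(2) False by auto
    ultimately show ?thesis by (simp only: power_mult of_real_power)
  qed
  \<comment> \<open>The value of the sum at x = 0, that is, the part of the completed square that
    does not depend on x.\<close>
  define c where "c = ?G * \<chi> (- (b\<^sup>2 / (4 * k)))"
  have four: "(4::'f) \<noteq> 0"
  proof -
    have "(4::'f) = 2 * 2" by simp
    then show ?thesis using two by (metis no_zero_divisors)
  qed
  have "\<chi> (- (b\<^sup>2 / (4 * k))) ^ N = 1" using b(1) \<chi>N by (cases ev) auto
  then have "c ^ N = of_real (norm c ^ N)" by (simp add: c_def power_mult_distrib G norm_mult)
  moreover have "c \<noteq> 0" using gauss_sum_nonzero[OF two k] by (simp add: c_def)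
  moreover have "(\<lambda>x. \<chi> (- (1 / (4 * k)) * x\<^sup>2 + - (b / (2 * k)) * x)) \<in> Q1"
    unfolding Q1_def using quad1_square[of "- (b / (2 * k))" "- (1 / (4 * k))"] b(1) by auto
  moreover have "(\<Sum>t\<in>UNIV. \<theta> t * \<chi> (t * x)) = c * \<chi> (- (1 / (4 * k)) * x\<^sup>2 + - (b / (2 * k)) * x)" for x
  proof -
    let ?e = "(b + x) / (2 * k)"
    have "(\<Sum>t\<in>UNIV. \<theta> t * \<chi> (t * x)) = (\<Sum>t\<in>UNIV. \<chi> (k * t\<^sup>2 + (b + x) * t))"
      by (simp add: b(2) \<chi>_add[symmetric] algebra_simps k_def)
    also have "\<dots> = (\<Sum>t\<in>UNIV. \<chi> (k * t\<^sup>2) * \<chi> (- ((b + x)\<^sup>2 / (4 * k))))"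
    proof (rule sum.reindex_bij_witness[of _ "\<lambda>t. t - ?e" "\<lambda>t. t + ?e"])
      fix t
      have 1: "k * (t + ?e)\<^sup>2 - (b + x)\<^sup>2 / (4 * k) = k * t\<^sup>2 + (b + x) * t"
      proof -
        have "k * (t + ?e)\<^sup>2 = k * t\<^sup>2 + 2 * (k * ?e) * t + (k * ?e) * ?e"
          by (simp add: power2_eq_square algebra_simps)
        moreover have "2 * (k * ?e) = b + x" using k two by (simp add: field_simps)
        moreover have "(k * ?e) * ?e = (b + x)\<^sup>2 / (4 * k)"
          using k two four by (simp add: field_simps power2_eq_square)
        ultimately show ?thesis by simp
      qed
      show "\<chi> (k * (t + ?e)\<^sup>2) * \<chi> (- ((b + x)\<^sup>2 / (4 * k))) = \<chi> (k * t\<^sup>2 + (b + x) * t)"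
        unfolding \<chi>_add[symmetric] 1[symmetric] by simp
    qed auto
    also have "\<dots> = ?G * \<chi> (- ((b + x)\<^sup>2 / (4 * k)))" by (simp add: sum_distrib_right)
    also have "- ((b + x)\<^sup>2 / (4 * k)) = - (b\<^sup>2 / (4 * k)) + (- (1 / (4 * k)) * x\<^sup>2 + - (b / (2 * k)) * x)"
    proof -
      have "b / (2 * k) = 2 * b / (2 * (2 * k))"
        using two by (rule mult_divide_mult_cancel_left[symmetric])
      then have "b / (2 * k) = 2 * b / (4 * k)" by simp
      moreover have "(b + x)\<^sup>2 / (4 * k) = b\<^sup>2 / (4 * k) + x\<^sup>2 / (4 * k) + 2 * b * x / (4 * k)"
        by (simp only: power2_sum add_divide_distrib)
      ultimately show ?thesis by (simp add: algebra_simps)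
    qed
    finally show ?thesis by (simp only: \<chi>_add c_def mult_ac)
  qed
  ultimately show ?thesis by blast
qed

end

text \<open>With q = 4m + 1, the polynomial X^(2m+1) - X has fewer than q roots. For a non-root x
  the power x^(2m) has square 1 without being 1, so it is -1, and x^m is the required root.\<close>

lemma minus_one_square:
  assumes "CARD('f::{finite,field}) mod 4 = 1"
  shows "\<exists>i::'f. i\<^sup>2 = -1"
proof -
  define m where "m = CARD('f) div 4"
  have q: "CARD('f) = 4 * m + 1" using assms by (simp add: m_def) presburger
  have m0: "m > 0"
  proof (rule ccontr)
    assume "\<not> m > 0"
    then have "CARD('f) = 1" using q by simp
    then obtain a where "(UNIV :: 'f set) = {a}" by (auto simp: card_1_singleton_iff)
    then have "(0::'f) = 1" by (metis UNIV_I singletonD)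
    then show False by simp
  qed
  let ?P = "monom 1 (2 * m + 1) - monom 1 1 :: 'f poly"
  have "coeff ?P (2 * m + 1) = 1" using m0 by simp
  then have P0: "?P \<noteq> 0" by (metis coeff_0 zero_neq_one)
  have "degree ?P \<le> 2 * m + 1" by (intro degree_diff_le) (auto intro: order.trans[OF degree_monom_le])
  then have "card {z. poly ?P z = 0} < CARD('f)" using card_poly_roots_bound[OF P0] q m0 by linarith
  then obtain x where x: "poly ?P x \<noteq> 0" by (metis (mono_tags, lifting) less_irrefl mem_Collect_eq UNIV_eq_I)
  then have x0: "x \<noteq> 0" "x ^ (2 * m) \<noteq> 1" by (auto simp: poly_monom)
  have "x * x ^ (4 * m) = x" using finite_field_power_card[of x] q by simp
  then have "x ^ (4 * m) = 1" using x0 by simp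
  then have "(x ^ (2 * m))\<^sup>2 = 1" by (simp add: power_mult[symmetric] mult.commute)
  then have "x ^ (2 * m) = -1" using x0 by (simp add: power2_eq_1_iff)
  then have "(x ^ m)\<^sup>2 = -1" by (simp add: power_mult[symmetric] mult.commute)
  then show ?thesis by blast
qed

section \<open>The three code types\<close>

definition code_chi :: "code_type \<Rightarrow> 'f::{finite,field} \<Rightarrow> complex" where
  "code_chi T x = e_QZ (beta T x 1)"

lemma e_QZ_beta: "e_QZ (beta T x y) = code_chi T (x * y)"
  by (simp add: code_chi_def beta_def split: code_type.split)

lemma two_element_field:
  assumes "CARD('f::{finite,field}) = 2"
  shows "(UNIV :: 'f set) = {0, 1}" "(1::'f) + 1 = 0" "prime_field_rep (0::'f) = 0" "prime_field_rep (1::'f) = 1"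
proof -
  show U: "(UNIV :: 'f set) = {0, 1}"
    by (rule card_subset_eq[symmetric]) (use assms in auto)
  have "(1::'f) + 1 \<in> {0, 1}" unfolding U[symmetric] by simp
  moreover have "(1::'f) + 1 \<noteq> 1" by (metis add_cancel_right_right zero_neq_one)
  ultimately show "(1::'f) + 1 = 0" by (simp del: one_add_one)
  show "prime_field_rep (0::'f) = 0" unfolding prime_field_rep_def by (rule Least_equality) auto
  show "prime_field_rep (1::'f) = 1" unfolding prime_field_rep_def
    by (rule Least_equality) (auto simp: Suc_le_eq intro: gr0I)
qed

lemma code_chi_2II:
  assumes "CARD('f::{finite,field}) = 2"
  shows "code_chi Type_2II (x :: 'f) = (if x = 0 then 1 else -1)"
proof -
  have "x = 0 \<or> x = 1" using two_element_field(1)[OF assms] by auto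
  then show ?thesis using two_element_field(3,4)[OF assms] by (auto simp: code_chi_def beta_def e_QZ_half)
qed

lemma odd_field_two:
  assumes "odd CARD('f::{finite,field})"
  shows "(2::'f) \<noteq> 0"
proof
  assume "(2::'f) = 0"
  then have "CHAR('f) dvd 2" using of_nat_eq_0_iff_char_dvd[of 2, where ?'a = 'f] by simp
  moreover have "CHAR('f) dvd CARD('f)"
    using card_eq_CHAR_field_degree[where ?'f = 'f] field_degree_pos[where ?'f = 'f] by (simp add: dvd_power)
  ultimately have "CHAR('f) dvd 1" using assms
    by (metis One_nat_def coprime_common_divisor coprime_right_2_iff_odd nat_dvd_1_iff_1 prime_nat_iff two_is_prime_nat)
  then show False using finite_field_CHAR_prime[where ?'f = 'f] by simp
qed

lemma quad_char_code_chi: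
  assumes "admissible_field T TYPE('f::{finite,field})" "N > 0"
  shows "quad_char (code_chi T :: 'f \<Rightarrow> complex) N"
proof (cases "T = Type_2II")
  case True
  then have q: "CARD('f) = 2" using assms by (simp add: admissible_field_def)
  have cases: "x = 0 \<or> x = 1" for x :: 'f using two_element_field(1)[OF q] by auto
  show ?thesis
  proof
    fix x y :: 'f
    show "code_chi T (x + y) = code_chi T x * code_chi T y"
      using cases[of x] cases[of y] two_element_field(2)[OF q] by (auto simp: True code_chi_2II[OF q])
    show "\<exists>x::'f. code_chi T x \<noteq> 1" by (rule exI[of _ 1]) (simp add: True code_chi_2II[OF q])
  qed (use assms in \<open>auto simp: code_chi_def\<close>)
next
  case False
  then have c: "code_chi T x = e_QZ (frac_tr x)" for x :: 'f by (cases T) (auto simp: code_chi_def beta_def)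
  show ?thesis
    by standard (use assms in \<open>auto simp: c e_QZ_frac_tr_add e_QZ_frac_tr_nontrivial\<close>)
qed

lemma order_integer_mod_group: "n > 0 \<Longrightarrow> Coset.order (integer_mod_group n) = n"
  by (simp add: Coset.order_def integer_mod_group_def)

lemma (in quad_char) \<chi>_power: "\<chi> x ^ k = \<chi> (of_nat k * x)"
  by (induction k) (simp_all add: \<chi>_add distrib_right)

lemma (in quad_char) \<chi>_power_CHAR: "CHAR('f) dvd N \<Longrightarrow> \<chi> x ^ N = 1"
  using of_nat_eq_0_iff_char_dvd[of N, where ?'a = 'f] by (simp add: \<chi>_power)

text \<open>For odd q, \<open>gcd (q + 1) 4\<close> is even, and it is 4 unless q = 1 mod 4, in
  which case -1 is a square. The factor F_p of Z yields divisibility by p.\<close>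

lemma order_Z_odd_imp:
  assumes odd: "odd CARD('f::{finite,field})" and T: "T = Type_qE \<or> T = Type_qE1"
    and N: "order_Z T TYPE('f) dvd N"
  shows "even N" "(\<And>i. i\<^sup>2 \<noteq> (-1::'f)) \<Longrightarrow> 4 dvd N" "T = Type_qE1 \<Longrightarrow> CHAR('f) dvd N"
proof -
  have g: "gcd (CARD('f) + 1) 4 dvd N" and p: "T = Type_qE1 \<Longrightarrow> CHAR('f) dvd N"
    using T N finite_field_CHAR_prime[where ?'f = 'f]
    by (auto simp: order_Z_def order_integer_mod_group prime_gt_0_nat Coset.order_def DirProd_def
        card_cartesian_product order_integer_mod_group[unfolded Coset.order_def] elim: dvd_mult_left dvd_mult_right)
  show "T = Type_qE1 \<Longrightarrow> CHAR('f) dvd N" by (rule p)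
  have "2 dvd gcd (CARD('f) + 1) 4" using odd by simp
  then show "even N" using g by (rule dvd_trans)
  assume "\<And>i. i\<^sup>2 \<noteq> (-1::'f)"
  then have "CARD('f) mod 4 \<noteq> 1" using minus_one_square by blast
  then have "4 dvd CARD('f) + 1" using odd by presburger
  then have "gcd (CARD('f) + 1) 4 = 4" by (simp add: gcd.commute gcd_proj1_iff)
  then show "4 dvd N" using g by simp
qed

text \<open>Over the field with two elements the functional equation at x = y = 1 is the only
  condition besides \<theta>(0) = 1, because 1 + 1 = 0.\<close>

lemma quad1_2II:
  assumes q: "CARD('f::{finite,field}) = 2" and N: "(N::nat) > 0"
    and "quad_char.quad1 (code_chi Type_2II :: 'f \<Rightarrow> complex) False a \<theta>"
  shows "\<theta> 0 = 1" "\<theta> 1 * \<theta> 1 * (if a = 0 then 1 else -1) = 1"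
proof -
  interpret quad_char "code_chi Type_2II :: 'f \<Rightarrow> complex" False N
    by (rule quad_char_code_chi) (simp_all add: admissible_field_def q N)
  show "\<theta> 0 = 1" using assms quad1D by blast
  then show "\<theta> 1 * \<theta> 1 * (if a = 0 then 1 else -1) = 1"
    using quad1D(2)[OF assms(3), of 1 1] two_element_field(2)[OF q] by (simp add: code_chi_2II[OF q] split: if_splits)
qed

lemma quad1I_2II:
  assumes q: "CARD('f::{finite,field}) = 2" and N: "(N::nat) > 0"
    and "\<theta> 0 = 1" "\<theta> 1 * \<theta> 1 * (if a = 0 then 1 else -1) = 1"
  shows "quad_char.quad1 (code_chi Type_2II :: 'f \<Rightarrow> complex) False a \<theta>"
proof -
  interpret quad_char "code_chi Type_2II :: 'f \<Rightarrow> complex" False N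
    by (rule quad_char_code_chi) (simp_all add: admissible_field_def q N)
  have cases: "x = 0 \<or> x = 1" for x :: 'f using two_element_field(1)[OF q] by auto
  show ?thesis
  proof (rule quad1I)
    fix x y :: 'f
    show "\<theta> (x + y) = \<theta> x * \<theta> y * code_chi Type_2II (a * x * y)"
      using cases[of x] cases[of y] assms(3,4) two_element_field(2)[OF q]
      by (elim disjE) (simp_all add: code_chi_2II[OF q])
  qed (use assms in auto)
qed

text \<open>In odd characteristic everything reduces to the Gauss sums above. For two elements the
  sums are evaluated by hand; they are sqrt 2 times primitive eighth roots of unity, which is the
  reason for the divisor 8.\<close>

lemma code_char_code_chi:
  assumes adm: "admissible_field T TYPE('f::{finite,field})" and N: "N > 0" "order_Z T TYPE('f) dvd N"
  shows "code_char (code_chi T :: 'f \<Rightarrow> complex) (T = Type_qE) N"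
proof (cases "T = Type_2II")
  case True
  then have q: "CARD('f) = 2" using adm by (simp add: admissible_field_def)
  have 8: "8 dvd N" using N True by (simp add: order_Z_def order_integer_mod_group)
  then obtain m where m: "N = 8 * m" by blast
  have cases: "x = 0 \<or> x = 1" for x :: 'f using two_element_field(1)[OF q] by auto
  interpret quad_char "code_chi T :: 'f \<Rightarrow> complex" False N
    using adm N by (rule_tac quad_char_code_chi)
  have sq: "\<theta> 1 = 1 \<or> \<theta> 1 = -1 \<or> \<theta> 1 = \<i> \<or> \<theta> 1 = -\<i>" if "quad1 a \<theta>" for a \<theta>
  proof -
    have "(\<theta> 1)\<^sup>2 = 1 \<or> (\<theta> 1)\<^sup>2 = \<i>\<^sup>2"
      using quad1_2II(2)[OF q N(1) that[unfolded True]] by (auto simp: power2_eq_square minus_equation_iff split: if_splits)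
    then show ?thesis by (metis power2_eq_1_iff power2_eq_iff)
  qed
  show ?thesis unfolding True[symmetric]
  proof (unfold True, simp, unfold True[symmetric], standard)
    fix a and \<theta> :: "'f \<Rightarrow> complex" assume qd: "quad1 a \<theta>"
    then have q2: "\<theta> 0 = 1" "\<theta> 1 * \<theta> 1 * (if a = 0 then 1 else -1) = 1" using quad1_2II[OF q N(1)] True by auto
    show "\<theta> x ^ N = 1" for x using sq[OF qd] q2 cases[of x] by (auto simp: m power_mult)
    assume a: "a \<noteq> 0"
    let ?z = "\<theta> 1"
    have "- (?z * ?z) = 1" using q2 a by simp
    then have z2: "?z * ?z = -1" by (metis minus_minus)
    have z: "?z = \<i> \<or> ?z = -\<i>" using sq[OF qd] z2 by auto
    \<comment> \<open>This is 1 + i or 1 - i, with square 2 z and eighth power 16.\<close>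
    define c where "c = 1 + ?z"
    \<comment> \<open>At x = 1 the sum is 1 - z, which equals (1 + z)(-z) because z^2 = -1.\<close>
    define \<theta>' :: "'f \<Rightarrow> complex" where "\<theta>' x = (if x = 0 then 1 else - ?z)" for x
    have "quad1 1 \<theta>'" unfolding True
      by (rule quad1I_2II[OF q N(1)]) (use z2 in \<open>auto simp: \<theta>'_def\<close>)
    then have "\<theta>' \<in> Q1" by (auto simp: Q1_def)
    moreover have c0: "c \<noteq> 0" using z by (auto simp: c_def complex_eq_iff)
    moreover have "c ^ N = of_real (norm c ^ N)"
    proof -
      have "c\<^sup>2 = 2 * ?z" using z2 by (simp add: c_def power2_eq_square algebra_simps)
      then have "(c\<^sup>2)\<^sup>2 = -4" using z2 by (simp add: power2_eq_square)
      moreover have "c ^ 8 = ((c\<^sup>2)\<^sup>2)\<^sup>2" by (simp flip: power_mult)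
      ultimately have c8: "c ^ 8 = 16" by simp
      have n2: "(norm c)\<^sup>2 = 2" using z by (auto simp: c_def cmod_power2)
      have "norm c ^ 8 = ((norm c)\<^sup>2) ^ 4" by (simp add: power_mult[symmetric])
      then have "norm c ^ 8 = 16" by (simp add: n2)
      then show ?thesis by (simp only: m power_mult c8) simp
    qed
    moreover have "(\<Sum>t\<in>UNIV. \<theta> t * code_chi T (t * x)) = c * \<theta>' x" for x
      using cases[of x] q2(1) z2 unfolding two_element_field(1)[OF q]
      by (elim disjE) (simp_all add: True code_chi_2II[OF q] c_def \<theta>'_def algebra_simps)
    ultimately show "\<exists>c \<theta>'. \<theta>' \<in> Q1 \<and> c \<noteq> 0 \<and> c ^ N = of_real (norm c ^ N) \<and>
        (\<forall>x. (\<Sum>t\<in>UNIV. \<theta> t * code_chi T (t * x)) = c * \<theta>' x)" by blast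
  qed simp
next
  case False
  then have odd: "odd CARD('f)" using adm by (cases T) (auto simp: admissible_field_def)
  have T: "T = Type_qE \<or> T = Type_qE1" using False by (cases T) auto
  note two = odd_field_two[OF odd] and oz = order_Z_odd_imp[OF odd T N(2)]
  interpret quad_char "code_chi T :: 'f \<Rightarrow> complex" "T = Type_qE" N
    using adm N by (rule_tac quad_char_code_chi)
  have \<chi>N: "code_chi T (x::'f) ^ N = 1" if "\<not> T = Type_qE" for x
    using that T oz(3) by (intro \<chi>_power_CHAR) auto
  show ?thesis
  proof
    fix a and \<theta> :: "'f \<Rightarrow> complex" assume qd: "quad1 a \<theta>"
    show "\<theta> x ^ N = 1" if "\<not> T = Type_qE" for x
      using quad1_odd[OF two qd] \<chi>N[OF that] by auto
    show "a \<noteq> 0 \<Longrightarrow> \<exists>c \<theta>'. \<theta>' \<in> Q1 \<and> c \<noteq> 0 \<and> c ^ N = of_real (norm c ^ N) \<and>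
        (\<forall>x. (\<Sum>t\<in>UNIV. \<theta> t * code_chi T (t * x)) = c * \<theta>' x)"
      by (rule gauss_odd[OF two oz(1,2) \<chi>N qd])
  qed (rule two)
qed

text \<open>For two elements a quadratic character is determined by its value at 1, which ranges
  over the fourth roots of unity; these are the powers of the exponential i of
  \<open>quarter_square 1\<close>. For odd q it is the explicit form of \<open>Q1\<close>.\<close>

lemma Q1_eq_Phi:
  assumes adm: "admissible_field T TYPE('f::{finite,field})"
  shows "quad_char.Q1 (code_chi T :: 'f \<Rightarrow> complex) (T = Type_qE) = (\<lambda>\<phi> x. e_QZ (\<phi> x)) ` Phi T"
proof (cases "T = Type_2II")
  case True
  then have q: "CARD('f) = 2" using adm by (simp add: admissible_field_def)
  interpret quad_char "code_chi Type_2II :: 'f \<Rightarrow> complex" False 1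
    by (rule quad_char_code_chi) (simp_all add: admissible_field_def q)
  have cases: "x = 0 \<or> x = 1" for x :: 'f using two_element_field(1)[OF q] by auto
  have ext: "\<theta> = \<theta>'" if "\<theta> 0 = \<theta>' 0" "\<theta> 1 = \<theta>' 1" for \<theta> \<theta>' :: "'f \<Rightarrow> complex"
    using that cases by (intro ext) metis
  have e: "e_QZ (quarter_square (0::'f)) = 1" "e_QZ (quarter_square (1::'f)) = \<i>"
    using two_element_field(3,4)[OF q] by (simp_all add: quarter_square_def e_QZ_quarter)
  have e2: "e_QZ (2 * r) = e_QZ r ^ 2" "e_QZ (3 * r) = e_QZ r ^ 3" for r
    using e_QZ_of_nat_mult[of 2 r] e_QZ_of_nat_mult[of 3 r] by simp_all
  have i3: "\<i> ^ 3 = - \<i>" by (simp add: power3_eq_cube)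
  show ?thesis unfolding True
  proof (simp, intro equalityI subsetI)
    fix \<theta> :: "'f \<Rightarrow> complex" assume "\<theta> \<in> Q1"
    then obtain a where "quad1 a \<theta>" by (auto simp: Q1_def)
    from quad1_2II[OF q _ this, of 1] have t: "\<theta> 0 = 1" "\<theta> 1 * \<theta> 1 * (if a = 0 then 1 else -1) = 1" by auto
    have "(\<theta> 1)\<^sup>2 = 1 \<or> (\<theta> 1)\<^sup>2 = \<i>\<^sup>2"
      using t by (auto simp: power2_eq_square minus_equation_iff split: if_splits)
    then have "\<theta> 1 = 1 \<or> \<theta> 1 = -1 \<or> \<theta> 1 = \<i> \<or> \<theta> 1 = -\<i>" by (metis power2_eq_1_iff power2_eq_iff)
    then have "\<theta> = (\<lambda>x. e_QZ 0) \<or> \<theta> = (\<lambda>x. e_QZ (2 * quarter_square x)) \<or>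
        \<theta> = (\<lambda>x. e_QZ (quarter_square x)) \<or> \<theta> = (\<lambda>x. e_QZ (3 * quarter_square x))"
      by (elim disjE) (auto intro!: ext simp: t e e2 i3)
    then show "\<theta> \<in> (\<lambda>\<phi> x. e_QZ (\<phi> x)) ` Phi Type_2II" by (auto simp: Phi_def)
  next
    fix \<theta> :: "'f \<Rightarrow> complex" assume "\<theta> \<in> (\<lambda>\<phi> x. e_QZ (\<phi> x)) ` Phi Type_2II"
    then have "\<theta> 0 = 1 \<and> (\<theta> 1 = 1 \<or> \<theta> 1 = -1 \<or> \<theta> 1 = \<i> \<or> \<theta> 1 = -\<i>)"
      by (auto simp: Phi_def e e2 i3)
    then show "\<theta> \<in> Q1" unfolding Q1_def
      using quad1I_2II[OF q, of 1 \<theta> 0] quad1I_2II[OF q, of 1 \<theta> 1] by auto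
  qed
next
  case False
  then have odd: "odd CARD('f)" using adm by (cases T) (auto simp: admissible_field_def)
  interpret quad_char "code_chi T :: 'f \<Rightarrow> complex" "T = Type_qE" 1
    using adm by (rule_tac quad_char_code_chi) auto
  have c: "code_chi T x = e_QZ (frac_tr x)" for x :: 'f using False by (cases T) (auto simp: code_chi_def beta_def)
  have "Phi T = (\<lambda>(a, b) x. frac_tr (a * x\<^sup>2 + b * x :: 'f)) ` (UNIV \<times> (if T = Type_qE then {0} else UNIV))"
    using False by (cases T) (auto simp: Phi_def image_iff)
  then show ?thesis unfolding Q1_odd[OF odd_field_two[OF odd]] c
    by (simp add: image_image case_prod_unfold)
qed

text \<open>The four characters over the field with two elements fit the formula q^2 of the odd
  affine type, so that later counts need to distinguish only linear and affine types.\<close>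

lemma card_Q1:
  assumes adm: "admissible_field T TYPE('f::{finite,field})"
  shows "card (quad_char.Q1 (code_chi T :: 'f \<Rightarrow> complex) (T = Type_qE)) =
    (if T = Type_qE then CARD('f) else CARD('f) ^ 2)"
proof (cases "T = Type_2II")
  case True
  then have q: "CARD('f) = 2" using adm by (simp add: admissible_field_def)
  interpret quad_char "code_chi Type_2II :: 'f \<Rightarrow> complex" False 1
    by (rule quad_char_code_chi) (simp_all add: admissible_field_def q)
  have cases: "x = 0 \<or> x = 1" for x :: 'f using two_element_field(1)[OF q] by auto
  let ?F = "\<lambda>z (x::'f). if x = 0 then 1 else z :: complex"
  have "Q1 = ?F ` {1, -1, \<i>, -\<i>}"
  proof (intro equalityI subsetI)
    fix \<theta> assume "\<theta> \<in> Q1"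
    then obtain a where "quad1 a \<theta>" by (auto simp: Q1_def)
    from quad1_2II[OF q _ this, of 1] have t: "\<theta> 0 = 1" "\<theta> 1 * \<theta> 1 * (if a = 0 then 1 else -1) = 1" by auto
    have "(\<theta> 1)\<^sup>2 = 1 \<or> (\<theta> 1)\<^sup>2 = \<i>\<^sup>2"
      using t by (auto simp: power2_eq_square minus_equation_iff split: if_splits)
    then have "\<theta> 1 \<in> {1, -1, \<i>, -\<i>}" by (metis insertCI power2_eq_1_iff power2_eq_iff)
    moreover have "\<theta> = ?F (\<theta> 1)" using t(1) cases by (intro ext) metis
    ultimately show "\<theta> \<in> ?F ` {1, -1, \<i>, -\<i>}" by blast
  next
    fix \<theta> assume "\<theta> \<in> ?F ` {1, -1, \<i>, -\<i>}"
    then show "\<theta> \<in> Q1" unfolding Q1_def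
      using quad1I_2II[OF q, of 1 \<theta> 0] quad1I_2II[OF q, of 1 \<theta> 1] by auto
  qed
  moreover have "inj_on ?F {1, -1, \<i>, -\<i>}" by (rule inj_onI) (metis zero_neq_one)
  ultimately have "card Q1 = card {1, -1, \<i>, -\<i>}" by (simp only: card_image)
  also have "\<dots> = 4" by (simp add: complex_eq_iff)
  finally show ?thesis by (simp add: True q)
next
  case False
  then have odd: "odd CARD('f)" using adm by (cases T) (auto simp: admissible_field_def)
  interpret quad_char "code_chi T :: 'f \<Rightarrow> complex" "T = Type_qE" 1
    using adm by (rule_tac quad_char_code_chi) auto
  show ?thesis using card_Q1_odd[OF odd_field_two[OF odd]] by simp
qed

section \<open>Quadratic states\<close>

text \<open>Vectors are functions on the naturals: the first coordinates are acted upon, all further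
  coordinates are spectators, so that tensor products with an identity need no extra notation.\<close>

definition sc :: "'f::field \<Rightarrow> (nat \<Rightarrow> 'f) \<Rightarrow> nat \<Rightarrow> 'f" where
  "sc c x = (\<lambda>i. c * x i)"

lemma sc_apply [simp]: "sc c x i = c * x i"
  by (simp add: sc_def)

interpretation fvec: vector_space "sc :: 'f::field \<Rightarrow> (nat \<Rightarrow> 'f) \<Rightarrow> _"
  by standard (auto simp: fun_eq_iff algebra_simps)

lemma vector_space_times: "vector_space ((*) :: 'f::field \<Rightarrow> 'f \<Rightarrow> 'f)"
  by standard (auto simp: algebra_simps)

definition lin :: "((nat \<Rightarrow> 'f::field) \<Rightarrow> nat \<Rightarrow> 'f) \<Rightarrow> bool" where
  "lin L \<longleftrightarrow> (\<forall>x y. L (x + y) = L x + L y) \<and> (\<forall>c x. L (sc c x) = sc c (L x))"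

definition linf :: "((nat \<Rightarrow> 'f::field) \<Rightarrow> 'f) \<Rightarrow> bool" where
  "linf l \<longleftrightarrow> (\<forall>x y. l (x + y) = l x + l y) \<and> (\<forall>c x. l (sc c x) = c * l x)"

definition bilin :: "((nat \<Rightarrow> 'f::field) \<Rightarrow> (nat \<Rightarrow> 'f) \<Rightarrow> 'f) \<Rightarrow> bool" where
  "bilin b \<longleftrightarrow> (\<forall>y. linf (\<lambda>x. b x y)) \<and> (\<forall>x. linf (b x))"

lemma linD: "lin L \<Longrightarrow> L (x + y) = L x + L y" "lin L \<Longrightarrow> L (sc c x) = sc c (L x)"
  by (auto simp: lin_def)

lemma linfD: "linf l \<Longrightarrow> l (x + y) = l x + l y" "linf l \<Longrightarrow> l (sc c x) = c * l x"
  by (auto simp: linf_def)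

lemma lin_0: "lin L \<Longrightarrow> L 0 = 0" using linD(2)[of L 0 0] by (simp add: sc_def zero_fun_def)

lemma linf_0: "linf l \<Longrightarrow> l 0 = 0" using linfD(2)[of l 0 0] by (simp add: sc_def zero_fun_def)

lemma sc_minus_one: "sc (-1) x = - x" by (auto simp: fun_eq_iff)

lemma lin_uminus: "lin L \<Longrightarrow> L (- x) = - L x" using linD(2)[of L "-1" x] by (simp add: sc_minus_one)

lemma linf_uminus: "linf l \<Longrightarrow> l (- x) = - l x" using linfD(2)[of l "-1" x] by (simp add: sc_minus_one)

lemma lin_diff: "lin L \<Longrightarrow> L (x - y) = L x - L y"
  by (simp only: diff_conv_add_uminus linD(1) lin_uminus)

lemma linf_diff: "linf l \<Longrightarrow> l (x - y) = l x - l y"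
  using linfD(1)[of l x "- y"] by (simp add: linf_uminus)

lemma bilinD:
  assumes "bilin b"
  shows "b (x + x') y = b x y + b x' y" "b (sc c x) y = c * b x y"
    "b x (y + y') = b x y + b x y'" "b x (sc c y) = c * b x y"
    "b 0 y = 0" "b x 0 = 0" "b (- x) y = - b x y" "b x (- y) = - b x y"
proof -
  have 1: "linf (\<lambda>x. b x y)" for y using assms by (simp add: bilin_def)
  have 2: "linf (b x)" for x using assms by (simp add: bilin_def)
  show "b (x + x') y = b x y + b x' y" by (rule linfD(1)[OF 1])
  show "b (sc c x) y = c * b x y" by (rule linfD(2)[OF 1])
  show "b x (y + y') = b x y + b x y'" by (rule linfD(1)[OF 2])
  show "b x (sc c y) = c * b x y" by (rule linfD(2)[OF 2])
  show "b 0 y = 0" by (rule linf_0[OF 1])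
  show "b x 0 = 0" by (rule linf_0[OF 2])
  show "b (- x) y = - b x y" by (rule linf_uminus[OF 1])
  show "b x (- y) = - b x y" by (rule linf_uminus[OF 2])
qed

text \<open>A basis of D stays independent after adding e, and a functional may be prescribed freely
  on an independent set.\<close>

lemma separating_functional:
  fixes e :: "nat \<Rightarrow> 'f::field"
  assumes D: "fvec.subspace D" and e: "e \<notin> D"
  shows "\<exists>l. linf l \<and> l e = 1 \<and> (\<forall>d\<in>D. l d = 0)"
proof -
  interpret vp: vector_space_pair "sc :: 'f \<Rightarrow> _" "(*) :: 'f \<Rightarrow> 'f \<Rightarrow> 'f"
    using fvec.vector_space_axioms vector_space_times by (rule vector_space_pair.intro)
  obtain B where B: "B \<subseteq> D" "fvec.independent B" "D \<subseteq> fvec.span B"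
    using fvec.maximal_independent_subset by blast
  have sB: "fvec.span B = D" using B D by (metis fvec.span_minimal subset_antisym)
  then have "fvec.independent (insert e B)" using B e by (simp add: fvec.independent_insert)
  from vp.linear_independent_extend[OF this, of "\<lambda>x. if x = e then 1 else 0"]
  obtain g where g: "Vector_Spaces.linear sc (*) g" "\<forall>x\<in>insert e B. g x = (if x = e then 1 else 0)" by blast
  have "linf g" using g(1) by (simp add: linf_def Vector_Spaces.linear.axioms vp.linear_add vp.linear_scale)
  moreover have "g d = 0" if "d \<in> D" for d
    by (rule vp.linear_eq_0_on_span[OF g(1), of B]) (use g(2) B e that sB in auto)
  ultimately show ?thesis using g(2) by auto
qed

context quad_char
begin

text \<open>The form of \<open>quad1\<close> in arbitrarily many variables. On the first n
  coordinates these are exactly the exponentials of the elements of \<open>Phi_n\<close>, see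
  \<open>Phi_n_quad\<close> and \<open>quad_Phi_n\<close>.\<close>

definition quad :: "((nat \<Rightarrow> 'f) \<Rightarrow> complex) \<Rightarrow> bool" where
  "quad \<psi> \<longleftrightarrow> \<psi> 0 = 1 \<and> (\<exists>b. bilin b \<and> (\<forall>x y. b x y = b y x) \<and> (\<forall>x y. \<psi> (x + y) = \<psi> x * \<psi> y * \<chi> (b x y))) \<and>
     (ev \<longrightarrow> (\<forall>x. \<psi> (- x) = \<psi> x))"

lemma quadI:
  assumes "\<psi> 0 = 1" "bilin b" "\<And>x y. b x y = b y x" "\<And>x y. \<psi> (x + y) = \<psi> x * \<psi> y * \<chi> (b x y)"
    "\<And>x. ev \<Longrightarrow> \<psi> (- x) = \<psi> x"
  shows "quad \<psi>"
  using assms unfolding quad_def by blast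

lemma quadE:
  assumes "quad \<psi>"
  obtains b where "\<psi> 0 = 1" "bilin b" "\<And>x y. b x y = b y x" "\<And>x y. \<psi> (x + y) = \<psi> x * \<psi> y * \<chi> (b x y)"
    "\<And>x. ev \<Longrightarrow> \<psi> (- x) = \<psi> x"
  using assms unfolding quad_def by blast

lemma quad_0: "quad \<psi> \<Longrightarrow> \<psi> 0 = 1"
  by (simp add: quad_def)

lemma quad_one: "quad (\<lambda>x. 1)"
  by (rule quadI[of _ "\<lambda>x y. 0"]) (auto simp: bilin_def linf_def)

lemma quad_comp_lin:
  assumes "quad \<psi>" "lin L"
  shows "quad (\<lambda>x. \<psi> (L x))"
proof (rule quadE[OF assms(1)])
  fix b assume b: "\<psi> 0 = 1" "bilin b" "\<And>x y. b x y = b y x" "\<And>x y. \<psi> (x + y) = \<psi> x * \<psi> y * \<chi> (b x y)"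
    "\<And>x. ev \<Longrightarrow> \<psi> (- x) = \<psi> x"
  have "bilin (\<lambda>x y. b (L x) (L y))"
    by (simp add: bilin_def linf_def linD[OF assms(2)] bilinD[OF b(2)])
  then show ?thesis
    by (rule quadI[rotated]) (simp_all add: b lin_0[OF assms(2)] linD[OF assms(2)] lin_uminus[OF assms(2)])
qed

lemma quad_mult:
  assumes "quad \<psi>" "quad \<phi>"
  shows "quad (\<lambda>x. \<psi> x * \<phi> x)"
proof (rule quadE[OF assms(1)], rule quadE[OF assms(2)])
  fix b b'
  assume b: "\<psi> 0 = 1" "bilin b" "\<And>x y. b x y = b y x" "\<And>x y. \<psi> (x + y) = \<psi> x * \<psi> y * \<chi> (b x y)"
    "\<And>x. ev \<Longrightarrow> \<psi> (- x) = \<psi> x"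
  assume b': "\<phi> 0 = 1" "bilin b'" "\<And>x y. b' x y = b' y x" "\<And>x y. \<phi> (x + y) = \<phi> x * \<phi> y * \<chi> (b' x y)"
    "\<And>x. ev \<Longrightarrow> \<phi> (- x) = \<phi> x"
  have "bilin (\<lambda>x y. b x y + b' x y)"
    by (simp add: bilin_def linf_def bilinD[OF b(2)] bilinD[OF b'(2)] algebra_simps)
  then show ?thesis
    by (rule quadI[rotated]) (simp_all add: b(1,4,5) b'(1,4,5) \<chi>_add, metis b(3) b'(3))
qed

lemma quad_cnj:
  assumes "quad \<psi>"
  shows "quad (\<lambda>x. cnj (\<psi> x))"
proof (rule quadE[OF assms(1)])
  fix b
  assume b: "\<psi> 0 = 1" "bilin b" "\<And>x y. b x y = b y x" "\<And>x y. \<psi> (x + y) = \<psi> x * \<psi> y * \<chi> (b x y)"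
    "\<And>x. ev \<Longrightarrow> \<psi> (- x) = \<psi> x"
  have "bilin (\<lambda>x y. - b x y)"
    by (simp add: bilin_def linf_def bilinD[OF b(2)])
  then show ?thesis
    by (rule quadI[rotated]) (simp_all add: b(1,4,5) \<chi>_minus, metis b(3))
qed

lemma quad_comp1:
  assumes "\<theta> \<in> Q1" "linf l"
  shows "quad (\<lambda>x. \<theta> (l x))"
proof -
  obtain a where a: "quad1 a \<theta>" using assms by (auto simp: Q1_def)
  have "bilin (\<lambda>x y. a * l x * l y)"
    by (simp add: bilin_def linf_def linfD[OF assms(2)] algebra_simps)
  then show ?thesis
    by (rule quadI[rotated]) (simp_all add: linf_0[OF assms(2)] linfD[OF assms(2)] linf_uminus[OF assms(2)] quad1D[OF a])
qed

text \<open>The polar form of x -> \<beta>(x, x) is \<beta>(x, y) + \<beta>(y, x), which is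
  symmetric even if \<beta> is not.\<close>

lemma quad_biform:
  assumes "bilin \<beta>"
  shows "quad (\<lambda>x. \<chi> (\<beta> x x))"
proof -
  have "bilin (\<lambda>x y. \<beta> x y + \<beta> y x)"
    by (simp add: bilin_def linf_def bilinD[OF assms] algebra_simps)
  then show ?thesis
    by (rule quadI[rotated]) (simp_all add: bilinD[OF assms] \<chi>_add[symmetric] add_ac)
qed

lemma quad_char_linf:
  assumes "linf l" "\<not> ev"
  shows "quad (\<lambda>x. \<chi> (l x))"
proof -
  have "quad1 0 (\<lambda>x. \<chi> (1 * x))" by (rule quad1_linear) (use assms in simp)
  then have "(\<lambda>x. \<chi> (1 * x)) \<in> Q1" unfolding Q1_def by blast
  from quad_comp1[OF this assms(1)] show ?thesis by simp
qed

text \<open>Restriction to a line is the bridge to the one-variable Gauss sums: the parameter of the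
  restricted character is b(e, e).\<close>

lemma quad_line:
  assumes "bilin b" "\<psi> 0 = 1" "\<And>x y. \<psi> (x + y) = \<psi> x * \<psi> y * \<chi> (b x y)" "\<And>x. ev \<Longrightarrow> \<psi> (- x) = \<psi> x"
  shows "quad1 (b e e) (\<lambda>t. \<psi> (sc t e))"
proof (rule quad1I)
  show "\<psi> (sc 0 e) = 1" using assms(2) by (simp add: sc_def zero_fun_def)
  fix x y
  have "sc (x + y) e = sc x e + sc y e" by (auto simp: fun_eq_iff algebra_simps)
  then show "\<psi> (sc (x + y) e) = \<psi> (sc x e) * \<psi> (sc y e) * \<chi> (b e e * x * y)"
    using assms(3) by (simp add: bilinD[OF assms(1)] mult_ac)
  have "sc (- x) e = - sc x e" by (auto simp: fun_eq_iff)
  then show "ev \<Longrightarrow> \<psi> (sc (- x) e) = \<psi> (sc x e)" using assms(4) by simp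
qed

lemma quad_line_Q1: "quad \<psi> \<Longrightarrow> (\<lambda>t. \<psi> (sc t e)) \<in> Q1"
  unfolding Q1_def by (erule quadE) (use quad_line in blast)

text \<open>The polar factor has absolute value 1, so the norm is multiplicative along the multiples
  of x, and the p-th multiple is 0.\<close>

lemma quad1_norm:
  assumes "quad1 a \<theta>"
  shows "norm (\<theta> x) = 1"
proof -
  have "norm (\<theta> (of_nat k * x)) = norm (\<theta> x) ^ k" for k
    by (induction k) (simp_all add: quad1D[OF assms] distrib_right norm_mult)
  from this[of "CHAR('f)"] have "norm (\<theta> x) ^ CHAR('f) = 1" by (simp add: quad1D[OF assms])
  then have "norm (\<theta> x) ^ CHAR('f) = 1 ^ CHAR('f)" by simp
  then show ?thesis
    by (rule power_eq_imp_eq_base) (simp_all add: prime_gt_0_nat[OF finite_field_CHAR_prime])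
qed

lemma quad_norm [simp]:
  assumes "quad \<psi>"
  shows "norm (\<psi> x) = 1"
proof -
  obtain a where "quad1 a (\<lambda>t. \<psi> (sc t x))" using quad_line_Q1[OF assms, of x] by (auto simp: Q1_def)
  from quad1_norm[OF this, of 1] show ?thesis by (simp add: sc_def)
qed

lemma quad_cnj_mult: "quad \<psi> \<Longrightarrow> \<psi> x * cnj (\<psi> x) = 1"
  by (simp add: complex_norm_square[symmetric])

text \<open>Closure under parallel translates of lines is required because over two elements a line
  consists of two points, so that closure under lines through two points would be no condition. In
  the even type nonempty sets contain 0 and are linear.\<close>

definition aff :: "(nat \<Rightarrow> 'f) set \<Rightarrow> bool" where
  "aff V \<longleftrightarrow> (\<forall>x\<in>V. \<forall>y\<in>V. \<forall>z\<in>V. \<forall>t. x + sc t (y - z) \<in> V) \<and> (ev \<longrightarrow> V \<noteq> {} \<longrightarrow> 0 \<in> V)"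

text \<open>Up to a nonnegative real factor, c is an N-th root of unity; this form avoids dividing
  by the norm and admits c = 0.\<close>

definition phase :: "complex \<Rightarrow> bool" where
  "phase c \<longleftrightarrow> c ^ N = of_real (norm c ^ N)"

lemma phase_mult: "phase c \<Longrightarrow> phase d \<Longrightarrow> phase (c * d)"
  by (simp add: phase_def power_mult_distrib norm_mult)

lemma phase_of_real: "r \<ge> 0 \<Longrightarrow> phase (of_real r)"
  by (simp add: phase_def)

lemma phase_root: "c ^ N = 1 \<Longrightarrow> norm c = 1 \<Longrightarrow> phase c"
  by (simp add: phase_def)

text \<open>Not normalized, and with \<open>V = {}\<close> the zero function is a state as well.\<close>

definition state :: "((nat \<Rightarrow> 'f) \<Rightarrow> complex) \<Rightarrow> bool" where
  "state s \<longleftrightarrow> (\<exists>c V \<psi>. phase c \<and> aff V \<and> quad \<psi> \<and> s = (\<lambda>x. if x \<in> V then c * \<psi> x else 0))"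

lemma stateI: "phase c \<Longrightarrow> aff V \<Longrightarrow> quad \<psi> \<Longrightarrow> (\<And>x. s x = (if x \<in> V then c * \<psi> x else 0)) \<Longrightarrow> state s"
  unfolding state_def by blast

lemma stateE:
  assumes "state s"
  obtains c V \<psi> where "phase c" "aff V" "quad \<psi>" "s = (\<lambda>x. if x \<in> V then c * \<psi> x else 0)"
  using assms unfolding state_def by blast

lemma state_zero: "state (\<lambda>x. 0)"
  by (rule stateI[of 1 "{}" "\<lambda>x. 1"]) (auto simp: aff_def quad_one phase_def)

lemma state_scale:
  assumes "phase d" "state s"
  shows "state (\<lambda>x. d * s x)"
proof (rule stateE[OF assms(2)])
  fix c V \<psi> assume s: "phase c" "aff V" "quad \<psi>" "s = (\<lambda>x. if x \<in> V then c * \<psi> x else 0)"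
  show ?thesis by (rule stateI[OF phase_mult[OF assms(1) s(1)] s(2,3)]) (simp add: s(4))
qed

lemma state_mult_quad:
  assumes "state s" "quad \<phi>"
  shows "state (\<lambda>x. s x * \<phi> x)"
proof (rule stateE[OF assms(1)])
  fix c V \<psi> assume s: "phase c" "aff V" "quad \<psi>" "s = (\<lambda>x. if x \<in> V then c * \<psi> x else 0)"
  show ?thesis by (rule stateI[OF s(1,2) quad_mult[OF s(3) assms(2)]]) (simp add: s(4))
qed

lemma state_comp_lin:
  assumes "state s" "lin L"
  shows "state (\<lambda>x. s (L x))"
proof (rule stateE[OF assms(1)])
  fix c V \<psi> assume s: "phase c" "aff V" "quad \<psi>" "s = (\<lambda>x. if x \<in> V then c * \<psi> x else 0)"
  show ?thesis
  proof (rule stateI[OF s(1) _ quad_comp_lin[OF s(3) assms(2)]])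
    show "aff (L -` V)" using s(2) unfolding aff_def
      by (auto simp: linD[OF assms(2)] lin_diff[OF assms(2)] lin_0[OF assms(2)])
  qed (simp add: s(4))
qed

lemma aff_inter_linf:
  assumes "aff V" "linf l" "ev \<Longrightarrow> k = 0"
  shows "aff {x \<in> V. l x = k}"
  using assms(1,3) unfolding aff_def
  by (auto simp: linfD[OF assms(2)] linf_diff[OF assms(2)] linf_0[OF assms(2)])

lemma aff_direction:
  assumes "aff V" "v \<in> V"
  defines "D \<equiv> {d. v + d \<in> V}"
  shows "fvec.subspace D" "\<And>x d t. x \<in> V \<Longrightarrow> d \<in> D \<Longrightarrow> x + sc t d \<in> V"
    "\<And>x y. x \<in> V \<Longrightarrow> y \<in> V \<Longrightarrow> x - y \<in> D"
proof -
  have V: "x + sc t (y - z) \<in> V" if "x \<in> V" "y \<in> V" "z \<in> V" for x y z t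
    using assms(1) that by (auto simp: aff_def)
  show 2: "x + sc t d \<in> V" if "x \<in> V" "d \<in> D" for x d t
    using V[of x "v + d" v t] that assms(2) by (simp add: D_def)
  have one: "sc 1 y = y" for y :: "nat \<Rightarrow> 'f" by (simp add: sc_def)
  show "x - y \<in> D" if "x \<in> V" "y \<in> V" for x y
    using V[of v x y 1] that assms(2) by (simp add: D_def one)
  show "fvec.subspace D"
  proof (rule fvec.subspaceI)
    show "0 \<in> D" using assms(2) by (simp add: D_def)
    fix x y assume xy: "x \<in> D" "y \<in> D"
    then have "v + x \<in> V" by (simp add: D_def)
    from 2[OF this xy(2), of 1] show "x + y \<in> D" by (simp add: D_def one add.assoc)
  next
    fix c x assume "x \<in> D"
    from 2[OF assms(2) this, of c] show "sc c x \<in> D" by (simp add: D_def)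
  qed
qed

end

context code_char
begin

lemma quad_root_of_unity: "\<not> ev \<Longrightarrow> quad \<psi> \<Longrightarrow> \<psi> x ^ N = 1"
  using quad_line_Q1[of \<psi> x] root_of_unity[of _ "\<lambda>t. \<psi> (sc t x)" 1] unfolding Q1_def by (auto simp add: sc_def)

text \<open>Translation by d multiplies by the constant \<psi>(d) and by the linear character
  \<chi>(b(x, d)). The latter is not even in general, hence d = 0 in the even type.\<close>

lemma quad_shift:
  assumes "quad \<psi>" "ev \<Longrightarrow> d = 0"
  shows "\<exists>\<psi>'. quad \<psi>' \<and> (\<forall>x. \<psi> (x + d) = \<psi> d * \<psi>' x)" "phase (\<psi> d)"
proof -
  show "\<exists>\<psi>'. quad \<psi>' \<and> (\<forall>x. \<psi> (x + d) = \<psi> d * \<psi>' x)"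
  proof (cases ev)
    case True
    then show ?thesis using assms by (intro exI[of _ \<psi>]) (simp add: quad_0)
  next
    case False
    obtain b where b: "bilin b" "\<And>x y. \<psi> (x + y) = \<psi> x * \<psi> y * \<chi> (b x y)"
      using assms(1) by (rule quadE) blast
    have "quad (\<lambda>x. \<psi> x * \<chi> (b x d))"
      by (rule quad_mult[OF assms(1) quad_char_linf[OF _ False]]) (use b(1) in \<open>simp add: bilin_def\<close>)
    then show ?thesis by (intro exI[of _ "\<lambda>x. \<psi> x * \<chi> (b x d)"]) (simp add: b(2))
  qed
  show "phase (\<psi> d)"
  proof (cases ev)
    case True
    then show ?thesis using assms by (simp add: quad_0 phase_def)
  next
    case False
    then show ?thesis using assms(1) quad_root_of_unity by (intro phase_root) auto
  qed
qed

text \<open>The reason why Fourier transforms preserve states. If e is a direction of the support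
  and b(e, e) is nonzero, the sum over the line is a Gauss sum and contributes a quadratic
  character. If b(e, e) = 0, an additive character is summed, which cuts the support down to a
  hyperplane section. If e is no direction of the support, each line meets it in at most one point,
  and the sum projects the support along e.\<close>

lemma state_sum_line:
  assumes "state s"
  shows "state (\<lambda>x. \<Sum>t\<in>UNIV. s (x + sc t e))"
proof (rule stateE[OF assms])
  fix c V \<psi> assume s: "phase c" "aff V" "quad \<psi>" "s = (\<lambda>x. if x \<in> V then c * \<psi> x else 0)"
  show ?thesis
  proof (cases "V = {}")
    case True
    then show ?thesis by (simp add: s(4) state_zero)
  next
    case False
    \<comment> \<open>The base point of the support; in the even type it must be 0 so that all later
      shifts are trivial.\<close>
    define v where "v = (if ev then 0 else SOME v. v \<in> V)"
    have v: "v \<in> V" "ev \<Longrightarrow> v = 0" using False s(2) by (auto simp: v_def aff_def some_in_eq)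
    define D where "D = {d. v + d \<in> V}"
    note D = aff_direction[OF s(2) v(1), folded D_def]
    obtain b where b: "\<psi> 0 = 1" "bilin b" "\<And>x y. b x y = b y x" "\<And>x y. \<psi> (x + y) = \<psi> x * \<psi> y * \<chi> (b x y)"
      "\<And>x. ev \<Longrightarrow> \<psi> (- x) = \<psi> x"
      using s(3) by (rule quadE) blast
    have linb: "linf (\<lambda>x. b x e)" using b(2) by (simp add: bilin_def)
    show ?thesis
    proof (cases "e \<in> D")
      case True
      let ?\<theta> = "\<lambda>t. \<psi> (sc t e)"
      have q1: "quad1 (b e e) ?\<theta>" by (rule quad_line[OF b(2,1,4,5)])
      have Ve: "x + sc t e \<in> V \<longleftrightarrow> x \<in> V" for x t
      proof
        assume "x + sc t e \<in> V"
        from D(2)[OF this True, of "- t"] show "x \<in> V" by (simp add: sc_def plus_fun_def)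
      qed (rule D(2)[OF _ True])
      have sum: "(\<Sum>t\<in>UNIV. s (x + sc t e)) =
          (if x \<in> V then c * \<psi> x * (\<Sum>t\<in>UNIV. ?\<theta> t * \<chi> (t * b x e)) else 0)" for x
        by (simp add: s(4) Ve b(4) bilinD[OF b(2)] sum_distrib_left mult_ac)
      show ?thesis
      proof (cases "b e e = 0")
        case False
        obtain d \<theta>' where d: "\<theta>' \<in> Q1" "d \<noteq> 0" "d ^ N = of_real (norm d ^ N)"
          "\<And>x. (\<Sum>t\<in>UNIV. ?\<theta> t * \<chi> (t * x)) = d * \<theta>' x"
          using gauss[OF q1 False] by blast
        show ?thesis
        proof (rule stateI[OF phase_mult[OF s(1), of d] s(2) quad_mult[OF s(3) quad_comp1[OF d(1) linb]]])
          show "phase d" using d(3) by (simp add: phase_def)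
        qed (simp add: sum d(4))
      next
        case True
        \<comment> \<open>In the even type k = 0, so the hyperplane below passes through 0 and the
          support stays linear.\<close>
        from quad1_0[OF q1[unfolded True] two] obtain k where k: "ev \<longrightarrow> k = 0" "\<And>t. ?\<theta> t = \<chi> (k * t)" by blast
        have "(\<Sum>t\<in>UNIV. ?\<theta> t * \<chi> (t * b x e)) = (\<Sum>t\<in>UNIV. \<chi> (t * (k + b x e)))" for x
          by (simp only: k(2) \<chi>_add[symmetric] distrib_left mult.commute[of k])
        then have sum2: "(\<Sum>t\<in>UNIV. ?\<theta> t * \<chi> (t * b x e)) = (if b x e = - k then of_nat CARD('f) else 0)" for x
          unfolding \<chi>_sum by (simp add: add_eq_0_iff)
        show ?thesis
        proof (rule stateI[OF phase_mult[OF s(1), of "of_real (of_nat CARD('f))"] aff_inter_linf[OF s(2) linb, of "- k"] s(3)])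
          show "phase (of_real (of_nat CARD('f)))" by (rule phase_of_real) simp
          show "ev \<Longrightarrow> - k = 0" using k(1) by simp
          show "(\<Sum>t\<in>UNIV. s (x + sc t e)) = (if x \<in> {x \<in> V. b x e = - k}
              then c * of_real (of_nat CARD('f)) * \<psi> x else 0)" for x
            unfolding sum sum2 by simp
        qed
      qed
    next
      case False
      obtain l where l: "linf l" "l e = 1" "\<And>d. d \<in> D \<Longrightarrow> l d = 0"
        using separating_functional[OF D(1) False] by blast
      \<comment> \<open>The projection along e onto the kernel of l. The point x + t e can lie in V
        only for t = l v - l x, and then it equals \<open>?P x + ?d\<close>.\<close>
      let ?P = "\<lambda>x. x + sc (- l x) e"
      let ?d = "sc (l v) e"
      have linP: "lin ?P"
        by (auto simp: lin_def linfD[OF l(1)] fun_eq_iff algebra_simps)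
      have d0: "ev \<Longrightarrow> ?d = 0" using v(2) linf_0[OF l(1)] by simp
      have eq: "x + sc t e \<in> V \<longleftrightarrow> ?P x + ?d \<in> V \<and> t = l v - l x" for x t
      proof -
        have "x + sc t e = ?P x + ?d" if "t = l v - l x"
          unfolding that by (auto simp: fun_eq_iff algebra_simps)
        moreover have "t = l v - l x" if "x + sc t e \<in> V"
        proof -
          have "l (x + sc t e - v) = 0" using D(3)[OF that v(1)] by (rule l(3))
          then show ?thesis by (simp add: linf_diff[OF l(1)] linfD[OF l(1)] l(2) algebra_simps)
        qed
        ultimately show ?thesis by metis
      qed
      have "(\<Sum>t\<in>UNIV. s (x + sc t e)) = (\<Sum>t\<in>UNIV. if t = l v - l x then s (?P x + ?d) else 0)" for x
      proof (rule sum.cong[OF refl])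
        fix t
        show "s (x + sc t e) = (if t = l v - l x then s (?P x + ?d) else 0)"
        proof (cases "t = l v - l x")
          case True
          have "x + sc t e = ?P x + ?d" unfolding True by (auto simp: fun_eq_iff algebra_simps)
          then show ?thesis using True by (simp only: if_True simp_thms)
        next
          case False
          then have "x + sc t e \<notin> V" using eq by blast
          then show ?thesis using False by (simp add: s(4))
        qed
      qed
      then have sum: "(\<Sum>t\<in>UNIV. s (x + sc t e)) = s (?P x + ?d)" for x by simp
      obtain \<psi>' where \<psi>': "quad \<psi>'" "\<And>x. \<psi> (x + ?d) = \<psi> ?d * \<psi>' x"
        using quad_shift(1)[OF s(3) d0] by blast
      show ?thesis
      proof (rule stateI[OF phase_mult[OF s(1) quad_shift(2)[OF s(3) d0]] _ quad_comp_lin[OF \<psi>'(1) linP]])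
        show "aff {x. ?P x + ?d \<in> V}" unfolding aff_def
        proof (intro conjI ballI allI impI)
          fix x y z t assume "x \<in> {x. ?P x + ?d \<in> V}" "y \<in> {x. ?P x + ?d \<in> V}" "z \<in> {x. ?P x + ?d \<in> V}"
          then have "(?P x + ?d) + sc t ((?P y + ?d) - (?P z + ?d)) \<in> V"
            using s(2) unfolding aff_def mem_Collect_eq by blast
          moreover have "(?P x + ?d) + sc t ((?P y + ?d) - (?P z + ?d)) = ?P (x + sc t (y - z)) + ?d"
            by (auto simp: fun_eq_iff linfD[OF l(1)] linf_diff[OF l(1)] algebra_simps)
          ultimately show "x + sc t (y - z) \<in> {x. ?P x + ?d \<in> V}" by (simp only: mem_Collect_eq)
        next
          assume ev
          then show "0 \<in> {x. ?P x + ?d \<in> V}" using d0 v linf_0[OF l(1)] by simp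
        qed
        show "(\<Sum>t\<in>UNIV. s (x + sc t e)) = (if x \<in> {x. ?P x + ?d \<in> V} then c * \<psi> ?d * \<psi>' (?P x) else 0)" for x
          unfolding sum unfolding s(4) \<psi>'(2) mem_Collect_eq mult.assoc by (rule refl)
      qed
    qed
  qed
qed

text \<open>Induction on the size of W: the line through e is split off, with the kernel of a
  functional as complement in W.\<close>

lemma state_sum_subspace:
  assumes "finite W" "fvec.subspace W" "state s"
  shows "state (\<lambda>x. \<Sum>w\<in>W. s (x + w))"
  using assms
proof (induction "card W" arbitrary: W s rule: less_induct)
  case less
  show ?case
  proof (cases "W \<subseteq> {0}")
    case True
    then have "W = {0}" using fvec.subspace_0[OF less.prems(2)] by auto
    then show ?thesis using less.prems by simp
  next
    case False
    then obtain e where e: "e \<in> W" "e \<noteq> 0" by auto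
    obtain l where l: "linf l" "l e = 1"
      using separating_functional[OF fvec.subspace_single_0, of e] e by auto
    define W' where "W' = {w \<in> W. l w = 0}"
    have sub: "fvec.subspace W'"
      using less.prems(2) l unfolding W'_def fvec.subspace_def by (auto simp: linfD linf_0)
    have "W' \<subseteq> W" "e \<notin> W'" using l by (simp_all add: W'_def)
    with e have "W' \<subset> W" by blast
    then have "card W' < card W" using less.prems by (intro psubset_card_mono)
    moreover have "finite W'" using less.prems by (simp add: W'_def)
    ultimately have "state (\<lambda>x. \<Sum>w\<in>W'. \<Sum>t\<in>UNIV. s ((x + w) + sc t e))"
      using less.hyps[of W' "\<lambda>x. \<Sum>t\<in>UNIV. s (x + sc t e)"] sub state_sum_line[OF less.prems(3)] by blast
    moreover have "(\<Sum>w\<in>W'. \<Sum>t\<in>UNIV. s ((x + w) + sc t e)) = (\<Sum>w\<in>W. s (x + w))" for x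
      unfolding sum.cartesian_product
    proof (rule sum.reindex_bij_witness[of _ "\<lambda>w. (w - sc (l w) e, l w)" "\<lambda>(w, t). w + sc t e"])
      fix w assume w: "w \<in> W"
      show "(\<lambda>(w, t). w + sc t e) (w - sc (l w) e, l w) = w" by simp
      show "(w - sc (l w) e, l w) \<in> W' \<times> UNIV"
        using w e l less.prems(2)
        by (auto simp: W'_def linf_diff linfD intro: fvec.subspace_diff fvec.subspace_scale)
    next
      fix a assume a: "a \<in> W' \<times> (UNIV :: 'f set)"
      then show "((\<lambda>(w, t). w + sc t e) a - sc (l ((\<lambda>(w, t). w + sc t e) a)) e, l ((\<lambda>(w, t). w + sc t e) a)) = a"
        using l by (auto simp: W'_def linfD)
      show "(\<lambda>(w, t). w + sc t e) a \<in> W" using a e less.prems(2)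
        by (auto simp: W'_def intro: fvec.subspace_add fvec.subspace_scale)
      show "s (x + (\<lambda>(w, t). w + sc t e) a) = (case a of (w, t) \<Rightarrow> s (x + w + sc t e))"
        by (cases a) (simp add: add.assoc)
    qed
    ultimately show ?thesis by simp
  qed
qed

end

section \<open>The action of substitutions on states\<close>

definition join :: "nat \<Rightarrow> 'f vec \<Rightarrow> (nat \<Rightarrow> 'f) \<Rightarrow> nat \<Rightarrow> 'f" where
  "join n v x = (\<lambda>i. if i < n then v $ i else x i)"

text \<open>The model of F^n inside the sequences; \<open>join n v 0\<close> passes from vectors to
  this model and \<open>vec n\<close> passes back.\<close>

definition coords :: "nat \<Rightarrow> (nat \<Rightarrow> 'f::zero) set" where
  "coords n = {x. \<forall>i\<ge>n. x i = 0}"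

lemma vec_join [simp]: "v \<in> carrier_vec n \<Longrightarrow> vec n (join n v x) = v"
  by (auto simp: join_def)

lemma join_join [simp]: "join n v (join n w x) = join n v x"
  by (auto simp: join_def fun_eq_iff)

lemma join_vec [simp]: "join n (vec n x) x = x"
  by (auto simp: join_def fun_eq_iff)

lemma join_coords [simp]: "n \<le> m \<Longrightarrow> x \<in> coords m \<Longrightarrow> join n v x \<in> coords m"
  by (auto simp: join_def coords_def)

lemma finite_coords [simp]: "finite (coords n :: (nat \<Rightarrow> 'f::{finite,zero}) set)"
proof -
  have "coords n \<subseteq> (\<lambda>v. join n v (\<lambda>_. 0)) ` (carrier_vec n :: 'f vec set)"
    by (auto simp: coords_def join_def fun_eq_iff intro!: image_eqI[of _ _ "vec n _"])
  then show ?thesis by (rule finite_subset) simp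
qed

lemma bij_coords: "bij_betw (\<lambda>v. join n v (0 :: nat \<Rightarrow> 'f::zero)) (carrier_vec n) (coords n)"
  by (rule bij_betw_byWitness[of _ "vec n"]) (auto simp: join_def coords_def fun_eq_iff)

definition vlin :: "nat \<Rightarrow> ((nat \<Rightarrow> 'f::field) \<Rightarrow> 'f vec) \<Rightarrow> bool" where
  "vlin n L \<longleftrightarrow> (\<forall>x. L x \<in> carrier_vec n) \<and> (\<forall>x y. L (x + y) = L x + L y) \<and> (\<forall>c x. L (sc c x) = c \<cdot>\<^sub>v L x)"

lemma vlinD:
  "vlin n L \<Longrightarrow> L x \<in> carrier_vec n" "vlin n L \<Longrightarrow> L (x + y) = L x + L y" "vlin n L \<Longrightarrow> L (sc c x) = c \<cdot>\<^sub>v L x"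
  by (auto simp: vlin_def)

lemma vlin_vec: "vlin n (vec n)"
  by (auto simp: vlin_def)

lemma vlin_comp: "vlin n L \<Longrightarrow> lin M \<Longrightarrow> vlin n (\<lambda>x. L (M x))"
  by (auto simp: vlin_def lin_def)

lemma vlin_mat: "A \<in> carrier_mat m n \<Longrightarrow> vlin n L \<Longrightarrow> vlin m (\<lambda>x. A *\<^sub>v L x)"
  by (auto simp: vlin_def mult_add_distrib_mat_vec mult_mat_vec)

lemma vlin_add: "vlin n L \<Longrightarrow> vlin n M \<Longrightarrow> vlin n (\<lambda>x. L x + M x)"
proof -
  assume L: "vlin n L" and M: "vlin n M"
  have d: "dim_vec (L x) = n" "dim_vec (M x) = n" for x using vlinD(1)[OF L] vlinD(1)[OF M] by auto
  show ?thesis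
    unfolding vlin_def by (auto simp: vlinD[OF L] vlinD[OF M] d algebra_simps intro!: eq_vecI carrier_vecI)
qed

lemma lin_join: "vlin n L \<Longrightarrow> lin M \<Longrightarrow> lin (\<lambda>x. join n (L x) (M x))"
proof -
  assume L: "vlin n L" and M: "lin M"
  have d: "dim_vec (L x) = n" for x using vlinD(1)[OF L] by auto
  show ?thesis
    by (auto simp: lin_def fun_eq_iff join_def vlinD[OF L] linD[OF M] d)
qed

lemma lin_id: "lin (\<lambda>x. x)" by (simp add: lin_def)

lemma lin_reindex: "lin (\<lambda>x i. x (h i))"
  by (auto simp: lin_def fun_eq_iff)

lemma lin_reindex_if: "lin (\<lambda>x i. if P i then x (h i) else 0)"
  by (auto simp: lin_def fun_eq_iff)

lemma bilin_scalar_prod: "vlin n L \<Longrightarrow> vlin n M \<Longrightarrow> bilin (\<lambda>x y. L x \<bullet> M y)"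
  unfolding bilin_def linf_def
  by (auto simp: vlinD intro!: add_scalar_prod_distrib[of _ n] scalar_prod_add_distrib[of _ n])
     (metis smult_scalar_prod_distrib vlinD(1), metis scalar_prod_smult_distrib vlinD(1))

lemma scalar_prod_transpose:
  fixes A :: "'f::comm_semiring_0 mat"
  assumes "A \<in> carrier_mat m n" "x \<in> carrier_vec n" "y \<in> carrier_vec m"
  shows "(A *\<^sub>v x) \<bullet> y = x \<bullet> (transpose_mat A *\<^sub>v y)"
proof -
  have "(A *\<^sub>v x) \<bullet> y = (\<Sum>i<m. \<Sum>j<n. A $$ (i,j) * x $ j * y $ i)"
    using assms by (auto simp: scalar_prod_def sum_distrib_right lessThan_atLeast0)
  also have "\<dots> = (\<Sum>j<n. \<Sum>i<m. x $ j * (A $$ (i,j) * y $ i))"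
    by (subst sum.swap) (simp add: mult_ac)
  also have "\<dots> = x \<bullet> (transpose_mat A *\<^sub>v y)"
    using assms by (auto simp: scalar_prod_def sum_distrib_left lessThan_atLeast0)
  finally show ?thesis .
qed

lemma scalar_prod_all_eq_0:
  assumes "y \<in> carrier_vec n" "\<And>x. x \<in> carrier_vec n \<Longrightarrow> x \<bullet> y = (0::'f::field)"
  shows "y = 0\<^sub>v n"
proof (rule eq_vecI)
  fix i assume "i < dim_vec (0\<^sub>v n)"
  then show "y $ i = 0\<^sub>v n $ i" using assms(2)[of "unit_vec n i"] assms(1) by auto
qed (use assms in auto)

subsection \<open>The group of substitutions\<close>

lemma subst_monoid_simps:
  "carrier (subst_monoid n) = {A. \<forall>v w. \<not> (v \<in> carrier_vec n \<and> w \<in> carrier_vec n) \<longrightarrow> A v w = 0}"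
  "A \<otimes>\<^bsub>subst_monoid n\<^esub> B = (\<lambda>v w. \<Sum>u\<in>carrier_vec n. A v u * B u w)"
  "\<one>\<^bsub>subst_monoid n\<^esub> = (\<lambda>v w. if v \<in> carrier_vec n \<and> w = v then 1 else 0)"
  by (auto simp: subst_monoid_def)

lemma monoid_subst: "Group.monoid (subst_monoid n :: 'f::{finite,field} subst monoid)"
proof
  fix x y z :: "'f subst"
  assume xyz: "x \<in> carrier (subst_monoid n)" "y \<in> carrier (subst_monoid n)" "z \<in> carrier (subst_monoid n)"
  show "x \<otimes>\<^bsub>subst_monoid n\<^esub> y \<otimes>\<^bsub>subst_monoid n\<^esub> z = x \<otimes>\<^bsub>subst_monoid n\<^esub> (y \<otimes>\<^bsub>subst_monoid n\<^esub> z)"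
    unfolding subst_monoid_simps sum_distrib_left sum_distrib_right mult.assoc
    by (intro ext) (rule sum.swap)
next
  fix x :: "'f subst" assume x: "x \<in> carrier (subst_monoid n)"
  have "(\<Sum>u\<in>carrier_vec n. (if v \<in> carrier_vec n \<and> u = v then 1 else 0) * x u w) = x v w" for v w
    using x by (cases "v \<in> carrier_vec n") (simp_all add: subst_monoid_simps if_distrib[of "\<lambda>x. x * _"] cong: if_cong)
  then show "\<one>\<^bsub>subst_monoid n\<^esub> \<otimes>\<^bsub>subst_monoid n\<^esub> x = x" by (simp add: subst_monoid_simps)
  have "(\<Sum>u\<in>carrier_vec n. x v u * (if u \<in> carrier_vec n \<and> w = u then 1 else 0)) = x v w" for v w
  proof -
    have "(\<Sum>u\<in>carrier_vec n. x v u * (if u \<in> carrier_vec n \<and> w = u then 1 else 0)) =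
        (\<Sum>u\<in>carrier_vec n. if u = w then x v w else 0)"
      by (rule sum.cong) auto
    then show ?thesis using x by (simp add: subst_monoid_simps)
  qed
  then show "x \<otimes>\<^bsub>subst_monoid n\<^esub> \<one>\<^bsub>subst_monoid n\<^esub> = x" by (simp add: subst_monoid_simps)
qed (auto simp: subst_monoid_simps)

definition adj :: "'f subst \<Rightarrow> 'f subst" where
  "adj A = (\<lambda>v w. cnj (A w v))"

text \<open>All generators are unitary. This makes the group inverse the conjugate transpose and
  lets the action preserve the normalisation of states.\<close>

definition unitary :: "nat \<Rightarrow> 'f::{finite,field} subst \<Rightarrow> bool" where
  "unitary n A \<longleftrightarrow> A \<in> carrier (subst_monoid n) \<and>
     A \<otimes>\<^bsub>subst_monoid n\<^esub> adj A = \<one>\<^bsub>subst_monoid n\<^esub> \<and> adj A \<otimes>\<^bsub>subst_monoid n\<^esub> A = \<one>\<^bsub>subst_monoid n\<^esub>"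

lemma adj_carrier: "A \<in> carrier (subst_monoid n) \<Longrightarrow> adj A \<in> carrier (subst_monoid n)"
  by (auto simp: subst_monoid_simps adj_def)

lemma adj_adj [simp]: "adj (adj A) = A"
  by (simp add: adj_def)

lemma adj_mult: "adj (A \<otimes>\<^bsub>subst_monoid n\<^esub> B) = adj B \<otimes>\<^bsub>subst_monoid n\<^esub> adj A"
  by (simp add: adj_def subst_monoid_simps mult.commute)

lemma unitary_adj: "unitary n A \<Longrightarrow> unitary n (adj A)"
  by (simp add: unitary_def adj_carrier)

lemma unitary_one: "unitary n \<one>\<^bsub>subst_monoid n\<^esub>"
proof -
  interpret Group.monoid "subst_monoid n" by (rule monoid_subst)
  have "adj \<one>\<^bsub>subst_monoid n\<^esub> = (\<one>\<^bsub>subst_monoid n\<^esub> :: 'a subst)"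
    by (auto simp: adj_def subst_monoid_simps fun_eq_iff)
  then show ?thesis by (simp add: unitary_def)
qed

lemma unitary_mult:
  assumes "unitary n A" "unitary n B"
  shows "unitary n (A \<otimes>\<^bsub>subst_monoid n\<^esub> B)"
proof -
  interpret Group.monoid "subst_monoid n" by (rule monoid_subst)
  note * = assms[unfolded unitary_def] adj_carrier[of A n] adj_carrier[of B n]
  have "B \<otimes>\<^bsub>subst_monoid n\<^esub> (adj B \<otimes>\<^bsub>subst_monoid n\<^esub> adj A) = adj A"
    using * by (simp add: m_assoc[symmetric])
  then have "A \<otimes>\<^bsub>subst_monoid n\<^esub> B \<otimes>\<^bsub>subst_monoid n\<^esub> (adj B \<otimes>\<^bsub>subst_monoid n\<^esub> adj A) = \<one>\<^bsub>subst_monoid n\<^esub>"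
    using * by (simp add: m_assoc)
  moreover have "adj A \<otimes>\<^bsub>subst_monoid n\<^esub> (A \<otimes>\<^bsub>subst_monoid n\<^esub> B) = B"
    using * by (simp add: m_assoc[symmetric])
  then have "adj B \<otimes>\<^bsub>subst_monoid n\<^esub> adj A \<otimes>\<^bsub>subst_monoid n\<^esub> (A \<otimes>\<^bsub>subst_monoid n\<^esub> B) = \<one>\<^bsub>subst_monoid n\<^esub>"
    using * by (simp add: m_assoc)
  ultimately show ?thesis using * by (simp add: unitary_def adj_mult)
qed

lemma unitary_Units: "unitary n A \<Longrightarrow> A \<in> Units (subst_monoid n)"
  unfolding unitary_def Units_def using adj_carrier by blast

lemma group_subst_GL: "group (subst_GL n)"
  unfolding subst_GL_def by (rule Group.monoid.units_group[OF monoid_subst])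

lemma subst_GL_simps:
  "carrier (subst_GL n) = Units (subst_monoid n)" "(\<otimes>\<^bsub>subst_GL n\<^esub>) = (\<otimes>\<^bsub>subst_monoid n\<^esub>)"
  "\<one>\<^bsub>subst_GL n\<^esub> = \<one>\<^bsub>subst_monoid n\<^esub>"
  by (simp_all add: subst_GL_def units_of_def)

lemma inv_subst_GL: "unitary n A \<Longrightarrow> inv\<^bsub>subst_GL n\<^esub> A = adj A"
proof -
  assume A: "unitary n A"
  interpret group "subst_GL n" by (rule group_subst_GL)
  have "A \<in> carrier (subst_GL n)" "adj A \<in> carrier (subst_GL n)"
    using unitary_Units[OF A] unitary_Units[OF unitary_adj[OF A]] by (simp_all add: subst_GL_simps)
  moreover have "adj A \<otimes>\<^bsub>subst_GL n\<^esub> A = \<one>\<^bsub>subst_GL n\<^esub>"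
    using A by (simp add: subst_GL_simps unitary_def)
  ultimately show ?thesis by (intro inv_equality)
qed

subsection \<open>Action on functions with spectator coordinates\<close>

text \<open>Multiplication of the row vector s by the matrix A on the first n coordinates, with the
  others as parameters. This is what a substitution does to the coefficients of a linear form, see
  \<open>apply_subst_lf\<close>; it is a right action.\<close>

definition act :: "nat \<Rightarrow> 'f::{finite,field} subst \<Rightarrow> ((nat \<Rightarrow> 'f) \<Rightarrow> complex) \<Rightarrow> (nat \<Rightarrow> 'f) \<Rightarrow> complex" where
  "act n A s = (\<lambda>x. \<Sum>v\<in>carrier_vec n. s (join n v x) * A v (vec n x))"

lemma act_mult: "act n B (act n A s) = act n (A \<otimes>\<^bsub>subst_monoid n\<^esub> B) s"
proof
  fix x
  have "act n B (act n A s) x = (\<Sum>w\<in>carrier_vec n. \<Sum>v\<in>carrier_vec n. s (join n v x) * A v w * B w (vec n x))"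
    by (simp add: act_def sum_distrib_right)
  then show "act n B (act n A s) x = act n (A \<otimes>\<^bsub>subst_monoid n\<^esub> B) s x"
    by (subst (asm) sum.swap) (simp add: act_def subst_monoid_simps sum_distrib_left mult.assoc)
qed

lemma act_one [simp]: "act n \<one>\<^bsub>subst_monoid n\<^esub> s = s"
  by (auto simp: act_def subst_monoid_simps fun_eq_iff if_distrib[of "\<lambda>x. _ * x"] cong: if_cong)

lemma act_scale: "act n A (\<lambda>x. c * s x) = (\<lambda>x. c * act n A s x)"
  by (simp add: act_def sum_distrib_left mult.assoc)

lemma act_adj: "unitary n A \<Longrightarrow> act n (adj A) (act n A s) = s" "unitary n A \<Longrightarrow> act n A (act n (adj A) s) = s"
  by (simp_all add: act_mult unitary_def)

lemma sum_coords_split: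
  assumes "n \<le> m"
  shows "(\<Sum>x\<in>coords m. F x) = (\<Sum>y | y \<in> coords m \<and> (\<forall>i<n. y i = (0::'f::{finite,field})). \<Sum>v\<in>carrier_vec n. F (join n v y))"
proof -
  let ?H = "{y. y \<in> coords m \<and> (\<forall>i<n. y i = (0::'f))}"
  have "(\<Sum>x\<in>coords m. F x) = (\<Sum>p\<in>?H \<times> carrier_vec n. F (join n (snd p) (fst p)))"
  proof (rule sum.reindex_bij_witness[of _ "\<lambda>p. join n (snd p) (fst p)" "\<lambda>x. (join n (0\<^sub>v n) x, vec n x)"])
    fix p :: "(nat \<Rightarrow> 'f) \<times> 'f vec" assume p: "p \<in> ?H \<times> carrier_vec n"
    then have "join n (0\<^sub>v n) (fst p) = fst p" by (auto simp: join_def fun_eq_iff)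
    then show "(join n (0\<^sub>v n) (join n (snd p) (fst p)), vec n (join n (snd p) (fst p))) = p"
      using p by (auto simp: prod_eq_iff)
    show "join n (snd p) (fst p) \<in> coords m" using p assms by auto
  next
    fix x :: "nat \<Rightarrow> 'f" assume x: "x \<in> coords m"
    have "join n (0\<^sub>v n) x \<in> coords m" using x assms by simp
    then show "(join n (0\<^sub>v n) x, vec n x) \<in> ?H \<times> carrier_vec n" by (auto simp: join_def)
  qed simp_all
  then show ?thesis by (simp add: sum.cartesian_product case_prod_unfold)
qed

text \<open>The rows of A are orthonormal, so the norm is preserved separately for each choice of
  the spectator coordinates.\<close>

lemma act_norm:
  assumes A: "unitary n A" and nm: "n \<le> m"
  shows "(\<Sum>x\<in>coords m. (norm (act n A s x))\<^sup>2) = (\<Sum>x\<in>coords m. (norm (s x))\<^sup>2)"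
proof -
  have one: "(\<Sum>z\<in>carrier_vec n. A v z * cnj (A w z)) = (if w = v then 1 else 0)"
    if "v \<in> carrier_vec n" "w \<in> carrier_vec n" for v w
  proof -
    have "(A \<otimes>\<^bsub>subst_monoid n\<^esub> adj A) v w = \<one>\<^bsub>subst_monoid n\<^esub> v w" using A by (simp add: unitary_def)
    then show ?thesis using that by (simp add: subst_monoid_simps adj_def)
  qed
  have "(\<Sum>z\<in>carrier_vec n. (norm (act n A s (join n z y)))\<^sup>2) = (\<Sum>v\<in>carrier_vec n. (norm (s (join n v y)))\<^sup>2)" for y
  proof -
    let ?s = "\<lambda>v. s (join n v y)"
    have "complex_of_real (\<Sum>z\<in>carrier_vec n. (norm (act n A s (join n z y)))\<^sup>2) =
        (\<Sum>z\<in>carrier_vec n. (\<Sum>v\<in>carrier_vec n. ?s v * A v z) * cnj (\<Sum>w\<in>carrier_vec n. ?s w * A w z))"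
      unfolding of_real_sum complex_norm_square by (rule sum.cong) (simp_all add: act_def)
    also have "\<dots> = (\<Sum>z\<in>carrier_vec n. \<Sum>v\<in>carrier_vec n. \<Sum>w\<in>carrier_vec n. ?s v * cnj (?s w) * (A v z * cnj (A w z)))"
      by (simp add: sum_product mult_ac)
    also have "\<dots> = (\<Sum>v\<in>carrier_vec n. \<Sum>w\<in>carrier_vec n. ?s v * cnj (?s w) * (\<Sum>z\<in>carrier_vec n. A v z * cnj (A w z)))"
      unfolding sum_distrib_left
      by (subst sum.swap, rule sum.cong[OF refl], rule sum.swap)
    also have "\<dots> = (\<Sum>v\<in>carrier_vec n. \<Sum>w\<in>carrier_vec n. if w = v then ?s v * cnj (?s v) else 0)"
      by (intro sum.cong refl) (simp add: one)
    also have "\<dots> = complex_of_real (\<Sum>v\<in>carrier_vec n. (norm (?s v))\<^sup>2)"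
      unfolding of_real_sum complex_norm_square by simp
    finally show ?thesis by (simp only: of_real_eq_iff)
  qed
  then show ?thesis unfolding sum_coords_split[OF nm] by simp
qed

lemma act_support:
  assumes "n \<le> m" "\<And>x. x \<notin> coords m \<Longrightarrow> s x = 0" "x \<notin> coords m"
  shows "act n A s x = 0"
proof -
  have "join n v x \<notin> coords m" for v using assms(1,3) by (auto simp: join_def coords_def)
  then show ?thesis by (simp add: act_def assms(2))
qed

section \<open>Generators of the Clifford-Weil group acting on states\<close>

locale code_setup =
  fixes T :: code_type and F :: "'f::{finite,field} itself" and N :: nat
  assumes adm: "admissible_field T TYPE('f)" and N_gt_0: "N > 0" and ord: "order_Z T TYPE('f) dvd N"

sublocale code_setup \<subseteq> code_char "code_chi T :: 'f \<Rightarrow> complex" "T = Type_qE" N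
  using adm N_gt_0 ord by (rule code_char_code_chi)

context code_setup
begin

abbreviation "\<chi> \<equiv> code_chi T :: 'f \<Rightarrow> complex"

lemma \<chi>_setsum: "\<chi> (\<Sum>i\<in>A. f i) = (\<Prod>i\<in>A. \<chi> (f i))"
  by (induction A rule: infinite_finite_induct) (auto simp: \<chi>_add)

lemma e_QZ_beta_n:
  assumes "x \<in> carrier_vec n" "y \<in> carrier_vec n"
  shows "e_QZ (beta_n T n x y) = \<chi> (x \<bullet> y)"
  using assms by (auto simp: beta_n_def e_QZ_sum e_QZ_beta scalar_prod_def \<chi>_setsum lessThan_atLeast0)

lemma quad_prod: "(\<And>i. i \<in> A \<Longrightarrow> quad (\<psi> i)) \<Longrightarrow> quad (\<lambda>x. \<Prod>i\<in>A. \<psi> i x)"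
  by (induction A rule: infinite_finite_induct) (auto simp: quad_one quad_mult)

lemma linf_coord: "linf (\<lambda>x. x i)"
  by (simp add: linf_def)

lemma Phi_n_quad:
  assumes "\<phi> \<in> Phi_n T n"
  shows "quad (\<lambda>x. e_QZ (\<phi> (vec n x)))"
proof -
  obtain p m where \<phi>: "\<phi> = (\<lambda>v. (\<Sum>i<n. p i (v $ i)) + (\<Sum>j<n. \<Sum>i<j. beta T (v $ i) (m i j * v $ j)))"
    and p: "\<And>i. i < n \<Longrightarrow> p i \<in> Phi T" using assms by (auto simp: Phi_n_def)
  have eq: "e_QZ (\<phi> (vec n x)) = (\<Prod>i<n. e_QZ (p i (x i))) * (\<Prod>j<n. \<Prod>i<j. \<chi> (x i * (m i j * x j)))" for x
    by (simp add: \<phi> e_QZ_add e_QZ_sum e_QZ_beta)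
  have "quad (\<lambda>x. e_QZ (p i (x i)))" if "i < n" for i
  proof (rule quad_comp1[OF _ linf_coord, where \<theta> = "\<lambda>t. e_QZ (p i t)"])
    show "(\<lambda>t. e_QZ (p i t)) \<in> Q1" using p[OF that] unfolding Q1_eq_Phi[OF adm] by blast
  qed
  moreover have "quad (\<lambda>x. \<chi> (x i * (m i j * x j)))" for i j
    by (rule quad_biform) (simp add: bilin_def linf_def algebra_simps)
  ultimately have "quad (\<lambda>x. (\<Prod>i<n. e_QZ (p i (x i))) * (\<Prod>j<n. \<Prod>i<j. \<chi> (x i * (m i j * x j))))"
    by (intro quad_mult quad_prod) simp_all
  then show ?thesis unfolding eq .
qed

definition uvec :: "nat \<Rightarrow> nat \<Rightarrow> 'f" where
  "uvec i = (\<lambda>j. if j = i then 1 else 0)"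

definition trunc :: "nat \<Rightarrow> (nat \<Rightarrow> 'f) \<Rightarrow> nat \<Rightarrow> 'f" where
  "trunc k x = (\<lambda>i. if i < k then x i else 0)"

lemma trunc_Suc: "trunc (Suc k) x = trunc k x + sc (x k) (uvec k)"
  by (auto simp: trunc_def uvec_def fun_eq_iff less_Suc_eq)

lemma linf_trunc: "linf l \<Longrightarrow> l (trunc k x) = (\<Sum>i<k. x i * l (uvec i))"
proof (induction k)
  case 0
  have "trunc 0 x = 0" by (simp add: trunc_def zero_fun_def)
  then show ?case using linf_0[OF 0] by (simp only: lessThan_0 sum.empty)
qed (simp add: trunc_Suc linfD)

text \<open>Adding one coordinate at a time, the functional equation separates the values on the
  axes from the polar form on pairs of unit vectors.\<close>

lemma quad_trunc:
  assumes "bilin b" "\<psi> 0 = 1" "\<And>x y. \<psi> (x + y) = \<psi> x * \<psi> y * \<chi> (b x y)"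
  shows "\<psi> (trunc k x) = (\<Prod>i<k. \<psi> (sc (x i) (uvec i))) * (\<Prod>j<k. \<Prod>i<j. \<chi> (x i * (b (uvec i) (uvec j) * x j)))"
proof (induction k)
  case 0
  have "trunc 0 x = 0" by (simp add: trunc_def zero_fun_def)
  then show ?case by (simp only: assms(2) lessThan_0 prod.empty mult_1)
next
  case (Suc k)
  have "linf (\<lambda>z. b z (uvec k))" using assms(1) by (simp add: bilin_def)
  from linf_trunc[OF this, of k x] have "\<chi> (b (trunc k x) (sc (x k) (uvec k))) = (\<Prod>i<k. \<chi> (x i * (b (uvec i) (uvec k) * x k)))"
    by (simp add: bilinD[OF assms(1)] \<chi>_setsum[symmetric] sum_distrib_left mult_ac)
  then show ?case unfolding trunc_Suc assms(3) Suc lessThan_Suc by (simp add: mult_ac del: sc_apply)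
qed

text \<open>The restrictions to the axes are the one-variable forms, and the polar form on unit
  vectors supplies the mixed coefficients. Thus multiplication by any quadratic character is
  performed by some \<open>d_sub\<close>.\<close>

lemma quad_Phi_n:
  assumes "quad \<psi>"
  shows "\<exists>\<phi>\<in>Phi_n T n. \<forall>v\<in>carrier_vec n. e_QZ (\<phi> v) = \<psi> (join n v 0)"
proof (rule quadE[OF assms])
  fix b assume b: "\<psi> 0 = 1" "bilin b" "\<And>x y. \<psi> (x + y) = \<psi> x * \<psi> y * \<chi> (b x y)"
  have "\<exists>p. p \<in> Phi T \<and> (\<lambda>t. \<psi> (sc t (uvec i))) = (\<lambda>x. e_QZ (p x))" for i
    using quad_line_Q1[OF assms, of "uvec i"] unfolding Q1_eq_Phi[OF adm] by blast
  then obtain p where p: "\<And>i. p i \<in> Phi T" "\<And>i t. \<psi> (sc t (uvec i)) = e_QZ (p i t)" by metis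
  define \<phi> where "\<phi> = (\<lambda>v::'f vec. (\<Sum>i<n. p i (v $ i)) + (\<Sum>j<n. \<Sum>i<j. beta T (v $ i) (b (uvec i) (uvec j) * v $ j)))"
  have "\<phi> \<in> Phi_n T n" unfolding Phi_n_def \<phi>_def mem_Collect_eq
    by (intro exI[of _ p] exI[of _ "\<lambda>i j. b (uvec i) (uvec j)"]) (simp add: p(1))
  moreover have "e_QZ (\<phi> v) = \<psi> (join n v 0)" if "v \<in> carrier_vec n" for v
  proof -
    have "join n v 0 = trunc n (\<lambda>i. v $ i)" by (auto simp: join_def trunc_def)
    then show ?thesis unfolding quad_trunc[OF b(2,1,3)] p(2) \<phi>_def
      by (simp only: quad_trunc[OF b(2,1,3)] p(2) e_QZ_add e_QZ_sum e_QZ_beta)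
  qed
  ultimately show ?thesis by blast
qed

end

section \<open>The generators of the parabolic subgroup: unitarity and action\<close>

lemma invertible_mat_obtain:
  assumes "u \<in> carrier_mat n n" "invertible_mat u"
  obtains u' where "u' \<in> carrier_mat n n" "u * u' = 1\<^sub>m n" "u' * u = 1\<^sub>m n"
proof -
  obtain u' where u': "inverts_mat u u'" "inverts_mat u' u" using assms by (auto simp: invertible_mat_def)
  have "dim_col (u * u') = dim_col (1\<^sub>m n :: 'a mat)" using u'(1) assms(1) by (auto simp: inverts_mat_def)
  then have c: "dim_col u' = n" by simp
  have "dim_col (u' * u) = dim_col (1\<^sub>m (dim_row u') :: 'a mat)" using u'(2) by (simp add: inverts_mat_def)
  then have "dim_row u' = n" using assms(1) by simp
  with c u' assms(1) show ?thesis by (intro that[of u']) (auto simp: inverts_mat_def)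
qed

lemma invertible_matI:
  assumes "u \<in> carrier_mat n n" "u' \<in> carrier_mat n n" "u * u' = 1\<^sub>m n" "u' * u = 1\<^sub>m n"
  shows "invertible_mat u"
  using assms unfolding invertible_mat_def inverts_mat_def square_mat.simps by auto

lemma mat_inverse_vec:
  fixes u u' :: "'a::comm_ring_1 mat"
  assumes "u \<in> carrier_mat n n" "u' \<in> carrier_mat n n" "u' * u = 1\<^sub>m n" "v \<in> carrier_vec n"
  shows "u' *\<^sub>v (u *\<^sub>v v) = v"
  unfolding assoc_mult_mat_vec[OF assms(2,1,4), symmetric] assms(3) by (rule one_mult_mat_vec[OF assms(4)])

lemma m_sub_carrier: "u \<in> carrier_mat n n \<Longrightarrow> m_sub n u \<in> carrier (subst_monoid n)"
  by (auto simp: subst_monoid_simps m_sub_def)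

lemma m_sub_mult:
  assumes "u \<in> carrier_mat n n" "u' \<in> carrier_mat n n" "u' * u = 1\<^sub>m n"
  shows "m_sub n u \<otimes>\<^bsub>subst_monoid n\<^esub> m_sub n u' = \<one>\<^bsub>subst_monoid n\<^esub>"
proof (intro ext)
  fix v w
  have "(m_sub n u \<otimes>\<^bsub>subst_monoid n\<^esub> m_sub n u') v w =
      (\<Sum>z\<in>carrier_vec n. if z = u *\<^sub>v v then (if v \<in> carrier_vec n \<and> w = u' *\<^sub>v (u *\<^sub>v v) then 1 else 0) else 0)"
    unfolding subst_monoid_simps m_sub_def by (rule sum.cong[OF refl]) auto
  also have "\<dots> = \<one>\<^bsub>subst_monoid n\<^esub> v w"
    using assms mat_inverse_vec[OF assms] by (auto simp: subst_monoid_simps)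
  finally show "(m_sub n u \<otimes>\<^bsub>subst_monoid n\<^esub> m_sub n u') v w = \<one>\<^bsub>subst_monoid n\<^esub> v w" .
qed

lemma adj_m_sub:
  assumes "u \<in> carrier_mat n n" "u' \<in> carrier_mat n n" "u * u' = 1\<^sub>m n" "u' * u = 1\<^sub>m n"
  shows "adj (m_sub n u) = m_sub n u'"
  using assms mat_inverse_vec[of u n u'] mat_inverse_vec[of u' n u]
  by (auto simp: adj_def m_sub_def fun_eq_iff)

lemma unitary_m_sub:
  assumes "u \<in> carrier_mat n n" "invertible_mat u"
  shows "unitary n (m_sub n u)"
proof -
  obtain u' where u': "u' \<in> carrier_mat n n" "u * u' = 1\<^sub>m n" "u' * u = 1\<^sub>m n"
    using invertible_mat_obtain[OF assms] by blast
  show ?thesis using assms u' by (simp add: unitary_def m_sub_carrier adj_m_sub[of u n u'] m_sub_mult)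
qed

text \<open>The substitution moves the coefficient at v to u v, so the new coefficient at x is the
  old one at the preimage, and the inverse matrix appears.\<close>

lemma act_m_sub:
  assumes "u \<in> carrier_mat n n" "u' \<in> carrier_mat n n" "u * u' = 1\<^sub>m n" "u' * u = 1\<^sub>m n"
  shows "act n (m_sub n u) s x = s (join n (u' *\<^sub>v vec n x) x)"
proof -
  have "vec n x = u *\<^sub>v v \<longleftrightarrow> v = u' *\<^sub>v vec n x" if "v \<in> carrier_vec n" for v
    using mat_inverse_vec[OF assms(1,2,4) that] mat_inverse_vec[OF assms(2,1,3), of "vec n x"] by auto
  then have "act n (m_sub n u) s x = (\<Sum>v\<in>carrier_vec n. if v = u' *\<^sub>v vec n x then s (join n v x) else 0)"
    unfolding act_def m_sub_def by (intro sum.cong) auto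
  also have "\<dots> = s (join n (u' *\<^sub>v vec n x) x)" using assms(2) by simp
  finally show ?thesis .
qed

lemma unitary_d_sub: "unitary n (d_sub n \<phi>)"
proof -
  have c: "d_sub n \<phi> \<in> carrier (subst_monoid n)" by (auto simp: subst_monoid_simps d_sub_def)
  have e: "e_QZ r * cnj (e_QZ r) = 1" for r by (simp add: complex_norm_square[symmetric])
  have "(\<Sum>u\<in>carrier_vec n. d_sub n \<phi> v u * cnj (d_sub n \<phi> w u)) = (if v \<in> carrier_vec n \<and> w = v then 1 else 0)" for v w
  proof -
    have "(\<Sum>u\<in>carrier_vec n. d_sub n \<phi> v u * cnj (d_sub n \<phi> w u)) =
        (\<Sum>u\<in>carrier_vec n. if u = v then (if w = v then 1 else 0) else 0)"
      by (rule sum.cong) (auto simp: d_sub_def e)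
    then show ?thesis by simp
  qed
  moreover have "(\<Sum>u\<in>carrier_vec n. cnj (d_sub n \<phi> u v) * d_sub n \<phi> u w) = (if v \<in> carrier_vec n \<and> w = v then 1 else 0)" for v w
  proof -
    have "(\<Sum>u\<in>carrier_vec n. cnj (d_sub n \<phi> u v) * d_sub n \<phi> u w) =
        (\<Sum>u\<in>carrier_vec n. if u = v then (if w = v then 1 else 0) else 0)"
      by (rule sum.cong) (auto simp: d_sub_def e mult.commute[of "cnj _"])
    then show ?thesis by simp
  qed
  ultimately show ?thesis using c by (simp add: unitary_def adj_def subst_monoid_simps)
qed

lemma act_d_sub: "act n (d_sub n \<phi>) s x = s x * e_QZ (\<phi> (vec n x))"
proof -
  have "act n (d_sub n \<phi>) s x = (\<Sum>v\<in>carrier_vec n. if v = vec n x then s (join n v x) * e_QZ (\<phi> v) else 0)"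
    unfolding act_def d_sub_def by (rule sum.cong) auto
  then show ?thesis by simp
qed

lemma act_adj_d_sub: "act n (adj (d_sub n \<phi>)) s x = s x * cnj (e_QZ (\<phi> (vec n x)))"
proof -
  have "act n (adj (d_sub n \<phi>)) s x = (\<Sum>v\<in>carrier_vec n. if v = vec n x then s (join n v x) * cnj (e_QZ (\<phi> v)) else 0)"
    unfolding act_def d_sub_def adj_def by (rule sum.cong) auto
  then show ?thesis by simp
qed

section \<open>Partial Fourier transforms attached to symmetric idempotents\<close>

locale sym_idem =
  fixes n :: nat and \<iota> u v :: "'f::{finite,field} mat"
  assumes sym_idem: "symmetric_idempotent n \<iota> u v"
begin

lemma carriers [simp]: "\<iota> \<in> carrier_mat n n" "u \<in> carrier_mat n n" "v \<in> carrier_mat n n"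
  using sym_idem by (auto simp: symmetric_idempotent_def intro!: mult_carrier_mat[of _ n n _ n])

lemma dims [simp]: "dim_row \<iota> = n" "dim_col \<iota> = n" "dim_row u = n" "dim_col u = n" "dim_row v = n" "dim_col v = n"
  using carrier_matD[OF carriers(1)] carrier_matD[OF carriers(2)] carrier_matD[OF carriers(3)] by auto

lemma idem: "\<iota> * \<iota> = \<iota>" "u * v = \<iota>" "v * u = transpose_mat \<iota>"
  using sym_idem by (auto simp: symmetric_idempotent_def)

lemma absorb: "transpose_mat \<iota> * v = v" "v * \<iota> = v"
proof -
  obtain M where M: "M \<in> carrier_mat n n" "v = transpose_mat \<iota> * M * \<iota>"
    using sym_idem by (auto simp: symmetric_idempotent_def)
  have t: "transpose_mat \<iota> * transpose_mat \<iota> = transpose_mat \<iota>"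
    using transpose_mult[of \<iota> n n \<iota> n] by (simp add: idem)
  have c: "transpose_mat \<iota> * M \<in> carrier_mat n n" using M(1) by (simp add: mult_carrier_mat[of _ n n])
  show "transpose_mat \<iota> * v = v" unfolding M(2)
    using M(1) c t assoc_mult_mat[of "transpose_mat \<iota>" n n "transpose_mat \<iota>" n M n]
      assoc_mult_mat[of "transpose_mat \<iota>" n n "transpose_mat \<iota> * M" n \<iota> n] by simp
  show "v * \<iota> = v" unfolding M(2)
    using M(1) c idem(1) assoc_mult_mat[of "transpose_mat \<iota> * M" n n \<iota> n \<iota> n] by simp
qed

lemma vec_carriers [simp]: "x \<in> carrier_vec n \<Longrightarrow> \<iota> *\<^sub>v x \<in> carrier_vec n" "x \<in> carrier_vec n \<Longrightarrow> v *\<^sub>v x \<in> carrier_vec n"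
  by (auto intro: mult_mat_vec_carrier[of _ n n])

abbreviation "W \<equiv> mat_image n \<iota>"

lemma W_iff: "w \<in> W \<longleftrightarrow> w \<in> carrier_vec n \<and> \<iota> *\<^sub>v w = w"
  using assoc_mult_mat_vec[of \<iota> n n \<iota> n] idem(1) unfolding mat_image_def by (auto simp: image_iff intro: sym)

lemma \<iota>_in_W: "x \<in> carrier_vec n \<Longrightarrow> \<iota> *\<^sub>v x \<in> W"
  unfolding mat_image_def by blast

lemma finite_W [simp]: "finite W"
  by (simp add: mat_image_def)

lemma W_0: "0\<^sub>v n \<in> W"
  by (auto simp: W_iff scalar_prod_def intro!: eq_vecI)

lemma card_W: "card W > 0"
  using W_0 by (auto simp: card_gt_0_iff)

lemma W_add: "a \<in> W \<Longrightarrow> b \<in> W \<Longrightarrow> a + b \<in> W" and W_smult: "a \<in> W \<Longrightarrow> c \<cdot>\<^sub>v a \<in> W"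
  and W_diff: "a \<in> W \<Longrightarrow> b \<in> W \<Longrightarrow> a - b \<in> W"
  by (auto simp: W_iff mult_add_distrib_mat_vec[of _ n n] mult_mat_vec[of _ n n] mult_minus_distrib_mat_vec[of _ n n])

lemma complement: "x \<in> carrier_vec n \<Longrightarrow> (1\<^sub>m n - \<iota>) *\<^sub>v x = x - \<iota> *\<^sub>v x"
  by (subst minus_mult_distrib_mat_vec[of _ n n]) auto

lemma \<iota>_complement: "x \<in> carrier_vec n \<Longrightarrow> \<iota> *\<^sub>v (x - \<iota> *\<^sub>v x) = 0\<^sub>v n"
  using assoc_mult_mat_vec[of \<iota> n n \<iota> n x] idem(1) by (auto simp: mult_minus_distrib_mat_vec[of _ n n])

text \<open>Decomposing vectors into image and kernel of the idempotent: x reaches z exactly if both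
  have the same kernel part, and then w is the image part of z. This reduces the sum in
  \<open>h_sub\<close> to one term per matrix entry.\<close>

lemma fibre_iff:
  assumes "x \<in> carrier_vec n" "z \<in> carrier_vec n"
  shows "(w \<in> W \<and> z = (1\<^sub>m n - \<iota>) *\<^sub>v x + w) \<longleftrightarrow> (x - \<iota> *\<^sub>v x = z - \<iota> *\<^sub>v z \<and> w = \<iota> *\<^sub>v z)"
proof
  assume "w \<in> W \<and> z = (1\<^sub>m n - \<iota>) *\<^sub>v x + w"
  then have w: "w \<in> W" and z: "z = (x - \<iota> *\<^sub>v x) + w" using complement[OF assms(1)] by auto
  have wc: "w \<in> carrier_vec n" "\<iota> *\<^sub>v w = w" using w by (auto simp: W_iff)
  have "\<iota> *\<^sub>v z = w"
    unfolding z using assms wc by (simp add: mult_add_distrib_mat_vec[of _ n n] \<iota>_complement)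
  then show "x - \<iota> *\<^sub>v x = z - \<iota> *\<^sub>v z \<and> w = \<iota> *\<^sub>v z"
    using assms wc by (auto simp: z intro!: eq_vecI)
next
  assume a: "x - \<iota> *\<^sub>v x = z - \<iota> *\<^sub>v z \<and> w = \<iota> *\<^sub>v z"
  have "z = (z - \<iota> *\<^sub>v z) + \<iota> *\<^sub>v z" using assms vec_carriers(1)[OF assms(2)] by (intro eq_vecI) auto
  then show "w \<in> W \<and> z = (1\<^sub>m n - \<iota>) *\<^sub>v x + w"
    using a assms by (simp add: complement \<iota>_in_W)
qed

end

context code_setup
begin

lemma h_sub_eq:
  fixes \<iota> u v :: "'f mat"
  assumes s: "sym_idem n \<iota> u v" and "x \<in> carrier_vec n" "z \<in> carrier_vec n"
  shows "h_sub T n \<iota> v x z =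
    (if x - \<iota> *\<^sub>v x = z - \<iota> *\<^sub>v z then \<chi> ((\<iota> *\<^sub>v z) \<bullet> (v *\<^sub>v x)) / of_real (sqrt (real (card (mat_image n \<iota>)))) else 0)"
proof -
  interpret sym_idem n \<iota> u v by (rule s)
  have "(\<Sum>w\<in>W. if z = (1\<^sub>m n - \<iota>) *\<^sub>v x + w then e_QZ (beta_n T n w (v *\<^sub>v x)) else 0) =
      (\<Sum>w\<in>W. if w = \<iota> *\<^sub>v z then (if x - \<iota> *\<^sub>v x = z - \<iota> *\<^sub>v z then \<chi> ((\<iota> *\<^sub>v z) \<bullet> (v *\<^sub>v x)) else 0) else 0)"
  proof (rule sum.cong[OF refl])
    fix w assume w: "w \<in> W"
    then have "e_QZ (beta_n T n w (v *\<^sub>v x)) = \<chi> (w \<bullet> (v *\<^sub>v x))"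
      using assms by (intro e_QZ_beta_n) (auto simp: W_iff)
    then show "(if z = (1\<^sub>m n - \<iota>) *\<^sub>v x + w then e_QZ (beta_n T n w (v *\<^sub>v x)) else 0) =
      (if w = \<iota> *\<^sub>v z then (if x - \<iota> *\<^sub>v x = z - \<iota> *\<^sub>v z then \<chi> ((\<iota> *\<^sub>v z) \<bullet> (v *\<^sub>v x)) else 0) else 0)"
      using fibre_iff[OF assms(2,3), of w] w by auto
  qed
  also have "\<dots> = (if x - \<iota> *\<^sub>v x = z - \<iota> *\<^sub>v z then \<chi> ((\<iota> *\<^sub>v z) \<bullet> (v *\<^sub>v x)) else 0)"
    using \<iota>_in_W[OF assms(3)] by simp
  finally show ?thesis using assms by (simp add: h_sub_def)
qed

lemma h_sub_carrier:
  fixes \<iota> u v :: "'f mat"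
  assumes s: "sym_idem n \<iota> u v"
  shows "h_sub T n \<iota> v \<in> carrier (subst_monoid n)"
proof -
  interpret sym_idem n \<iota> u v by (rule s)
  have "h_sub T n \<iota> v x z = 0" if "z \<notin> carrier_vec n" for x z
  proof (cases "x \<in> carrier_vec n")
    case True
    have "z \<noteq> (1\<^sub>m n - \<iota>) *\<^sub>v x + w" if "w \<in> W" for w
      using that True \<open>z \<notin> carrier_vec n\<close> complement[OF True] by (auto simp: W_iff)
    then show ?thesis by (simp add: h_sub_def)
  qed (simp add: h_sub_def)
  moreover have "h_sub T n \<iota> v x z = 0" if "x \<notin> carrier_vec n" for x z
    using that by (simp add: h_sub_def)
  ultimately show ?thesis by (auto simp: subst_monoid_simps)
qed

lemma sum_fibre:
  fixes \<iota> u v :: "'f mat"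
  assumes s: "sym_idem n \<iota> u v" and "x \<in> carrier_vec n"
  shows "(\<Sum>z\<in>carrier_vec n. if x - \<iota> *\<^sub>v x = z - \<iota> *\<^sub>v z then G z else (0::complex)) =
    (\<Sum>w\<in>mat_image n \<iota>. G ((x - \<iota> *\<^sub>v x) + w))"
proof -
  interpret sym_idem n \<iota> u v by (rule s)
  have "(\<Sum>z\<in>carrier_vec n. if x - \<iota> *\<^sub>v x = z - \<iota> *\<^sub>v z then G z else 0) =
      (\<Sum>z\<in>{z \<in> carrier_vec n. x - \<iota> *\<^sub>v x = z - \<iota> *\<^sub>v z}. G z)"
    by (simp add: sum.inter_filter)
  also have "\<dots> = (\<Sum>w\<in>W. G ((x - \<iota> *\<^sub>v x) + w))"
  proof (rule sum.reindex_bij_witness[of _ "\<lambda>w. (x - \<iota> *\<^sub>v x) + w" "\<lambda>z. \<iota> *\<^sub>v z"])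
    fix z assume "z \<in> {z \<in> carrier_vec n. x - \<iota> *\<^sub>v x = z - \<iota> *\<^sub>v z}"
    then show "x - \<iota> *\<^sub>v x + \<iota> *\<^sub>v z = z" "\<iota> *\<^sub>v z \<in> W" "G (x - \<iota> *\<^sub>v x + \<iota> *\<^sub>v z) = G z"
      using fibre_iff[OF assms(2), of z "\<iota> *\<^sub>v z"] complement[OF assms(2)] by auto
  next
    fix w assume w: "w \<in> W"
    then have c: "x - \<iota> *\<^sub>v x + w \<in> carrier_vec n" using assms by (auto simp: W_iff)
    show "\<iota> *\<^sub>v (x - \<iota> *\<^sub>v x + w) = w" "x - \<iota> *\<^sub>v x + w \<in> {z \<in> carrier_vec n. x - \<iota> *\<^sub>v x = z - \<iota> *\<^sub>v z}"
      using fibre_iff[OF assms(2) c, of w] complement[OF assms(2)] w c by auto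
  qed
  finally show ?thesis .
qed

text \<open>Translation by a suitable multiple of w0 permutes W and multiplies the sum by a number
  other than 1.\<close>

lemma sum_\<chi>_W:
  fixes \<iota> u v :: "'f mat"
  assumes s: "sym_idem n \<iota> u v" and y: "y \<in> carrier_vec n" "w0 \<in> mat_image n \<iota>" "w0 \<bullet> y \<noteq> 0"
  shows "(\<Sum>w\<in>mat_image n \<iota>. \<chi> (w \<bullet> y)) = 0"
proof -
  interpret sym_idem n \<iota> u v by (rule s)
  obtain t where t: "\<chi> (t * (w0 \<bullet> y)) \<noteq> 1" using \<chi>_eq_1_imp_0 y(3) by blast
  let ?w = "t \<cdot>\<^sub>v w0"
  have w: "?w \<in> W" "?w \<in> carrier_vec n" using W_smult[OF y(2)] by (auto simp: W_iff)
  have ne: "\<chi> (?w \<bullet> y) \<noteq> 1" using t y by (simp add: W_iff)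
  have "(\<Sum>z\<in>W. \<chi> (z \<bullet> y)) = (\<Sum>z\<in>W. \<chi> ((?w + z) \<bullet> y))"
  proof (rule sum.reindex_bij_witness[of _ "\<lambda>z. ?w + z" "\<lambda>z. z - ?w"])
    fix z assume z: "z \<in> W"
    then have zc: "z \<in> carrier_vec n" by (simp add: W_iff)
    show "?w + (z - ?w) = z" "?w + z - ?w = z" using zc w(2) by (auto intro!: eq_vecI)
    then show "\<chi> ((?w + (z - ?w)) \<bullet> y) = \<chi> (z \<bullet> y)" by simp
    show "z - ?w \<in> W" "?w + z \<in> W" using w z by (auto intro: W_add W_diff)
  qed
  also have "\<dots> = (\<Sum>z\<in>W. \<chi> (?w \<bullet> y) * \<chi> (z \<bullet> y))"
    by (rule sum.cong) (use w y in \<open>auto simp: W_iff add_scalar_prod_distrib[of _ n] \<chi>_add\<close>)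
  also have "\<dots> = \<chi> (?w \<bullet> y) * (\<Sum>z\<in>W. \<chi> (z \<bullet> y))" by (simp add: sum_distrib_left)
  finally show ?thesis using ne by (metis mult_cancel_right1)
qed

text \<open>Orthogonality of characters: rows x and y overlap only if they agree modulo W, and the
  sum over W vanishes unless W is orthogonal to v (x - y). In that case v (x - y) = 0, and applying
  u gives x = y since u v is the identity on W.\<close>

lemma h_sub_mult_adj:
  fixes \<iota> u v :: "'f mat"
  assumes s: "sym_idem n \<iota> u v"
  shows "h_sub T n \<iota> v \<otimes>\<^bsub>subst_monoid n\<^esub> adj (h_sub T n \<iota> v) = \<one>\<^bsub>subst_monoid n\<^esub>"
proof (intro ext)
  interpret sym_idem n \<iota> u v by (rule s)
  fix x y
  let ?r = "complex_of_real (sqrt (real (card W)))"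
  have rr: "?r * ?r = of_nat (card W)" by (simp flip: of_real_mult)
  have r: "cnj ?r = ?r" "?r \<noteq> 0" using card_W by auto
  show "(h_sub T n \<iota> v \<otimes>\<^bsub>subst_monoid n\<^esub> adj (h_sub T n \<iota> v)) x y = \<one>\<^bsub>subst_monoid n\<^esub> x y"
  proof (cases "x \<in> carrier_vec n \<and> y \<in> carrier_vec n")
    case False
    then show ?thesis using h_sub_carrier[OF s] by (auto simp: subst_monoid_simps adj_def)
  next
    case True
    then have xy: "x \<in> carrier_vec n" "y \<in> carrier_vec n" by auto
    have d: "x - y \<in> carrier_vec n" using xy by simp
    have "(h_sub T n \<iota> v \<otimes>\<^bsub>subst_monoid n\<^esub> adj (h_sub T n \<iota> v)) x y =
        (\<Sum>z\<in>carrier_vec n. if x - \<iota> *\<^sub>v x = z - \<iota> *\<^sub>v z then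
          (if x - \<iota> *\<^sub>v x = y - \<iota> *\<^sub>v y then \<chi> ((\<iota> *\<^sub>v z) \<bullet> (v *\<^sub>v (x - y))) / of_nat (card W) else 0) else 0)"
      unfolding subst_monoid_simps
    proof (rule sum.cong[OF refl])
      fix z :: "'f vec" assume z: "z \<in> carrier_vec n"
      have "(\<iota> *\<^sub>v z) \<bullet> (v *\<^sub>v (x - y)) = (\<iota> *\<^sub>v z) \<bullet> (v *\<^sub>v x) - (\<iota> *\<^sub>v z) \<bullet> (v *\<^sub>v y)"
        using xy z by (simp add: mult_minus_distrib_mat_vec[of _ n n] scalar_prod_minus_distrib[of _ n])
      then show "h_sub T n \<iota> v x z * adj (h_sub T n \<iota> v) z y = (if x - \<iota> *\<^sub>v x = z - \<iota> *\<^sub>v z then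
          (if x - \<iota> *\<^sub>v x = y - \<iota> *\<^sub>v y then \<chi> ((\<iota> *\<^sub>v z) \<bullet> (v *\<^sub>v (x - y))) / of_nat (card W) else 0) else 0)"
        using h_sub_eq[OF s xy(1) z] h_sub_eq[OF s xy(2) z]
        by (auto simp: adj_def \<chi>_diff rr[symmetric] r)
    qed
    also have "\<dots> = (if x - \<iota> *\<^sub>v x = y - \<iota> *\<^sub>v y then (\<Sum>w\<in>W. \<chi> (w \<bullet> (v *\<^sub>v (x - y)))) / of_nat (card W) else 0)"
    proof -
      have e: "\<iota> *\<^sub>v (x - \<iota> *\<^sub>v x + w) = w" if "w \<in> W" for w
        using that xy by (auto simp: W_iff mult_add_distrib_mat_vec[of _ n n] \<iota>_complement)
      show ?thesis
      proof (cases "x - \<iota> *\<^sub>v x = y - \<iota> *\<^sub>v y")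
        case True
        show ?thesis unfolding sum_fibre[OF s xy(1)] sum_divide_distrib if_P[OF True]
          by (rule sum.cong[OF refl]) (simp only: e)
      next
        case False
        show ?thesis unfolding sum_fibre[OF s xy(1)] if_not_P[OF False] by simp
      qed
    qed
    also have "\<dots> = \<one>\<^bsub>subst_monoid n\<^esub> x y"
    proof (cases "x = y")
      case True
      have "v *\<^sub>v (x - y) = 0\<^sub>v n" using True xy by (auto intro!: eq_vecI)
      then have "(\<Sum>w\<in>W. \<chi> (w \<bullet> (v *\<^sub>v (x - y)))) = of_nat (card W)" by (simp add: W_iff)
      then show ?thesis using True xy W_0 by (auto simp: subst_monoid_simps)
    next
      case False
      show ?thesis
      proof (cases "x - \<iota> *\<^sub>v x = y - \<iota> *\<^sub>v y")
        case eq: True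
        have \<iota>d: "\<iota> *\<^sub>v (x - y) = x - y"
        proof (rule eq_vecI)
          fix i assume i: "i < dim_vec (x - y)"
          have "(x - \<iota> *\<^sub>v x) $ i = (y - \<iota> *\<^sub>v y) $ i" using eq by simp
          then have "x $ i - (\<iota> *\<^sub>v x) $ i = y $ i - (\<iota> *\<^sub>v y) $ i"
            using i xy vec_carriers(1)[OF xy(1)] vec_carriers(1)[OF xy(2)] by auto
          then show "(\<iota> *\<^sub>v (x - y)) $ i = (x - y) $ i"
            using i xy vec_carriers(1)[OF xy(1)] vec_carriers(1)[OF xy(2)]
            by (simp add: mult_minus_distrib_mat_vec[of _ n n] algebra_simps)
        qed (use d xy in auto)
        have "\<exists>w\<in>W. w \<bullet> (v *\<^sub>v (x - y)) \<noteq> 0"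
        proof (rule ccontr)
          assume "\<not> ?thesis"
          then have z: "(\<iota> *\<^sub>v z) \<bullet> (v *\<^sub>v (x - y)) = 0" if "z \<in> carrier_vec n" for z using \<iota>_in_W[OF that] by blast
          have "v *\<^sub>v (x - y) = 0\<^sub>v n"
          proof (rule scalar_prod_all_eq_0)
            fix z :: "'f vec" assume zc: "z \<in> carrier_vec n"
            have "transpose_mat \<iota> *\<^sub>v (v *\<^sub>v (x - y)) = v *\<^sub>v (x - y)"
              using assoc_mult_mat_vec[of "transpose_mat \<iota>" n n v n "x - y"] d by (simp add: absorb)
            then show "z \<bullet> (v *\<^sub>v (x - y)) = 0"
              using z[OF zc] scalar_prod_transpose[of \<iota> n n z "v *\<^sub>v (x - y)"] zc d by simp
          qed (use d in simp)
          moreover have "u *\<^sub>v (v *\<^sub>v (x - y)) = x - y"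
            using assoc_mult_mat_vec[of u n n v n "x - y"] d \<iota>d by (simp add: idem)
          ultimately have "x - y = u *\<^sub>v 0\<^sub>v n" by simp
          then have "x - y = 0\<^sub>v n" by (auto intro!: eq_vecI)
          then have d0: "(x - y) $ i = 0" if "i < n" for i using that by simp
          have "x = y"
          proof (rule eq_vecI)
            fix i assume "i < dim_vec y"
            then show "x $ i = y $ i" using d0[of i] xy by auto
          qed (use xy in auto)
          with False show False by simp
        qed
        then obtain w0 where "w0 \<in> W" "w0 \<bullet> (v *\<^sub>v (x - y)) \<noteq> 0" by blast
        from sum_\<chi>_W[OF s _ this] show ?thesis using d False by (auto simp: subst_monoid_simps)
      qed (use False in \<open>auto simp: subst_monoid_simps\<close>)
    qed
    finally show ?thesis .
  qed
qed

text \<open>Conjugation negates the argument of \<chi> and transposition exchanges the two entries,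
  so the adjoint should be the transform with - v^T in place of v. The same idempotent admits this
  second pair of matrices.\<close>

lemma sym_idem_adj:
  fixes \<iota> u v :: "'f mat"
  assumes s: "sym_idem n \<iota> u v"
  shows "sym_idem n \<iota> (- transpose_mat u) (- transpose_mat v)"
proof -
  interpret sym_idem n \<iota> u v by (rule s)
  obtain M where M: "M \<in> carrier_mat n n" "v = transpose_mat \<iota> * M * \<iota>"
    using sym_idem by (auto simp: symmetric_idempotent_def)
  obtain M' where M': "M' \<in> carrier_mat n n" "u = \<iota> * M' * transpose_mat \<iota>"
    using sym_idem by (auto simp: symmetric_idempotent_def)
  have um: "- (A * B) = A * (- B)" "- (A * B) = (- A) * B" if "A \<in> carrier_mat n n" "B \<in> carrier_mat n n" for A B :: "'f mat"
    using that by (auto intro!: eq_matI simp: scalar_prod_def sum_negf)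
  have neg3: "- (A * (B * C)) = A * (- B) * C"
    if "A \<in> carrier_mat n n" "B \<in> carrier_mat n n" "C \<in> carrier_mat n n" for A B C :: "'f mat"
  proof -
    have "- (A * (B * C)) = A * (- (B * C))" using that by (intro um(1)) (auto intro: mult_carrier_mat)
    also have "\<dots> = A * ((- B) * C)" using um(2)[OF that(2,3)] by simp
    also have "\<dots> = A * (- B) * C" using that by (intro assoc_mult_mat[symmetric]) auto
    finally show ?thesis .
  qed
  have "transpose_mat v = transpose_mat \<iota> * (transpose_mat M * \<iota>)"
    unfolding M(2) using M(1) transpose_mult[of "transpose_mat \<iota> * M" n n \<iota> n] transpose_mult[of "transpose_mat \<iota>" n n M n]
    by (simp add: mult_carrier_mat[of _ n n])
  then have v': "- transpose_mat v = transpose_mat \<iota> * (- transpose_mat M) * \<iota>"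
    using M(1) by (simp only:) (intro neg3, auto)
  have "transpose_mat u = \<iota> * (transpose_mat M' * transpose_mat \<iota>)"
    unfolding M'(2) using M'(1) transpose_mult[of "\<iota> * M'" n n "transpose_mat \<iota>" n] transpose_mult[of \<iota> n n M' n]
    by (simp add: mult_carrier_mat[of _ n n])
  then have u': "- transpose_mat u = \<iota> * (- transpose_mat M') * transpose_mat \<iota>"
    using M'(1) by (simp only:) (intro neg3, auto)
  have um2: "(- A) * (- B) = A * B" if "A \<in> carrier_mat n n" "B \<in> carrier_mat n n" for A B :: "'f mat"
    using that by (auto intro!: eq_matI simp: scalar_prod_def)
  have "(- transpose_mat u) * (- transpose_mat v) = transpose_mat u * transpose_mat v"
    by (rule um2) auto
  also have "\<dots> = \<iota>" using transpose_mult[of v n n u n] by (simp add: idem)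
  finally have 1: "\<iota> = (- transpose_mat u) * (- transpose_mat v)" by simp
  have "(- transpose_mat v) * (- transpose_mat u) = transpose_mat v * transpose_mat u"
    by (rule um2) auto
  also have "\<dots> = transpose_mat \<iota>" using transpose_mult[of u n n v n] by (simp add: idem)
  finally have 2: "(- transpose_mat v) * (- transpose_mat u) = transpose_mat \<iota>" .
  show ?thesis
    unfolding sym_idem_def symmetric_idempotent_def
  proof (intro conjI)
    show "- transpose_mat u \<in> {\<iota> * M * transpose_mat \<iota> | M. M \<in> carrier_mat n n}"
      using u' M'(1) by (intro CollectI exI[of _ "- transpose_mat M'"] conjI) auto
    show "- transpose_mat v \<in> {transpose_mat \<iota> * M * \<iota> | M. M \<in> carrier_mat n n}"
      using v' M(1) by (intro CollectI exI[of _ "- transpose_mat M"] conjI) auto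
  qed (fact 1 2 idem carriers)+
qed

lemma adj_h_sub:
  fixes \<iota> u v :: "'f mat"
  assumes s: "sym_idem n \<iota> u v"
  shows "adj (h_sub T n \<iota> v) = h_sub T n \<iota> (- transpose_mat v)"
proof (intro ext)
  interpret sym_idem n \<iota> u v by (rule s)
  note s' = sym_idem_adj[OF s]
  fix x z
  show "adj (h_sub T n \<iota> v) x z = h_sub T n \<iota> (- transpose_mat v) x z"
  proof (cases "x \<in> carrier_vec n \<and> z \<in> carrier_vec n")
    case False
    then show ?thesis using h_sub_carrier[OF s] h_sub_carrier[OF s'] by (auto simp: subst_monoid_simps adj_def)
  next
    case True
    then have xz: "x \<in> carrier_vec n" "z \<in> carrier_vec n" by auto
    have tv: "transpose_mat v *\<^sub>v x \<in> carrier_vec n" using xz by (auto intro: mult_mat_vec_carrier[of _ n n])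
    have "transpose_mat \<iota> * transpose_mat v = transpose_mat v"
      using transpose_mult[of v n n \<iota> n] by (simp add: absorb)
    then have a: "(\<iota> *\<^sub>v z) \<bullet> (transpose_mat v *\<^sub>v x) = z \<bullet> (transpose_mat v *\<^sub>v x)"
      using scalar_prod_transpose[of \<iota> n n z "transpose_mat v *\<^sub>v x"] tv xz
        assoc_mult_mat_vec[of "transpose_mat \<iota>" n n "transpose_mat v" n x] by simp
    have "transpose_mat \<iota> *\<^sub>v (v *\<^sub>v z) = v *\<^sub>v z"
      using assoc_mult_mat_vec[of "transpose_mat \<iota>" n n v n z] xz by (simp add: absorb)
    then have "(\<iota> *\<^sub>v x) \<bullet> (v *\<^sub>v z) = x \<bullet> (v *\<^sub>v z)"
      using scalar_prod_transpose[of \<iota> n n x "v *\<^sub>v z"] xz by simp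
    also have "\<dots> = (v *\<^sub>v z) \<bullet> x" using xz by (intro comm_scalar_prod[of _ n]) auto
    also have "\<dots> = z \<bullet> (transpose_mat v *\<^sub>v x)" using xz by (intro scalar_prod_transpose[of v n n]) auto
    finally have b: "(\<iota> *\<^sub>v x) \<bullet> (v *\<^sub>v z) = z \<bullet> (transpose_mat v *\<^sub>v x)" .
    have "(\<iota> *\<^sub>v z) \<bullet> ((- transpose_mat v) *\<^sub>v x) = - ((\<iota> *\<^sub>v z) \<bullet> (transpose_mat v *\<^sub>v x))"
      using xz tv by (simp add: scalar_prod_uminus_right)
    then have "cnj (\<chi> ((\<iota> *\<^sub>v x) \<bullet> (v *\<^sub>v z))) = \<chi> ((\<iota> *\<^sub>v z) \<bullet> ((- transpose_mat v) *\<^sub>v x))"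
      by (simp add: a b \<chi>_minus)
    then show ?thesis
      using h_sub_eq[OF s xz(2,1)] h_sub_eq[OF s' xz] by (auto simp: adj_def)
  qed
qed

text \<open>The adjoint is again of the form \<open>h_sub\<close>, so the identity for the product
  in one order, applied to the adjoint, gives the other order.\<close>

lemma unitary_h_sub:
  fixes \<iota> u v :: "'f mat"
  assumes s: "sym_idem n \<iota> u v"
  shows "unitary n (h_sub T n \<iota> v)"
proof -
  have "adj (h_sub T n \<iota> (- transpose_mat v)) = h_sub T n \<iota> v"
    using adj_h_sub[OF s] by (metis adj_adj)
  then show ?thesis
    using h_sub_mult_adj[OF s] h_sub_mult_adj[OF sym_idem_adj[OF s]] h_sub_carrier[OF s] adj_h_sub[OF s]
    by (simp add: unitary_def)
qed

lemma act_h_sub_eq: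
  fixes \<iota> u v :: "'f mat"
  assumes s: "sym_idem n \<iota> u v"
  shows "act n (h_sub T n \<iota> v) s x = (\<Sum>w\<in>mat_image n \<iota>. s (join n (vec n x - \<iota> *\<^sub>v vec n x + w) x) *
    \<chi> ((\<iota> *\<^sub>v vec n x) \<bullet> (v *\<^sub>v w)) / of_real (sqrt (real (card (mat_image n \<iota>)))))"
proof -
  interpret sym_idem n \<iota> u v by (rule s)
  let ?z = "vec n x" and ?r = "complex_of_real (sqrt (real (card W)))"
  have z: "?z \<in> carrier_vec n" by simp
  have "act n (h_sub T n \<iota> v) s x = (\<Sum>y\<in>carrier_vec n. if ?z - \<iota> *\<^sub>v ?z = y - \<iota> *\<^sub>v y then
      s (join n y x) * \<chi> ((\<iota> *\<^sub>v ?z) \<bullet> (v *\<^sub>v y)) / ?r else 0)"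
    unfolding act_def by (rule sum.cong[OF refl]) (auto simp: h_sub_eq[OF s _ z])
  also have "\<dots> = (\<Sum>w\<in>W. s (join n (?z - \<iota> *\<^sub>v ?z + w) x) * \<chi> ((\<iota> *\<^sub>v ?z) \<bullet> (v *\<^sub>v (?z - \<iota> *\<^sub>v ?z + w))) / ?r)"
    by (rule sum_fibre[OF s z])
  also have "\<dots> = (\<Sum>w\<in>W. s (join n (?z - \<iota> *\<^sub>v ?z + w) x) * \<chi> ((\<iota> *\<^sub>v ?z) \<bullet> (v *\<^sub>v w)) / ?r)"
  proof (rule sum.cong[OF refl])
    fix w assume w: "w \<in> W"
    then have wc: "w \<in> carrier_vec n" by (auto simp: W_iff)
    have "v *\<^sub>v (?z - \<iota> *\<^sub>v ?z) = 0\<^sub>v n"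
      using assoc_mult_mat_vec[of v n n \<iota> n ?z] by (simp add: mult_minus_distrib_mat_vec[of _ n n] absorb)
    then have "v *\<^sub>v (?z - \<iota> *\<^sub>v ?z + w) = v *\<^sub>v w"
      using wc by (simp add: mult_add_distrib_mat_vec[of _ n n])
    then show "s (join n (?z - \<iota> *\<^sub>v ?z + w) x) * \<chi> ((\<iota> *\<^sub>v ?z) \<bullet> (v *\<^sub>v (?z - \<iota> *\<^sub>v ?z + w))) / ?r =
        s (join n (?z - \<iota> *\<^sub>v ?z + w) x) * \<chi> ((\<iota> *\<^sub>v ?z) \<bullet> (v *\<^sub>v w)) / ?r" by simp
  qed
  finally show ?thesis .
qed

text \<open>The transform sums a function of x and w whose kernel is a quadratic character in both
  variables together. To stay within one sequence space, x is stored at the even positions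
  (\<open>ev'\<close>, \<open>ins\<close>) and w at the odd ones (\<open>od\<close>,
  \<open>oin\<close>). Then \<open>S\<close> is a state, \<open>state_sum_subspace\<close> performs
  the sum over w, and pulling back along \<open>ins\<close> returns to functions of x.\<close>

lemma state_act_h_sub:
  fixes \<iota> u v :: "'f mat"
  assumes s: "sym_idem n \<iota> u v" and st: "state s"
  shows "state (act n (h_sub T n \<iota> v) s)"
proof -
  interpret sym_idem n \<iota> u v by (rule s)
  define ev' :: "(nat \<Rightarrow> 'f) \<Rightarrow> nat \<Rightarrow> 'f" where "ev' x = (\<lambda>i. x (2 * i))" for x
  define od :: "(nat \<Rightarrow> 'f) \<Rightarrow> nat \<Rightarrow> 'f" where "od x = (\<lambda>i. x (2 * i + 1))" for x
  define ins :: "(nat \<Rightarrow> 'f) \<Rightarrow> nat \<Rightarrow> 'f" where "ins x = (\<lambda>i. if even i then x (i div 2) else 0)" for x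
  define oin :: "'f vec \<Rightarrow> nat \<Rightarrow> 'f" where "oin w = (\<lambda>i. if odd i \<and> i div 2 < n then w $ (i div 2) else 0)" for w
  have lins: "lin ev'" "lin od" "lin ins"
    unfolding ev'_def[abs_def] od_def[abs_def] ins_def[abs_def] by (rule lin_reindex lin_reindex_if)+
  have vl: "vlin n (\<lambda>x. vec n (ev' x))" "vlin n (\<lambda>x. vec n (od x))"
    using vlin_comp[OF vlin_vec lins(1)] vlin_comp[OF vlin_vec lins(2)] by auto
  define S where "S x = s (join n ((1\<^sub>m n - \<iota>) *\<^sub>v vec n (ev' x) + vec n (od x)) (ev' x)) *
      \<chi> ((\<iota> *\<^sub>v vec n (ev' x)) \<bullet> (v *\<^sub>v vec n (od x)))" for x
  have "state S" unfolding S_def[abs_def]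
  proof (rule state_mult_quad)
    show "state (\<lambda>x. s (join n ((1\<^sub>m n - \<iota>) *\<^sub>v vec n (ev' x) + vec n (od x)) (ev' x)))"
      by (rule state_comp_lin[OF st lin_join[OF vlin_add[OF vlin_mat[OF _ vl(1)] vl(2)] lins(1)]])
        (rule minus_carrier_mat[OF carriers(1)])
    show "quad (\<lambda>x. \<chi> ((\<iota> *\<^sub>v vec n (ev' x)) \<bullet> (v *\<^sub>v vec n (od x))))"
      by (rule quad_biform[OF bilin_scalar_prod[OF vlin_mat[OF carriers(1) vl(1)] vlin_mat[OF carriers(3) vl(2)]]])
  qed
  have inj: "inj_on oin W"
  proof (rule inj_onI)
    fix a b assume ab: "a \<in> W" "b \<in> W" "oin a = oin b"
    show "a = b"
    proof (rule eq_vecI)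
      fix i assume "i < dim_vec b"
      then have "i < n" using ab by (auto simp: W_iff)
      then show "a $ i = b $ i" using fun_cong[OF ab(3), of "2 * i + 1"] by (simp add: oin_def)
    qed (use ab in \<open>auto simp: W_iff\<close>)
  qed
  have "fvec.subspace (oin ` W)"
  proof (rule fvec.subspaceI)
    show "0 \<in> oin ` W" by (rule image_eqI[OF _ W_0]) (auto simp: oin_def fun_eq_iff)
    fix x y c
    show "x + y \<in> oin ` W" if xy: "x \<in> oin ` W" "y \<in> oin ` W"
    proof -
      obtain a b where ab: "x = oin a" "y = oin b" "a \<in> W" "b \<in> W" using xy by blast
      show ?thesis by (rule image_eqI[OF _ W_add[OF ab(3,4)]]) (use ab in \<open>auto simp: oin_def fun_eq_iff W_iff\<close>)
    qed
    show "sc c x \<in> oin ` W" if x: "x \<in> oin ` W"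
    proof -
      obtain a where a: "x = oin a" "a \<in> W" using x by blast
      show ?thesis by (rule image_eqI[OF _ W_smult[OF a(2), of c]]) (use a in \<open>auto simp: oin_def fun_eq_iff W_iff\<close>)
    qed
  qed
  from state_sum_subspace[OF _ this \<open>state S\<close>] have "state (\<lambda>x. \<Sum>w\<in>oin ` W. S (x + w))" by simp
  from state_comp_lin[OF this lins(3)] have *: "state (\<lambda>x. \<Sum>w\<in>oin ` W. S (ins x + w))" .
  have eq: "act n (h_sub T n \<iota> v) s x = of_real (1 / sqrt (real (card W))) * (\<Sum>w\<in>oin ` W. S (ins x + w))" for x
  proof -
    let ?z = "vec n x" and ?r = "complex_of_real (sqrt (real (card W)))"
    have "act n (h_sub T n \<iota> v) s x = (\<Sum>w\<in>W. S (ins x + oin w) / ?r)"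
      unfolding act_h_sub_eq[OF s]
    proof (rule sum.cong[OF refl])
      fix w assume w: "w \<in> W"
      then have wc: "w \<in> carrier_vec n" by (auto simp: W_iff)
      have e: "ev' (ins x + oin w) = x" by (auto simp: ev'_def ins_def oin_def fun_eq_iff)
      have o: "vec n (od (ins x + oin w)) = w" using wc by (auto simp: od_def ins_def oin_def)
      show "s (join n (?z - \<iota> *\<^sub>v ?z + w) x) * \<chi> ((\<iota> *\<^sub>v ?z) \<bullet> (v *\<^sub>v w)) / ?r = S (ins x + oin w) / ?r"
        unfolding S_def e o by (simp add: complement)
    qed
    also have "\<dots> = of_real (1 / sqrt (real (card W))) * (\<Sum>w\<in>oin ` W. S (ins x + w))"
      by (simp add: sum.reindex[OF inj] sum_divide_distrib)
    finally show ?thesis .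
  qed
  have "state (\<lambda>x. of_real (1 / sqrt (real (card W))) * (\<Sum>w\<in>oin ` W. S (ins x + w)))"
    by (rule state_scale[OF phase_of_real *]) simp
  then show ?thesis unfolding eq[symmetric] .
qed

end

section \<open>The Clifford-Weil group acts transitively on states\<close>

lemma carrier_clifford_weil: "carrier (clifford_weil T n) = generate (subst_GL n) (clifford_weil_gens T n)"
  by (simp add: clifford_weil_def)

context code_setup
begin

abbreviation C :: "nat \<Rightarrow> 'f subst set" where
  "C n \<equiv> generate (subst_GL n) (clifford_weil_gens T n)"

lemma gens_cases:
  assumes "A \<in> clifford_weil_gens T n"
  obtains (m) u where "A = m_sub n u" "u \<in> carrier_mat n n" "invertible_mat u"
  | (d) \<phi> where "A = d_sub n \<phi>" "\<phi> \<in> Phi_n T n"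
  | (h) \<iota> u v where "A = h_sub T n \<iota> v" "sym_idem n \<iota> u v"
  using assms unfolding clifford_weil_gens_def parabolic_gens_def sym_idem_def by blast

lemma unitary_gens: "(A :: 'f subst) \<in> clifford_weil_gens T n \<Longrightarrow> unitary n A"
  by (erule gens_cases) (auto simp: unitary_m_sub unitary_d_sub unitary_h_sub)

lemma unitary_C: "\<sigma> \<in> C n \<Longrightarrow> unitary n \<sigma>"
  by (induction rule: generate.induct)
     (auto simp: subst_GL_simps unitary_one unitary_gens inv_subst_GL unitary_adj unitary_mult)

lemma gens_subset: "clifford_weil_gens T n \<subseteq> carrier (subst_GL n :: 'f subst monoid)"
  using unitary_Units unitary_gens by (auto simp: subst_GL_simps)

lemma C_subgroup: "subgroup (C n) (subst_GL n)"
  by (rule group.generate_is_subgroup[OF group_subst_GL gens_subset])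

lemma C_mult: "\<sigma> \<in> C n \<Longrightarrow> \<tau> \<in> C n \<Longrightarrow> \<sigma> \<otimes>\<^bsub>subst_monoid n\<^esub> \<tau> \<in> C n"
  using subgroup.m_closed[OF C_subgroup[of n]] by (simp add: subst_GL_simps)

lemma C_one: "\<one>\<^bsub>subst_monoid n\<^esub> \<in> C n"
  using subgroup.one_closed[OF C_subgroup[of n]] by (simp add: subst_GL_simps)

lemma C_adj: "\<sigma> \<in> C n \<Longrightarrow> adj \<sigma> \<in> C n"
  using subgroup.m_inv_closed[OF C_subgroup[of n], of \<sigma>] inv_subst_GL[OF unitary_C, of \<sigma> n] by simp

lemma C_gens: "A \<in> clifford_weil_gens T n \<Longrightarrow> A \<in> C n"
  by (rule generate.incl)

lemma m_sub_C: "u \<in> carrier_mat n n \<Longrightarrow> invertible_mat u \<Longrightarrow> m_sub n u \<in> C n"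
  by (rule C_gens) (auto simp: clifford_weil_gens_def parabolic_gens_def)

lemma d_sub_C: "\<phi> \<in> Phi_n T n \<Longrightarrow> d_sub n \<phi> \<in> C n"
  by (rule C_gens) (auto simp: clifford_weil_gens_def parabolic_gens_def)

lemma state_act_m_sub:
  fixes u :: "'f mat"
  assumes "u \<in> carrier_mat n n" "invertible_mat u" "state s"
  shows "state (act n (m_sub n u) s)"
proof -
  obtain u' where u': "u' \<in> carrier_mat n n" "u * u' = 1\<^sub>m n" "u' * u = 1\<^sub>m n"
    using invertible_mat_obtain[OF assms(1,2)] by blast
  have "state (\<lambda>x. s (join n (u' *\<^sub>v vec n x) x))"
    by (rule state_comp_lin[OF assms(3) lin_join[OF vlin_mat[OF u'(1) vlin_vec] lin_id]])
  then show ?thesis using act_m_sub[OF assms(1) u'] by presburger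
qed

lemma state_act_gens:
  assumes "(A :: 'f subst) \<in> clifford_weil_gens T n" "state s"
  shows "state (act n A s)" "state (act n (adj A) s)"
proof -
  show "state (act n A s)"
    using assms(1)
  proof (cases rule: gens_cases)
    case (m u)
    then show ?thesis using state_act_m_sub assms(2) by simp
  next
    case (d \<phi>)
    have "act n A s = (\<lambda>x. s x * e_QZ (\<phi> (vec n x)))" by (simp add: d act_d_sub fun_eq_iff)
    then show ?thesis using state_mult_quad[OF assms(2) Phi_n_quad[OF d(2)]] by simp
  next
    case (h \<iota> u v)
    then show ?thesis using state_act_h_sub assms(2) by simp
  qed
  show "state (act n (adj A) s)"
    using assms(1)
  proof (cases rule: gens_cases)
    case (m u)
    obtain u' where u': "u' \<in> carrier_mat n n" "u * u' = 1\<^sub>m n" "u' * u = 1\<^sub>m n"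
      using invertible_mat_obtain[OF m(2,3)] by blast
    then have "invertible_mat u'" using m(2) by (intro invertible_matI[of u' n u]) auto
    then show ?thesis using state_act_m_sub[OF u'(1) _ assms(2)] adj_m_sub[OF m(2) u'] by (simp add: m)
  next
    case (d \<phi>)
    have "act n (adj A) s = (\<lambda>x. s x * cnj (e_QZ (\<phi> (vec n x))))" by (simp add: d act_adj_d_sub fun_eq_iff)
    then show ?thesis using state_mult_quad[OF assms(2) quad_cnj[OF Phi_n_quad[OF d(2)]]] by simp
  next
    case (h \<iota> u v)
    then show ?thesis using state_act_h_sub[OF sym_idem_adj[OF h(2)] assms(2)] adj_h_sub[OF h(2)] by simp
  qed
qed

lemma state_act_C: "\<sigma> \<in> C n \<Longrightarrow> state s \<Longrightarrow> state (act n \<sigma> s)"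
proof (induction arbitrary: s rule: generate.induct)
  case (inv h)
  then show ?case using state_act_gens(2) inv_subst_GL[OF unitary_gens] by simp
next
  case (eng h1 h2)
  then show ?case by (simp add: subst_GL_simps act_mult[symmetric])
qed (simp_all add: subst_GL_simps state_act_gens)

definition St :: "nat \<Rightarrow> ((nat \<Rightarrow> 'f) \<Rightarrow> complex) set" where
  "St m = {s. state s \<and> (\<forall>x. x \<notin> coords m \<longrightarrow> s x = 0) \<and> (\<Sum>x\<in>coords m. (norm (s x))\<^sup>2) = 1}"

lemma St_act:
  assumes "\<sigma> \<in> C n" "n \<le> m" "s \<in> St m"
  shows "act n \<sigma> s \<in> St m"
  using assms state_act_C[OF assms(1)] act_norm[OF unitary_C[OF assms(1)] assms(2)] act_support[OF assms(2), of s]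
  by (auto simp: St_def)

lemma root_norm: "\<mu> ^ N = 1 \<Longrightarrow> norm (\<mu> :: complex) = 1"
proof -
  assume "\<mu> ^ N = 1"
  then have "norm \<mu> ^ N = 1 ^ N" by (simp add: norm_power[symmetric])
  then show ?thesis by (rule power_eq_imp_eq_base) (simp_all add: N_gt_0)
qed

lemma St_scale: "\<mu> ^ N = 1 \<Longrightarrow> s \<in> St m \<Longrightarrow> (\<lambda>x. \<mu> * s x) \<in> St m"
  using state_scale[OF phase_root, of \<mu> s] root_norm[of \<mu>] by (auto simp: St_def norm_mult)

lemma St_cases:
  assumes "s \<in> St m"
  obtains c V \<psi> where "phase c" "c \<noteq> 0" "aff V" "V \<noteq> {}" "V \<subseteq> coords m" "quad \<psi>"
    "s = (\<lambda>x. if x \<in> V then c * \<psi> x else 0)" "(norm c)\<^sup>2 * real (card V) = 1"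
proof -
  obtain c V \<psi> where s: "phase c" "aff V" "quad \<psi>" "s = (\<lambda>x. if x \<in> V then c * \<psi> x else 0)"
    using assms unfolding St_def by (auto elim: stateE)
  have sum: "(\<Sum>x\<in>coords m. (norm (s x))\<^sup>2) = 1" and supp: "\<And>x. x \<notin> coords m \<Longrightarrow> s x = 0"
    using assms by (auto simp: St_def)
  have \<psi>0: "\<psi> x \<noteq> 0" for x using quad_norm[OF s(3), of x] by (metis norm_zero zero_neq_one)
  have c0: "c \<noteq> 0"
  proof
    assume "c = 0"
    then have "s x = 0" for x by (simp add: s(4))
    then show False using sum by simp
  qed
  have V: "V \<subseteq> coords m"
  proof
    fix x assume "x \<in> V"
    then have "s x \<noteq> 0" using c0 \<psi>0 by (simp add: s(4))
    then show "x \<in> coords m" using supp by blast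
  qed
  have "(\<Sum>x\<in>coords m. (norm (s x))\<^sup>2) = (\<Sum>x\<in>V. (norm (s x))\<^sup>2)"
    by (rule sum.mono_neutral_right) (use V in \<open>auto simp: s(4)\<close>)
  also have "\<dots> = (\<Sum>x\<in>V. (norm c)\<^sup>2)"
    by (rule sum.cong) (auto simp: s(3,4) norm_mult)
  finally have 1: "(norm c)\<^sup>2 * real (card V) = 1" using sum by (simp add: mult.commute)
  then have "V \<noteq> {}" by auto
  with s c0 V 1 show ?thesis by (intro that)
qed

lemma StI:
  assumes "phase c" "aff V" "V \<subseteq> coords m" "quad \<psi>" "(norm c)\<^sup>2 * real (card V) = 1"
  shows "(\<lambda>x. if x \<in> V then c * \<psi> x else 0) \<in> St m"
proof -
  have "(\<Sum>x\<in>coords m. (norm (if x \<in> V then c * \<psi> x else 0))\<^sup>2) = (\<Sum>x\<in>V. (norm (if x \<in> V then c * \<psi> x else 0))\<^sup>2)"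
    by (rule sum.mono_neutral_right) (use assms in auto)
  also have "\<dots> = (\<Sum>x\<in>V. (norm c)\<^sup>2)"
    by (rule sum.cong) (use assms in \<open>auto simp: norm_mult\<close>)
  finally show ?thesis using assms unfolding St_def by (auto simp: mult.commute intro: stateI)
qed

definition delta :: "(nat \<Rightarrow> 'f) \<Rightarrow> (nat \<Rightarrow> 'f) \<Rightarrow> complex" where
  "delta v = (\<lambda>x. if x = v then 1 else 0)"

lemma aff_single: "(T = Type_qE \<Longrightarrow> v = 0) \<Longrightarrow> aff {v}"
  by (auto simp: aff_def)

lemma delta_St: "v \<in> coords m \<Longrightarrow> (T = Type_qE \<Longrightarrow> v = 0) \<Longrightarrow> delta v \<in> St m"
proof -
  assume v: "v \<in> coords m" "T = Type_qE \<Longrightarrow> v = 0"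
  have "(\<lambda>x. if x \<in> {v} then 1 * 1 else 0) \<in> St m"
    by (rule StI) (use v aff_single[of v] quad_one in \<open>auto simp: phase_def\<close>)
  moreover have "delta v = (\<lambda>x. if x \<in> {v} then 1 * 1 else 0)" by (simp add: delta_def fun_eq_iff)
  ultimately show ?thesis by (simp only:)
qed

lemma zero_coords [simp]: "0 \<in> coords m" "(\<lambda>i. 0) \<in> coords m"
  by (auto simp: coords_def)

text \<open>The normalisation determines the norm of c from the size of the support, and c is that
  norm times an N-th root of unity. The values of quadratic characters are values of the finitely
  many elements of \<open>Q1\<close> at 1.\<close>

lemma finite_St: "finite (St m)"
proof -
  define R where "R = (\<lambda>\<theta>. \<theta> 1) ` Q1"
  have "card Q1 > 0" using card_Q1[OF adm] by simp
  then have R: "finite R" by (simp add: R_def card_gt_0_iff)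
  define A where "A = (\<Union>k\<in>{1..card (coords m :: (nat \<Rightarrow> 'f) set)}. {z::complex. z ^ N = of_real (sqrt (1 / real k) ^ N)})"
  have A: "finite A" unfolding A_def using N_gt_0 by (auto intro!: finite_nth_roots)
  define D where "D = insert 0 ((\<lambda>(c, r). c * r) ` (A \<times> R))"
  have "St m \<subseteq> {f. \<forall>x. (x \<in> coords m \<longrightarrow> f x \<in> D) \<and> (x \<notin> coords m \<longrightarrow> f x = 0)}"
  proof (intro subsetI CollectI allI conjI impI)
    fix s x assume s: "s \<in> St m"
    show "x \<notin> coords m \<Longrightarrow> s x = 0" using s by (auto simp: St_def)
    obtain c V \<psi> where c: "phase c" "c \<noteq> 0" "aff V" "V \<noteq> {}" "V \<subseteq> coords m" "quad \<psi>"
      "s = (\<lambda>x. if x \<in> V then c * \<psi> x else 0)" "(norm c)\<^sup>2 * real (card V) = 1" using s by (rule St_cases)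
    have "finite V" using c(5) by (rule finite_subset) simp
    then have k: "card V \<in> {1..card (coords m :: (nat \<Rightarrow> 'f) set)}"
      using c(4,5) by (auto simp: Suc_le_eq card_gt_0_iff intro: card_mono)
    have "(norm c)\<^sup>2 = 1 / real (card V)" using c(8) k by (simp add: field_simps)
    then have "norm c = sqrt (1 / real (card V))" by (metis norm_ge_zero real_sqrt_unique)
    then have "c \<in> A" using c(1) k unfolding A_def phase_def by auto
    moreover have "\<psi> x \<in> R" unfolding R_def
      by (rule image_eqI[OF _ quad_line_Q1[OF c(6), of x]]) (simp add: sc_def)
    ultimately show "s x \<in> D" by (auto simp: D_def c(7))
  qed
  moreover have "finite D" using A R by (simp add: D_def)
  then have "finite {f. \<forall>x::nat \<Rightarrow> 'f. (x \<in> coords m \<longrightarrow> f x \<in> D) \<and> (x \<notin> coords m \<longrightarrow> f x = 0)}"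
    by (rule finite_set_of_finite_funs[OF finite_coords])
  ultimately show ?thesis by (rule finite_subset)
qed

subsection \<open>Fourier transform along a line\<close>

text \<open>The transform for a rank one idempotent: \<open>\<iota>\<close> projects onto the span
  of e and reads off the i-th coordinate, v is the matrix unit at (i, i), and u is e e^T. The
  argument x + (t - x_i) e is x with its i-th coordinate moved to t along e.\<close>

lemma line_fourier:
  assumes e: "e \<in> coords n" "i < n" "e i = 1"
  shows "\<exists>\<sigma>\<in>C n. \<forall>s x. act n \<sigma> s x =
    (\<Sum>t\<in>UNIV. s (x + sc (t - x i) e) * \<chi> (t * x i)) / of_real (sqrt (real CARD('f)))"
proof -
  define \<iota> where "\<iota> = mat n n (\<lambda>(r, c). if c = i then e r else 0)"
  define v where "v = mat n n (\<lambda>(r, c). if r = i \<and> c = i then 1 else (0::'f))"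
  define u where "u = mat n n (\<lambda>(r, c). e r * e c)"
  have cr [simp]: "\<iota> \<in> carrier_mat n n" "v \<in> carrier_mat n n" "u \<in> carrier_mat n n"
    by (auto simp: \<iota>_def v_def u_def)
  have sd: "(\<Sum>k = 0..<n. (if k = i then f k else 0)) = (f i :: 'f)" for f using e(2) by simp
  have p1: "\<iota> * \<iota> = \<iota>" using e
    by (auto intro!: eq_matI simp: \<iota>_def scalar_prod_def if_distrib[of "\<lambda>x. x * _"] sd cong: if_cong)
  have p2: "\<iota> * v = \<iota>" using e
    by (auto intro!: eq_matI simp: \<iota>_def v_def scalar_prod_def if_distrib[of "\<lambda>x. x * _"] sd cong: if_cong)
  have p3: "\<iota> * transpose_mat \<iota> = u" using e
    by (auto intro!: eq_matI simp: \<iota>_def u_def scalar_prod_def if_distrib[of "\<lambda>x. x * _"] sd cong: if_cong)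
  have p4: "transpose_mat \<iota> * v = v" using e
    by (auto intro!: eq_matI simp: \<iota>_def v_def scalar_prod_def if_distrib[of "\<lambda>x. _ * x"] sd cong: if_cong)
  have p5: "v * \<iota> = v" using e
    by (auto intro!: eq_matI simp: \<iota>_def v_def scalar_prod_def if_distrib[of "\<lambda>x. x * _"] sd cong: if_cong)
  have p6: "u * v = \<iota>" using e
    by (auto intro!: eq_matI simp: \<iota>_def v_def u_def scalar_prod_def if_distrib[of "\<lambda>x. _ * x"] sd cong: if_cong)
  have p7: "v * u = transpose_mat \<iota>" using e
    by (auto intro!: eq_matI simp: \<iota>_def v_def u_def scalar_prod_def if_distrib[of "\<lambda>x. x * _"] sd cong: if_cong)
  have si: "sym_idem n \<iota> u v"
    unfolding sym_idem_def symmetric_idempotent_def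
  proof (intro conjI)
    show "u \<in> {\<iota> * M * transpose_mat \<iota> |M. M \<in> carrier_mat n n}"
      by (intro CollectI exI[of _ v]) (simp add: p2 p3)
    show "v \<in> {transpose_mat \<iota> * M * \<iota> |M. M \<in> carrier_mat n n}"
      by (intro CollectI exI[of _ v]) (simp add: p4 p5)
  qed (simp_all add: p1 p6 p7)
  have "h_sub T n \<iota> v \<in> C n"
    by (rule C_gens) (use si in \<open>auto simp: clifford_weil_gens_def sym_idem_def\<close>)
  let ?e = "vec n e"
  have \<iota>x: "\<iota> *\<^sub>v x = (x $ i) \<cdot>\<^sub>v ?e" if "x \<in> carrier_vec n" for x
    using that e by (auto intro!: eq_vecI simp: \<iota>_def scalar_prod_def if_distrib[of "\<lambda>x. x * _"] sd cong: if_cong)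
  have W: "mat_image n \<iota> = (\<lambda>t. t \<cdot>\<^sub>v ?e) ` UNIV"
  proof (intro equalityI subsetI)
    fix w assume "w \<in> (\<lambda>t. t \<cdot>\<^sub>v ?e) ` UNIV"
    then obtain t where "w = t \<cdot>\<^sub>v ?e" by blast
    then have "w = \<iota> *\<^sub>v (t \<cdot>\<^sub>v ?e)" using e by (simp add: \<iota>x)
    then show "w \<in> mat_image n \<iota>" unfolding mat_image_def by auto
  qed (auto simp: mat_image_def \<iota>x)
  have inj: "inj (\<lambda>t. t \<cdot>\<^sub>v ?e)"
  proof (rule injI)
    fix a b assume "a \<cdot>\<^sub>v ?e = b \<cdot>\<^sub>v ?e"
    then have "(a \<cdot>\<^sub>v ?e) $ i = (b \<cdot>\<^sub>v ?e) $ i" by simp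
    then show "a = b" using e by simp
  qed
  have cW: "card (mat_image n \<iota>) = CARD('f)" unfolding W by (rule card_image[OF inj])
  have "act n (h_sub T n \<iota> v) s x = (\<Sum>t\<in>UNIV. s (x + sc (t - x i) e) * \<chi> (t * x i)) / of_real (sqrt (real CARD('f)))" for s x
  proof -
    have j: "join n (vec n x - \<iota> *\<^sub>v vec n x + t \<cdot>\<^sub>v ?e) x = x + sc (t - x i) e" for t
      using e by (auto simp: \<iota>x join_def fun_eq_iff coords_def algebra_simps)
    have "(\<iota> *\<^sub>v vec n x) \<bullet> (v *\<^sub>v (t \<cdot>\<^sub>v ?e)) = t * x i" for t
    proof -
      have "v *\<^sub>v (t \<cdot>\<^sub>v ?e) = vec n (\<lambda>r. if r = i then t else 0)"
        using e by (auto intro!: eq_vecI simp: v_def scalar_prod_def if_distrib[of "\<lambda>x. x * _"] sd cong: if_cong)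
      then show ?thesis using e by (simp add: \<iota>x scalar_prod_def if_distrib[of "\<lambda>x. _ * x"] sd mult.commute cong: if_cong)
    qed
    then show ?thesis
      unfolding act_h_sub_eq[OF si] cW unfolding W sum.reindex[OF inj] by (simp add: j sum_divide_distrib)
  qed
  then show ?thesis using \<open>h_sub T n \<iota> v \<in> C n\<close> by blast
qed

lemma quad_factor:
  assumes "quad \<psi>"
  shows "\<exists>\<sigma>\<in>C n. \<forall>s x. act n \<sigma> s x = s x * \<psi> (join n (vec n x) 0)"
proof -
  obtain \<phi> where \<phi>: "\<phi> \<in> Phi_n T n" "\<And>v. v \<in> carrier_vec n \<Longrightarrow> e_QZ (\<phi> v) = \<psi> (join n v 0)"
    using quad_Phi_n[OF assms] by blast
  show ?thesis by (rule bexI[OF _ d_sub_C[OF \<phi>(1)]]) (simp add: act_d_sub \<phi>(2))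
qed

lemma join_coords_id: "x \<in> coords n \<Longrightarrow> join n (vec n x) 0 = x"
  by (auto simp: join_def coords_def fun_eq_iff)

text \<open>Each step clears one coordinate of the support.\<close>

lemma St_reduce:
  assumes "s \<in> St n"
  shows "\<exists>\<sigma>\<in>C n. \<exists>\<mu>. \<mu> ^ N = 1 \<and> act n \<sigma> s = (\<lambda>x. \<mu> * delta 0 x)"
  using assms
proof (induction "card {i. \<exists>x. s x \<noteq> 0 \<and> x i \<noteq> 0}" arbitrary: s rule: less_induct)
  case less
  let ?I = "\<lambda>s :: (nat \<Rightarrow> 'f) \<Rightarrow> complex. {i. \<exists>x. s x \<noteq> 0 \<and> x i \<noteq> 0}"
  obtain c V \<psi> where s: "phase c" "c \<noteq> 0" "aff V" "V \<noteq> {}" "V \<subseteq> coords n" "quad \<psi>"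
    "s = (\<lambda>x. if x \<in> V then c * \<psi> x else 0)" "(norm c)\<^sup>2 * real (card V) = 1" using less.prems by (rule St_cases)
  have \<psi>0: "\<psi> x \<noteq> 0" for x using quad_norm[OF s(6), of x] by (metis norm_zero zero_neq_one)
  have sI: "?I s = {i. \<exists>x\<in>V. x i \<noteq> 0}" using s(2) \<psi>0 by (auto simp: s(7))
  have "?I s \<subseteq> {..<n}" using s(5) unfolding sI by (auto simp: coords_def subset_iff not_less[symmetric])
  then have finI: "finite (?I s)" by (rule finite_subset) simp
  have V: "x + sc t (y - z) \<in> V" if "x \<in> V" "y \<in> V" "z \<in> V" for x y z t
    using s(3) that by (auto simp: aff_def)
  show ?case
  proof (cases "?I s = {}")
    case True
    then have "V \<subseteq> {0}" unfolding sI by (auto simp: fun_eq_iff)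
    then have V0: "V = {0}" using s(4) by auto
    then have "norm c = 1" using s(8) by (simp add: power2_eq_1_iff) (use norm_ge_zero[of c] in linarith)
    then have "c ^ N = 1" using s(1) by (simp add: phase_def)
    moreover have "s = (\<lambda>x. c * delta 0 x)" by (auto simp: s(7) V0 delta_def quad_0[OF s(6)])
    ultimately show ?thesis by (intro bexI[OF _ C_one] exI[of _ c]) simp
  next
    case False
    then obtain i v where iv: "v \<in> V" "v i \<noteq> 0" unfolding sI by blast
    then have i: "i < n" using s(5) by (auto simp: coords_def subset_iff not_less[symmetric])
    have iI: "i \<in> ?I s" unfolding sI using iv by blast
    \<comment> \<open>Dividing by the quadratic character leaves a multiple of the indicator
      function of V.\<close>
    obtain \<delta> where \<delta>: "\<delta> \<in> C n" "\<And>s x. act n \<delta> s x = s x * cnj (\<psi> (join n (vec n x) 0))"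
      using quad_factor[OF quad_cnj[OF s(6)], of n] by blast
    have s1: "act n \<delta> s = (\<lambda>x. if x \<in> V then c else 0)"
    proof
      fix x
      show "act n \<delta> s x = (if x \<in> V then c else 0)"
      proof (cases "x \<in> V")
        case True
        then have "join n (vec n x) 0 = x" using s(5) by (intro join_coords_id) auto
        then show ?thesis using True quad_cnj_mult[OF s(6), of x] by (simp add: \<delta>(2) s(7) mult.assoc)
      qed (simp add: \<delta>(2) s(7))
    qed
    let ?r = "complex_of_real (sqrt (real CARD('f)))"
    have rr: "?r * ?r = of_nat CARD('f)" by (simp flip: of_real_mult)
    have r0: "?r \<noteq> 0" by simp
    have red: "\<exists>\<tau>\<in>C n. ?I (act n \<tau> s) \<subseteq> ?I s - {i}"
    proof (cases "\<exists>y\<in>V. \<exists>z\<in>V. y i \<noteq> z i")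
      case True
      then obtain y z where yz: "y \<in> V" "z \<in> V" "y i \<noteq> z i" by blast
      \<comment> \<open>A direction of V with i-th coordinate 1. The support is invariant under
        shifts by e, so the transform along e sums \<chi>(t x_i) over all t and leaves only the
        points with x_i = 0.\<close>
      define e where "e = sc (1 / (y i - z i)) (y - z)"
      have "y \<in> coords n" "z \<in> coords n" using yz s(5) by auto
      then have e: "e \<in> coords n" "e i = 1" using yz(3) by (auto simp: e_def coords_def)
      have Ve: "x + sc t e \<in> V \<longleftrightarrow> x \<in> V" for x t
      proof -
        have 1: "x + sc t e \<in> V" if "x \<in> V" for x t
          using V[OF that yz(1,2), of "t * (1 / (y i - z i))"] by (simp add: e_def)
        show ?thesis using 1[of x t] 1[of "x + sc t e" "- t"] by auto
      qed
      obtain \<eta> where \<eta>: "\<eta> \<in> C n" "\<And>s x. act n \<eta> s x = (\<Sum>t\<in>UNIV. s (x + sc (t - x i) e) * \<chi> (t * x i)) / ?r"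
        using line_fourier[OF e(1) i e(2)] by blast
      have "act n \<eta> (act n \<delta> s) x = (if x \<in> V then c * (\<Sum>t\<in>UNIV. \<chi> (t * x i)) / ?r else 0)" for x
        by (simp add: \<eta>(2) s1 Ve sum_distrib_left)
      then have "?I (act n \<eta> (act n \<delta> s)) \<subseteq> ?I s - {i}"
        unfolding sI by (auto simp: \<chi>_sum split: if_splits)
      then show ?thesis
        using C_mult[OF \<delta>(1) \<eta>(1)] by (auto simp: act_mult)
    next
      case False
      define k where "k = v i"
      have Vk: "x i = k" if "x \<in> V" for x using False iv that by (auto simp: k_def)
      have nev: "\<not> T = Type_qE"
      proof
        assume "T = Type_qE"
        then have "0 \<in> V" using s(3,4) unfolding aff_def by blast
        from Vk[OF this] iv show False by (simp add: k_def)
      qed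
      \<comment> \<open>Now V lies in the hyperplane x_i = k with k nonzero. The transform along the
        i-th axis spreads the support over the whole axis and produces the factor \<chi>(k x_i);
        \<open>\<kappa>\<close> removes it, and a second transform concentrates the support at x_i =
        0.\<close>
      define e where "e = uvec i"
      have e: "e \<in> coords n" "e i = 1" using i by (auto simp: e_def coords_def uvec_def)
      obtain \<eta> where \<eta>: "\<eta> \<in> C n" "\<And>s x. act n \<eta> s x = (\<Sum>t\<in>UNIV. s (x + sc (t - x i) e) * \<chi> (t * x i)) / ?r"
        using line_fourier[OF e(1) i e(2)] by blast
      have lk: "linf (\<lambda>x. - k * x i)" by (simp add: linf_def algebra_simps)
      obtain \<kappa> where \<kappa>: "\<kappa> \<in> C n" "\<And>s x. act n \<kappa> s x = s x * \<chi> (- k * (join n (vec n x) 0) i)"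
        using quad_factor[OF quad_char_linf[OF lk nev], of n] by blast
      have V': "x + sc (t - x i) e \<in> V \<longleftrightarrow> t = k \<and> x + sc (k - x i) e \<in> V" for x t
        using Vk[of "x + sc (t - x i) e"] e(2) by auto
      have s2: "act n \<eta> (act n \<delta> s) x = (if x + sc (k - x i) e \<in> V then c * \<chi> (k * x i) / ?r else 0)" for x
      proof -
        have "(\<Sum>t\<in>UNIV. act n \<delta> s (x + sc (t - x i) e) * \<chi> (t * x i)) =
            (\<Sum>t\<in>UNIV. if t = k then (if x + sc (k - x i) e \<in> V then c * \<chi> (k * x i) else 0) else 0)"
          unfolding s1
        proof (rule sum.cong[OF refl])
          fix t
          show "(if x + sc (t - x i) e \<in> V then c else 0) * \<chi> (t * x i) =
            (if t = k then (if x + sc (k - x i) e \<in> V then c * \<chi> (k * x i) else 0) else 0)"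
          proof (cases "t = k")
            case False
            then have "x + sc (t - x i) e \<notin> V" using V' by blast
            then show ?thesis using False by simp
          qed simp
        qed
        then show ?thesis by (simp add: \<eta>(2))
      qed
      have s3: "act n \<kappa> (act n \<eta> (act n \<delta> s)) x = (if x + sc (k - x i) e \<in> V then c / ?r else 0)" for x
        using i by (simp add: \<kappa>(2) s2 join_def \<chi>_minus \<chi>_cnj mult.assoc)
      have "act n \<eta> (act n \<kappa> (act n \<eta> (act n \<delta> s))) x =
          (if x + sc (k - x i) e \<in> V then c / ?r * (\<Sum>t\<in>UNIV. \<chi> (t * x i)) / ?r else 0)" for x
      proof -
        have eqt: "(x + sc (t - x i) e) + sc (k - (x + sc (t - x i) e) i) e = x + sc (k - x i) e" for t
          using e(2) by (auto simp: fun_eq_iff algebra_simps)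
        show ?thesis unfolding \<eta>(2)[of "act n \<kappa> _"] s3 eqt by (simp add: sum_distrib_left)
      qed
      then have a1: "x + sc (k - x i) e \<in> V \<and> x i = 0" if "act n \<eta> (act n \<kappa> (act n \<eta> (act n \<delta> s))) x \<noteq> 0" for x
        using that by (auto simp: \<chi>_sum split: if_splits)
      have a2: "x j = (x + sc (k - x i) e) j" if "j \<noteq> i" for x j using that by (simp add: e_def uvec_def)
      have "?I (act n \<eta> (act n \<kappa> (act n \<eta> (act n \<delta> s)))) \<subseteq> ?I s - {i}"
      proof
        fix j assume "j \<in> ?I (act n \<eta> (act n \<kappa> (act n \<eta> (act n \<delta> s))))"
        then obtain x where x: "act n \<eta> (act n \<kappa> (act n \<eta> (act n \<delta> s))) x \<noteq> 0" "x j \<noteq> 0" by blast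
        from a1[OF x(1)] have xi: "x + sc (k - x i) e \<in> V" "x i = 0" by auto
        then have ji: "j \<noteq> i" using x(2) by auto
        then have "(x + sc (k - x i) e) j \<noteq> 0" using a2[OF ji, of x] x(2) by (simp only: not_False_eq_True)
        then have "j \<in> ?I s" unfolding sI using xi(1) by blast
        then show "j \<in> ?I s - {i}" using ji by blast
      qed
      then show ?thesis
        using C_mult[OF C_mult[OF C_mult[OF \<delta>(1) \<eta>(1)] \<kappa>(1)] \<eta>(1)] by (auto simp: act_mult)
    qed
    then obtain \<tau> where \<tau>: "\<tau> \<in> C n" "?I (act n \<tau> s) \<subseteq> ?I s - {i}" by blast
    have "card (?I (act n \<tau> s)) \<le> card (?I s - {i})" using finI by (intro card_mono \<tau>(2)) auto
    also have "\<dots> < card (?I s)" using finI iI by (intro psubset_card_mono) auto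
    finally obtain \<sigma> \<mu> where \<sigma>: "\<sigma> \<in> C n" "\<mu> ^ N = 1" "act n \<sigma> (act n \<tau> s) = (\<lambda>x. \<mu> * delta 0 x)"
      using less.hyps[of "act n \<tau> s"] St_act[OF \<tau>(1) order.refl less.prems] by blast
    then show ?thesis using C_mult[OF \<tau>(1) \<sigma>(1)] by (auto simp: act_mult)
  qed
qed

lemma St_transitive:
  assumes "s \<in> St n"
  shows "\<exists>\<sigma>\<in>C n. \<exists>\<mu>. \<mu> ^ N = 1 \<and> s = (\<lambda>x. \<mu> * act n \<sigma> (delta 0) x)"
proof -
  obtain \<sigma> \<mu> where \<sigma>: "\<sigma> \<in> C n" "\<mu> ^ N = 1" "act n \<sigma> s = (\<lambda>x. \<mu> * delta 0 x)" using St_reduce[OF assms] by blast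
  have "s = act n (adj \<sigma>) (act n \<sigma> s)" using act_adj(1)[OF unitary_C[OF \<sigma>(1)]] by simp
  then have "s = (\<lambda>x. \<mu> * act n (adj \<sigma>) (delta 0) x)" unfolding \<sigma>(3) by (simp only: act_scale)
  then show ?thesis using C_adj[OF \<sigma>(1)] \<sigma>(2) by blast
qed

subsection \<open>Finiteness\<close>

lemma act_delta:
  assumes "v \<in> carrier_vec n" "x \<in> coords n"
  shows "act n \<sigma> (delta (join n v 0)) x = \<sigma> v (vec n x)"
proof -
  have "join n w x = join n v 0 \<longleftrightarrow> w = v" if "w \<in> carrier_vec n" for w
  proof
    assume "join n w x = join n v 0"
    then have "vec n (join n w x) = vec n (join n v 0)" by simp
    then show "w = v" using that assms by simp
  qed (use assms in \<open>auto simp: join_def coords_def fun_eq_iff\<close>)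
  then have "act n \<sigma> (delta (join n v 0)) x = (\<Sum>w\<in>carrier_vec n. if w = v then \<sigma> v (vec n x) else 0)"
    unfolding act_def delta_def by (intro sum.cong) auto
  then show ?thesis using assms by simp
qed

text \<open>A group element is determined by the images of the point masses. These are states, hence
  so are their images, and there are finitely many states. In type \<open>Type_qE\<close> only the
  point mass at 0 is a state, so that case needs another argument.\<close>

lemma finite_C_affine:
  assumes "T \<noteq> Type_qE"
  shows "finite (C n)"
proof -
  let ?r = "\<lambda>\<sigma> v. if v \<in> carrier_vec n then act n \<sigma> (delta (join n v 0)) else 0"
  have inj: "inj_on ?r (C n)"
  proof (rule inj_onI)
    fix \<sigma> \<tau> assume st: "\<sigma> \<in> C n" "\<tau> \<in> C n" "?r \<sigma> = ?r \<tau>"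
    have "\<sigma> v w = \<tau> v w" for v w
    proof (cases "v \<in> carrier_vec n \<and> w \<in> carrier_vec n")
      case True
      then have "act n \<sigma> (delta (join n v 0)) = act n \<tau> (delta (join n v 0))"
        using fun_cong[OF st(3), of v] by simp
      then show ?thesis
        using act_delta[of v n "join n w 0" \<sigma>] act_delta[of v n "join n w 0" \<tau>] True by simp
    next
      case False
      then show ?thesis using unitary_C[OF st(1)] unitary_C[OF st(2)] unfolding unitary_def subst_monoid_simps by auto
    qed
    then show "\<sigma> = \<tau>" by blast
  qed
  let ?B = "{f. \<forall>v::'f vec. (v \<in> carrier_vec n \<longrightarrow> f v \<in> St n) \<and> (v \<notin> carrier_vec n \<longrightarrow> f v = (0 :: (nat \<Rightarrow> 'f) \<Rightarrow> complex))}"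
  have "finite ?B" by (rule finite_set_of_finite_funs[OF finite_carrier_vec finite_St])
  moreover have "?r ` C n \<subseteq> ?B"
    using St_act[OF _ order.refl] delta_St assms by auto
  ultimately have "finite (?r ` C n)" by (rule rev_finite_subset)
  then show ?thesis using inj by (rule finite_imageD)
qed

end

lemma generate_mono_gens: "x \<in> generate G H \<Longrightarrow> H \<subseteq> K \<Longrightarrow> x \<in> generate G K"
  by (induction rule: generate.induct) (auto intro: generate.intros)

text \<open>The generators for \<open>Type_qE\<close> are among those for \<open>Type_qE1\<close>,
  whose group is finite by the preceding argument with the order of its own Z in place of N.\<close>

lemma (in code_setup) finite_C: "finite (C n)"
proof (cases "T = Type_qE")
  case False
  then show ?thesis by (rule finite_C_affine)
next
  case True
  have odd: "odd CARD('f)" using adm True by (simp add: admissible_field_def)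
  have oz: "order_Z Type_qE1 TYPE('f) > 0"
    using finite_field_CHAR_prime[where ?'f = 'f]
    by (simp add: order_Z_def Coset.order_def DirProd_def card_cartesian_product
        order_integer_mod_group[unfolded Coset.order_def] prime_gt_0_nat)
  interpret E1: code_setup Type_qE1 F "order_Z Type_qE1 TYPE('f)"
    by standard (use odd oz in \<open>auto simp: admissible_field_def\<close>)
  have b: "beta Type_qE = (beta Type_qE1 :: 'f \<Rightarrow> _)" by (auto simp: beta_def fun_eq_iff)
  have "Phi Type_qE \<subseteq> (Phi Type_qE1 :: ('f \<Rightarrow> rat) set)"
  proof
    fix \<phi> :: "'f \<Rightarrow> rat" assume "\<phi> \<in> Phi Type_qE"
    then obtain a where "\<phi> = (\<lambda>x. frac_tr (a * x\<^sup>2 + 0 * x))" by (auto simp: Phi_def)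
    then have "\<exists>a b. \<phi> = (\<lambda>x. frac_tr (a * x\<^sup>2 + b * x))" by (intro exI)
    then show "\<phi> \<in> Phi Type_qE1" unfolding Phi_def by simp
  qed
  then have "Phi_n Type_qE n \<subseteq> (Phi_n Type_qE1 n :: ('f vec \<Rightarrow> rat) set)"
    unfolding Phi_n_def b by blast
  then have d: "{d_sub n \<phi> | \<phi>. \<phi> \<in> Phi_n Type_qE n} \<subseteq> {d_sub n \<phi> | \<phi> :: 'f vec \<Rightarrow> rat. \<phi> \<in> Phi_n Type_qE1 n}"
    by auto
  have h: "h_sub Type_qE n = (h_sub Type_qE1 n :: 'f mat \<Rightarrow> _)"
  proof -
    have bn: "beta_n Type_qE n = (beta_n Type_qE1 n :: 'f vec \<Rightarrow> _)" by (intro ext) (simp add: beta_n_def b)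
    show ?thesis by (intro ext) (simp only: h_sub_def bn)
  qed
  have sub: "clifford_weil_gens Type_qE n \<subseteq> (clifford_weil_gens Type_qE1 n :: 'f subst set)"
    unfolding clifford_weil_gens_def parabolic_gens_def h by (intro Un_mono order.refl d)
  have "C n \<subseteq> E1.C n" unfolding True by (rule subsetI, erule generate_mono_gens[OF _ sub])
  then show ?thesis using E1.finite_C_affine by (rule finite_subset) simp
qed

section \<open>Counting states\<close>

context code_setup
begin

text \<open>The coordinates from n on are set to 0. This commutes with \<open>act n\<close>, which
  is how group elements for n are used on states in more variables.\<close>

definition slice :: "nat \<Rightarrow> ((nat \<Rightarrow> 'f) \<Rightarrow> complex) \<Rightarrow> (nat \<Rightarrow> 'f) \<Rightarrow> complex" where
  "slice n s = (\<lambda>x. if x \<in> coords n then s x else 0)"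

text \<open>Positivity of r fixes the phase, so every state with nonzero slice lies over exactly one
  normalised state t.\<close>

definition fib :: "nat \<Rightarrow> nat \<Rightarrow> ((nat \<Rightarrow> 'f) \<Rightarrow> complex) \<Rightarrow> ((nat \<Rightarrow> 'f) \<Rightarrow> complex) set" where
  "fib n m t = {s \<in> St m. \<exists>r>0. slice n s = (\<lambda>x. of_real r * t x)}"

lemma coords_join_iff: "join n v x \<in> coords n \<longleftrightarrow> x \<in> coords n"
  by (auto simp: join_def coords_def)

lemma slice_act: "slice n (act n \<sigma> s) = act n \<sigma> (slice n s)"
  by (auto simp: slice_def act_def coords_join_iff fun_eq_iff)

lemma state_slice:
  assumes "state s"
  shows "state (slice n s)"
proof (rule stateE[OF assms])
  fix c V \<psi> assume s: "phase c" "aff V" "quad \<psi>" "s = (\<lambda>x. if x \<in> V then c * \<psi> x else 0)"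
  show ?thesis
  proof (rule stateI[OF s(1) _ s(3)])
    show "aff (V \<inter> coords n)" using s(2) by (auto simp: aff_def coords_def)
  qed (simp add: slice_def s(4))
qed

definition nrm :: "nat \<Rightarrow> ((nat \<Rightarrow> 'f) \<Rightarrow> complex) \<Rightarrow> real" where
  "nrm n s = sqrt (\<Sum>x\<in>coords n. (norm (s x))\<^sup>2)"

lemma nrm_pos: "slice n s \<noteq> (\<lambda>x. 0) \<Longrightarrow> nrm n s > 0"
proof -
  assume "slice n s \<noteq> (\<lambda>x. 0)"
  then obtain x where "x \<in> coords n" "s x \<noteq> 0" by (auto simp: slice_def fun_eq_iff split: if_splits)
  then have "0 < (\<Sum>x\<in>coords n. (norm (s x))\<^sup>2)" by (intro sum_pos2[of _ x]) auto
  then show ?thesis by (simp add: nrm_def)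
qed

lemma slice_normalized:
  assumes "s \<in> St m" "slice n s \<noteq> (\<lambda>x. 0)"
  shows "(\<lambda>x. of_real (1 / nrm n s) * slice n s x) \<in> St n"
proof -
  have pos: "nrm n s > 0" using nrm_pos[OF assms(2)] .
  have "state (\<lambda>x. of_real (1 / nrm n s) * slice n s x)"
    using assms(1) pos by (intro state_scale phase_of_real state_slice) (auto simp: St_def)
  moreover have "(\<Sum>x\<in>coords n. (norm (of_real (1 / nrm n s) * slice n s x))\<^sup>2) = 1"
  proof -
    have "(\<Sum>x\<in>coords n. (norm (of_real (1 / nrm n s) * slice n s x))\<^sup>2) = (\<Sum>x\<in>coords n. (1 / nrm n s)\<^sup>2 * (norm (s x))\<^sup>2)"
      by (rule sum.cong) (use pos in \<open>auto simp: slice_def norm_mult norm_divide power_mult_distrib power_divide\<close>)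
    also have "\<dots> = (1 / nrm n s)\<^sup>2 * (nrm n s)\<^sup>2"
      by (simp add: sum_distrib_left[symmetric] nrm_def sum_nonneg)
    finally show ?thesis using pos by (simp add: power_divide)
  qed
  ultimately show ?thesis by (auto simp: St_def slice_def)
qed

lemma slice_normalized_eq:
  assumes "t \<in> St n" "r > 0" "slice n s = (\<lambda>x. of_real r * t x)"
  shows "(\<lambda>x. of_real (1 / nrm n s) * slice n s x) = t"
proof -
  have "(nrm n s)\<^sup>2 = (\<Sum>x\<in>coords n. (norm (slice n s x))\<^sup>2)"
    by (simp add: nrm_def sum_nonneg slice_def)
  also have "\<dots> = r\<^sup>2 * (\<Sum>x\<in>coords n. (norm (t x))\<^sup>2)"
    unfolding assms(3) using assms(2) by (simp add: norm_mult power_mult_distrib sum_distrib_left)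
  also have "\<dots> = r\<^sup>2" using assms(1) by (simp add: St_def)
  finally have "nrm n s = r" using assms(2) by (simp add: nrm_def sum_nonneg power2_eq_iff_nonneg)
  then show ?thesis using assms(2,3) by (simp add: fun_eq_iff)
qed

text \<open>Since slicing is equivariant and \<open>C n\<close> is transitive on \<open>St n\<close>
  up to roots of unity, all fibres carry the same sum. With the constant 1 this counts states; with
  \<open>Fs\<close> it reduces the pairing to one fibre.\<close>

lemma fibre_sum:
  fixes H :: "((nat \<Rightarrow> 'f) \<Rightarrow> complex) \<Rightarrow> 'b::semiring_1"
  assumes nm: "n \<le> m"
    and act: "\<And>\<sigma> s. \<sigma> \<in> C n \<Longrightarrow> s \<in> St m \<Longrightarrow> H (act n \<sigma> s) = H s"
    and root: "\<And>\<mu> s. \<mu> ^ N = 1 \<Longrightarrow> s \<in> St m \<Longrightarrow> H (\<lambda>x. \<mu> * s x) = H s"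
  shows "(\<Sum>s | s \<in> St m \<and> slice n s \<noteq> (\<lambda>x. 0). H s) = of_nat (card (St n)) * (\<Sum>s\<in>fib n m (delta 0). H s)"
proof -
  let ?S = "{s. s \<in> St m \<and> slice n s \<noteq> (\<lambda>x. 0)}"
  let ?g = "\<lambda>s x. of_real (1 / nrm n s) * slice n s x"
  have fin: "finite ?S" using finite_St[of m] by simp
  have fibt: "{s \<in> ?S. ?g s = t} = fib n m t" if t: "t \<in> St n" for t
  proof (intro equalityI subsetI)
    fix s assume "s \<in> {s \<in> ?S. ?g s = t}"
    then have s: "s \<in> St m" "slice n s \<noteq> (\<lambda>x. 0)" and g: "t = ?g s" by auto
    have pos: "nrm n s > 0" using nrm_pos[OF s(2)] .
    then have "slice n s = (\<lambda>x. of_real (nrm n s) * t x)" unfolding g by (simp add: fun_eq_iff)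
    then show "s \<in> fib n m t" using s pos unfolding fib_def by blast
  next
    fix s assume "s \<in> fib n m t"
    then obtain r where r: "s \<in> St m" "r > 0" "slice n s = (\<lambda>x. of_real r * t x)" by (auto simp: fib_def)
    have "slice n s \<noteq> (\<lambda>x. 0)"
    proof
      assume "slice n s = (\<lambda>x. 0)"
      then have "t x = 0" for x using fun_cong[OF r(3), of x] r(2) by simp
      then show False using t by (simp add: St_def)
    qed
    then show "s \<in> {s \<in> ?S. ?g s = t}" using r slice_normalized_eq[OF t r(2,3)] by simp
  qed
  have eq: "(\<Sum>s\<in>fib n m t. H s) = (\<Sum>s\<in>fib n m (delta 0). H s)" if t: "t \<in> St n" for t
  proof -
    obtain \<sigma> \<mu> where \<sigma>: "\<sigma> \<in> C n" "\<mu> ^ N = 1" "t = (\<lambda>x. \<mu> * act n \<sigma> (delta 0) x)"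
      using St_transitive[OF t] by blast
    have \<mu>0: "\<mu> \<noteq> 0" using root_norm[OF \<sigma>(2)] by auto
    have \<mu>i: "(1 / \<mu>) ^ N = 1" using \<sigma>(2) by (simp add: power_divide)
    note u = unitary_C[OF \<sigma>(1)]
    let ?f = "\<lambda>s x. \<mu> * act n \<sigma> s x" and ?b = "\<lambda>s. act n (adj \<sigma>) (\<lambda>x. 1 / \<mu> * s x)"
    have fb: "?f (?b s) = s" "?b (?f s) = s" for s
      using \<mu>0 act_adj[OF u] by (simp_all add: act_scale)
    have fSt: "?f s \<in> St m" if "s \<in> St m" for s using that \<sigma> nm by (intro St_scale St_act) auto
    have bSt: "?b s \<in> St m" if "s \<in> St m" for s using that \<sigma>(1) nm \<mu>i by (intro St_act St_scale C_adj) auto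
    have sl: "slice n (?f s) = (\<lambda>x. \<mu> * act n \<sigma> (slice n s) x)" for s
      unfolding slice_act[symmetric] by (auto simp: slice_def)
    show ?thesis
    proof (rule sum.reindex_bij_witness[of _ ?f ?b])
      fix s assume "s \<in> fib n m (delta 0)"
      then obtain r where r: "s \<in> St m" "r > 0" "slice n s = (\<lambda>x. of_real r * delta 0 x)" by (auto simp: fib_def)
      have "slice n (?f s) = (\<lambda>x. of_real r * t x)" unfolding sl r(3) \<sigma>(3) by (simp add: act_scale mult_ac)
      then show "?f s \<in> fib n m t" using fSt[OF r(1)] r(2) unfolding fib_def by blast
      show "?b (?f s) = s" by (rule fb)
    next
      fix s assume "s \<in> fib n m t"
      then obtain r where r: "s \<in> St m" "r > 0" "slice n s = (\<lambda>x. of_real r * t x)" by (auto simp: fib_def)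
      have s1: "slice n (\<lambda>x. 1 / \<mu> * s x) = (\<lambda>x. of_real r * act n \<sigma> (delta 0) x)"
      proof
        fix x
        have "slice n (\<lambda>x. 1 / \<mu> * s x) x = 1 / \<mu> * slice n s x" by (simp add: slice_def)
        then show "slice n (\<lambda>x. 1 / \<mu> * s x) x = of_real r * act n \<sigma> (delta 0) x"
          unfolding r(3) \<sigma>(3) using \<mu>0 by simp
      qed
      have "slice n (?b s) = act n (adj \<sigma>) (slice n (\<lambda>x. 1 / \<mu> * s x))" by (rule slice_act)
      also have "\<dots> = (\<lambda>x. of_real r * delta 0 x)" unfolding s1 by (simp only: act_scale act_adj(1)[OF u])
      finally have "slice n (?b s) = (\<lambda>x. of_real r * delta 0 x)" .
      then show "?b s \<in> fib n m (delta 0)" using bSt[OF r(1)] r(2) unfolding fib_def by blast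
      show "?f (?b s) = s" by (rule fb)
      show "H (?b s) = H s" using act[OF C_adj[OF \<sigma>(1)] St_scale[OF \<mu>i r(1)]] root[OF \<mu>i r(1)] by simp
    qed
  qed
  have "(\<Sum>s\<in>?S. H s) = (\<Sum>t\<in>St n. \<Sum>s\<in>{s \<in> ?S. ?g s = t}. H s)"
    by (rule sum.group[symmetric, OF fin finite_St]) (use slice_normalized in auto)
  also have "\<dots> = (\<Sum>t\<in>St n. \<Sum>s\<in>fib n m (delta 0). H s)"
    by (rule sum.cong[OF refl]) (simp only: fibt eq)
  finally show ?thesis by simp
qed

text \<open>The value at 0 is positive, so the support contains 0 and is linear, and the phase
  factor is that positive number.\<close>

lemma fib_delta_cases:
  assumes "s \<in> fib n m (delta 0)"
  obtains c V \<psi> where "c > 0" "aff V" "0 \<in> V" "V \<subseteq> coords m" "quad \<psi>" "V \<inter> coords n = {0}"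
    "s = (\<lambda>x. if x \<in> V then of_real c * \<psi> x else 0)" "c\<^sup>2 * real (card V) = 1" "s \<in> St m"
proof -
  obtain r where r: "s \<in> St m" "r > 0" "slice n s = (\<lambda>x. of_real r * delta 0 x)" using assms by (auto simp: fib_def)
  obtain c V \<psi> where s: "phase c" "c \<noteq> 0" "aff V" "V \<noteq> {}" "V \<subseteq> coords m" "quad \<psi>"
    "s = (\<lambda>x. if x \<in> V then c * \<psi> x else 0)" "(norm c)\<^sup>2 * real (card V) = 1" using r(1) by (rule St_cases)
  have \<psi>0: "\<psi> x \<noteq> 0" for x using quad_norm[OF s(6), of x] by (metis norm_zero zero_neq_one)
  have s0: "s 0 = of_real r" using fun_cong[OF r(3), of 0] by (simp add: slice_def delta_def)
  then have V0: "0 \<in> V" using r(2) by (auto simp: s(7) split: if_splits)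
  then have c: "c = of_real r" using s0 quad_0[OF s(6)] by (simp add: s(7))
  have "V \<inter> coords n = {0}"
  proof -
    have "x = 0" if "x \<in> V" "x \<in> coords n" for x
      using fun_cong[OF r(3), of x] that s(2) \<psi>0[of x] by (auto simp: slice_def delta_def s(7) split: if_splits)
    then show ?thesis using V0 by auto
  qed
  moreover have "r\<^sup>2 * real (card V) = 1" using s(8) r(2) by (simp add: c)
  ultimately show ?thesis
    by (rule_tac that[of r V \<psi>]) (use r s c V0 in auto)
qed

lemma coords_Suc: "x \<in> coords (Suc n) \<Longrightarrow> x n = 0 \<Longrightarrow> x \<in> coords n"
  by (auto simp: coords_def) (metis Suc_leI le_neq_implies_less)

lemma coords_mono: "n \<le> m \<Longrightarrow> x \<in> coords n \<Longrightarrow> x \<in> coords m"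
  by (auto simp: coords_def)

lemma aff_0:
  assumes "aff V" "0 \<in> V"
  shows "x \<in> V \<Longrightarrow> sc t x \<in> V" "x \<in> V \<Longrightarrow> y \<in> V \<Longrightarrow> x + sc t y \<in> V"
proof -
  have V: "x + sc t (y - z) \<in> V" if "x \<in> V" "y \<in> V" "z \<in> V" for x y z t
    using assms(1) that unfolding aff_def by blast
  show "x \<in> V \<Longrightarrow> sc t x \<in> V" using V[of 0 x 0 t] assms(2) by simp
  show "x \<in> V \<Longrightarrow> y \<in> V \<Longrightarrow> x + sc t y \<in> V" using V[of x y 0 t] assms(2) by simp
qed

lemma finite_Q1: "finite Q1"
  using card_Q1[OF adm] by (metis card.infinite finite_UNIV_card_ge_0 finite less_irrefl power_eq_0_iff zero_less_card_finite)

lemma card_coords: "card (coords n :: (nat \<Rightarrow> 'f) set) = CARD('f) ^ n"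
proof (induction n)
  case 0
  have "coords 0 = {0 :: nat \<Rightarrow> 'f}" by (auto simp: coords_def fun_eq_iff)
  then show ?case by simp
next
  case (Suc n)
  have "bij_betw (\<lambda>(x, t). x + sc t (uvec n)) (coords n \<times> UNIV) (coords (Suc n) :: (nat \<Rightarrow> 'f) set)"
  proof (rule bij_betw_byWitness[of _ "\<lambda>x. (trunc n x, x n)"])
    show "\<forall>a\<in>coords n \<times> UNIV. (trunc n ((\<lambda>(x, t). x + sc t (uvec n)) a), (\<lambda>(x, t). x + sc t (uvec n)) a n) = a"
      by (auto simp: trunc_def uvec_def coords_def fun_eq_iff not_less)
    show "\<forall>a\<in>coords (Suc n). (\<lambda>(x, t). x + sc t (uvec n)) (trunc n a, a n) = a"
    proof
      fix a :: "nat \<Rightarrow> 'f" assume a: "a \<in> coords (Suc n)"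
      then have "trunc (Suc n) a = a" by (auto simp: trunc_def coords_def fun_eq_iff)
      then show "(\<lambda>(x, t). x + sc t (uvec n)) (trunc n a, a n) = a" using trunc_Suc[of n a] by simp
    qed
  qed (auto simp: trunc_def uvec_def coords_def)
  from bij_betw_same_card[OF this] show ?case using Suc by (simp add: card_cartesian_product mult.commute)
qed

text \<open>The support meets the hyperplane x_n = 0 only in 0, so it is {0} or a line. A line has a
  unique direction w + e_n with w in F^n and carries one character from \<open>Q1\<close>; the
  remaining state is the point mass.\<close>

lemma card_fib_Suc: "card (fib n (Suc n) (delta 0)) = 1 + CARD('f) ^ n * card Q1"
proof -
  define q where "q = 1 / sqrt (real CARD('f))"
  have q: "q > 0" "q\<^sup>2 * real CARD('f) = 1" by (auto simp: q_def power_divide)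
  define g where "g = (\<lambda>(w, \<theta>) x. if x = sc (x n) (w + uvec n) then complex_of_real q * \<theta> (x n) else 0)"
  have gQ: "g (w, \<theta>) (sc t (w + uvec n)) = of_real q * \<theta> t" if "w \<in> coords n" for w \<theta> t
  proof -
    have e: "sc t (w + uvec n) n = t" using that by (simp add: coords_def uvec_def)
    show ?thesis by (simp only: g_def prod.case e simp_thms if_True)
  qed
  have in_fib: "g (w, \<theta>) \<in> fib n (Suc n) (delta 0)" if w: "w \<in> coords n" and \<theta>: "\<theta> \<in> Q1" for w \<theta>
  proof -
    let ?d = "w + uvec n" and ?V = "{x. x = sc (x n) (w + uvec n)}"
    have dn: "?d n = 1" using w by (simp add: coords_def uvec_def)
    have V: "?V = (\<lambda>t. sc t ?d) ` UNIV"
    proof (intro equalityI subsetI)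
      fix x assume "x \<in> (\<lambda>t. sc t ?d) ` UNIV"
      then obtain t where x: "x = sc t ?d" by blast
      then have "x n = t" using dn by simp
      then show "x \<in> ?V" using x by simp
    qed auto
    have "inj (\<lambda>t. sc t ?d)"
    proof (rule injI)
      fix a b assume "sc a ?d = sc b ?d"
      then have "sc a ?d n = sc b ?d n" by (rule fun_cong)
      then show "a = b" using dn by simp
    qed
    then have cV: "card ?V = CARD('f)" unfolding V by (rule card_image)
    have "aff ?V" unfolding aff_def
    proof (intro conjI ballI allI impI)
      fix x y z t assume "x \<in> ?V" "y \<in> ?V" "z \<in> ?V"
      then obtain a b c where "x = sc a ?d" "y = sc b ?d" "z = sc c ?d" unfolding V by blast
      then have "x + sc t (y - z) = sc (a + t * (b - c)) ?d" by (simp add: fun_eq_iff algebra_simps)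
      then show "x + sc t (y - z) \<in> ?V" unfolding V by blast
    next
      show "0 \<in> ?V" by simp
    qed
    moreover have "?V \<subseteq> coords (Suc n)" unfolding V using w by (auto simp: coords_def uvec_def)
    ultimately have "(\<lambda>x. if x \<in> ?V then of_real q * (\<lambda>x. \<theta> (x n)) x else 0) \<in> St (Suc n)"
      using quad_comp1[OF \<theta> linf_coord] cV q by (intro StI phase_of_real) auto
    then have gSt: "g (w, \<theta>) \<in> St (Suc n)" by (simp add: g_def)
    have \<theta>0: "\<theta> 0 = 1" using \<theta> quad1D(1) by (auto simp: Q1_def)
    have "slice n (g (w, \<theta>)) = (\<lambda>x. of_real q * delta 0 x)"
    proof
      fix x :: "nat \<Rightarrow> 'f"
      have "x n = 0" if "x \<in> coords n" using that by (simp add: coords_def)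
      then show "slice n (g (w, \<theta>)) x = of_real q * delta 0 x" by (auto simp: slice_def g_def delta_def \<theta>0)
    qed
    then show ?thesis using gSt q(1) unfolding fib_def by blast
  qed
  have d0: "delta 0 \<in> fib n (Suc n) (delta 0)"
  proof -
    have "slice n (delta 0) = (\<lambda>x. of_real 1 * delta 0 x)" by (auto simp: slice_def delta_def)
    then show ?thesis using delta_St[of 0 "Suc n"] unfolding fib_def by (auto intro!: exI[of _ 1])
  qed
  have sub: "fib n (Suc n) (delta 0) \<subseteq> insert (delta 0) (g ` (coords n \<times> Q1))"
  proof
    fix s assume "s \<in> fib n (Suc n) (delta 0)"
    then obtain c V \<psi> where s: "c > 0" "aff V" "0 \<in> V" "V \<subseteq> coords (Suc n)" "quad \<psi>" "V \<inter> coords n = {0}"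
      "s = (\<lambda>x. if x \<in> V then of_real c * \<psi> x else 0)" "c\<^sup>2 * real (card V) = 1" by (rule fib_delta_cases)
    show "s \<in> insert (delta 0) (g ` (coords n \<times> Q1))"
    proof (cases "V = {0}")
      case True
      then have "c = 1" using s(1,8) by (simp add: power2_eq_1_iff)
      then have "s = delta 0" by (auto simp: s(7) True delta_def quad_0[OF s(5)])
      then show ?thesis by simp
    next
      case False
      then obtain v where v: "v \<in> V" "v \<noteq> 0" using s(3) by blast
      then have vn: "v n \<noteq> 0" using s(4,6) coords_Suc by blast
      define d where "d = sc (1 / v n) v"
      have d: "d \<in> V" "d n = 1" using aff_0(1)[OF s(2,3) v(1)] vn by (auto simp: d_def)
      define w where "w = trunc n d"
      have w: "w \<in> coords n" by (auto simp: w_def trunc_def coords_def)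
      have dw: "d = w + uvec n"
      proof -
        have "trunc (Suc n) d = d" using d(1) s(4) by (auto simp: trunc_def coords_def fun_eq_iff)
        then show ?thesis using trunc_Suc[of n d] d(2) by (simp add: w_def)
      qed
      have V: "x \<in> V \<longleftrightarrow> x = sc (x n) d" for x
      proof
        assume x: "x \<in> V"
        have m: "x + sc (- x n) d \<in> V" by (rule aff_0(2)[OF s(2,3) x d(1)])
        moreover have "(x + sc (- x n) d) n = 0" using d(2) by simp
        ultimately have "x + sc (- x n) d = 0" using s(4,6) coords_Suc by blast
        then show "x = sc (x n) d" by (simp add: add_eq_0_iff2)
      next
        assume "x = sc (x n) d"
        then show "x \<in> V" using aff_0(1)[OF s(2,3) d(1), of "x n"] by simp
      qed
      have "V = (\<lambda>t. sc t d) ` UNIV"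
      proof (intro equalityI subsetI)
        fix x assume "x \<in> V"
        then show "x \<in> (\<lambda>t. sc t d) ` UNIV" using V by blast
      qed (use aff_0(1)[OF s(2,3) d(1)] in auto)
      moreover have "inj (\<lambda>t. sc t d)"
      proof (rule injI)
        fix a b assume "sc a d = sc b d"
        then have "sc a d n = sc b d n" by (rule fun_cong)
        then show "a = b" using d(2) by simp
      qed
      ultimately have "card V = CARD('f)" by (simp add: card_image)
      then have "c\<^sup>2 = q\<^sup>2" using s(8) q(2) by (metis mult_right_cancel mult_zero_right zero_neq_one)
      then have cq: "c = q" using s(1) q(1) by (simp add: power2_eq_iff)
      have "s = g (w, \<lambda>t. \<psi> (sc t d))"
      proof
        fix x
        show "s x = g (w, \<lambda>t. \<psi> (sc t d)) x"
          using V[of x] by (auto simp: s(7) g_def cq dw[symmetric])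
      qed
      then show ?thesis using w quad_line_Q1[OF s(5), of d] by blast
    qed
  qed
  have inj: "inj_on g (coords n \<times> Q1)"
  proof (rule inj_onI, clarify)
    fix w \<theta> w' \<theta>' assume a: "w \<in> coords n" "\<theta> \<in> Q1" "w' \<in> coords n" "\<theta>' \<in> Q1" "g (w, \<theta>) = g (w', \<theta>')"
    have nz: "\<theta> 1 \<noteq> 0" using a(2) quad1_nonzero by (auto simp: Q1_def)
    have "g (w, \<theta>) (sc 1 (w + uvec n)) \<noteq> 0" unfolding gQ[OF a(1)] using nz q by simp
    then have ww: "sc 1 (w + uvec n) = sc (sc 1 (w + uvec n) n) (w' + uvec n)"
      unfolding a(5) by (auto simp: g_def split: if_splits)
    have hn: "sc 1 (w + uvec n) n = 1" using a(1) by (simp add: coords_def uvec_def)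
    have "w = w'" using ww unfolding hn by simp
    moreover have "\<theta> t = \<theta>' t" for t
      using gQ[OF a(1), of \<theta> t] gQ[OF a(3), of \<theta>' t] a(5) \<open>w = w'\<close> q by simp
    ultimately show "w = w' \<and> \<theta> = \<theta>'" by auto
  qed
  have nin: "delta 0 \<notin> g ` (coords n \<times> Q1)"
  proof
    assume "delta 0 \<in> g ` (coords n \<times> Q1)"
    then obtain w \<theta> where a: "w \<in> coords n" "\<theta> \<in> Q1" "delta 0 = g (w, \<theta>)" by auto
    have nz: "\<theta> 1 \<noteq> 0" using a(2) quad1_nonzero by (auto simp: Q1_def)
    then have "delta 0 (sc 1 (w + uvec n)) \<noteq> 0" unfolding a(3) gQ[OF a(1)] using q by simp
    then have "sc 1 (w + uvec n) = 0" by (auto simp: delta_def split: if_splits)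
    then have "sc 1 (w + uvec n) n = 0" by (simp only: zero_fun_apply)
    then show False using a(1) by (simp add: coords_def uvec_def)
  qed
  have "fib n (Suc n) (delta 0) = insert (delta 0) (g ` (coords n \<times> Q1))"
    using sub d0 in_fib by auto
  then have "card (fib n (Suc n) (delta 0)) = Suc (card (g ` (coords n \<times> Q1)))"
    using nin finite_Q1 by simp
  then show ?thesis by (simp add: card_image[OF inj] card_cartesian_product card_coords)
qed

text \<open>The affine support moves along and \<open>quad_shift\<close> handles the character. In
  the even type the support would have to keep containing 0.\<close>

lemma state_shift:
  assumes "state s" "\<not> T = Type_qE"
  shows "state (\<lambda>x. s (x + d))"
proof (rule stateE[OF assms(1)])
  fix c V \<psi> assume s: "phase c" "aff V" "quad \<psi>" "s = (\<lambda>x. if x \<in> V then c * \<psi> x else 0)"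
  have e: "T = Type_qE \<Longrightarrow> d = 0" using assms(2) by simp
  obtain \<psi>' where \<psi>': "quad \<psi>'" "\<And>x. \<psi> (x + d) = \<psi> d * \<psi>' x" using quad_shift(1)[OF s(3) e] by blast
  show ?thesis
  proof (rule stateI[OF phase_mult[OF s(1) quad_shift(2)[OF s(3) e]] _ \<psi>'(1)])
    show "aff {x. x + d \<in> V}" unfolding aff_def
    proof (intro conjI ballI allI impI)
      fix x y z t assume "x \<in> {x. x + d \<in> V}" "y \<in> {x. x + d \<in> V}" "z \<in> {x. x + d \<in> V}"
      then have "(x + d) + sc t ((y + d) - (z + d)) \<in> V" using s(2) unfolding aff_def mem_Collect_eq by blast
      moreover have "(x + d) + sc t ((y + d) - (z + d)) = x + sc t (y - z) + d" by (simp add: add_ac)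
      ultimately show "x + sc t (y - z) \<in> {x. x + d \<in> V}" by (simp only: mem_Collect_eq)
    qed (use assms(2) in simp)
    show "s (x + d) = (if x \<in> {x. x + d \<in> V} then c * \<psi> d * \<psi>' x else 0)" for x
      by (simp add: s(4) \<psi>'(2))
  qed
qed

text \<open>A support disjoint from x_n = 0 lies in one parallel hyperplane x_n = k with k nonzero,
  and translation identifies such states with states on F^n. In type \<open>Type_qE\<close> every
  support contains 0.\<close>

lemma card_slice_0:
  "card {s \<in> St (Suc n). slice n s = (\<lambda>x. 0)} = (if T = Type_qE then 0 else (CARD('f) - 1) * card (St n))"
proof (cases "T = Type_qE")
  case True
  have "slice n s \<noteq> (\<lambda>x. 0)" if sS: "s \<in> St (Suc n)" for s
  proof
    assume sl: "slice n s = (\<lambda>x. 0)"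
    obtain c V \<psi> where s: "phase c" "c \<noteq> 0" "aff V" "V \<noteq> {}" "V \<subseteq> coords (Suc n)" "quad \<psi>"
      "s = (\<lambda>x. if x \<in> V then c * \<psi> x else 0)" "(norm c)\<^sup>2 * real (card V) = 1" using sS by (rule St_cases)
    have "0 \<in> V" using s(3,4) True unfolding aff_def by blast
    then have "s 0 = c" using quad_0[OF s(6)] by (simp add: s(7))
    then show False using fun_cong[OF sl, of 0] s(2) by (simp add: slice_def)
  qed
  then have e: "{s \<in> St (Suc n). slice n s = (\<lambda>x. 0)} = {}" by blast
  show ?thesis unfolding e using True by simp
next
  case False
  let ?e = "\<lambda>k. sc k (uvec n) :: nat \<Rightarrow> 'f"
  let ?g = "\<lambda>(k, t) x. t (x - ?e k) :: complex"
  have en: "?e k n = k" for k by (simp add: uvec_def)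
  have nsum: "(\<Sum>x\<in>coords (Suc n). (norm (t (x - ?e k)))\<^sup>2) = (\<Sum>x\<in>coords n. (norm (t x))\<^sup>2)"
    if "\<And>x. x \<notin> coords n \<Longrightarrow> t x = 0" for t :: "_ \<Rightarrow> complex" and k
  proof -
    have "(\<Sum>x\<in>coords (Suc n). (norm (t (x - ?e k)))\<^sup>2) = (\<Sum>x\<in>(\<lambda>x. x + ?e k) ` coords n. (norm (t (x - ?e k)))\<^sup>2)"
    proof (rule sum.mono_neutral_right)
      show "(\<lambda>x. x + ?e k) ` coords n \<subseteq> coords (Suc n)" by (auto simp: coords_def uvec_def)
      show "\<forall>i\<in>coords (Suc n) - (\<lambda>x. x + ?e k) ` coords n. (norm (t (i - ?e k)))\<^sup>2 = 0"
      proof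
        fix i assume i: "i \<in> coords (Suc n) - (\<lambda>x. x + ?e k) ` coords n"
        have "i - ?e k \<notin> coords n"
        proof
          assume "i - ?e k \<in> coords n"
          then have "i \<in> (\<lambda>x. x + ?e k) ` coords n" by (intro image_eqI[of _ _ "i - ?e k"]) simp_all
          then show False using i by blast
        qed
        then show "(norm (t (i - ?e k)))\<^sup>2 = 0" using that by simp
      qed
    qed simp
    also have "\<dots> = (\<Sum>x\<in>coords n. (norm (t x))\<^sup>2)"
      by (subst sum.reindex) (auto simp: inj_on_def)
    finally show ?thesis .
  qed
  have "bij_betw ?g ((UNIV - {0}) \<times> St n) {s \<in> St (Suc n). slice n s = (\<lambda>x. 0)}"
  proof (rule bij_betwI')
    fix a b :: "'f \<times> ((nat \<Rightarrow> 'f) \<Rightarrow> complex)" assume ab: "a \<in> (UNIV - {0}) \<times> St n" "b \<in> (UNIV - {0}) \<times> St n"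
    obtain k t l u where kt: "a = (k, t)" "b = (l, u)" by (metis surj_pair)
    show "(?g a = ?g b) = (a = b)"
    proof
      assume g: "?g a = ?g b"
      have "t \<in> St n" "u \<in> St n" using ab kt by auto
      have "\<exists>x\<in>coords n. t x \<noteq> 0"
      proof (rule ccontr)
        assume "\<not> (\<exists>x\<in>coords n. t x \<noteq> 0)"
        then have "(\<Sum>x\<in>coords n. (norm (t x))\<^sup>2) = 0" by simp
        then show False using \<open>t \<in> St n\<close> by (simp add: St_def)
      qed
      then obtain x where x: "x \<in> coords n" "t x \<noteq> 0" by blast
      have "t x = u (x + ?e k - ?e l)" using fun_cong[OF g, of "x + ?e k"] by (simp add: kt)
      then have "x + ?e k - ?e l \<in> coords n" using x \<open>u \<in> St n\<close> by (auto simp: St_def)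
      then have "(x + ?e k - ?e l) n = 0" by (simp add: coords_def)
      moreover have "x n = 0" using x by (simp add: coords_def)
      ultimately have kl: "k = l" by (simp add: uvec_def)
      have "t y = u y" for y using fun_cong[OF g, of "y + ?e k"] kl by (simp add: kt)
      then show "a = b" using kl kt by auto
    qed simp
  next
    fix a :: "'f \<times> ((nat \<Rightarrow> 'f) \<Rightarrow> complex)" assume a: "a \<in> (UNIV - {0}) \<times> St n"
    obtain k t where kt: "a = (k, t)" by (metis surj_pair)
    then have k: "k \<noteq> 0" and t: "t \<in> St n" using a by auto
    have supp: "\<And>x. x \<notin> coords n \<Longrightarrow> t x = 0" using t by (auto simp: St_def)
    have "state (\<lambda>x. t (x + (- ?e k)))" using t by (intro state_shift[OF _ False]) (simp add: St_def)
    moreover have "t (x - ?e k) = 0" if "x \<notin> coords (Suc n)" for x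
    proof (rule supp)
      show "x - ?e k \<notin> coords n"
      proof
        assume "x - ?e k \<in> coords n"
        then have "x \<in> coords (Suc n)" by (auto simp: coords_def uvec_def)
        with that show False by simp
      qed
    qed
    moreover have "slice n (\<lambda>x. t (x - ?e k)) = (\<lambda>x. 0)"
    proof
      fix x
      have "x - ?e k \<notin> coords n" if "x \<in> coords n"
      proof
        assume "x - ?e k \<in> coords n"
        then have "(x - ?e k) n = 0" by (simp add: coords_def)
        moreover have "x n = 0" using that by (simp add: coords_def)
        ultimately show False using k by (simp add: uvec_def)
      qed
      then show "slice n (\<lambda>x. t (x - ?e k)) x = 0" using supp by (simp add: slice_def)
    qed
    ultimately show "?g a \<in> {s \<in> St (Suc n). slice n s = (\<lambda>x. 0)}"
      using nsum[where t = t and k = k, OF supp] t by (simp add: kt St_def)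
  next
    fix s assume "s \<in> {s \<in> St (Suc n). slice n s = (\<lambda>x. 0)}"
    then have sS: "s \<in> St (Suc n)" and sl: "slice n s = (\<lambda>x. 0)" by auto
    obtain c V \<psi> where s: "phase c" "c \<noteq> 0" "aff V" "V \<noteq> {}" "V \<subseteq> coords (Suc n)" "quad \<psi>"
      "s = (\<lambda>x. if x \<in> V then c * \<psi> x else 0)" "(norm c)\<^sup>2 * real (card V) = 1" using sS by (rule St_cases)
    have \<psi>0: "\<psi> x \<noteq> 0" for x using quad_norm[OF s(6), of x] by (metis norm_zero zero_neq_one)
    have Vn: "x n \<noteq> 0" if "x \<in> V" for x
    proof
      assume "x n = 0"
      then have "x \<in> coords n" using that s(5) coords_Suc by blast
      then show False using fun_cong[OF sl, of x] that s(2) \<psi>0[of x] by (simp add: slice_def s(7))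
    qed
    obtain v where v: "v \<in> V" using s(4) by blast
    define k where "k = v n"
    have Vk: "x n = k" if x: "x \<in> V" for x
    proof (rule ccontr)
      assume ne: "x n \<noteq> k"
      \<comment> \<open>The multiplier is chosen such that the last coordinate vanishes on the line
        through v and x.\<close>
      have "v + sc (- k / (k - x n)) (v - x) \<in> V" using s(3) v x unfolding aff_def by blast
      moreover have "(v + sc (- k / (k - x n)) (v - x)) n = 0" using ne by (simp add: k_def)
      ultimately show False using Vn by blast
    qed
    define t where "t = (\<lambda>x. s (x + ?e k))"
    have supp: "t x = 0" if "x \<notin> coords n" for x
    proof (rule ccontr)
      assume "t x \<noteq> 0"
      then have xV: "x + ?e k \<in> V" by (auto simp: t_def s(7) split: if_splits)
      then have "x n = 0" using Vk[OF xV] by (simp add: uvec_def)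
      moreover have "x + ?e k \<in> coords (Suc n)" using xV s(5) by blast
      then have "x \<in> coords (Suc n)" by (auto simp: coords_def uvec_def)
      ultimately show False using that coords_Suc by blast
    qed
    have st: "(\<lambda>x. t (x - ?e k)) = s" by (simp add: t_def)
    have "state t" unfolding t_def using sS by (intro state_shift[OF _ False]) (simp add: St_def)
    moreover have "(\<Sum>x\<in>coords n. (norm (t x))\<^sup>2) = 1"
      using nsum[where t = t and k = k, OF supp] sS fun_cong[OF st] by (simp add: St_def)
    ultimately have "t \<in> St n" using supp by (simp add: St_def)
    moreover have "k \<noteq> 0" using Vn[OF v] by (simp add: k_def)
    ultimately show "\<exists>a\<in>(UNIV - {0}) \<times> St n. s = ?g a"
      using st by (intro bexI[of _ "(k, t)"]) auto
  qed
  from bij_betw_same_card[OF this] show ?thesis using False by (simp add: card_cartesian_product)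
qed

text \<open>States with zero and with nonzero slice together: the factor is 1 + q^n q in type
  \<open>Type_qE\<close>, and (q - 1) + (1 + q^n q^2) = q (1 + q^(n+1)) otherwise.\<close>

lemma card_St_Suc:
  "card (St (Suc n)) = card (St n) * ((if T = Type_qE then 1 else CARD('f)) * (1 + CARD('f) ^ Suc n))"
proof -
  let ?q = "CARD('f)"
  have "card (St (Suc n)) = card {s \<in> St (Suc n). slice n s = (\<lambda>x. 0)} + card {s. s \<in> St (Suc n) \<and> slice n s \<noteq> (\<lambda>x. 0)}"
    using finite_St[of "Suc n"] by (subst card_Un_disjoint[symmetric]) (auto intro!: arg_cong[of _ _ card])
  also have "card {s. s \<in> St (Suc n) \<and> slice n s \<noteq> (\<lambda>x. 0)} = card (St n) * (1 + ?q ^ n * card Q1)"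
    using fibre_sum[of n "Suc n" "\<lambda>_. 1 :: nat"] card_fib_Suc[of n] by simp
  also have "card {s \<in> St (Suc n). slice n s = (\<lambda>x. 0)} + card (St n) * (1 + ?q ^ n * card Q1) =
      card (St n) * ((if T = Type_qE then 1 else ?q) * (1 + ?q ^ Suc n))"
  proof (cases "T = Type_qE")
    case True
    then show ?thesis using card_slice_0[of n] card_Q1[OF adm] by simp
  next
    case False
    obtain m where m: "?q = Suc m" using zero_less_card_finite[where ?'a = 'f] gr0_implies_Suc by blast
    have "(?q - 1) * card (St n) + card (St n) * (1 + ?q ^ n * ?q ^ 2) = card (St n) * (?q * (1 + ?q ^ Suc n))"
      unfolding m by (simp add: algebra_simps power2_eq_square)
    then show ?thesis using False card_slice_0[of n] card_Q1[OF adm] by simp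
  qed
  finally show ?thesis .
qed

end

section \<open>Counting invertible matrices\<close>

lemma inj_mat_invertible:
  assumes A: "(A :: 'f::field mat) \<in> carrier_mat n n" and inj: "\<And>x. x \<in> carrier_vec n \<Longrightarrow> A *\<^sub>v x = 0\<^sub>v n \<Longrightarrow> x = 0\<^sub>v n"
  shows "invertible_mat A"
proof -
  have "det A \<noteq> 0" using det_0_iff_vec_prod_zero_field[OF A] inj by blast
  from det_non_zero_imp_unit[OF A this, of "()"] obtain B
    where "B \<in> carrier_mat n n" "B * A = 1\<^sub>m n" "A * B = 1\<^sub>m n"
    by (auto simp: Units_def ring_mat_def)
  then show ?thesis using A by (intro invertible_matI[of A n B]) auto
qed

text \<open>Full column rank; \<open>k\<close> is the induction variable of the count, and
  \<open>k = n\<close> is the general linear group.\<close>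

definition inj_mats :: "nat \<Rightarrow> nat \<Rightarrow> 'f::field mat set" where
  "inj_mats k n = {A \<in> carrier_mat n k. \<forall>x\<in>carrier_vec k. A *\<^sub>v x = 0\<^sub>v n \<longrightarrow> x = 0\<^sub>v k}"

definition mat_snoc :: "nat \<Rightarrow> nat \<Rightarrow> 'f mat \<Rightarrow> 'f vec \<Rightarrow> 'f mat" where
  "mat_snoc n k A v = mat n (Suc k) (\<lambda>(i, j). if j < k then A $$ (i, j) else v $ i)"

lemma mat_snoc_mult:
  fixes A :: "'f::field mat"
  assumes "A \<in> carrier_mat n k" "v \<in> carrier_vec n" "x \<in> carrier_vec (Suc k)"
  shows "mat_snoc n k A v *\<^sub>v x = A *\<^sub>v vec k (\<lambda>i. x $ i) + (x $ k) \<cdot>\<^sub>v v"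
proof (rule eq_vecI)
  fix i assume "i < dim_vec (A *\<^sub>v vec k (\<lambda>i. x $ i) + (x $ k) \<cdot>\<^sub>v v)"
  then have i: "i < n" using assms by simp
  have "(mat_snoc n k A v *\<^sub>v x) $ i = (\<Sum>j\<in>{0..<Suc k}. (if j < k then A $$ (i, j) else v $ i) * x $ j)"
    using i assms by (simp add: mat_snoc_def scalar_prod_def)
  also have "\<dots> = (\<Sum>j\<in>{0..<k}. A $$ (i, j) * x $ j) + v $ i * x $ k"
    by simp
  also have "\<dots> = (A *\<^sub>v vec k (\<lambda>i. x $ i) + (x $ k) \<cdot>\<^sub>v v) $ i"
    using i assms by (simp add: scalar_prod_def mult.commute)
  finally show "(mat_snoc n k A v *\<^sub>v x) $ i = (A *\<^sub>v vec k (\<lambda>i. x $ i) + (x $ k) \<cdot>\<^sub>v v) $ i" .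
qed (use assms in \<open>simp add: mat_snoc_def\<close>)

lemma finite_carrier_mat: "finite (carrier_mat n k :: 'f::finite mat set)"
proof -
  have "carrier_mat n k \<subseteq> (\<lambda>f. mat n k f) ` {f. \<forall>p. (p \<in> {..<n} \<times> {..<k} \<longrightarrow> f p \<in> (UNIV :: 'f set)) \<and> (p \<notin> {..<n} \<times> {..<k} \<longrightarrow> f p = undefined)}"
  proof
    fix A :: "'f mat" assume A: "A \<in> carrier_mat n k"
    let ?f = "\<lambda>p. if p \<in> {..<n} \<times> {..<k} then A $$ p else undefined"
    have "A = mat n k ?f" using A by (auto intro!: eq_matI)
    then show "A \<in> (\<lambda>f. mat n k f) ` {f. \<forall>p. (p \<in> {..<n} \<times> {..<k} \<longrightarrow> f p \<in> UNIV) \<and> (p \<notin> {..<n} \<times> {..<k} \<longrightarrow> f p = undefined)}"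
      by (intro image_eqI[of _ _ ?f]) auto
  qed
  moreover have "finite {f. \<forall>p. (p \<in> {..<n} \<times> {..<k} \<longrightarrow> f p \<in> (UNIV :: 'f set)) \<and> (p \<notin> {..<n} \<times> {..<k} \<longrightarrow> f p = undefined)}"
    by (rule finite_set_of_finite_funs) auto
  ultimately show ?thesis by (rule finite_subset[OF _ finite_imageI])
qed

text \<open>A further column keeps the columns independent exactly if it avoids the column space,
  which has q^k elements by injectivity.\<close>

lemma card_inj_mats_Suc:
  assumes cv: "\<And>m. card (carrier_vec m :: 'f::{finite,field} vec set) = CARD('f) ^ m"
  shows "card (inj_mats (Suc k) n :: 'f mat set) = card (inj_mats k n :: 'f mat set) * (CARD('f) ^ n - CARD('f) ^ k)"
proof -
  let ?img = "\<lambda>A :: 'f mat. (\<lambda>x. A *\<^sub>v x) ` carrier_vec k"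
  let ?S = "Sigma (inj_mats k n :: 'f mat set) (\<lambda>A. carrier_vec n - ?img A)"
  have "bij_betw (\<lambda>(A, v). mat_snoc n k A v) ?S (inj_mats (Suc k) n)"
  proof (rule bij_betw_byWitness[of _ "\<lambda>A. (mat n k (\<lambda>p. A $$ p), col A k)"])
    show "\<forall>a\<in>?S. (mat n k (\<lambda>p. (\<lambda>(A, v). mat_snoc n k A v) a $$ p), col ((\<lambda>(A, v). mat_snoc n k A v) a) k) = a"
      by (auto simp: inj_mats_def mat_snoc_def intro!: eq_matI eq_vecI)
    show "\<forall>a\<in>inj_mats (Suc k) n. (\<lambda>(A, v). mat_snoc n k A v) (mat n k (\<lambda>p. a $$ p), col a k) = a"
      by (auto simp: inj_mats_def mat_snoc_def less_Suc_eq intro!: eq_matI)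
    show "(\<lambda>(A, v). mat_snoc n k A v) ` ?S \<subseteq> inj_mats (Suc k) n"
    proof (clarify)
      fix A :: "'f mat" and v assume A: "A \<in> inj_mats k n" and v: "v \<in> carrier_vec n" "v \<notin> ?img A"
      have Ac: "A \<in> carrier_mat n k" using A by (simp add: inj_mats_def)
      show "mat_snoc n k A v \<in> inj_mats (Suc k) n"
        unfolding inj_mats_def
      proof (intro CollectI conjI ballI impI)
        show "mat_snoc n k A v \<in> carrier_mat n (Suc k)" by (simp add: mat_snoc_def)
        fix x :: "'f vec" assume x: "x \<in> carrier_vec (Suc k)" and 0: "mat_snoc n k A v *\<^sub>v x = 0\<^sub>v n"
        let ?y = "vec k (\<lambda>i. x $ i)"
        have e: "A *\<^sub>v ?y + (x $ k) \<cdot>\<^sub>v v = 0\<^sub>v n" using 0 mat_snoc_mult[OF Ac v(1) x] by simp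
        have Ay: "A *\<^sub>v ?y \<in> carrier_vec n" using Ac by (intro mult_mat_vec_carrier[of _ n k]) auto
        have xk: "x $ k = 0"
        proof (rule ccontr)
          assume nz: "x $ k \<noteq> 0"
          have "v = A *\<^sub>v ((- (1 / x $ k)) \<cdot>\<^sub>v ?y)"
          proof (rule eq_vecI)
            fix i assume "i < dim_vec (A *\<^sub>v ((- (1 / x $ k)) \<cdot>\<^sub>v ?y))"
            then have i: "i < n" using Ac by simp
            have "(A *\<^sub>v ?y + (x $ k) \<cdot>\<^sub>v v) $ i = 0" using e i by simp
            then have "(A *\<^sub>v ?y) $ i + x $ k * v $ i = 0" using i v Ay by simp
            then have "x $ k * v $ i = - ((A *\<^sub>v ?y) $ i)" by (simp only: add_eq_0_iff)
            then have "x $ k * v $ i / x $ k = - ((A *\<^sub>v ?y) $ i) / x $ k" by (rule arg_cong)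
            then have "v $ i = - (1 / x $ k) * (A *\<^sub>v ?y) $ i" using nz by simp
            then show "v $ i = (A *\<^sub>v ((- (1 / x $ k)) \<cdot>\<^sub>v ?y)) $ i"
              using i Ac Ay by (subst mult_mat_vec[of _ n k]) auto
          qed (use v Ac in simp)
          then have "v \<in> ?img A" by (rule image_eqI) simp
          with v(2) show False by contradiction
        qed
        have "A *\<^sub>v ?y = 0\<^sub>v n"
        proof (rule eq_vecI)
          fix i assume "i < dim_vec (0\<^sub>v n)"
          then have i: "i < n" by simp
          have "(A *\<^sub>v ?y + (x $ k) \<cdot>\<^sub>v v) $ i = 0" using e i by simp
          then show "(A *\<^sub>v ?y) $ i = 0\<^sub>v n $ i" using i v Ay xk by simp
        qed (use Ac in auto)
        then have "?y = 0\<^sub>v k" using A by (simp add: inj_mats_def)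
        then have "x $ i = 0" if "i < k" for i using that by (metis index_vec index_zero_vec(1))
        then show "x = 0\<^sub>v (Suc k)" using xk x by (auto intro!: eq_vecI simp: less_Suc_eq)
      qed
    qed
    show "(\<lambda>A. (mat n k (\<lambda>p. A $$ p), col A k)) ` inj_mats (Suc k) n \<subseteq> ?S"
    proof clarify
      fix A :: "'f mat" assume A: "A \<in> inj_mats (Suc k) n"
      then have Ac: "A \<in> carrier_mat n (Suc k)" by (simp add: inj_mats_def)
      let ?B = "mat n k (\<lambda>p. A $$ p)" and ?v = "col A k"
      have AB: "A = mat_snoc n k ?B ?v" using Ac by (auto simp: mat_snoc_def less_Suc_eq intro!: eq_matI)
      have B: "?B \<in> carrier_mat n k" and v: "?v \<in> carrier_vec n" using Ac by auto
      have zero: "y = 0\<^sub>v k \<and> t = 0" if y: "y \<in> carrier_vec k" and e: "?B *\<^sub>v y + t \<cdot>\<^sub>v ?v = 0\<^sub>v n" for y t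
      proof -
        let ?x = "vec (Suc k) (\<lambda>i. if i < k then y $ i else t)"
        have "vec k (\<lambda>i. ?x $ i) = y" using y by (auto intro!: eq_vecI)
        then have "A *\<^sub>v ?x = 0\<^sub>v n" using mat_snoc_mult[OF B v, of ?x] AB e by simp
        then have x0: "?x = 0\<^sub>v (Suc k)" using A by (simp add: inj_mats_def)
        have "?x $ i = 0" if "i < Suc k" for i using that by (simp add: x0)
        from this[of k] have "t = 0" by simp
        moreover have "y $ i = 0" if "i < k" for i using \<open>\<And>i. i < Suc k \<Longrightarrow> ?x $ i = 0\<close>[of i] that by simp
        ultimately show ?thesis using y by (auto intro!: eq_vecI)
      qed
      have "?B \<in> inj_mats k n" unfolding inj_mats_def
      proof (intro CollectI conjI ballI impI B)
        fix x :: "'f vec" assume "x \<in> carrier_vec k" "?B *\<^sub>v x = 0\<^sub>v n"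
        moreover have "0 \<cdot>\<^sub>v ?v = 0\<^sub>v n" using Ac by (intro eq_vecI) simp_all
        ultimately show "x = 0\<^sub>v k" using zero[of x 0] by simp
      qed
      moreover have "?v \<notin> ?img ?B"
      proof
        assume "?v \<in> ?img ?B"
        then obtain y where y: "y \<in> carrier_vec k" "?v = ?B *\<^sub>v y" by blast
        have "?B *\<^sub>v y + (-1) \<cdot>\<^sub>v ?v = 0\<^sub>v n" unfolding y(2)[symmetric] using Ac by (intro eq_vecI) simp_all
        from zero[OF y(1) this] show False by simp
      qed
      ultimately show "?B \<in> inj_mats k n \<and> ?v \<in> carrier_vec n - ?img ?B" using v by blast
    qed
  qed
  from bij_betw_same_card[OF this] have "card (inj_mats (Suc k) n :: 'f mat set) = card ?S" by simp
  also have "\<dots> = (\<Sum>A\<in>(inj_mats k n :: 'f mat set). card (carrier_vec n - ?img A))"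
    by (rule card_SigmaI) (auto intro: finite_subset[OF _ finite_carrier_mat] simp: inj_mats_def)
  also have "\<dots> = (\<Sum>A\<in>(inj_mats k n :: 'f mat set). CARD('f) ^ n - CARD('f) ^ k)"
  proof (rule sum.cong[OF refl])
    fix A :: "'f mat" assume A: "A \<in> inj_mats k n"
    then have Ac: "A \<in> carrier_mat n k" by (simp add: inj_mats_def)
    have "inj_on (\<lambda>x. A *\<^sub>v x) (carrier_vec k)"
    proof (rule inj_onI)
      fix x y :: "'f vec" assume xy: "x \<in> carrier_vec k" "y \<in> carrier_vec k" "A *\<^sub>v x = A *\<^sub>v y"
      have "A *\<^sub>v (x - y) = 0\<^sub>v n" using xy Ac by (simp add: mult_minus_distrib_mat_vec[of _ n k])
      then have d: "x - y = 0\<^sub>v k" using A xy by (simp add: inj_mats_def)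
      show "x = y"
      proof (rule eq_vecI)
        fix i assume "i < dim_vec y"
        then have "(x - y) $ i = 0" "i < dim_vec y" using d xy by auto
        then show "x $ i = y $ i" by simp
      qed (use xy in auto)
    qed
    then have "card (?img A) = CARD('f) ^ k" by (simp add: card_image cv)
    moreover have "?img A \<subseteq> carrier_vec n" using Ac by (auto intro: mult_mat_vec_carrier[of _ n k])
    ultimately show "card (carrier_vec n - ?img A) = CARD('f) ^ n - CARD('f) ^ k"
      by (subst card_Diff_subset) (auto simp: cv intro: finite_subset)
  qed
  finally show ?thesis by simp
qed

context code_setup
begin

lemma card_carrier_vec: "card (carrier_vec n :: 'f vec set) = CARD('f) ^ n"
  using bij_betw_same_card[OF bij_coords[where ?'f = 'f and n = n]] card_coords[of n] by simp

definition GL :: "nat \<Rightarrow> 'f mat set" where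
  "GL n = {u \<in> carrier_mat n n. invertible_mat u}"

lemma card_GL: "card (GL n) = (\<Prod>k<n. CARD('f) ^ n - CARD('f) ^ k)"
proof -
  have "card (inj_mats k n :: 'f mat set) = (\<Prod>i<k. CARD('f) ^ n - CARD('f) ^ i)" for k
  proof (induction k)
    case 0
    have "inj_mats 0 n = {0\<^sub>m n 0 :: 'f mat}" by (auto simp: inj_mats_def)
    then show ?case by simp
  next
    case (Suc k)
    then show ?case using card_inj_mats_Suc[OF card_carrier_vec, of k n] by simp
  qed
  moreover have "GL n = inj_mats n n"
  proof (intro equalityI subsetI)
    fix u assume "u \<in> GL n"
    then have u: "u \<in> carrier_mat n n" "invertible_mat u" by (auto simp: GL_def)
    obtain u' where u': "u' \<in> carrier_mat n n" "u' * u = 1\<^sub>m n" using invertible_mat_obtain[OF u] by blast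
    have "x = 0\<^sub>v n" if x: "x \<in> carrier_vec n" "u *\<^sub>v x = 0\<^sub>v n" for x
    proof -
      have "x = u' *\<^sub>v 0\<^sub>v n" using mat_inverse_vec[OF u(1) u' x(1)] x(2) by simp
      then show ?thesis using u'(1) by (auto intro!: eq_vecI)
    qed
    then show "u \<in> inj_mats n n" using u by (auto simp: inj_mats_def)
  next
    fix u :: "'f mat" assume "u \<in> inj_mats n n"
    then show "u \<in> GL n" using inj_mat_invertible[of u n] by (auto simp: inj_mats_def GL_def)
  qed
  ultimately show ?thesis by simp
qed

section \<open>Counting quadratic characters\<close>

definition restr :: "nat \<Rightarrow> ((nat \<Rightarrow> 'f) \<Rightarrow> complex) \<Rightarrow> (nat \<Rightarrow> 'f) \<Rightarrow> complex" where
  "restr n \<psi> = (\<lambda>x. if x \<in> coords n then \<psi> x else 0)"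

text \<open>The cutoff identifies characters that differ only in spectator coordinates and so makes
  the set finite.\<close>

definition QF :: "nat \<Rightarrow> ((nat \<Rightarrow> 'f) \<Rightarrow> complex) set" where
  "QF n = restr n ` {\<psi>. quad \<psi>}"

lemma quad_nonzero: "quad \<psi> \<Longrightarrow> \<psi> x \<noteq> 0"
  using quad_cnj_mult[of \<psi> x] by auto

lemma trunc_in_coords [simp]: "trunc n x \<in> coords n"
  by (auto simp: trunc_def coords_def)

lemma trunc_coords: "x \<in> coords n \<Longrightarrow> trunc n x = x"
  by (auto simp: trunc_def coords_def fun_eq_iff)

lemma lin_trunc: "lin (trunc n)"
  unfolding trunc_def[abs_def] by (rule lin_reindex_if)

text \<open>Splitting off the last coordinate, a character on F^(n+1) consists of a character on
  F^n, a character of the last coordinate and the n mixed coefficients a of the polar form. They are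
  recovered from the values at x_n = 0, on the last axis and on sums of two unit vectors, in this
  order.\<close>

lemma card_QF: "card (QF n) = (\<Prod>k<n. CARD('f) ^ k) * card Q1 ^ n"
proof (induction n)
  case 0
  have "QF 0 = {restr 0 (\<lambda>x. 1)}"
  proof -
    have r0: "restr 0 \<psi> = restr 0 (\<lambda>x. 1)" if "quad \<psi>" for \<psi>
    proof
      fix x :: "nat \<Rightarrow> 'f"
      have "x = 0" if "x \<in> coords 0" using that by (auto simp: coords_def fun_eq_iff)
      then show "restr 0 \<psi> x = restr 0 (\<lambda>x. 1) x" using quad_0[OF that] by (auto simp: restr_def)
    qed
    show ?thesis
    proof (intro equalityI subsetI)
      fix z assume "z \<in> QF 0"
      then show "z \<in> {restr 0 (\<lambda>x. 1)}" using r0 unfolding QF_def by blast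
    next
      fix z assume "z \<in> {restr 0 (\<lambda>x. 1)}"
      then show "z \<in> QF 0" using quad_one unfolding QF_def by blast
    qed
  qed
  then show ?case by simp
next
  case (Suc n)
  let ?l = "\<lambda>a x. \<Sum>i<n. a i * x i :: 'f"
  define g where "g = (\<lambda>(\<phi>, a, \<theta>). restr (Suc n) (\<lambda>x. \<phi> (trunc n x) * \<theta> (x n) * \<chi> (x n * ?l a x)))"
  have "bij_betw g (QF n \<times> coords n \<times> Q1) (QF (Suc n))"
    unfolding bij_betw_def
  proof
    show "g ` (QF n \<times> coords n \<times> Q1) = QF (Suc n)"
    proof (intro equalityI subsetI)
      fix z assume "z \<in> g ` (QF n \<times> coords n \<times> Q1)"
      then obtain \<psi> a \<theta> where z: "z = g (restr n \<psi>, a, \<theta>)" "quad \<psi>" "a \<in> coords n" "\<theta> \<in> Q1" by (auto simp: QF_def)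
      have "bilin (\<lambda>x y. x n * ?l a y)"
        by (simp add: bilin_def linf_def algebra_simps sum.distrib sum_distrib_left)
      then have "quad (\<lambda>x. \<psi> (trunc n x) * \<theta> (x n) * \<chi> (x n * ?l a x))"
        by (intro quad_mult quad_comp_lin[OF z(2) lin_trunc] quad_comp1[OF z(4) linf_coord] quad_biform)
      moreover have "z = restr (Suc n) (\<lambda>x. \<psi> (trunc n x) * \<theta> (x n) * \<chi> (x n * ?l a x))"
        by (simp add: z(1) g_def restr_def cong: if_cong)
      ultimately show "z \<in> QF (Suc n)" unfolding QF_def by blast
    next
      fix z assume "z \<in> QF (Suc n)"
      then obtain \<psi> where z: "z = restr (Suc n) \<psi>" "quad \<psi>" by (auto simp: QF_def)
      obtain b where b: "bilin b" "\<And>x y. \<psi> (x + y) = \<psi> x * \<psi> y * \<chi> (b x y)" using z(2) by (rule quadE) blast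
      define a where "a = trunc n (\<lambda>i. b (uvec i) (uvec n))"
      have lb: "linf (\<lambda>x. b x (uvec n))" using b(1) by (simp add: bilin_def)
      have "\<psi> x = \<psi> (trunc n x) * \<psi> (sc (x n) (uvec n)) * \<chi> (x n * ?l a x)" if "x \<in> coords (Suc n)" for x
      proof -
        have "x = trunc n x + sc (x n) (uvec n)" using trunc_Suc[of n x] trunc_coords[OF that] by simp
        then have "\<psi> x = \<psi> (trunc n x) * \<psi> (sc (x n) (uvec n)) * \<chi> (b (trunc n x) (sc (x n) (uvec n)))"
          using b(2)[of "trunc n x" "sc (x n) (uvec n)"] by metis
        also have "b (trunc n x) (sc (x n) (uvec n)) = x n * b (trunc n x) (uvec n)" by (rule bilinD(4)[OF b(1)])
        also have "b (trunc n x) (uvec n) = ?l a x"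
          unfolding linf_trunc[OF lb] by (simp add: a_def trunc_def mult.commute)
        finally show ?thesis .
      qed
      then have "z = g (restr n \<psi>, a, \<lambda>t. \<psi> (sc t (uvec n)))"
        by (auto simp: z(1) g_def restr_def fun_eq_iff)
      moreover have "restr n \<psi> \<in> QF n" using z(2) by (auto simp: QF_def)
      moreover have "a \<in> coords n" by (simp add: a_def)
      ultimately show "z \<in> g ` (QF n \<times> coords n \<times> Q1)" using quad_line_Q1[OF z(2)] by blast
    qed
    show "inj_on g (QF n \<times> coords n \<times> Q1)"
    proof (rule inj_onI)
      fix p p' assume pp: "p \<in> QF n \<times> coords n \<times> Q1" "p' \<in> QF n \<times> coords n \<times> Q1" "g p = g p'"
      obtain \<phi> a \<theta> \<phi>' a' \<theta>' where p: "p = (\<phi>, a, \<theta>)" "p' = (\<phi>', a', \<theta>')" by (metis surj_pair)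
      have \<phi>: "\<phi> \<in> QF n" "\<phi>' \<in> QF n" and a: "a \<in> coords n" "a' \<in> coords n" and \<theta>: "\<theta> \<in> Q1" "\<theta>' \<in> Q1"
        using pp by (auto simp: p)
      have eq: "\<phi> (trunc n x) * \<theta> (x n) * \<chi> (x n * ?l a x) = \<phi>' (trunc n x) * \<theta>' (x n) * \<chi> (x n * ?l a' x)"
        if "x \<in> coords (Suc n)" for x
        using fun_cong[OF pp(3), of x] that by (simp add: p g_def restr_def)
      have \<theta>0: "\<theta> 0 = 1" "\<theta>' 0 = 1" using \<theta> quad1D(1) by (auto simp: Q1_def)
      have \<phi>0: "\<phi> 0 = 1" "\<phi>' 0 = 1" using \<phi> by (auto simp: QF_def restr_def quad_0)
      have "\<phi> x = \<phi>' x" for x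
      proof (cases "x \<in> coords n")
        case True
        then have "x n = 0" "x \<in> coords (Suc n)" by (auto simp: coords_def)
        then show ?thesis using eq[of x] trunc_coords[OF True] \<theta>0 by simp
      qed (use \<phi> in \<open>auto simp: QF_def restr_def\<close>)
      then have \<phi>\<phi>: "\<phi> = \<phi>'" by blast
      have u: "sc t (uvec n) \<in> coords (Suc n)" "trunc n (sc t (uvec n)) = 0" "sc t (uvec n) n = t" "?l c (sc t (uvec n)) = 0" for t c
        by (auto simp: coords_def uvec_def trunc_def fun_eq_iff)
      have "\<theta> t = \<theta>' t" for t
        using eq[OF u(1), of t] unfolding u \<phi>0 by simp
      then have \<theta>\<theta>: "\<theta> = \<theta>'" by blast
      have "a i = a' i" for i
      proof (cases "i < n")
        case True
        have "a i - a' i = 0"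
        proof (rule \<chi>_eq_1_imp_0)
          fix t
          let ?x = "uvec i + sc t (uvec n)"
          have x: "?x \<in> coords (Suc n)" "?x n = t" "trunc n ?x = uvec i" using True
            by (auto simp: coords_def uvec_def trunc_def fun_eq_iff)
          have l: "?l c ?x = c i" for c :: "nat \<Rightarrow> 'f"
          proof -
            have "?l c ?x = (\<Sum>j<n. if j = i then c i else 0)" by (rule sum.cong) (auto simp: uvec_def)
            then show ?thesis using True by simp
          qed
          have "\<phi> (uvec i) \<noteq> 0"
          proof -
            obtain \<psi> where "\<phi> = restr n \<psi>" "quad \<psi>" using \<phi>(1) by (auto simp: QF_def)
            moreover have "uvec i \<in> coords n" using True by (auto simp: coords_def uvec_def)
            ultimately show ?thesis using quad_nonzero by (simp add: restr_def)
          qed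
          moreover have "\<theta> t \<noteq> 0" using \<theta>(1) quad1_nonzero by (auto simp: Q1_def)
          ultimately have "\<chi> (t * a i) = \<chi> (t * a' i)" using eq[OF x(1)] unfolding x(2,3) l \<phi>\<phi> \<theta>\<theta> by simp
          then show "\<chi> (t * (a i - a' i)) = 1" by (simp add: right_diff_distrib \<chi>_diff \<chi>_cnj)
        qed
        then show ?thesis by simp
      qed (use a in \<open>auto simp: coords_def\<close>)
      then show "p = p'" using \<phi>\<phi> \<theta>\<theta> by (auto simp: p)
    qed
  qed
  from bij_betw_same_card[OF this] show ?case
    using Suc by (simp add: card_cartesian_product card_coords mult_ac)
qed

subsection \<open>States given by an isomorphism\<close>

definition hi :: "nat \<Rightarrow> (nat \<Rightarrow> 'f) \<Rightarrow> 'f vec" where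
  "hi g x = vec g (\<lambda>i. x (i + g))"

text \<open>The position (a, b) of a matrix entry. The index b occupies the first g coordinates
  because \<open>act g\<close> operates there; a occupies the next g.\<close>

definition J :: "nat \<Rightarrow> 'f vec \<Rightarrow> 'f vec \<Rightarrow> nat \<Rightarrow> 'f" where
  "J g a b = join g b (\<lambda>i. if i < 2 * g then a $ (i - g) else 0)"

lemma J_simps [simp]:
  assumes "a \<in> carrier_vec g" "b \<in> carrier_vec g"
  shows "hi g (J g a b) = a" "vec g (J g a b) = b" "J g a b \<in> coords (2 * g)"
  using assms by (auto simp: hi_def J_def join_def coords_def intro!: eq_vecI)

lemma J_hi: "x \<in> coords (2 * g) \<Longrightarrow> J g (hi g x) (vec g x) = x"
  by (auto simp: hi_def J_def join_def coords_def fun_eq_iff)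

lemma vlin_hi: "vlin g (hi g)"
  using vlin_comp[OF vlin_vec lin_reindex[of "\<lambda>i. i + g"], of g] by (simp add: hi_def[abs_def])

text \<open>The state supported on the graph b = u a. As a matrix in a and b it is monomial:
  q^(-g/2) times a product of a \<open>d_sub\<close> and an \<open>m_sub\<close>.\<close>

definition iso_state :: "nat \<Rightarrow> 'f mat \<Rightarrow> ((nat \<Rightarrow> 'f) \<Rightarrow> complex) \<Rightarrow> (nat \<Rightarrow> 'f) \<Rightarrow> complex" where
  "iso_state g u \<phi> = (\<lambda>x. if x \<in> coords (2 * g) \<and> vec g x = u *\<^sub>v hi g x
     then of_real (1 / sqrt (real CARD('f) ^ g)) * \<phi> (join g (hi g x) 0) else 0)"

lemma iso_state_fib:
  assumes u: "u \<in> GL g" and \<phi>: "\<phi> \<in> QF g"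
  shows "iso_state g u \<phi> \<in> fib g (2 * g) (delta 0)"
proof -
  have uc: "u \<in> carrier_mat g g" using u by (simp add: GL_def)
  obtain \<psi> where \<psi>: "\<phi> = restr g \<psi>" "quad \<psi>" using \<phi> by (auto simp: QF_def)
  let ?q = "1 / sqrt (real CARD('f) ^ g)"
  have q: "?q > 0" by simp
  let ?V = "{x \<in> coords (2 * g). vec g x = u *\<^sub>v hi g x}"
  have vl: "vlin g (\<lambda>x. u *\<^sub>v hi g x)" by (rule vlin_mat[OF uc vlin_hi])
  have "bij_betw (\<lambda>a. J g a (u *\<^sub>v a)) (carrier_vec g) ?V"
  proof (rule bij_betw_byWitness[of _ "hi g"])
    show "\<forall>x\<in>?V. J g (hi g x) (u *\<^sub>v hi g x) = x"
    proof
      fix x assume x: "x \<in> ?V"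
      then have h: "u *\<^sub>v hi g x = vec g x" by simp
      show "J g (hi g x) (u *\<^sub>v hi g x) = x" unfolding h by (rule J_hi) (use x in simp)
    qed
  qed (auto simp: vlinD(1)[OF vlin_hi] mult_mat_vec_carrier[OF uc])
  from bij_betw_same_card[OF this] have cV: "card ?V = CARD('f) ^ g" by (simp add: card_carrier_vec)
  have aff: "aff ?V" unfolding aff_def
  proof (intro conjI ballI allI impI)
    fix x y z t assume xyz: "x \<in> ?V" "y \<in> ?V" "z \<in> ?V"
    have "y - z = y + sc (-1) z" by (simp add: fun_eq_iff)
    moreover have "vec g (x + sc t (y + sc (-1) z)) = u *\<^sub>v hi g (x + sc t (y + sc (-1) z))"
      unfolding vlinD(2,3)[OF vl] vlinD(2,3)[OF vlin_vec] using xyz by simp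
    moreover have "x + sc t (y + sc (-1) z) \<in> coords (2 * g)" using xyz by (auto simp: coords_def)
    ultimately show "x + sc t (y - z) \<in> ?V" by (simp only: mem_Collect_eq simp_thms)
  next
    show "0 \<in> ?V" using uc by (auto simp: hi_def coords_def scalar_prod_def intro!: eq_vecI)
  qed
  have quad: "quad (\<lambda>x. \<psi> (join g (hi g x) 0))"
  proof (rule quad_comp_lin[OF \<psi>(2)])
    have "lin (\<lambda>x :: nat \<Rightarrow> 'f. 0 :: nat \<Rightarrow> 'f)" by (simp add: lin_def)
    then show "lin (\<lambda>x. join g (hi g x) 0)" by (rule lin_join[OF vlin_hi])
  qed
  have "(\<lambda>x. if x \<in> ?V then of_real ?q * \<psi> (join g (hi g x) 0) else 0) \<in> St (2 * g)"
  proof (rule StI[OF phase_of_real aff _ quad])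
    show "(norm (complex_of_real ?q))\<^sup>2 * real (card ?V) = 1"
      unfolding norm_of_real cV by (simp add: power_divide)
  qed auto
  moreover have "iso_state g u \<phi> = (\<lambda>x. if x \<in> ?V then of_real ?q * \<psi> (join g (hi g x) 0) else 0)"
    by (auto simp: iso_state_def \<psi>(1) restr_def fun_eq_iff)
  ultimately have St: "iso_state g u \<phi> \<in> St (2 * g)" by simp
  have "slice g (iso_state g u \<phi>) = (\<lambda>x. of_real ?q * delta 0 x)"
  proof
    fix x
    show "slice g (iso_state g u \<phi>) x = of_real ?q * delta 0 x"
    proof (cases "x \<in> coords g")
      case True
      have h: "hi g x = 0\<^sub>v g" using True by (auto simp: hi_def coords_def intro!: eq_vecI)
      have uh: "u *\<^sub>v 0\<^sub>v g = 0\<^sub>v g" using uc by (auto intro!: eq_vecI)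
      have "vec g x = 0\<^sub>v g \<longleftrightarrow> x = 0"
      proof
        assume "vec g x = 0\<^sub>v g"
        then have "x i = 0" if "i < g" for i using that by (metis index_vec index_zero_vec(1))
        then show "x = 0" using True by (auto simp: coords_def fun_eq_iff) (metis not_less)
      qed auto
      moreover have "\<phi> (join g (0\<^sub>v g) 0) = 1"
      proof -
        have "join g (0\<^sub>v g) 0 = (0 :: nat \<Rightarrow> 'f)" by (auto simp: join_def)
        then show ?thesis using quad_0[OF \<psi>(2)] by (simp add: \<psi>(1) restr_def)
      qed
      moreover have "x \<in> coords (2 * g)" using True by (rule coords_mono[rotated]) simp
      ultimately show ?thesis using True unfolding slice_def iso_state_def h uh delta_def by simp
    next
      case False
      then have "x \<noteq> 0" by auto
      then show ?thesis using False by (simp add: slice_def delta_def)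
    qed
  qed
  then show ?thesis using St q unfolding fib_def by blast
qed

lemma inj_iso_state: "inj_on (\<lambda>(u, \<phi>). iso_state g u \<phi>) (GL g \<times> QF g)"
proof (rule inj_onI, clarify)
  fix u \<phi> u' \<phi>' assume a: "u \<in> GL g" "\<phi> \<in> QF g" "u' \<in> GL g" "\<phi>' \<in> QF g" "iso_state g u \<phi> = iso_state g u' \<phi>'"
  have c: "u \<in> carrier_mat g g" "u' \<in> carrier_mat g g" using a by (auto simp: GL_def)
  obtain \<psi> where \<psi>: "\<phi> = restr g \<psi>" "quad \<psi>" using a(2) by (auto simp: QF_def)
  have val: "iso_state g u \<phi> (J g z (u *\<^sub>v z)) = of_real (1 / sqrt (real CARD('f) ^ g)) * \<phi> (join g z 0)"
    if "z \<in> carrier_vec g" for z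
    using that c mult_mat_vec_carrier[OF c(1) that] by (simp add: iso_state_def)
  have nz: "\<phi> (join g z 0) \<noteq> 0" if "z \<in> carrier_vec g" for z
  proof -
    have "join g z 0 \<in> coords g" by (auto simp: join_def coords_def)
    then show ?thesis using quad_nonzero[OF \<psi>(2)] by (simp add: \<psi>(1) restr_def)
  qed
  have uu: "u *\<^sub>v z = u' *\<^sub>v z" and \<phi>\<phi>: "\<phi> (join g z 0) = \<phi>' (join g z 0)" if z: "z \<in> carrier_vec g" for z
  proof -
    have "iso_state g u' \<phi>' (J g z (u *\<^sub>v z)) \<noteq> 0" using val[OF z] nz[OF z] a(5) by simp
    then show uu: "u *\<^sub>v z = u' *\<^sub>v z"
      using z mult_mat_vec_carrier[OF c(1) z] by (auto simp: iso_state_def split: if_splits)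
    have "iso_state g u' \<phi>' (J g z (u' *\<^sub>v z)) = of_real (1 / sqrt (real CARD('f) ^ g)) * \<phi>' (join g z 0)"
      using z c mult_mat_vec_carrier[OF c(2) z] by (simp add: iso_state_def)
    then show "\<phi> (join g z 0) = \<phi>' (join g z 0)"
      using val[OF z] unfolding a(5) uu by simp
  qed
  have "u = u'"
  proof (rule eq_matI)
    fix i j assume ij: "i < dim_row u'" "j < dim_col u'"
    have "(u *\<^sub>v unit_vec g j) $ i = (u' *\<^sub>v unit_vec g j) $ i" using uu[of "unit_vec g j"] by simp
    then show "u $$ (i, j) = u' $$ (i, j)" using ij c by simp
  qed (use c in auto)
  moreover have "\<phi> x = \<phi>' x" for x
  proof (cases "x \<in> coords g")
    case True
    then show ?thesis using \<phi>\<phi>[of "vec g x"] join_coords_id[OF True] by simp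
  qed (use a(2,4) in \<open>auto simp: QF_def restr_def\<close>)
  ultimately show "u = u' \<and> \<phi> = \<phi>'" by blast
qed

text \<open>The support V meets a = 0 only in 0, so the projection to a is injective;
  \<open>full\<close> makes the projection to b surjective. Both targets have q^g elements, hence
  both projections are bijective and V is the graph of an invertible map.\<close>

lemma fib_full_iso_state:
  assumes s: "s \<in> fib g (2 * g) (delta 0)"
    and full: "\<And>b. b \<in> carrier_vec g \<Longrightarrow> \<exists>a\<in>carrier_vec g. s (J g a b) \<noteq> 0"
  shows "s \<in> (\<lambda>(u, \<phi>). iso_state g u \<phi>) ` (GL g \<times> QF g)"
proof -
  obtain c V \<psi> where s: "c > 0" "aff V" "0 \<in> V" "V \<subseteq> coords (2 * g)" "quad \<psi>" "V \<inter> coords g = {0}"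
      "s = (\<lambda>x. if x \<in> V then of_real c * \<psi> x else 0)" "c\<^sup>2 * real (card V) = 1" using s by (rule fib_delta_cases)
  have finV: "finite V" using s(4) by (rule finite_subset) simp
  have add: "x + sc t y \<in> V" "sc t x \<in> V" if "x \<in> V" "y \<in> V" for x y t
    using aff_0[OF s(2,3)] that by auto
  have inj: "inj_on (hi g) V"
  proof (rule inj_onI)
    fix x y assume xy: "x \<in> V" "y \<in> V" "hi g x = hi g y"
    have m: "x + sc (-1) y \<in> V" using add xy by blast
    have "(x + sc (-1) y) i = 0" if "i \<ge> g" for i
    proof (cases "i < 2 * g")
      case True
      then have "i - g < g" using that by simp
      then have "hi g x $ (i - g) = x i" "hi g y $ (i - g) = y i" using that by (auto simp: hi_def)
      then show ?thesis using xy(3) by simp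
    next
      case False
      then show ?thesis using s(4) m by (auto simp: coords_def subset_iff)
    qed
    then have "x + sc (-1) y \<in> coords g" by (simp add: coords_def)
    then have "x + sc (-1) y = 0" using m s(6) by blast
    then show "x = y" by (simp add: sc_minus_one)
  qed
  have hiV: "hi g ` V \<subseteq> carrier_vec g" by (auto simp: hi_def)
  have loV: "vec g ` V = carrier_vec g"
  proof (intro equalityI subsetI)
    fix b :: "'f vec" assume b: "b \<in> carrier_vec g"
    obtain a where a: "a \<in> carrier_vec g" "s (J g a b) \<noteq> 0" using full[OF b] by blast
    then have "J g a b \<in> V" by (auto simp: s(7) split: if_splits)
    then show "b \<in> vec g ` V" using a(1) b by (intro image_eqI[of _ _ "J g a b"]) auto
  qed auto
  have "CARD('f) ^ g \<le> card V" using card_image_le[OF finV, of "vec g"] loV by (simp add: card_carrier_vec)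
  moreover have "card V \<le> CARD('f) ^ g"
    using card_mono[OF finite_carrier_vec hiV] card_image[OF inj] by (simp add: card_carrier_vec)
  ultimately have cV: "card V = CARD('f) ^ g" by simp
  have hi_eq: "hi g ` V = carrier_vec g"
    by (rule card_subset_eq[OF finite_carrier_vec hiV]) (simp add: card_image[OF inj] cV card_carrier_vec)
  have injlo: "inj_on (vec g) V"
    by (rule eq_card_imp_inj_on[OF finV]) (simp add: loV cV card_carrier_vec)
  define h where "h = inv_into V (hi g)"
  have h: "h a \<in> V" "hi g (h a) = a" if "a \<in> carrier_vec g" for a
    using that hi_eq by (auto simp: h_def inv_into_into f_inv_into_f)
  have h_hi: "h (hi g x) = x" if "x \<in> V" for x using that inj by (simp add: h_def)
  have hlin: "h (hi g x + t \<cdot>\<^sub>v hi g y) = x + sc t y" if "x \<in> V" "y \<in> V" for x y t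
    using h_hi[OF add(1)[OF that, of t]] by (simp add: vlinD[OF vlin_hi])
  have h0: "h (0\<^sub>v g) = 0"
  proof -
    have "hi g 0 = 0\<^sub>v g" by (auto simp: hi_def)
    then show ?thesis using h_hi[OF s(3)] by simp
  qed
  \<comment> \<open>Only compatibility of \<open>h\<close> with
    \<open>hi g x + t \<cdot> hi g y\<close> for x, y in V is known so far; adding one coordinate at
    a time gives its full linearity.\<close>
  have hsum: "h (vec g (\<lambda>i. if i < k then a $ i else 0)) = (\<Sum>j<k. sc (a $ j) (h (unit_vec g j)))"
    if "a \<in> carrier_vec g" "k \<le> g" for a k
    using that(2)
  proof (induction k)
    case 0
    have "vec g (\<lambda>i. if i < 0 then a $ i else 0) = 0\<^sub>v g" by auto
    then show ?case using h0 by simp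
  next
    case (Suc k)
    let ?w = "vec g (\<lambda>i. if i < k then a $ i else 0)"
    have e: "vec g (\<lambda>i. if i < Suc k then a $ i else 0) = hi g (h ?w) + (a $ k) \<cdot>\<^sub>v hi g (h (unit_vec g k))"
      using h(2)[of ?w] h(2)[of "unit_vec g k"] Suc.prems by (auto intro!: eq_vecI simp: less_Suc_eq)
    show ?case unfolding e using hlin[OF h(1) h(1), of ?w "unit_vec g k" "a $ k"] Suc by simp
  qed
  define u where "u = mat g g (\<lambda>(i, j). h (unit_vec g j) i)"
  have uc: "u \<in> carrier_mat g g" by (simp add: u_def)
  have hL: "h a = (\<Sum>j<g. sc (a $ j) (h (unit_vec g j)))" if "a \<in> carrier_vec g" for a
  proof -
    have "vec g (\<lambda>i. if i < g then a $ i else 0) = a" using that by auto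
    then show ?thesis using hsum[OF that, of g] by simp
  qed
  have sum_app: "(\<Sum>j\<in>A. f j) i = (\<Sum>j\<in>A. f j i)" for A :: "nat set" and f :: "nat \<Rightarrow> nat \<Rightarrow> 'f" and i
    by (induction A rule: infinite_finite_induct) auto
  have uh: "vec g (h a) = u *\<^sub>v a" if a: "a \<in> carrier_vec g" for a
  proof (rule eq_vecI)
    fix i assume "i < dim_vec (u *\<^sub>v a)"
    then have i: "i < g" by (simp add: u_def)
    have "h a i = (\<Sum>j<g. a $ j * h (unit_vec g j) i)" by (subst hL[OF a]) (simp add: sum_app)
    then show "vec g (h a) $ i = (u *\<^sub>v a) $ i"
      using i a by (simp add: u_def scalar_prod_def lessThan_atLeast0 mult.commute)
  qed (simp add: u_def)
  have V: "x \<in> V \<longleftrightarrow> x \<in> coords (2 * g) \<and> vec g x = u *\<^sub>v hi g x" for x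
  proof
    assume x: "x \<in> V"
    then show "x \<in> coords (2 * g) \<and> vec g x = u *\<^sub>v hi g x"
      using s(4) uh[of "hi g x"] h_hi[OF x] by (auto simp: vlinD(1)[OF vlin_hi])
  next
    assume x: "x \<in> coords (2 * g) \<and> vec g x = u *\<^sub>v hi g x"
    have hc: "hi g x \<in> carrier_vec g" by (simp add: vlinD(1)[OF vlin_hi])
    have "x = J g (hi g x) (vec g x)" by (rule J_hi[symmetric]) (use x in blast)
    also have "\<dots> = J g (hi g (h (hi g x))) (vec g (h (hi g x)))" using x uh[OF hc] h(2)[OF hc] by simp
    also have "\<dots> = h (hi g x)" using h(1)[OF hc] s(4) by (intro J_hi) blast
    finally show "x \<in> V" using h(1)[OF hc] by simp
  qed
  have "invertible_mat u"
  proof (rule inj_mat_invertible[OF uc])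
    fix a assume a: "a \<in> carrier_vec g" "u *\<^sub>v a = 0\<^sub>v g"
    have "vec g (h a) = vec g 0" using uh[OF a(1)] a(2) by auto
    then have "h a = 0" using injlo h(1)[OF a(1)] s(3) by (auto simp: inj_on_def)
    then have "a = hi g 0" using h(2)[OF a(1)] by simp
    then show "a = 0\<^sub>v g" by (auto simp: hi_def)
  qed
  then have uGL: "u \<in> GL g" using uc by (simp add: GL_def)
  \<comment> \<open>\<open>quad_comp_lin\<close> requires a linear map on all sequences, so the
    linear map behind \<open>h\<close> is extended by its values on unit vectors.\<close>
  define L where "L y = (\<Sum>j<g. sc (y j) (h (unit_vec g j)))" for y
  have "lin L" unfolding lin_def L_def
    by (auto simp: fvec.scale_left_distrib sum.distrib fvec.scale_sum_right)
  then have qL: "quad (\<lambda>y. \<psi> (L y))" by (rule quad_comp_lin[OF s(5)])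
  have cq: "c = 1 / sqrt (real CARD('f) ^ g)"
  proof -
    have "c\<^sup>2 = (1 / sqrt (real CARD('f) ^ g))\<^sup>2" using s(8) cV by (simp add: field_simps power_divide)
    then show ?thesis using s(1) by (simp add: power2_eq_iff_nonneg)
  qed
  have "s = iso_state g u (restr g (\<lambda>y. \<psi> (L y)))"
  proof
    fix x
    show "s x = iso_state g u (restr g (\<lambda>y. \<psi> (L y))) x"
    proof (cases "x \<in> V")
      case True
      have hc: "hi g x \<in> carrier_vec g" by (simp add: vlinD(1)[OF vlin_hi])
      have j: "join g (hi g x) 0 \<in> coords g" by (auto simp: join_def coords_def)
      have "L (join g (hi g x) 0) = (\<Sum>j<g. sc (hi g x $ j) (h (unit_vec g j)))"
        unfolding L_def by (rule sum.cong) (auto simp: join_def)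
      also have "\<dots> = x" using hL[OF hc] h_hi[OF True] by simp
      finally have "L (join g (hi g x) 0) = x" .
      then show ?thesis using True V[of x] j by (simp add: s(7) iso_state_def restr_def cq)
    next
      case False
      then have "\<not> (x \<in> coords (2 * g) \<and> vec g x = u *\<^sub>v hi g x)" using V by blast
      then show ?thesis using False unfolding s(7) iso_state_def by (simp only: if_False)
    qed
  qed
  then show ?thesis using uGL qL unfolding QF_def by blast
qed

end

section \<open>Pairing with a cusp form\<close>

lemma keys_conj_poly: "Poly_Mapping.keys (conj_poly p) = Poly_Mapping.keys p"
  by (auto simp: conj_poly_def in_keys_iff Poly_Mapping.map.rep_eq when_def)

lemma lookup_conj_poly: "Poly_Mapping.lookup (conj_poly p) m = cnj (Poly_Mapping.lookup p m)"
  by (auto simp: conj_poly_def Poly_Mapping.map.rep_eq when_def)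

lemma peval_conj_poly: "peval pconst s (conj_poly p) = peval (\<lambda>c. pconst (cnj c)) s p"
  by (simp add: peval_def keys_conj_poly lookup_conj_poly)

lemma pconst_cnj_hom: "comm_ring_hom (\<lambda>c. pconst (cnj c) :: ('v, complex) mpoly)"
  by unfold_locales (simp_all add: pconst.hom_add pconst.hom_mult)

lemma conj_poly_eq_peval: "conj_poly p = peval (\<lambda>c. pconst (cnj c)) pvar p"
  using peval_pvar_id[of "conj_poly p"] by (simp add: peval_conj_poly)

lemma conj_poly_hom: "comm_ring_hom (conj_poly :: ('v, complex) mpoly \<Rightarrow> _)"
proof -
  have eq: "conj_poly = peval (\<lambda>c. pconst (cnj c)) (pvar :: 'v \<Rightarrow> ('v, complex) mpoly)"
    by (intro ext conj_poly_eq_peval)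
  show ?thesis unfolding eq by (rule comm_ring_hom.peval_hom[OF pconst_cnj_hom])
qed

lemma conj_poly_pconst [simp]: "conj_poly (pconst c) = pconst (cnj c)"
  using comm_ring_hom.peval_pconst[OF pconst_cnj_hom, of pvar c] by (simp add: conj_poly_eq_peval)

lemma conj_poly_pvar [simp]: "conj_poly (pvar v) = pvar v"
  using comm_ring_hom.peval_pvar[OF pconst_cnj_hom, of pvar v] by (simp add: conj_poly_eq_peval)

lemma conj_poly_peval:
  fixes s :: "'a \<Rightarrow> ('b, complex) mpoly"
  shows "conj_poly (peval pconst s p) = peval pconst (\<lambda>v. conj_poly (s v)) (conj_poly p)"
proof -
  interpret comm_ring_hom "conj_poly :: ('b, complex) mpoly \<Rightarrow> _" by (rule conj_poly_hom)
  show ?thesis by (simp add: hom_peval peval_conj_poly)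
qed

lemma conj_apply_subst:
  "conj_poly (apply_subst n A p) = apply_subst n (\<lambda>v w. cnj (A v w)) (conj_poly p)"
proof -
  interpret comm_ring_hom "conj_poly :: ('a vec, complex) mpoly \<Rightarrow> _" by (rule conj_poly_hom)
  show ?thesis unfolding apply_subst_def conj_poly_peval by (simp add: hom_sum hom_mult)
qed

lemma peval_scale:
  fixes p :: "('v, complex) mpoly" and a :: "'v \<Rightarrow> ('w, complex) mpoly"
  assumes "homogeneous N p"
  shows "peval pconst (\<lambda>v. pconst c * a v) p = pconst (c ^ N) * peval pconst a p"
proof -
  have "peval pconst (\<lambda>v. pconst c * a v) p = (\<Sum>m\<in>Poly_Mapping.keys p. pconst (c ^ N) * (pconst (Poly_Mapping.lookup p m) * monom_eval a m))"
    unfolding peval_def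
  proof (rule sum.cong[OF refl])
    fix m assume m: "m \<in> Poly_Mapping.keys p"
    have "monom_eval (\<lambda>v. pconst c * a v) m = (\<Prod>v\<in>Poly_Mapping.keys m. pconst c ^ Poly_Mapping.lookup m v) * monom_eval a m"
      by (simp add: power_mult_distrib prod.distrib)
    also have "(\<Prod>v\<in>Poly_Mapping.keys m. (pconst c :: ('w, complex) mpoly) ^ Poly_Mapping.lookup m v) = pconst c ^ N"
      using assms m by (simp add: power_sum[symmetric] homogeneous_def)
    finally show "pconst (Poly_Mapping.lookup p m) * monom_eval (\<lambda>v. pconst c * a v) m =
        pconst (c ^ N) * (pconst (Poly_Mapping.lookup p m) * monom_eval a m)"
      by (simp add: pconst.hom_power mult_ac)
  qed
  then show ?thesis by (simp add: peval_def sum_distrib_left)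
qed

locale cusp_setup = code_setup T F N
  for T :: code_type and F :: "'f::{finite,field} itself" and N +
  fixes g :: nat and f :: "('f vec, complex) mpoly"
  assumes g_pos: "g \<ge> 1" and hom_f: "homogeneous N f" and cusp: "cusp_form T g f"
begin

abbreviation "fbar \<equiv> conj_poly f"

lemma fbar_in: "fbar \<in> polys_in (carrier_vec g)"
  using cusp by (simp add: cusp_form_def polys_in_def keys_conj_poly)

lemma hom_fbar: "homogeneous N fbar"
  using hom_f by (simp add: homogeneous_def keys_conj_poly)

text \<open>Invariance of f under the conjugate transpose of \<tau>, followed by conjugation of all
  coefficients, is invariance of \<open>fbar\<close> under the transpose.\<close>

lemma fbar_transpose:
  assumes "\<tau> \<in> C g"
  shows "apply_subst g (\<lambda>v w. \<tau> w v) fbar = fbar"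
proof -
  have "apply_subst g (adj \<tau>) f = f"
    using cusp C_adj[OF assms] by (simp add: cusp_form_def carrier_clifford_weil)
  then have "conj_poly (apply_subst g (adj \<tau>) f) = fbar" by simp
  then show ?thesis by (simp add: conj_apply_subst adj_def)
qed

text \<open>The linear form with coefficients s(a, b) for fixed b; it is the coefficient of y_b in
  the doubled linear form, see \<open>doubling_lf\<close>.\<close>

definition lform :: "((nat \<Rightarrow> 'f) \<Rightarrow> complex) \<Rightarrow> 'f vec \<Rightarrow> ('f vec, complex) mpoly" where
  "lform s b = (\<Sum>a\<in>carrier_vec g. pconst (s (J g a b)) * pvar a)"

text \<open>Up to \<open>fact N\<close>, the pairing of the doubled N-th power with f, see
  \<open>inner_doubling_lf\<close>.\<close>

definition Fs :: "((nat \<Rightarrow> 'f) \<Rightarrow> complex) \<Rightarrow> ('f vec, complex) mpoly" where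
  "Fs s = peval pconst (lform s) fbar"

lemma act_J:
  assumes "a \<in> carrier_vec g" "b \<in> carrier_vec g"
  shows "act g \<tau> s (J g a b) = (\<Sum>v\<in>carrier_vec g. s (J g a v) * \<tau> v b)"
proof -
  have "join g v (J g a b) = J g a v" for v by (simp add: J_def)
  then show ?thesis using assms by (simp add: act_def)
qed

text \<open>The action on the index b combines the linear forms by the transpose of \<tau>, which
  \<open>fbar\<close> absorbs.\<close>

lemma Fs_act:
  assumes "\<tau> \<in> C g"
  shows "Fs (act g \<tau> s) = Fs s"
proof -
  have eq: "lform (act g \<tau> s) b = (\<Sum>v\<in>carrier_vec g. pconst (\<tau> v b) * lform s v)" if b: "b \<in> carrier_vec g" for b
  proof -
    have "lform (act g \<tau> s) b = (\<Sum>a\<in>carrier_vec g. \<Sum>v\<in>carrier_vec g. pconst (\<tau> v b) * (pconst (s (J g a v)) * pvar a))"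
      unfolding lform_def
      by (rule sum.cong[OF refl]) (simp add: act_J[OF _ b] pconst.hom_sum pconst.hom_mult sum_distrib_right sum_distrib_left mult_ac)
    then show ?thesis by (subst (asm) sum.swap) (simp add: lform_def sum_distrib_left)
  qed
  have "Fs (act g \<tau> s) = peval pconst (\<lambda>b. \<Sum>v\<in>carrier_vec g. pconst (\<tau> v b) * lform s v) fbar"
    unfolding Fs_def by (rule peval_cong[OF fbar_in]) (rule eq)
  also have "\<dots> = peval pconst (lform s) (apply_subst g (\<lambda>v w. \<tau> w v) fbar)"
  proof -
    interpret h: comm_ring_hom "peval pconst (lform s)" by (rule pconst.peval_hom)
    show ?thesis unfolding apply_subst_def
      by (simp add: h.hom_peval h.hom_sum h.hom_mult pconst.peval_pconst pconst.peval_pvar)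
  qed
  finally show ?thesis by (simp add: fbar_transpose[OF assms] Fs_def)
qed

lemma Fs_scale: "Fs (\<lambda>x. c * s x) = pconst (c ^ N) * Fs s"
proof -
  have "lform (\<lambda>x. c * s x) = (\<lambda>b. pconst c * lform s b)"
    by (simp add: lform_def fun_eq_iff pconst.hom_mult sum_distrib_left mult_ac)
  then show ?thesis unfolding Fs_def using peval_scale[OF hom_fbar] by simp
qed

lemma Fs_root: "\<mu> ^ N = 1 \<Longrightarrow> Fs (\<lambda>x. \<mu> * s x) = Fs s"
  by (simp add: Fs_scale)

lemma Phi_op_fbar: "Phi_op g fbar = 0"
proof -
  interpret comm_ring_hom "conj_poly :: ('f vec, complex) mpoly \<Rightarrow> _" by (rule conj_poly_hom)
  have "(\<lambda>v :: 'f vec. conj_poly (if v $ (g - 1) = 0 then pvar (vec_first v (g - 1)) else 0)) =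
      (\<lambda>v. if v $ (g - 1) = 0 then pvar (vec_first v (g - 1)) else 0)" by auto
  then have "Phi_op g fbar = conj_poly (Phi_op g f)"
    unfolding Phi_op_def conj_poly_peval by simp
  then show ?thesis using cusp by (simp add: cusp_form_def)
qed

text \<open>If only rows with vanishing last coordinate survive, the substitution factors through the
  operator \<open>Phi_op\<close>.\<close>

lemma Fs_cusp:
  assumes "\<And>a b. a \<in> carrier_vec g \<Longrightarrow> b \<in> carrier_vec g \<Longrightarrow> s (J g a b) \<noteq> 0 \<Longrightarrow> b $ (g - 1) = 0"
  shows "Fs s = 0"
proof -
  let ?e = "\<lambda>w. vec g (\<lambda>i. if i < g - 1 then w $ i else 0)"
  let ?\<Psi> = "peval pconst (\<lambda>w. lform s (?e w))"
  interpret h: comm_ring_hom ?\<Psi> by (rule pconst.peval_hom)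
  have "?\<Psi> (Phi_op g fbar) = peval pconst (\<lambda>v. if v $ (g - 1) = 0 then lform s (?e (vec_first v (g - 1))) else 0) fbar"
  proof -
    have e: "?\<Psi> (if v $ (g - 1) = 0 then pvar (vec_first v (g - 1)) else 0) =
        (if v $ (g - 1) = 0 then lform s (?e (vec_first v (g - 1))) else 0)" for v :: "'f vec"
      by (cases "v $ (g - 1) = 0") (simp_all only: refl simp_thms if_True if_False pconst.peval_pvar h.hom_zero)
    show ?thesis unfolding Phi_op_def h.hom_peval e by (simp add: pconst.peval_pconst)
  qed
  also have "\<dots> = Fs s" unfolding Fs_def
  proof (rule peval_cong[OF fbar_in])
    fix b :: "'f vec" assume b: "b \<in> carrier_vec g"
    show "(if b $ (g - 1) = 0 then lform s (?e (vec_first b (g - 1))) else 0) = lform s b"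
    proof (cases "b $ (g - 1) = 0")
      case True
      have "?e (vec_first b (g - 1)) = b"
      proof (rule eq_vecI)
        fix i assume "i < dim_vec b"
        then have i: "i < g" using b by simp
        then show "?e (vec_first b (g - 1)) $ i = b $ i"
        proof (cases "i < g - 1")
          case False
          then have "i = g - 1" using i by linarith
          then show ?thesis using True g_pos i False by simp
        qed (simp add: vec_first_def)
      qed (use b in simp)
      then show ?thesis using True by simp
    next
      case False
      then have "s (J g a b) = 0" if "a \<in> carrier_vec g" for a using assms[OF that b] by blast
      then have "lform s b = 0" by (simp add: lform_def)
      then show ?thesis using False by simp
    qed
  qed
  finally show ?thesis using Phi_op_fbar h.hom_zero by simp
qed

text \<open>The vector p becomes the last row. With p_i nonzero, the other rows are all unit vectors
  except the i-th one; \<open>\<sigma>\<close> gives row i the index g - 1 that the last row leaves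
  free.\<close>

lemma exists_mat_last_row:
  fixes p :: "'f vec"
  assumes p: "p \<in> carrier_vec g" "p \<noteq> 0\<^sub>v g"
  shows "\<exists>u. u \<in> carrier_mat g g \<and> invertible_mat u \<and> (\<forall>x\<in>carrier_vec g. (u *\<^sub>v x) $ (g - 1) = p \<bullet> x)"
proof -
  obtain i where i: "i < g" "p $ i \<noteq> 0"
  proof (rule ccontr)
    assume "\<not> thesis"
    then have "p $ i = 0" if "i < g" for i using that \<open>\<And>i. i < g \<Longrightarrow> p $ i \<noteq> 0 \<Longrightarrow> thesis\<close> by blast
    then have "p = 0\<^sub>v g" using p(1) by (auto intro!: eq_vecI)
    then show False using p(2) by simp
  qed
  define \<sigma> where "\<sigma> r = (if r = i then g - 1 else r)" for r
  define u where "u = mat g g (\<lambda>(r, c). if r = g - 1 then p $ c else if c = \<sigma> r then 1 else (0::'f))"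
  have uc: "u \<in> carrier_mat g g" by (simp add: u_def)
  have g1: "g - 1 < g" using g_pos by simp
  have last: "(u *\<^sub>v x) $ (g - 1) = p \<bullet> x" if "x \<in> carrier_vec g" for x
    using that p(1) g1 by (simp add: u_def scalar_prod_def)
  have other: "(u *\<^sub>v x) $ r = x $ \<sigma> r" if "x \<in> carrier_vec g" "r < g" "r \<noteq> g - 1" for x r
  proof -
    have \<sigma>r: "\<sigma> r < g" using that g1 by (simp add: \<sigma>_def)
    have "(u *\<^sub>v x) $ r = (\<Sum>c = 0..<g. (if c = \<sigma> r then 1 else 0) * x $ c)"
      using that by (simp add: u_def scalar_prod_def)
    also have "\<dots> = (\<Sum>c = 0..<g. if c = \<sigma> r then x $ \<sigma> r else 0)" by (rule sum.cong) simp_all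
    finally have "(u *\<^sub>v x) $ r = (\<Sum>c = 0..<g. if c = \<sigma> r then x $ \<sigma> r else 0)" .
    then show ?thesis using \<sigma>r by simp
  qed
  have "invertible_mat u"
  proof (rule inj_mat_invertible[OF uc])
    fix x assume x: "x \<in> carrier_vec g" "u *\<^sub>v x = 0\<^sub>v g"
    have ne: "x $ j = 0" if "j < g" "j \<noteq> i" for j
    proof (cases "j = g - 1")
      case True
      then have "i \<noteq> g - 1" using that by simp
      then have "x $ \<sigma> i = 0" using other[OF x(1) i(1)] x(2) i(1) by simp
      then show ?thesis using True by (simp add: \<sigma>_def)
    next
      case False
      then have "x $ \<sigma> j = 0" using other[OF x(1) that(1)] x(2) that(1) by simp
      then show ?thesis using that(2) by (simp add: \<sigma>_def)
    qed
    have "p \<bullet> x = (\<Sum>j = 0..<g. if j = i then p $ i * x $ i else 0)"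
      unfolding scalar_prod_def using x(1) ne by (intro sum.cong) auto
    then have "p \<bullet> x = p $ i * x $ i" using i(1) by simp
    moreover have "p \<bullet> x = 0" using last[OF x(1)] x(2) g1 by simp
    ultimately have "x $ i = 0" using i(2) by simp
    then show "x = 0\<^sub>v g" using ne x(1) by (intro eq_vecI) auto
  qed
  then show ?thesis using uc last by blast
qed

text \<open>A linear change of the index b turns the hyperplane into b_(g-1) = 0 and does not change
  \<open>Fs\<close>, so the cusp condition applies.\<close>

lemma Fs_hyperplane:
  assumes p: "p \<in> carrier_vec g" "p \<noteq> 0\<^sub>v g"
    and s: "\<And>a b. a \<in> carrier_vec g \<Longrightarrow> b \<in> carrier_vec g \<Longrightarrow> s (J g a b) \<noteq> 0 \<Longrightarrow> p \<bullet> b = 0"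
  shows "Fs s = 0"
proof -
  obtain u where u: "u \<in> carrier_mat g g" "invertible_mat u" "\<And>x. x \<in> carrier_vec g \<Longrightarrow> (u *\<^sub>v x) $ (g - 1) = p \<bullet> x"
    using exists_mat_last_row[OF p] by blast
  obtain u' where u': "u' \<in> carrier_mat g g" "u * u' = 1\<^sub>m g" "u' * u = 1\<^sub>m g"
    using invertible_mat_obtain[OF u(1,2)] by blast
  have "Fs (act g (m_sub g u) s) = 0"
  proof (rule Fs_cusp)
    fix a b assume ab: "a \<in> carrier_vec g" "b \<in> carrier_vec g" "act g (m_sub g u) s (J g a b) \<noteq> 0"
    have ub: "u' *\<^sub>v b \<in> carrier_vec g" using u'(1) ab(2) by (rule mult_mat_vec_carrier)
    have "join g (u' *\<^sub>v b) (J g a b) = J g a (u' *\<^sub>v b)" by (simp add: J_def)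
    then have "s (J g a (u' *\<^sub>v b)) \<noteq> 0" using ab act_m_sub[OF u(1) u', of s "J g a b"] by simp
    then have "p \<bullet> (u' *\<^sub>v b) = 0" by (rule s[OF ab(1) ub])
    then show "b $ (g - 1) = 0" using u(3)[OF ub] mat_inverse_vec[OF u'(1) u(1) u'(2) ab(2)] by simp
  qed
  then show ?thesis using Fs_act[OF m_sub_C[OF u(1,2)]] by simp
qed

text \<open>By \<open>fib_full_iso_state\<close> some b has no entry in the support. So the
  b-projection D of the support is a proper subspace, and a functional that vanishes on D but not at
  b provides the hyperplane.\<close>

lemma Fs_fib:
  assumes s: "s \<in> fib g (2 * g) (delta 0)" and no: "s \<notin> (\<lambda>(u, \<phi>). iso_state g u \<phi>) ` (GL g \<times> QF g)"
  shows "Fs s = 0"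
proof -
  obtain b where b: "b \<in> carrier_vec g" "\<And>a. a \<in> carrier_vec g \<Longrightarrow> s (J g a b) = 0"
    using fib_full_iso_state[OF s] no by blast
  obtain c V \<psi> where s: "c > 0" "aff V" "0 \<in> V" "V \<subseteq> coords (2 * g)" "quad \<psi>" "V \<inter> coords g = {0}"
      "s = (\<lambda>x. if x \<in> V then of_real c * \<psi> x else 0)" "c\<^sup>2 * real (card V) = 1" using s by (rule fib_delta_cases)
  have sV: "s x \<noteq> 0 \<longleftrightarrow> x \<in> V" for x using s(1) quad_nonzero[OF s(5)] by (simp add: s(7))
  define D where "D = trunc g ` V"
  have sub: "fvec.subspace D"
  proof (rule fvec.subspaceI)
    have "trunc g 0 = 0" by (auto simp: trunc_def)
    then show "0 \<in> D" unfolding D_def using s(3) by (intro image_eqI[of _ _ 0]) simp_all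
    fix x y t
    show "x + y \<in> D" if xy: "x \<in> D" "y \<in> D"
    proof -
      obtain v w where vw: "x = trunc g v" "y = trunc g w" "v \<in> V" "w \<in> V" using xy by (auto simp: D_def)
      have "v + sc 1 w \<in> V" by (rule aff_0(2)[OF s(2,3) vw(3,4)])
      moreover have "x + y = trunc g (v + sc 1 w)" using linD[OF lin_trunc] vw by simp
      ultimately show ?thesis unfolding D_def by blast
    qed
    show "sc t x \<in> D" if x: "x \<in> D"
    proof -
      obtain v where v: "x = trunc g v" "v \<in> V" using x by (auto simp: D_def)
      have "sc t v \<in> V" by (rule aff_0(1)[OF s(2,3) v(2)])
      moreover have "sc t x = trunc g (sc t v)" using linD[OF lin_trunc] v by simp
      ultimately show ?thesis unfolding D_def by blast
    qed
  qed
  have "join g b 0 \<notin> D"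
  proof
    assume "join g b 0 \<in> D"
    then obtain x where x: "x \<in> V" "join g b 0 = trunc g x" by (auto simp: D_def)
    have "vec g x = b"
    proof (rule eq_vecI)
      fix i assume "i < dim_vec b"
      then have i: "i < g" using b(1) by simp
      show "vec g x $ i = b $ i" using fun_cong[OF x(2), of i] i by (simp add: join_def trunc_def)
    qed (use b in simp)
    then have "x = J g (hi g x) b" using J_hi[of x g] x(1) s(4) by auto
    then have "s x = 0" using b(2)[of "hi g x"] by (simp add: vlinD(1)[OF vlin_hi])
    then show False using sV x(1) by blast
  qed
  from separating_functional[OF sub this] obtain l where l: "linf l" "l (join g b 0) = 1" "\<And>d. d \<in> D \<Longrightarrow> l d = 0" by blast
  define p where "p = vec g (\<lambda>i. l (uvec i))"
  have pl: "p \<bullet> y = l (trunc g (\<lambda>i. y $ i))" if "y \<in> carrier_vec g" for y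
    unfolding linf_trunc[OF l(1)] using that by (simp add: p_def scalar_prod_def lessThan_atLeast0 mult.commute)
  show ?thesis
  proof (rule Fs_hyperplane[of p])
    show "p \<in> carrier_vec g" by (simp add: p_def)
    have "trunc g (\<lambda>i. b $ i) = join g b 0" by (auto simp: trunc_def join_def)
    then have "p \<bullet> b = 1" using pl[OF b(1)] l(2) by simp
    then show "p \<noteq> 0\<^sub>v g" using b(1) by auto
    fix a' b' assume ab: "a' \<in> carrier_vec g" "b' \<in> carrier_vec g" "s (J g a' b') \<noteq> 0"
    then have "J g a' b' \<in> V" using sV by blast
    moreover have "trunc g (\<lambda>i. b' $ i) = trunc g (J g a' b')" by (auto simp: trunc_def J_def join_def)
    ultimately have "trunc g (\<lambda>i. b' $ i) \<in> D" by (simp add: D_def)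
    then show "p \<bullet> b' = 0" using pl[OF ab(2)] l(3) by simp
  qed
qed

text \<open>The matrix of an \<open>iso_state\<close> is a scalar times an element of
  \<open>C g\<close>, transposed as \<open>fbar_transpose\<close> requires; homogeneity raises the
  scalar to the N-th power.\<close>

lemma Fs_iso_state:
  assumes u: "u \<in> GL g" and \<phi>: "\<phi> \<in> QF g"
  shows "Fs (iso_state g u \<phi>) = pconst (of_real (1 / sqrt (real CARD('f) ^ g)) ^ N) * fbar"
proof -
  have uc: "u \<in> carrier_mat g g" "invertible_mat u" using u by (auto simp: GL_def)
  obtain \<psi> where \<psi>: "\<phi> = restr g \<psi>" "quad \<psi>" using \<phi> by (auto simp: QF_def)
  obtain \<phi>' where \<phi>': "\<phi>' \<in> Phi_n T g" "\<And>v. v \<in> carrier_vec g \<Longrightarrow> e_QZ (\<phi>' v) = \<psi> (join g v 0)"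
    using quad_Phi_n[OF \<psi>(2)] by blast
  let ?\<tau> = "d_sub g \<phi>' \<otimes>\<^bsub>subst_monoid g\<^esub> m_sub g u" and ?c = "complex_of_real (1 / sqrt (real CARD('f) ^ g))"
  have \<tau>: "?\<tau> \<in> C g" by (intro C_mult d_sub_C m_sub_C \<phi>'(1) uc)
  have \<tau>v: "?\<tau> a b = (if b = u *\<^sub>v a then \<phi> (join g a 0) else 0)" if a: "a \<in> carrier_vec g" for a b
  proof -
    have "join g a 0 \<in> coords g" by (auto simp: join_def coords_def)
    then have e: "e_QZ (\<phi>' a) = \<phi> (join g a 0)" using \<phi>'(2)[OF a] by (simp add: \<psi>(1) restr_def)
    have "?\<tau> a b = (\<Sum>z\<in>carrier_vec g. if z = a then (if b = u *\<^sub>v a then \<phi> (join g a 0) else 0) else 0)"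
      unfolding subst_monoid_simps by (rule sum.cong[OF refl]) (auto simp: d_sub_def m_sub_def e)
    then show ?thesis using a by simp
  qed
  have "Fs (iso_state g u \<phi>) = peval pconst (\<lambda>b. pconst ?c * (\<Sum>a\<in>carrier_vec g. pconst (?\<tau> a b) * pvar a)) fbar"
    unfolding Fs_def
  proof (rule peval_cong[OF fbar_in])
    fix b :: "'f vec" assume b: "b \<in> carrier_vec g"
    have "iso_state g u \<phi> (J g a b) = ?c * ?\<tau> a b" if a: "a \<in> carrier_vec g" for a
      unfolding iso_state_def \<tau>v[OF a] J_simps(1,2)[OF a b] using J_simps(3)[OF a b] by simp
    then show "lform (iso_state g u \<phi>) b = pconst ?c * (\<Sum>a\<in>carrier_vec g. pconst (?\<tau> a b) * pvar a)"
      unfolding lform_def sum_distrib_left by (intro sum.cong refl) (simp only: pconst.hom_mult mult.assoc)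
  qed
  also have "\<dots> = pconst (?c ^ N) * apply_subst g (\<lambda>v w. ?\<tau> w v) fbar"
    unfolding apply_subst_def by (rule peval_scale[OF hom_fbar])
  finally show ?thesis by (simp only: fbar_transpose[OF \<tau>])
qed

lemma J_shift:
  assumes "a \<in> carrier_vec g" "a0 \<in> carrier_vec g"
  shows "J g a b + J g a0 (0\<^sub>v g) = J g (a + a0) b"
  using assms by (auto simp: J_def join_def fun_eq_iff)

text \<open>In the affine types the support may avoid a = 0. Translating a by \<open>a0\<close>
  makes the slice nonzero and only renames the variables in \<open>Fs\<close>. If the normalised
  translate were an \<open>iso_state\<close>, its support would contain a point over every a, also
  over a = -a0; but there the translate is the zero slice of s.\<close>

lemma Fs_slice_0:
  assumes s: "s \<in> St (2 * g)" and sl: "slice g s = (\<lambda>x. 0)"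
  shows "Fs s = 0"
proof -
  obtain c V \<psi> where sc: "phase c" "c \<noteq> 0" "aff V" "V \<noteq> {}" "V \<subseteq> coords (2 * g)" "quad \<psi>"
    "s = (\<lambda>x. if x \<in> V then c * \<psi> x else 0)" "(norm c)\<^sup>2 * real (card V) = 1" using s by (rule St_cases)
  have nE: "\<not> T = Type_qE"
  proof
    assume "T = Type_qE"
    then have "0 \<in> V" using sc(3,4) unfolding aff_def by blast
    then have "s 0 \<noteq> 0" using sc(2) quad_nonzero[OF sc(6)] by (simp add: sc(7))
    then show False using fun_cong[OF sl, of 0] by (simp add: slice_def)
  qed
  obtain x0 where x0: "x0 \<in> V" using sc(4) by blast
  define a0 where "a0 = hi g x0"
  have a0: "a0 \<in> carrier_vec g" by (simp add: a0_def vlinD(1)[OF vlin_hi])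
  define d where "d = J g a0 (0\<^sub>v g)"
  have dc: "d \<in> coords (2 * g)" using a0 by (simp add: d_def)
  define s' where "s' = (\<lambda>x. s (x + d))"
  have dcs: "x + d \<in> coords (2 * g) \<longleftrightarrow> x \<in> coords (2 * g)" for x using dc by (auto simp: coords_def)
  have s'St: "s' \<in> St (2 * g)"
  proof -
    have "state s'" unfolding s'_def using s by (intro state_shift[OF _ nE]) (simp add: St_def)
    moreover have "s' x = 0" if "x \<notin> coords (2 * g)" for x using s that dcs[of x] by (auto simp: s'_def St_def)
    moreover have "(\<Sum>x\<in>coords (2 * g). (norm (s' x))\<^sup>2) = (\<Sum>x\<in>coords (2 * g). (norm (s x))\<^sup>2)"
    proof (rule sum.reindex_bij_witness[of _ "\<lambda>x. x - d" "\<lambda>x. x + d"])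
      fix x :: "nat \<Rightarrow> 'f" assume "x \<in> coords (2 * g)"
      then show "x - d \<in> coords (2 * g)" using dcs[of "x - d"] by simp
    qed (auto simp: s'_def dcs)
    ultimately show ?thesis using s by (simp add: St_def)
  qed
  have s'J: "s' (J g a b) = s (J g (a + a0) b)" if "a \<in> carrier_vec g" for a b
    unfolding s'_def d_def using J_shift[OF that a0] by simp
  have Js: "join g b 0 = J g (0\<^sub>v g) b" if "b \<in> carrier_vec g" for b by (auto simp: J_def join_def fun_eq_iff)
  have "slice g s' \<noteq> (\<lambda>x. 0)"
  proof
    assume a: "slice g s' = (\<lambda>x. 0)"
    let ?y = "join g (vec g x0) 0"
    have "?y \<in> coords g" by (auto simp: join_def coords_def)
    then have "s' ?y = 0" using fun_cong[OF a, of ?y] by (simp add: slice_def)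
    moreover have "s' ?y = s (J g (0\<^sub>v g + a0) (vec g x0))" using s'J[of "0\<^sub>v g"] Js by simp
    moreover have "J g (0\<^sub>v g + a0) (vec g x0) = x0" using a0 J_hi[of x0 g] x0 sc(5) by (auto simp: a0_def)
    ultimately have "s x0 = 0" by simp
    then show False using x0 sc(2) quad_nonzero[OF sc(6)] by (simp add: sc(7))
  qed
  then have t: "(\<lambda>x. of_real (1 / nrm g s') * slice g s' x) \<in> St g" (is "?t \<in> _") and pos: "nrm g s' > 0"
    using slice_normalized[OF s'St] nrm_pos by auto
  obtain \<sigma> \<mu> where \<sigma>: "\<sigma> \<in> C g" "\<mu> ^ N = 1" "act g \<sigma> ?t = (\<lambda>x. \<mu> * delta 0 x)" using St_reduce[OF t] by blast
  have \<mu>0: "\<mu> \<noteq> 0" using root_norm[OF \<sigma>(2)] by auto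
  have \<mu>i: "(1 / \<mu>) ^ N = 1" using \<sigma>(2) by (simp add: power_divide)
  define s2 where "s2 = (\<lambda>x. 1 / \<mu> * act g \<sigma> s' x)"
  have s2St: "s2 \<in> St (2 * g)" unfolding s2_def by (rule St_scale[OF \<mu>i St_act[OF \<sigma>(1) _ s'St]]) simp
  have "slice g s2 = (\<lambda>x. of_real (nrm g s') * delta 0 x)"
  proof
    fix x
    have "slice g s2 x = 1 / \<mu> * act g \<sigma> (slice g s') x"
      unfolding slice_act[symmetric] by (simp add: slice_def s2_def)
    also have "slice g s' = (\<lambda>x. of_real (nrm g s') * ?t x)" using pos by (simp add: fun_eq_iff)
    also have "act g \<sigma> (\<lambda>x. of_real (nrm g s') * ?t x) = (\<lambda>x. of_real (nrm g s') * (\<mu> * delta 0 x))"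
      unfolding act_scale[of g \<sigma> _ ?t] \<sigma>(3) ..
    finally show "slice g s2 x = of_real (nrm g s') * delta 0 x" using \<mu>0 by simp
  qed
  then have fibs2: "s2 \<in> fib g (2 * g) (delta 0)" using s2St pos unfolding fib_def by blast
  have Fs2: "Fs s2 = Fs s'" unfolding s2_def Fs_root[OF \<mu>i] by (rule Fs_act[OF \<sigma>(1)])
  have "s2 \<notin> (\<lambda>(u, \<phi>). iso_state g u \<phi>) ` (GL g \<times> QF g)"
  proof
    assume "s2 \<in> (\<lambda>(u, \<phi>). iso_state g u \<phi>) ` (GL g \<times> QF g)"
    then obtain u \<phi> where u: "s2 = iso_state g u \<phi>" "u \<in> GL g" "\<phi> \<in> QF g" by auto
    obtain \<psi> where \<psi>: "\<phi> = restr g \<psi>" "quad \<psi>" using u(3) by (auto simp: QF_def)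
    \<comment> \<open>Undoes the translation: the entries of \<open>s'\<close> at this a are those
      of s at a = 0.\<close>
    let ?a = "0\<^sub>v g - a0"
    have ac: "?a \<in> carrier_vec g" using a0 by simp
    have ub: "u *\<^sub>v ?a \<in> carrier_vec g" using u(2) ac by (auto simp: GL_def intro: mult_mat_vec_carrier)
    have "join g ?a 0 \<in> coords g" by (auto simp: join_def coords_def)
    then have "s2 (J g ?a (u *\<^sub>v ?a)) \<noteq> 0"
      unfolding u(1) using ac ub quad_nonzero[OF \<psi>(2)] by (simp add: iso_state_def \<psi>(1) restr_def)
    moreover have "s' (J g ?a v) = 0" if "v \<in> carrier_vec g" for v
    proof -
      have "?a + a0 = 0\<^sub>v g" using a0 by (intro eq_vecI) auto
      then have "s' (J g ?a v) = s (join g v 0)" using s'J[OF ac] Js[OF that] by simp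
      moreover have "join g v 0 \<in> coords g" by (auto simp: join_def coords_def)
      ultimately show ?thesis using fun_cong[OF sl, of "join g v 0"] by (simp add: slice_def)
    qed
    then have "act g \<sigma> s' (J g ?a (u *\<^sub>v ?a)) = 0" using act_J[OF ac ub] by simp
    ultimately show False by (simp add: s2_def)
  qed
  then have "Fs s' = 0" using Fs_fib[OF fibs2] Fs2 by simp
  moreover have "Fs s' = peval pconst (\<lambda>a. pvar (a - a0)) (Fs s)"
  proof -
    interpret h: comm_ring_hom "peval pconst (\<lambda>a. pvar (a - a0)) :: ('f vec, complex) mpoly \<Rightarrow> _" by (rule pconst.peval_hom)
    have lf: "lform s' b = (\<Sum>a\<in>carrier_vec g. pconst (s (J g a b)) * pvar (a - a0))" for b
      unfolding lform_def
      by (rule sum.reindex_bij_witness[of _ "\<lambda>a. a - a0" "\<lambda>a. a + a0"]) (use a0 s'J in \<open>auto intro!: arg_cong2[of _ _ _ _ "(*)"] arg_cong[of _ _ pvar] eq_vecI\<close>)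
    have "lform s' = (\<lambda>b. peval pconst (\<lambda>a. pvar (a - a0)) (lform s b))"
      by (rule ext, unfold lf) (simp add: lform_def h.hom_sum h.hom_mult pconst.peval_pconst pconst.peval_pvar)
    then show ?thesis unfolding Fs_def h.hom_peval by (simp add: pconst.peval_pconst)
  qed
  ultimately have *: "peval pconst (\<lambda>a. pvar (a - a0)) (Fs s) = 0" by simp
  \<comment> \<open>Renaming the variables by the opposite translation recovers \<open>Fs s\<close>
    from its vanishing translate.\<close>
  interpret k: comm_ring_hom "peval pconst (\<lambda>a. pvar (a + a0)) :: ('f vec, complex) mpoly \<Rightarrow> _" by (rule pconst.peval_hom)
  have "Fs s = peval pconst (\<lambda>a. pvar (a + a0)) (peval pconst (\<lambda>a. pvar (a - a0)) (Fs s))"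
  proof -
    interpret h: comm_ring_hom "peval pconst (\<lambda>a. pvar (a - a0)) :: ('f vec, complex) mpoly \<Rightarrow> _" by (rule pconst.peval_hom)
    have id: "a - a0 + a0 = a" if "a \<in> carrier_vec g" for a using that a0 by (intro eq_vecI) auto
    have "peval pconst (\<lambda>a. pvar (a + a0)) (peval pconst (\<lambda>a. pvar (a - a0)) (lform s b)) = lform s b" for b
      by (simp add: lform_def h.hom_sum h.hom_mult k.hom_sum k.hom_mult pconst.peval_pconst pconst.peval_pvar id)
    then show ?thesis unfolding Fs_def h.hom_peval k.hom_peval by (simp add: pconst.peval_pconst)
  qed
  then show ?thesis unfolding * by (simp only: k.hom_zero)
qed

text \<open>Zero slices contribute nothing, the other states reduce to the fibre over the point mass
  at 0, and within it exactly the \<open>iso_state\<close> elements survive, all with the same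
  value.\<close>

lemma sum_Fs:
  "(\<Sum>s\<in>St (2 * g). Fs s) = of_nat (card (St g)) * (of_nat (card (GL g) * card (QF g)) *
     (pconst (of_real (1 / sqrt (real CARD('f) ^ g)) ^ N) * fbar))"
proof -
  have "(\<Sum>s\<in>St (2 * g). Fs s) = (\<Sum>s | s \<in> St (2 * g) \<and> slice g s \<noteq> (\<lambda>x. 0). Fs s)"
    by (rule sum.mono_neutral_right) (auto simp: finite_St Fs_slice_0)
  also have "\<dots> = of_nat (card (St g)) * (\<Sum>s\<in>fib g (2 * g) (delta 0). Fs s)"
    by (rule fibre_sum) (simp_all add: Fs_act Fs_root)
  also have "(\<Sum>s\<in>fib g (2 * g) (delta 0). Fs s) = (\<Sum>s\<in>(\<lambda>(u, \<phi>). iso_state g u \<phi>) ` (GL g \<times> QF g). Fs s)"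
  proof (rule sum.mono_neutral_right)
    show "finite (fib g (2 * g) (delta 0))" by (rule finite_subset[OF _ finite_St[of "2 * g"]]) (auto simp: fib_def)
    show "(\<lambda>(u, \<phi>). iso_state g u \<phi>) ` (GL g \<times> QF g) \<subseteq> fib g (2 * g) (delta 0)" using iso_state_fib by auto
    show "\<forall>s\<in>fib g (2 * g) (delta 0) - (\<lambda>(u, \<phi>). iso_state g u \<phi>) ` (GL g \<times> QF g). Fs s = 0" using Fs_fib by blast
  qed
  also have "\<dots> = (\<Sum>z\<in>GL g \<times> QF g. Fs ((\<lambda>(u, \<phi>). iso_state g u \<phi>) z))"
    by (simp add: sum.reindex[OF inj_iso_state])
  also have "\<dots> = (\<Sum>z\<in>GL g \<times> QF g. pconst (of_real (1 / sqrt (real CARD('f) ^ g)) ^ N) * fbar)"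
    by (rule sum.cong[OF refl]) (auto simp only: Fs_iso_state split: prod.splits)
  also have "\<dots> = of_nat (card (GL g) * card (QF g)) * (pconst (of_real (1 / sqrt (real CARD('f) ^ g)) ^ N) * fbar)"
    by (simp only: sum_constant card_cartesian_product)
  finally show ?thesis .
qed

end

section \<open>Eisenstein series as sums over states\<close>

text \<open>By invariance F is constant on right cosets of H, so the arbitrary representatives taken
  in \<open>eisenstein\<close> do not matter.\<close>

lemma (in group) sum_rcosets:
  fixes F :: "'a \<Rightarrow> 'r::comm_ring_1"
  assumes H: "subgroup H G" and fin: "finite (carrier G)"
    and inv: "\<And>h x. h \<in> H \<Longrightarrow> x \<in> carrier G \<Longrightarrow> F (h \<otimes> x) = F x"
  shows "(\<Sum>x\<in>carrier G. F x) = of_nat (card H) * (\<Sum>S\<in>rcosets H. F (SOME x. x \<in> S))"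
proof -
  have HG: "H \<subseteq> carrier G" by (rule subgroup.subset[OF H])
  have part: "\<Union>(rcosets H) = carrier G" by (rule rcosets_part_G[OF H])
  have fS: "finite S" if "S \<in> rcosets H" for S using that part fin by (intro finite_subset[OF _ fin]) blast
  have "(\<Sum>x\<in>carrier G. F x) = (\<Sum>S\<in>rcosets H. \<Sum>x\<in>S. F x)"
    unfolding part[symmetric] using rcos_disjoint[OF H] fS
    by (subst sum.Union_disjoint) (auto simp: pairwise_def disjnt_def)
  also have "\<dots> = (\<Sum>S\<in>rcosets H. of_nat (card H) * F (SOME x. x \<in> S))"
  proof (rule sum.cong[OF refl])
    fix S assume S: "S \<in> rcosets H"
    then obtain a where a: "a \<in> carrier G" "S = H #> a" by (auto simp: RCOSETS_def)
    have Fa: "F x = F a" if "x \<in> S" for x using that a inv by (auto simp: r_coset_def)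
    have "a \<in> S" using a subgroup.one_closed[OF H] by (force simp: r_coset_def)
    then have "F (SOME x. x \<in> S) = F a" by (intro Fa) (rule someI)
    moreover have "card S = card H" using card_rcosets_equal[OF S HG] by simp
    ultimately show "(\<Sum>x\<in>S. F x) = of_nat (card H) * F (SOME x. x \<in> S)" using Fa by simp
  qed
  finally show ?thesis by (simp add: sum_distrib_left)
qed

lemma pconst_of_nat: "pconst (of_nat k) = (of_nat k :: ('v, 'a::comm_ring_1) mpoly)"
  by (induction k) (simp_all add: pconst.hom_add)

definition lf :: "nat \<Rightarrow> ((nat \<Rightarrow> 'f) \<Rightarrow> complex) \<Rightarrow> ('f::{finite,field} vec, complex) mpoly" where
  "lf n s = (\<Sum>v\<in>carrier_vec n. pconst (s (join n v 0)) * pvar v)"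

text \<open>Exchanging the sums over rows and columns turns a substitution in the variables into the
  action on coefficients, by which the seed is compared with states.\<close>

lemma apply_subst_lf: "apply_subst n A (lf n s) = lf n (act n A s)"
proof -
  interpret h: comm_ring_hom "apply_subst n A" by (rule apply_subst_hom)
  have "apply_subst n A (lf n s) = (\<Sum>v\<in>carrier_vec n. \<Sum>w\<in>carrier_vec n. pconst (s (join n v 0) * A v w) * pvar w)"
    by (simp add: lf_def h.hom_sum h.hom_mult sum_distrib_left pconst.hom_mult mult.assoc)
  also have "\<dots> = (\<Sum>w\<in>carrier_vec n. \<Sum>v\<in>carrier_vec n. pconst (s (join n v 0) * A v w) * pvar w)" by (rule sum.swap)
  also have "\<dots> = lf n (act n A s)"
    unfolding lf_def act_def by (rule sum.cong[OF refl]) (simp add: pconst.hom_sum sum_distrib_right)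
  finally show ?thesis .
qed

lemma lf_scale: "lf n (\<lambda>x. c * s x) = pconst c * lf n s"
  by (simp add: lf_def pconst.hom_mult sum_distrib_left mult.assoc)

context code_setup
begin

lemma lf_delta:
  assumes v: "v \<in> carrier_vec n"
  shows "lf n (delta (join n v 0)) = pvar v"
proof -
  have inj: "join n w 0 = join n v (0 :: nat \<Rightarrow> 'f) \<longleftrightarrow> w = v" if "w \<in> carrier_vec n" for w
    using inj_onD[OF bij_betw_imp_inj_on[OF bij_coords], of n w v] that v by blast
  have "lf n (delta (join n v 0)) = (\<Sum>w\<in>carrier_vec n. if w = v then pvar v else 0)"
    unfolding lf_def delta_def by (rule sum.cong[OF refl]) (simp add: inj)
  then show ?thesis using v by simp
qed

lemma C_cancel:
  assumes "\<tau> \<in> C n" "\<sigma> \<in> C n"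
  shows "adj \<tau> \<otimes>\<^bsub>subst_monoid n\<^esub> (\<tau> \<otimes>\<^bsub>subst_monoid n\<^esub> \<sigma>) = \<sigma>"
    "\<tau> \<otimes>\<^bsub>subst_monoid n\<^esub> (adj \<tau> \<otimes>\<^bsub>subst_monoid n\<^esub> \<sigma>) = \<sigma>"
proof -
  interpret Group.monoid "subst_monoid n" by (rule monoid_subst)
  note * = unitary_C[OF assms(1), unfolded unitary_def] unitary_C[OF assms(2), unfolded unitary_def] adj_carrier[of \<tau> n]
  show "adj \<tau> \<otimes>\<^bsub>subst_monoid n\<^esub> (\<tau> \<otimes>\<^bsub>subst_monoid n\<^esub> \<sigma>) = \<sigma>"
    "\<tau> \<otimes>\<^bsub>subst_monoid n\<^esub> (adj \<tau> \<otimes>\<^bsub>subst_monoid n\<^esub> \<sigma>) = \<sigma>"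
    using * by (simp_all add: m_assoc[symmetric])
qed

lemma sum_C_translate:
  assumes "\<tau> \<in> C n"
  shows "(\<Sum>\<sigma>\<in>C n. h (\<tau> \<otimes>\<^bsub>subst_monoid n\<^esub> \<sigma>)) = (\<Sum>\<sigma>\<in>C n. h \<sigma>)"
  by (rule sum.reindex_bij_witness[of _ "\<lambda>\<sigma>. adj \<tau> \<otimes>\<^bsub>subst_monoid n\<^esub> \<sigma>" "\<lambda>\<sigma>. \<tau> \<otimes>\<^bsub>subst_monoid n\<^esub> \<sigma>"])
     (simp_all only: C_cancel[OF assms] C_mult[OF assms] C_mult[OF C_adj[OF assms]])

definition orbit_sum :: "nat \<Rightarrow> ((nat \<Rightarrow> 'f) \<Rightarrow> complex) \<Rightarrow> ('f vec, complex) mpoly" where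
  "orbit_sum n s = (\<Sum>\<sigma>\<in>C n. lf n (act n \<sigma> s) ^ N)"

text \<open>By transitivity s is a root of unity times a translate of the point mass. The N-th power
  removes the root of unity, and translation permutes the group.\<close>

lemma orbit_sum_eq:
  assumes "s \<in> St n"
  shows "orbit_sum n s = orbit_sum n (delta 0)"
proof -
  obtain \<tau> \<mu> where t: "\<tau> \<in> C n" "\<mu> ^ N = 1" "s = (\<lambda>x. \<mu> * act n \<tau> (delta 0) x)"
    using St_transitive[OF assms] by blast
  have "lf n (act n \<sigma> s) ^ N = lf n (act n (\<tau> \<otimes>\<^bsub>subst_monoid n\<^esub> \<sigma>) (delta 0)) ^ N" for \<sigma>
  proof -
    have "lf n (act n \<sigma> s) = pconst \<mu> * lf n (act n (\<tau> \<otimes>\<^bsub>subst_monoid n\<^esub> \<sigma>) (delta 0))"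
      unfolding t(3) act_scale act_mult lf_scale ..
    then show ?thesis by (simp only: power_mult_distrib pconst.hom_power[symmetric] t(2) pconst.hom_one mult_1)
  qed
  then show ?thesis unfolding orbit_sum_def
    using sum_C_translate[OF t(1), of "\<lambda>\<sigma>. lf n (act n \<sigma> (delta 0)) ^ N"] by simp
qed

text \<open>The sum over all pairs of a group element and a state is evaluated in both orders: every
  orbit sum is the same, and every group element permutes the states.\<close>

lemma sum_St_orbit:
  "of_nat (card (C n)) * (\<Sum>s\<in>St n. lf n s ^ N) = of_nat (card (St n)) * orbit_sum n (delta 0)"
proof -
  have "of_nat (card (St n)) * orbit_sum n (delta 0) = (\<Sum>s\<in>St n. orbit_sum n s)"
    by (simp add: orbit_sum_eq)
  also have "\<dots> = (\<Sum>\<sigma>\<in>C n. \<Sum>s\<in>St n. lf n (act n \<sigma> s) ^ N)"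
    unfolding orbit_sum_def by (rule sum.swap)
  also have "\<dots> = (\<Sum>\<sigma>\<in>C n. \<Sum>s\<in>St n. lf n s ^ N)"
  proof (rule sum.cong[OF refl])
    fix \<sigma> assume \<sigma>: "\<sigma> \<in> C n"
    show "(\<Sum>s\<in>St n. lf n (act n \<sigma> s) ^ N) = (\<Sum>s\<in>St n. lf n s ^ N)"
      by (rule sum.reindex_bij_witness[of _ "act n (adj \<sigma>)" "act n \<sigma>"])
         (simp_all only: act_adj[OF unitary_C[OF \<sigma>]] St_act[OF \<sigma> order.refl] St_act[OF C_adj[OF \<sigma>] order.refl])
  qed
  finally show ?thesis by simp
qed

definition seed_vecs :: "nat \<Rightarrow> 'f vec set" where
  "seed_vecs n = (if T = Type_qE then {0\<^sub>v n} else carrier_vec n)"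

lemma seed_vecs_carrier: "v \<in> seed_vecs n \<Longrightarrow> v \<in> carrier_vec n"
  by (auto simp: seed_vecs_def split: if_splits)

abbreviation seed :: "nat \<Rightarrow> ('f vec, complex) mpoly" where
  "seed n \<equiv> eisenstein_seed T n N"

lemma eisenstein_seed_eq: "seed n = (\<Sum>v\<in>seed_vecs n. pvar v ^ N)"
  unfolding eisenstein_seed_def seed_vecs_def by (cases T) simp_all

lemma apply_subst_seed:
  "apply_subst n A (seed n) = (\<Sum>v\<in>seed_vecs n. (\<Sum>w\<in>carrier_vec n. pconst (A v w) * pvar w) ^ N)"
proof -
  interpret h: comm_ring_hom "apply_subst n A" by (rule apply_subst_hom)
  show ?thesis by (simp add: eisenstein_seed_eq h.hom_sum h.hom_power)
qed

lemma seed_one: "apply_subst n \<one>\<^bsub>subst_monoid n\<^esub> (seed n) = seed n"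
  unfolding apply_subst_seed unfolding eisenstein_seed_eq
proof (rule sum.cong[OF refl])
  fix v assume "v \<in> seed_vecs n"
  then have v: "v \<in> carrier_vec n" by (rule seed_vecs_carrier)
  have "(\<Sum>w\<in>carrier_vec n. pconst (\<one>\<^bsub>subst_monoid n\<^esub> v w) * pvar w) = (\<Sum>w\<in>carrier_vec n. if w = v then pvar v else 0)"
    unfolding subst_monoid_simps using v by (intro sum.cong) auto
  then show "(\<Sum>w\<in>carrier_vec n. pconst (\<one>\<^bsub>subst_monoid n\<^esub> v w) * pvar w) ^ N = pvar v ^ N" using v by simp
qed

text \<open>Matrices permute the seed vectors. Diagonal generators multiply the variables by values
  of quadratic characters, which are N-th roots of unity in the affine types and equal to 1 at the
  only seed vector 0 otherwise.\<close>

lemma seed_gens: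
  fixes A :: "'f subst"
  assumes "A \<in> parabolic_gens T n"
  shows "apply_subst n A (seed n) = seed n"
proof -
  consider (m) u where "A = m_sub n u" "u \<in> carrier_mat n n" "invertible_mat u"
    | (d) \<phi> where "A = d_sub n \<phi>" "\<phi> \<in> Phi_n T n"
    using assms unfolding parabolic_gens_def by blast
  then show ?thesis
  proof cases
    case m
    obtain u' where u': "u' \<in> carrier_mat n n" "u * u' = 1\<^sub>m n" "u' * u = 1\<^sub>m n"
      using invertible_mat_obtain[OF m(2,3)] by blast
    have "(\<Sum>w\<in>carrier_vec n. pconst (A v w) * pvar w) = pvar (u *\<^sub>v v)" if v: "v \<in> carrier_vec n" for v
    proof -
      have "(\<Sum>w\<in>carrier_vec n. pconst (A v w) * pvar w) = (\<Sum>w\<in>carrier_vec n. if w = u *\<^sub>v v then pvar (u *\<^sub>v v) else 0)"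
        using v by (intro sum.cong) (auto simp: m(1) m_sub_def)
      then show ?thesis using mult_mat_vec_carrier[OF m(2) v] by simp
    qed
    then have "apply_subst n A (seed n) = (\<Sum>v\<in>seed_vecs n. pvar (u *\<^sub>v v) ^ N)"
      unfolding apply_subst_seed by (intro sum.cong) (simp_all add: seed_vecs_carrier)
    also have "\<dots> = (\<Sum>v\<in>seed_vecs n. pvar v ^ N)"
    proof (rule sum.reindex_bij_witness[of _ "\<lambda>v. u' *\<^sub>v v" "\<lambda>v. u *\<^sub>v v"])
      fix v assume v: "v \<in> seed_vecs n"
      show "u' *\<^sub>v (u *\<^sub>v v) = v" by (rule mat_inverse_vec[OF m(2) u'(1,3) seed_vecs_carrier[OF v]])
      show "u *\<^sub>v (u' *\<^sub>v v) = v" by (rule mat_inverse_vec[OF u'(1) m(2) u'(2) seed_vecs_carrier[OF v]])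
      show "u *\<^sub>v v \<in> seed_vecs n" "u' *\<^sub>v v \<in> seed_vecs n"
        using v m(2) u'(1) by (auto simp: seed_vecs_def split: if_splits)
    qed simp
    finally show ?thesis by (simp only: eisenstein_seed_eq)
  next
    case d
    note q = Phi_n_quad[OF d(2)]
    have e: "e_QZ (\<phi> v) ^ N = 1" if v: "v \<in> seed_vecs n" for v
    proof (cases "T = Type_qE")
      case True
      have "vec n (0 :: nat \<Rightarrow> 'f) = v" using v unfolding seed_vecs_def if_P[OF True] by auto
      then show ?thesis using quad_0[OF q] by simp
    next
      case False
      then show ?thesis using quad_root_of_unity[OF _ q, of "join n v 0"] seed_vecs_carrier[OF v] by simp
    qed
    show ?thesis unfolding apply_subst_seed unfolding eisenstein_seed_eq
    proof (rule sum.cong[OF refl])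
      fix v assume sv: "v \<in> seed_vecs n"
      then have v: "v \<in> carrier_vec n" by (rule seed_vecs_carrier)
      have "(\<Sum>w\<in>carrier_vec n. pconst (A v w) * pvar w) = (\<Sum>w\<in>carrier_vec n. if w = v then pconst (e_QZ (\<phi> v)) * pvar v else 0)"
        using v by (intro sum.cong) (auto simp: d(1) d_sub_def)
      then have "(\<Sum>w\<in>carrier_vec n. pconst (A v w) * pvar w) = pconst (e_QZ (\<phi> v)) * pvar v" using v by simp
      then show "(\<Sum>w\<in>carrier_vec n. pconst (A v w) * pvar w) ^ N = pvar v ^ N"
        by (simp only: power_mult_distrib pconst.hom_power[symmetric] e[OF sv] pconst.hom_one mult_1)
    qed
  qed
qed

lemma parabolic_gens_subset: "parabolic_gens T n \<subseteq> (clifford_weil_gens T n :: 'f subst set)"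
  by (auto simp: clifford_weil_gens_def)

lemma seed_parabolic:
  "A \<in> parabolic T n \<Longrightarrow> apply_subst n A (seed n) = seed n"
  unfolding parabolic_def
proof (induction rule: generate.induct)
  case one
  then show ?case by (simp only: subst_GL_simps seed_one)
next
  case (incl h)
  then show ?case by (rule seed_gens)
next
  case (inv h)
  then have u: "unitary n h" using parabolic_gens_subset[of n] by (intro unitary_gens) blast
  have "apply_subst n (adj h) (seed n) = apply_subst n (adj h) (apply_subst n h (seed n))"
    by (simp only: seed_gens[OF inv])
  also have "\<dots> = seed n"
    using u unfolding apply_subst_apply_subst unitary_def by (simp only: seed_one)
  finally show ?case by (simp only: inv_subst_GL[OF u])
next
  case (eng h1 h2)
  then show ?case by (simp only: subst_GL_simps apply_subst_apply_subst[symmetric])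
qed

text \<open>Each coset contributes as many equal terms as \<open>parabolic\<close> has elements, and
  Lagrange's theorem turns the number of cosets into the order of the group.\<close>

lemma eisenstein_eq_C_sum:
  "of_nat (card (C n)) * eisenstein T n N = (\<Sum>\<sigma>\<in>C n. apply_subst n \<sigma> (seed n))"
proof -
  let ?G = "clifford_weil T n :: 'f subst monoid" and ?P = "parabolic T n :: 'f subst set"
  have car: "carrier ?G = C n" by (rule carrier_clifford_weil)
  have mult: "\<sigma> \<otimes>\<^bsub>?G\<^esub> \<tau> = \<sigma> \<otimes>\<^bsub>subst_monoid n\<^esub> \<tau>" for \<sigma> \<tau> by (simp add: clifford_weil_def subst_GL_simps)
  interpret G: group ?G
    unfolding clifford_weil_def by (rule subgroup.subgroup_is_group[OF C_subgroup group_subst_GL])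
  have "?P \<subseteq> C n" unfolding parabolic_def using parabolic_gens_subset by (auto intro: generate_mono_gens)
  moreover have "subgroup ?P (subst_GL n)" unfolding parabolic_def
    by (rule group.generate_is_subgroup[OF group_subst_GL order.trans[OF parabolic_gens_subset gens_subset]])
  ultimately have P: "subgroup ?P ?G" unfolding clifford_weil_def
    by (intro group.subgroup_incl[OF group_subst_GL _ C_subgroup])
  have lag: "card (rcosets\<^bsub>?G\<^esub> ?P) * card ?P = card (C n)"
    using G.lagrange[OF P] by (simp add: Coset.order_def car)
  have "card (C n) > 0" using finite_C C_one by (auto simp: card_gt_0_iff)
  then have pos: "card (rcosets\<^bsub>?G\<^esub> ?P) > 0" using lag by (metis mult_0 neq0_conv)
  let ?S = "\<Sum>S\<in>rcosets\<^bsub>?G\<^esub> ?P. apply_subst n (SOME \<sigma>. \<sigma> \<in> S) (seed n)"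
  have "(\<Sum>\<sigma>\<in>carrier ?G. apply_subst n \<sigma> (seed n)) = of_nat (card ?P) * ?S"
    by (rule G.sum_rcosets[OF P])
       (simp_all only: car finite_C mult apply_subst_apply_subst[symmetric] seed_parabolic)
  moreover have "eisenstein T n N = pconst (1 / of_nat (card (rcosets\<^bsub>?G\<^esub> ?P))) * ?S"
    unfolding eisenstein_def Let_def ..
  moreover have "of_nat (card (C n)) * (pconst (1 / of_nat (card (rcosets\<^bsub>?G\<^esub> ?P))) * ?S) = of_nat (card ?P) * ?S"
  proof -
    have "(of_nat (card (C n)) :: ('f vec, complex) mpoly) = pconst (of_nat (card (C n)))" by (simp only: pconst_of_nat)
    also have "\<dots> * (pconst (1 / of_nat (card (rcosets\<^bsub>?G\<^esub> ?P))) * ?S) =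
        pconst (of_nat (card (C n)) * (1 / of_nat (card (rcosets\<^bsub>?G\<^esub> ?P)))) * ?S"
      by (simp only: pconst.hom_mult mult.assoc)
    also have "of_nat (card (C n)) * (1 / of_nat (card (rcosets\<^bsub>?G\<^esub> ?P))) = (of_nat (card ?P) :: complex)"
      unfolding lag[symmetric] using pos by simp
    finally show ?thesis by (simp only: pconst_of_nat)
  qed
  ultimately show ?thesis by (simp only: car)
qed

text \<open>Every variable in the seed is the linear form of a point mass, which is a state for the
  seed vectors of the type. So each seed vector contributes the same orbit sum, which is then spread
  over all states.\<close>

lemma eisenstein_eq_St_sum:
  "eisenstein T n N = pconst (of_nat (card (seed_vecs n)) / of_nat (card (St n))) * (\<Sum>s\<in>St n. lf n s ^ N)"
proof -
  have "(\<Sum>\<sigma>\<in>C n. apply_subst n \<sigma> (seed n)) = (\<Sum>\<sigma>\<in>C n. \<Sum>v\<in>seed_vecs n. lf n (act n \<sigma> (delta (join n v 0))) ^ N)"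
  proof (rule sum.cong[OF refl])
    fix \<sigma> :: "'f subst"
    interpret h: comm_ring_hom "apply_subst n \<sigma>" by (rule apply_subst_hom)
    have "apply_subst n \<sigma> (seed n) = apply_subst n \<sigma> (\<Sum>v\<in>seed_vecs n. lf n (delta (join n v 0)) ^ N)"
      by (simp add: eisenstein_seed_eq lf_delta seed_vecs_carrier)
    then show "apply_subst n \<sigma> (seed n) = (\<Sum>v\<in>seed_vecs n. lf n (act n \<sigma> (delta (join n v 0))) ^ N)"
      by (simp only: h.hom_sum h.hom_power apply_subst_lf)
  qed
  also have "\<dots> = (\<Sum>v\<in>seed_vecs n. orbit_sum n (delta (join n v 0)))"
    unfolding orbit_sum_def by (rule sum.swap)
  also have "\<dots> = (\<Sum>v\<in>seed_vecs n. orbit_sum n (delta 0))"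
  proof (intro sum.cong refl orbit_sum_eq delta_St)
    fix v assume v: "v \<in> seed_vecs n"
    show "join n v 0 \<in> coords n" by (auto simp: join_def coords_def)
    show "join n v 0 = 0" if "T = Type_qE" using v unfolding seed_vecs_def if_P[OF that] by (auto simp: join_def fun_eq_iff)
  qed
  finally have A: "of_nat (card (C n)) * eisenstein T n N = of_nat (card (seed_vecs n)) * orbit_sum n (delta 0)"
    by (simp add: eisenstein_eq_C_sum)
  have nz: "card (C n) > 0" "card (St n) > 0"
    using finite_C[of n] C_one[of n] finite_St[of n] delta_St[of 0 n] by (auto simp: card_gt_0_iff)
  let ?c = "of_nat (card (C n)) :: complex" and ?t = "of_nat (card (St n)) :: complex" and ?v = "of_nat (card (seed_vecs n)) :: complex"
  have 1: "pconst ?c * eisenstein T n N = pconst ?v * orbit_sum n (delta 0)" using A by (simp only: pconst_of_nat)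
  have 2: "pconst ?c * (\<Sum>s\<in>St n. lf n s ^ N) = pconst ?t * orbit_sum n (delta 0)" using sum_St_orbit[of n] by (simp only: pconst_of_nat)
  have "eisenstein T n N = pconst (1 / ?c) * (pconst ?c * eisenstein T n N)"
    using nz unfolding mult.assoc[symmetric] pconst.hom_mult[symmetric] by simp
  also have "\<dots> = pconst (?v / ?t / ?c) * (pconst ?t * orbit_sum n (delta 0))"
    unfolding 1 mult.assoc[symmetric] pconst.hom_mult[symmetric] using nz by (simp add: field_simps)
  also have "\<dots> = pconst (?v / ?t) * (\<Sum>s\<in>St n. lf n s ^ N)"
    unfolding 2[symmetric] mult.assoc[symmetric] pconst.hom_mult[symmetric] using nz by simp
  finally show ?thesis .
qed

end

section \<open>Doubling\<close>

text \<open>\<open>act g\<close> acts on the first half of the coordinates, whereas the variables \<open>y\<close> of the doubling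
  map belong to the second half.\<close>

definition swap_halves :: "nat \<Rightarrow> (nat \<Rightarrow> 'f) \<Rightarrow> nat \<Rightarrow> 'f" where
  "swap_halves g x = (\<lambda>i. x (if i < g then i + g else if i < 2 * g then i - g else i))"

lemma swap_halves_swap_halves [simp]: "swap_halves g (swap_halves g x) = x"
  by (auto simp: swap_halves_def fun_eq_iff)

lemma swap_halves_coords: "x \<in> coords (2 * g) \<Longrightarrow> swap_halves g x \<in> coords (2 * g)"
  by (auto simp: swap_halves_def coords_def)

lemma swap_halves_coords_iff: "swap_halves g x \<in> coords (2 * g) \<longleftrightarrow> x \<in> coords (2 * g)"
  using swap_halves_coords[of x g] swap_halves_coords[of "swap_halves g x" g] by auto

lemma lin_swap_halves: "lin (swap_halves g)"
  unfolding swap_halves_def[abs_def] by (rule lin_reindex)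

lemma pconst_pconst_hom: "comm_ring_hom (\<lambda>c. pconst (pconst c) :: ('v, ('w, complex) mpoly) mpoly)"
  by unfold_locales (simp_all add: pconst.hom_add pconst.hom_mult)

lemma doubling_hom: "comm_ring_hom (doubling g)"
  unfolding doubling_def[abs_def] by (rule comm_ring_hom.peval_hom[OF pconst_pconst_hom])

lemma doubling_pconst: "doubling g (pconst c) = pconst (pconst c)"
  unfolding doubling_def by (rule comm_ring_hom.peval_pconst[OF pconst_pconst_hom])

lemma doubling_pvar: "doubling g (pvar v) = pconst (pvar (vec_first v g)) * pvar (vec_last v g)"
  unfolding doubling_def by (rule comm_ring_hom.peval_pvar[OF pconst_pconst_hom])

context code_setup
begin

lemma St_swap_halves: "s \<in> St (2 * g) \<Longrightarrow> (\<lambda>x. s (swap_halves g x)) \<in> St (2 * g)"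
proof -
  assume s: "s \<in> St (2 * g)"
  have "state (\<lambda>x. s (swap_halves g x))" using s by (simp add: St_def state_comp_lin[OF _ lin_swap_halves])
  moreover have "(\<Sum>x\<in>coords (2 * g). (norm (s (swap_halves g x)))\<^sup>2) = (\<Sum>x\<in>coords (2 * g). (norm (s x))\<^sup>2)"
    by (rule sum.reindex_bij_witness[of _ "swap_halves g" "swap_halves g"]) (simp_all add: swap_halves_coords)
  ultimately show ?thesis using s by (simp add: St_def swap_halves_coords_iff)
qed

lemma swap_halves_append:
  assumes "a \<in> carrier_vec g" "b \<in> carrier_vec g"
  shows "swap_halves g (join (2 * g) (a @\<^sub>v b) 0) = J g a b"
  using assms by (auto simp: swap_halves_def J_def join_def fun_eq_iff)

lemma card_St_add:
  "card (St (g + j)) = card (St g) * ((if T = Type_qE then 1 else CARD('f)) ^ j * (\<Prod>i=1..j. CARD('f) ^ (g + i) + 1))"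
proof (induction j)
  case (Suc j)
  then show ?case using card_St_Suc[of "g + j"] by (simp add: algebra_simps)
qed simp

end

section \<open>The arithmetic of the constant\<close>

lemma prod_powers_square: "(\<Prod>k<g. q ^ k)\<^sup>2 * q ^ g = (q::'a::comm_semiring_1) ^ (g * g)"
proof (induction g)
  case (Suc g)
  have "(\<Prod>k<Suc g. q ^ k)\<^sup>2 * q ^ Suc g = ((\<Prod>k<g. q ^ k)\<^sup>2 * q ^ g) * q ^ (2 * g + 1) "
    by (simp add: power_mult_distrib power_add power_mult power2_eq_square mult_ac)
  also have "\<dots> = q ^ (Suc g * Suc g)" unfolding Suc.IH power_add[symmetric] by (rule arg_cong[of _ _ "(^) q"]) simp
  finally show ?case .
qed simp

lemma prod_power_differences:
  fixes q :: real
  shows "(\<Prod>k<g. q ^ g - q ^ k) = (\<Prod>k<g. q ^ k) * (\<Prod>i=1..g. q ^ i - 1)"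
proof -
  have "(\<Prod>k<g. q ^ g - q ^ k) = (\<Prod>k<g. q ^ k * (q ^ (g - k) - 1))"
    by (rule prod.cong) (auto simp: algebra_simps power_add[symmetric])
  also have "\<dots> = (\<Prod>k<g. q ^ k) * (\<Prod>k<g. q ^ (g - k) - 1)" by (rule prod.distrib)
  also have "(\<Prod>k<g. q ^ (g - k) - 1) = (\<Prod>i=1..g. q ^ i - 1)"
    by (rule prod.reindex_bij_witness[of _ "\<lambda>i. g - i" "\<lambda>k. g - k"]) auto
  finally show ?thesis .
qed

lemma inverse_sqrt_power:
  assumes "q > 0"
  shows "(1 / sqrt (real q ^ g)) ^ N = real q powr (- (real N * real g / 2))"
proof -
  have "sqrt (real q ^ g) = real q powr (real g / 2)"
    using assms by (simp add: powr_half_sqrt[symmetric] powr_realpow[symmetric] powr_powr)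
  then have "(1 / sqrt (real q ^ g)) ^ N = (real q powr (- (real g / 2))) ^ N" by (simp add: powr_minus_divide)
  also have "\<dots> = real q powr (- (real g / 2) * real N)"
    using assms by (simp add: powr_realpow[symmetric] powr_powr)
  finally show ?thesis by (simp add: mult.commute)
qed

context cusp_setup
begin

text \<open>Concatenated indices list a, the index of x, first, while \<open>J\<close> lists b
  first; \<open>swap_halves\<close> mediates. Collecting terms by b gives a linear form in y whose
  coefficients are linear forms in x.\<close>

lemma doubling_lf:
  "doubling g (lf (2 * g) (\<lambda>x. s (swap_halves g x))) = (\<Sum>b\<in>carrier_vec g. pconst (lform s b) * pvar b)"
proof -
  interpret d: comm_ring_hom "doubling g :: ('f vec, complex) mpoly \<Rightarrow> _" by (rule doubling_hom)
  have "doubling g (lf (2 * g) (\<lambda>x. s (swap_halves g x))) =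
      (\<Sum>v\<in>carrier_vec (2 * g). pconst (pconst (s (swap_halves g (join (2 * g) v 0)))) * (pconst (pvar (vec_first v g)) * pvar (vec_last v g)))"
    by (simp add: lf_def d.hom_sum d.hom_mult doubling_pconst doubling_pvar)
  also have "\<dots> = (\<Sum>(b, a)\<in>carrier_vec g \<times> carrier_vec g. pconst (pconst (s (J g a b))) * (pconst (pvar a) * pvar b))"
  proof (rule sum.reindex_bij_witness[of _ "\<lambda>(b, a). a @\<^sub>v b" "\<lambda>v. (vec_last v g, vec_first v g)"])
    fix v :: "'f vec" assume v: "v \<in> carrier_vec (2 * g)"
    then have v': "v \<in> carrier_vec (g + g)" by (simp add: mult_2)
    show eq: "(case (vec_last v g, vec_first v g) of (b, a) \<Rightarrow> a @\<^sub>v b) = v"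
      using vec_first_last_append[OF v'] by simp
    show "(vec_last v g, vec_first v g) \<in> carrier_vec g \<times> carrier_vec g" by simp
    show "(case (vec_last v g, vec_first v g) of (b, a) \<Rightarrow> pconst (pconst (s (J g a b))) * (pconst (pvar a) * pvar b)) =
      pconst (pconst (s (swap_halves g (join (2 * g) v 0)))) * (pconst (pvar (vec_first v g)) * pvar (vec_last v g))"
      using swap_halves_append[of "vec_first v g" g "vec_last v g"] eq by simp
  next
    fix ba :: "'f vec \<times> 'f vec" assume "ba \<in> carrier_vec g \<times> carrier_vec g"
    then obtain b a where ba: "ba = (b, a)" "a \<in> carrier_vec g" "b \<in> carrier_vec g" by auto
    show "(case ba of (b, a) \<Rightarrow> a @\<^sub>v b) \<in> carrier_vec (2 * g)" using ba by (simp add: mult_2)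
    show "(vec_last (case ba of (b, a) \<Rightarrow> a @\<^sub>v b) g, vec_first (case ba of (b, a) \<Rightarrow> a @\<^sub>v b) g) = ba"
      using ba by (auto simp: vec_first_def vec_last_def intro!: eq_vecI)
  qed
  also have "\<dots> = (\<Sum>b\<in>carrier_vec g. \<Sum>a\<in>carrier_vec g. pconst (pconst (s (J g a b))) * (pconst (pvar a) * pvar b))"
    by (rule sum.cartesian_product[symmetric])
  also have "\<dots> = (\<Sum>b\<in>carrier_vec g. pconst (lform s b) * pvar b)"
    by (simp add: lform_def pconst.hom_sum pconst.hom_mult sum_distrib_right mult.assoc)
  finally show ?thesis .
qed

lemma inner_doubling_lf:
  "inner_y (doubling g (lf (2 * g) (\<lambda>x. s (swap_halves g x)) ^ N)) f = pconst (fact N) * Fs s"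
proof -
  interpret d: comm_ring_hom "doubling g :: ('f vec, complex) mpoly \<Rightarrow> _" by (rule doubling_hom)
  have "f \<in> polys_in (carrier_vec g)" using cusp by (simp add: cusp_form_def)
  then show ?thesis unfolding d.hom_power doubling_lf Fs_def
    by (intro inner_y_linear_form_power finite_carrier_vec hom_f)
qed

text \<open>The exchange of the halves permutes the states, so the sum may be reindexed by it before
  doubling.\<close>

lemma inner_doubling_eisenstein:
  "inner_y (doubling g (eisenstein T (2 * g) N)) f =
     pconst (of_nat (card (seed_vecs (2 * g))) / of_nat (card (St (2 * g))) * fact N) * (\<Sum>s\<in>St (2 * g). Fs s)"
proof -
  interpret d: comm_ring_hom "doubling g :: ('f vec, complex) mpoly \<Rightarrow> _" by (rule doubling_hom)
  have eq: "(\<Sum>s\<in>St (2 * g). lf (2 * g) s ^ N) = (\<Sum>s\<in>St (2 * g). lf (2 * g) (\<lambda>x. s (swap_halves g x)) ^ N)"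
    by (rule sum.reindex_bij_witness[of _ "\<lambda>s x. s (swap_halves g x)" "\<lambda>s x. s (swap_halves g x)"])
       (simp_all add: St_swap_halves)
  show ?thesis
    unfolding eisenstein_eq_St_sum eq d.hom_mult doubling_pconst inner_y_pconst_mult
    by (simp only: d.hom_sum inner_y_sum inner_doubling_lf sum_distrib_left[symmetric] pconst.hom_mult mult.assoc)
qed

text \<open>The power Q, the product of the q^i for i < g, occurs once in |GL_g| and once in the
  number of quadratic characters; with the remaining q^g this gives exactly q^(g^2). The factors k^g
  from that number and from the quotient of the state counts cancel, so that only k^(2g) from the
  seed survives.\<close>

lemma constant_eq:
  "real (card (seed_vecs (2 * g))) / real (card (St (2 * g))) *
     (real (card (St g)) * (real (card (GL g) * card (QF g)) * (1 / sqrt (real CARD('f) ^ g)) ^ N)) =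
   doubling_const T CARD('f) g N"
proof -
  let ?q = "real CARD('f)"
  \<comment> \<open>The factor by which each dimension of an affine type exceeds type
    \<open>Type_qE\<close> in the counts.\<close>
  define k where "k = (if T = Type_qE then 1 else ?q)"
  define Q A B where "Q = (\<Prod>i<g. ?q ^ i)" and "A = (\<Prod>i=1..g. ?q ^ i - 1)" and "B = (\<Prod>i=1..g. ?q ^ (g + i) + 1)"
  have q1: "CARD('f) > 1"
  proof -
    have "card {0, 1 :: 'f} \<le> CARD('f)" by (rule card_mono) auto
    then show ?thesis by simp
  qed
  have k0: "k > 0" using q1 by (simp add: k_def)
  have St0: "card (St g) > 0" using finite_St[of g] delta_St[of 0 g] by (auto simp: card_gt_0_iff)
  have B0: "B > 0" unfolding B_def by (rule prod_pos) (simp add: add_pos_pos add_nonneg_pos)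
  have seed: "real (card (seed_vecs (2 * g))) = k ^ (2 * g)"
    by (simp add: seed_vecs_def k_def card_carrier_vec)
  have St2: "real (card (St (2 * g))) = real (card (St g)) * (k ^ g * B)"
    unfolding mult_2 card_St_add by (simp add: k_def B_def add.commute)
  have GL: "real (card (GL g)) = Q * A"
  proof -
    have "real (card (GL g)) = (\<Prod>i<g. ?q ^ g - ?q ^ i)"
      unfolding card_GL of_nat_prod
      by (rule prod.cong[OF refl]) (use q1 in \<open>simp add: of_nat_diff power_increasing\<close>)
    then show ?thesis unfolding Q_def A_def by (simp only: prod_power_differences)
  qed
  have QF: "real (card (QF g)) = Q * (?q ^ g * k ^ g)"
  proof -
    have "real (card Q1) = ?q * k" using card_Q1[OF adm] by (simp add: k_def power2_eq_square)
    then show ?thesis unfolding card_QF by (simp add: Q_def power_mult_distrib)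
  qed
  have Q: "Q * Q * ?q ^ g = ?q ^ (g * g)"
    using prod_powers_square[of "?q" g] by (simp add: Q_def power2_eq_square)
  have "k ^ (2 * g) / (real (card (St g)) * (k ^ g * B)) * (real (card (St g)) * (Q * A * (Q * (?q ^ g * k ^ g)) * X)) =
      k ^ (2 * g) * (Q * Q * ?q ^ g) * X * (A / B)" for X
    using St0 k0 B0 by (simp add: field_simps)
  then have lhs: "real (card (seed_vecs (2 * g))) / real (card (St (2 * g))) *
      (real (card (St g)) * (real (card (GL g) * card (QF g)) * (1 / sqrt (?q ^ g)) ^ N)) =
      k ^ (2 * g) * ?q ^ (g * g) * (?q powr (- (real N * real g / 2))) * (A / B)"
    unfolding seed St2 of_nat_mult GL QF Q using q1 by (simp add: inverse_sqrt_power)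
  have AB: "A / B = (\<Prod>i=1..g. (?q ^ i - 1) / (?q ^ (g + i) + 1))"
    by (simp add: A_def B_def prod_dividef)
  have p1: "?q ^ (g * g) = ?q powr (real g ^ 2)"
    using q1 by (simp add: powr_realpow[symmetric] power2_eq_square)
  have p2: "?q ^ (2 * g) = ?q powr (2 * real g)"
    using q1 by (simp add: powr_realpow[symmetric])
  have "k ^ (2 * g) * ?q ^ (g * g) * (?q powr (- (real N * real g / 2))) =
      ?q powr ((if T = Type_qE then real g ^ 2 else real g ^ 2 + 2 * real g) - real N * real g / 2)"
  proof (cases "T = Type_qE")
    case True
    then show ?thesis unfolding p1 by (simp add: k_def powr_add[symmetric])
  next
    case False
    then have "k ^ (2 * g) = ?q powr (2 * real g)" unfolding p2[symmetric] by (simp add: k_def)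
    then show ?thesis unfolding p1 using False by (simp add: powr_add[symmetric] add.commute)
  qed
  moreover have "?q = 2" if "T = Type_2II" using adm that by (simp add: admissible_field_def)
  ultimately show ?thesis unfolding lhs AB doubling_const_def
    by (cases T) simp_all
qed

theorem doubling_formula:
  "inner_y (doubling g (eisenstein T (2 * g) N)) f =
     pconst (complex_of_real (doubling_const T CARD('f) g N) * fact N) * fbar"
proof -
  have "inner_y (doubling g (eisenstein T (2 * g) N)) f =
      pconst (of_nat (card (seed_vecs (2 * g))) / of_nat (card (St (2 * g))) * fact N *
        (of_nat (card (St g)) * (of_nat (card (GL g) * card (QF g)) * of_real (1 / sqrt (real CARD('f) ^ g)) ^ N))) * fbar"
    unfolding inner_doubling_eisenstein sum_Fs pconst_of_nat[symmetric]
    by (simp only: pconst.hom_mult mult.assoc)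
  also have "of_nat (card (seed_vecs (2 * g))) / of_nat (card (St (2 * g))) * fact N *
        (of_nat (card (St g)) * (of_nat (card (GL g) * card (QF g)) * of_real (1 / sqrt (real CARD('f) ^ g)) ^ N)) =
      complex_of_real (doubling_const T CARD('f) g N) * fact N"
    unfolding constant_eq[symmetric] by simp
  finally show ?thesis .
qed

end

theorem mainTheorem1:
  fixes T :: code_type and g N :: nat
    and f :: "('f::{finite,field} vec, complex) mpoly"
  assumes "g \<ge> 1"
    and "admissible_field T TYPE('f)"
    and "N > 0"
    and "order_Z T TYPE('f) dvd N"
    and "homogeneous N f"
    and "cusp_form T g f"
  shows "inner_y (doubling g (eisenstein T (2 * g) N)) f =
    pconst (complex_of_real (doubling_const T CARD('f) g N) * fact N) * conj_poly f"
proof -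
  interpret cusp_setup T "TYPE('f)" N g f
    by unfold_locales (use assms in auto)
  show ?thesis by (rule doubling_formula)
qed

end
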